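(* Let $\Sigma^2$ be an oriented $2$-manifold, $(M^3,g)$ an oriented Riemannian $3$-manifold, $f:\Sigma^2\to(M^3,g)$ a frontal, and $p$ a singular point of the first kind of $f$. (i) The product curvature $\kappa_\Pi$ and the derivate product curvature $\kappa_\Pi'$ are both intrinsic invariants: if $\tilde f:\Sigma^2\to(\tilde M^3,\tilde g)$ is another frontal into an oriented Riemannian $3$-manifold, having $p$ as a singular point of the first kind and with the same first fundamental form as $f$ near $p$ (i.e. $\tilde f^*\tilde g=f^*g$), and if the unit normals of $f$ and $\tilde f$ are normalized with respect to one and the same adapted coordinate system at $p$, then $f$ and $\tilde f$ have the same $\kappa_\Pi$ along the singular curve near $p$ and the same $\kappa'_\Pi(p)$. (ii) The Gaussian curvature $K$ of $f$ is rationally bounded (resp. rationally continuous) at $p$ if and only if $\kappa_\Pi(p)=0$ (resp. $\kappa_\Pi(p)=\kappa'_\Pi(p)=0$). (iii) $K$ is bounded on a neighborhood of $p$ if and only if $\kappa_\Pi=0$ along the singular curve in a neighborhood of $p$.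
   Context: All manifolds and maps are $C^\infty$. Write $\langle\cdot,\cdot\rangle=g$, $|\cdot|$ for the norm, $\nabla$ for the Levi-Civita connection and $\det_g$ for the Riemannian volume form; $f_u=df(\partial_u)$, $f_{uu}=\nabla_{\partial_u}f_u$, $f_{vv}=\nabla_{\partial_v}f_v$, etc. The product $\times_g$ is defined by $\langle a\times_g b,c\rangle=\det_g(a,b,c)$. Frontals: a singular point of $f$ is a point where $f$ is not an immersion; other points are regular. $f$ is a frontal if around each point there is a unit vector field $\nu$ along $f$ with $\nu\perp df(a)$ for all tangent vectors $a$. Singular points: with $\lambda=\det_g(f_u,f_v,\nu)$ for a positively oriented local coordinate system $(u,v)$, a singular point $p$ is non-degenerate if $d\lambda(p)\neq0$. Then $df(p)$ has rank one and near $p$ the singular set is a regular curve $\gamma(t)$, $\gamma(0)=p$ (the singular curve). A null vector field along $\gamma$ is a nowhere vanishing field $\eta(t)$ along $\gamma$ with $df(\eta(t))=0$. A non-degenerate singular point $p$ is of the first kind if $\gamma'(0),\eta(0)$ are linearly independent. Put $\hat\gamma=f\circ\gamma$. Limiting normal curvature (first kind): $\kappa_\nu(\gamma(t))=\langle\nabla_{\hat\gamma'}\hat\gamma',\nu\rangle/|\hat\gamma'|^2$. Cuspidal curvature: let $\eta$ be a vector field near $p$ whose restriction to $\gamma$ is a null vector field, with $\{\gamma',\eta\}$ positively oriented; put $f_\eta=df(\eta)$, $f_{\eta\eta}=\nabla_\eta f_\eta$, $f_{\eta\eta\eta}=\nabla_\eta f_{\eta\eta}$. Then, along $\gamma$,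 $$\kappa_c=\frac{|\hat\gamma'|^{3/2}\det_g(\hat\gamma',f_{\eta\eta},f_{\eta\eta\eta})}{|\hat\gamma'\times_g f_{\eta\eta}|^{5/2}}.$$ Adapted coordinates: a positively oriented coordinate system $(u,v)$ centered at $p$ is adapted if along the $u$-axis $|f_u|=1$, $f_v=0$ (in particular the singular set is the $u$-axis) and $\{f_u,f_{vv},\nu\}$ is orthonormal. Equivalently, along the $u$-axis, $\langle f_u,f_u\rangle=1$, $\langle f_v,f_v\rangle=\partial_v\langle f_u,f_v\rangle=0$, $\partial_v^2\langle f_v,f_v\rangle=2$; so this notion depends only on the first fundamental form $f^*g$. The unit normal $\nu$ is normalized with respect to an adapted coordinate system if $\{f_u,f_{vv},\nu\}$ is a positively oriented frame along the $u$-axis. Product curvatures: $\kappa_\Pi:=\kappa_\nu\kappa_c$ along $\gamma$ and $\kappa_\Pi'(p):=\kappa_\nu'(p)\kappa_c(p)+\kappa_\nu(p)\kappa_c'(p)$, where $'$ is the derivative with respect to the arclength parameter of $\hat\gamma$ (the parameter $u$ in an adapted coordinate system). Gaussian curvature: $K$ is the Gaussian curvature of $f^*g$ on the set of regular points. Rational boundedness and continuity: on $\mathbb R\times S^1$ ($S^1=\mathbb R/2\pi\mathbb Z$) let $(r,\theta)\sim(-r,\theta+\pi)$, let $\mathcal M$ be the quotient and $\pi$ the projection, and let $\Phi:\mathcal M\to\mathbb R^2$ be the map with $\Phi(\pi(r,\theta))=(r\cos\theta,r\sin\theta)$. Transplanting by a local coordinate system centered at $p$ gives the blow up $\Phi:\hat\Sigma^2_p\to\Sigma^2$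 at $p$ (independent of the coordinates). Let $W$ be a neighborhood of $p$ and $\mathcal O$ an open dense subset of $W$. A $C^\infty$ function $\varphi:\mathcal O\to\mathbb R$ is rationally bounded at $p$ if there is a $C^\infty$ function $\rho:\Phi^{-1}(W)\to\mathbb R$ such that (a) $\Phi^{-1}(\mathcal O\setminus\{p\})=\Phi^{-1}(W\setminus\{p\})\cap\rho^{-1}(\mathbb R\setminus\{0\})$; (b) $\rho^{-1}(0)\cap\Phi^{-1}(p)$ is a finite set; (c) there is a $C^\infty$ function $\psi:\Phi^{-1}(W)\to\mathbb R$ with $\psi(q)=\rho(q)\,\varphi(\Phi(q))$ for $q\in\Phi^{-1}(\mathcal O)$. It is rationally continuous at $p$ if moreover there is a constant $c$ with $\psi(q)=c\,\rho(q)$ for all $q\in\Phi^{-1}(p)$. For $\varphi=K$, one takes $W$ a sufficiently small neighborhood of $p$ and $\mathcal O$ the set of regular points of $f$ in $W$. *)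

theory Defs
  imports "HOL-Analysis.Analysis"
begin

section \<open>Smooth maps between Euclidean spaces\<close>

primrec Ck_on :: "nat \<Rightarrow> 'a::euclidean_space set \<Rightarrow> ('a \<Rightarrow> 'b::real_normed_vector) \<Rightarrow> bool" where
  "Ck_on 0 S f = continuous_on S f"
| "Ck_on (Suc k) S f =
     ((\<forall>x\<in>S. f differentiable (at x)) \<and> (\<forall>v. Ck_on k S (\<lambda>x. frechet_derivative f (at x) v)))"

text \<open>Only used for open sets \<open>S\<close>.\<close>

definition smooth_on :: "'a::euclidean_space set \<Rightarrow> ('a \<Rightarrow> 'b::real_normed_vector) \<Rightarrow> bool" where
  "smooth_on S f \<longleftrightarrow> (\<forall>k. Ck_on k S f)"

definition pderiv_at :: "'n \<Rightarrow> (real^'n \<Rightarrow> real) \<Rightarrow> real^'n \<Rightarrow> real" where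
  "pderiv_at i h z = frechet_derivative h (at z) (axis i 1)"


section \<open>Oriented manifolds\<close>

text \<open>A chart is a pair of a domain and a coordinate map; the values of the coordinate map outside
  the domain are irrelevant. The underlying set of a manifold is a whole type.\<close>

type_synonym ('m, 'n) chart = "'m set \<times> ('m \<Rightarrow> real^'n)"

abbreviation cdom :: "('m, 'n) chart \<Rightarrow> 'm set" where
  "cdom c \<equiv> fst c"

abbreviation cmap :: "('m, 'n) chart \<Rightarrow> 'm \<Rightarrow> real^'n" where
  "cmap c \<equiv> snd c"

abbreviation cinv :: "('m, 'n) chart \<Rightarrow> real^'n \<Rightarrow> 'm" where
  "cinv c \<equiv> inv_into (cdom c) (cmap c)"

definition is_chart :: "('m::topological_space, 'n::finite) chart \<Rightarrow> bool" where
  "is_chart c \<longleftrightarrow> open (cdom c) \<and> open (cmap c ` cdom c) \<and>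
     homeomorphism (cdom c) (cmap c ` cdom c) (cmap c) (cinv c)"

definition pos_transition :: "('m, 'n::finite) chart \<Rightarrow> ('m, 'n) chart \<Rightarrow> bool" where
  "pos_transition c d \<longleftrightarrow>
     (let D = cmap c ` (cdom c \<inter> cdom d); \<tau> = cmap d \<circ> cinv c
      in smooth_on D \<tau> \<and> (\<forall>z\<in>D. 0 < det (matrix (frechet_derivative \<tau> (at z)))))"

text \<open>An oriented smooth structure is given by its maximal oriented atlas, so the elements of \<open>A\<close>
  are precisely all positively oriented local coordinate systems.\<close>

definition oriented_manifold ::
    "('m::{t2_space,second_countable_topology}, 'n::finite) chart set \<Rightarrow> bool" where
  "oriented_manifold A \<longleftrightarrow>
     (\<forall>c\<in>A. is_chart c) \<and> \<Union>(cdom ` A) = UNIV \<and>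
     (\<forall>c\<in>A. \<forall>d\<in>A. pos_transition c d) \<and>
     (\<forall>c. is_chart c \<and> (\<forall>d\<in>A. pos_transition c d \<and> pos_transition d c) \<longrightarrow> c \<in> A)"

text \<open>A tangent vector at \<open>q\<close> is the family of its component vectors in all charts around \<open>q\<close>
  (transforming by the Jacobians of the coordinate changes), extended by 0 to other indices. With
  this normalization \<open>tangent_space A q\<close> is a vector space under the pointwise operations and its
  zero vector is \<open>\<lambda>_. 0\<close>.\<close>

type_synonym ('m, 'n) tvec = "('m, 'n) chart \<Rightarrow> real^'n"

definition tangent_space :: "('m, 'n::finite) chart set \<Rightarrow> 'm \<Rightarrow> ('m, 'n) tvec set" where
  "tangent_space A q = {a.
     (\<forall>c\<in>A. \<forall>d\<in>A. q \<in> cdom c \<and> q \<in> cdom d \<longrightarrow>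
        a d = frechet_derivative (cmap d \<circ> cinv c) (at (cmap c q)) (a c)) \<and>
     (\<forall>c. \<not> (c \<in> A \<and> q \<in> cdom c) \<longrightarrow> a c = 0)}"

text \<open>The tangent vector at \<open>q\<close> with components \<open>w\<close> in the chart \<open>c\<close>, and the coordinate
  vector fields.\<close>

definition coord_vec ::
    "('m, 'n::finite) chart set \<Rightarrow> ('m, 'n) chart \<Rightarrow> 'm \<Rightarrow> real^'n \<Rightarrow> ('m, 'n) tvec" where
  "coord_vec A c q w = (\<lambda>d. if d \<in> A \<and> q \<in> cdom d
     then frechet_derivative (cmap d \<circ> cinv c) (at (cmap c q)) w else 0)"

definition cfield ::
    "('m, 'n::finite) chart set \<Rightarrow> ('m, 'n) chart \<Rightarrow> 'n \<Rightarrow> 'm \<Rightarrow> ('m, 'n) tvec" where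
  "cfield A c i q = coord_vec A c q (axis i 1)"

text \<open>The derivative of a vector-valued function \<open>h\<close>, defined near \<open>q\<close>, in the direction of the
  tangent vector \<open>a\<close> at \<open>q\<close>; the value is the same in all charts.\<close>

definition tderiv ::
    "('m, 'n::finite) chart set \<Rightarrow> 'm \<Rightarrow> ('m, 'n) tvec \<Rightarrow> ('m \<Rightarrow> 'b::real_normed_vector) \<Rightarrow> 'b" where
  "tderiv A q a h = (THE y. \<forall>c\<in>A. q \<in> cdom c \<longrightarrow>
     y = frechet_derivative (h \<circ> cinv c) (at (cmap c q)) (a c))"

definition smooth_fun_on ::
    "('m::topological_space, 'n::finite) chart set \<Rightarrow> 'm set \<Rightarrow> ('m \<Rightarrow> 'b::real_normed_vector) \<Rightarrow> bool" where
  "smooth_fun_on A U h \<longleftrightarrow> open U \<and>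
     (\<forall>c\<in>A. smooth_on (cmap c ` (U \<inter> cdom c)) (h \<circ> cinv c))"

definition smooth_map ::
    "('m::topological_space, 'k::finite) chart set \<Rightarrow> ('w::topological_space, 'n::finite) chart set \<Rightarrow>
     ('m \<Rightarrow> 'w) \<Rightarrow> bool" where
  "smooth_map A B f \<longleftrightarrow> continuous_on UNIV f \<and> (\<forall>d\<in>B. smooth_fun_on A (f -` cdom d) (cmap d \<circ> f))"

text \<open>Smooth vector fields along \<open>f\<close> on the open set \<open>U\<close>; tangential vector fields are the case
  \<open>f = id\<close>.\<close>

definition vfield_along ::
    "('m::topological_space, 'k::finite) chart set \<Rightarrow> ('w::topological_space, 'n::finite) chart set \<Rightarrow>
     ('m \<Rightarrow> 'w) \<Rightarrow> 'm set \<Rightarrow> ('m \<Rightarrow> ('w, 'n) tvec) \<Rightarrow> bool" where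
  "vfield_along A B f U V \<longleftrightarrow> open U \<and> (\<forall>q\<in>U. V q \<in> tangent_space B (f q)) \<and>
     (\<forall>d\<in>B. smooth_fun_on A (U \<inter> f -` cdom d) (\<lambda>q. V q d))"

definition dmap ::
    "('m, 'k::finite) chart set \<Rightarrow> ('w, 'n::finite) chart set \<Rightarrow>
     ('m \<Rightarrow> 'w) \<Rightarrow> 'm \<Rightarrow> ('m, 'k) tvec \<Rightarrow> ('w, 'n) tvec" where
  "dmap A B f q a = (\<lambda>d. if d \<in> B \<and> f q \<in> cdom d then tderiv A q a (cmap d \<circ> f) else 0)"

definition smooth_curve_on ::
    "('m::topological_space, 'n::finite) chart set \<Rightarrow> real set \<Rightarrow> (real \<Rightarrow> 'm) \<Rightarrow> bool" where
  "smooth_curve_on A I \<gamma> \<longleftrightarrow> open I \<and> continuous_on I \<gamma> \<and>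
     (\<forall>c\<in>A. smooth_on (I \<inter> \<gamma> -` cdom c) (cmap c \<circ> \<gamma>))"

definition velocity :: "('m, 'n::finite) chart set \<Rightarrow> (real \<Rightarrow> 'm) \<Rightarrow> real \<Rightarrow> ('m, 'n) tvec" where
  "velocity A \<gamma> t =
     (\<lambda>c. if c \<in> A \<and> \<gamma> t \<in> cdom c then vector_derivative (cmap c \<circ> \<gamma>) (at t) else 0)"

definition tvec_indep :: "('m, 'n::finite) tvec \<Rightarrow> ('m, 'n) tvec \<Rightarrow> bool" where
  "tvec_indep a b \<longleftrightarrow>
     (\<forall>s t :: real. (\<lambda>c. s *\<^sub>R a c + t *\<^sub>R b c) = (\<lambda>_. 0) \<longrightarrow> s = 0 \<and> t = 0)"

definition pos_oriented2 :: "('m, 2) chart set \<Rightarrow> 'm \<Rightarrow> ('m, 2) tvec \<Rightarrow> ('m, 2) tvec \<Rightarrow> bool" where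
  "pos_oriented2 A q a b \<longleftrightarrow>
     (\<forall>c\<in>A. q \<in> cdom c \<longrightarrow> 0 < det (vector [a c, b c] :: real^2^2))"


section \<open>Riemannian geometry\<close>

text \<open>A field of bilinear forms; only its values on tangent vectors at the given point matter.\<close>

type_synonym ('m, 'n) metric = "'m \<Rightarrow> ('m, 'n) tvec \<Rightarrow> ('m, 'n) tvec \<Rightarrow> real"

definition mcomp ::
    "('m, 'n::finite) chart set \<Rightarrow> ('m, 'n) metric \<Rightarrow> ('m, 'n) chart \<Rightarrow> real^'n \<Rightarrow> real^'n^'n" where
  "mcomp B g c z =
     (\<chi> i j. g (cinv c z) (cfield B c i (cinv c z)) (cfield B c j (cinv c z)))"

definition riemannian_metric ::
    "('m::topological_space, 'n::finite) chart set \<Rightarrow> ('m, 'n) metric \<Rightarrow> bool" where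
  "riemannian_metric B g \<longleftrightarrow>
     (\<forall>q. \<forall>a\<in>tangent_space B q. \<forall>b\<in>tangent_space B q.
        g q a b = g q b a \<and> (a \<noteq> (\<lambda>_. 0) \<longrightarrow> 0 < g q a a) \<and>
        (\<forall>v\<in>tangent_space B q. \<forall>s. g q (\<lambda>c. s *\<^sub>R a c + b c) v = s * g q a v + g q b v)) \<and>
     (\<forall>c\<in>B. smooth_on (cmap c ` cdom c) (mcomp B g c))"

definition oriented_riemannian_manifold ::
    "('m::{t2_space,second_countable_topology}, 'n::finite) chart set \<Rightarrow> ('m, 'n) metric \<Rightarrow> bool" where
  "oriented_riemannian_manifold B g \<longleftrightarrow> oriented_manifold B \<and> riemannian_metric B g"

definition gnorm :: "('m, 'n) metric \<Rightarrow> 'm \<Rightarrow> ('m, 'n) tvec \<Rightarrow> real" where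
  "gnorm g q a = sqrt (g q a a)"

definition christoffel ::
    "('m, 'n::finite) chart set \<Rightarrow> ('m, 'n) metric \<Rightarrow> ('m, 'n) chart \<Rightarrow> 'n \<Rightarrow> 'n \<Rightarrow> 'n \<Rightarrow> real^'n \<Rightarrow> real" where
  "christoffel B g c k i j z = (1/2) * (\<Sum>l\<in>UNIV. matrix_inv (mcomp B g c z) $ k $ l *
     (pderiv_at i (\<lambda>y. mcomp B g c y $ j $ l) z + pderiv_at j (\<lambda>y. mcomp B g c y $ i $ l) z
      - pderiv_at l (\<lambda>y. mcomp B g c y $ i $ j) z))"

definition christoffel_term ::
    "('m, 'n::finite) chart set \<Rightarrow> ('m, 'n) metric \<Rightarrow> ('m, 'n) chart \<Rightarrow> 'm \<Rightarrow> real^'n \<Rightarrow> real^'n \<Rightarrow> real^'n" where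
  "christoffel_term B g c q v w =
     (\<chi> k. \<Sum>i\<in>UNIV. \<Sum>j\<in>UNIV. christoffel B g c k i j (cmap c q) * v $ i * w $ j)"

text \<open>The Levi-Civita covariant derivative of a vector field \<open>V\<close> along a map \<open>f\<close> in the direction
  of a tangent vector \<open>a\<close> at \<open>q\<close>, and of a vector field \<open>V\<close> along a curve \<open>\<sigma>\<close>.\<close>

definition cov ::
    "('m, 'k::finite) chart set \<Rightarrow> ('w, 'n::finite) chart set \<Rightarrow> ('w, 'n) metric \<Rightarrow> ('m \<Rightarrow> 'w) \<Rightarrow>
     ('m \<Rightarrow> ('w, 'n) tvec) \<Rightarrow> 'm \<Rightarrow> ('m, 'k) tvec \<Rightarrow> ('w, 'n) tvec" where
  "cov A B g f V q a = (\<lambda>d. if d \<in> B \<and> f q \<in> cdom d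
     then tderiv A q a (\<lambda>x. V x d) + christoffel_term B g d (f q) (dmap A B f q a d) (V q d)
     else 0)"

definition cov_curve ::
    "('w, 'n::finite) chart set \<Rightarrow> ('w, 'n) metric \<Rightarrow> (real \<Rightarrow> 'w) \<Rightarrow> (real \<Rightarrow> ('w, 'n) tvec) \<Rightarrow>
     real \<Rightarrow> ('w, 'n) tvec" where
  "cov_curve B g \<sigma> V t = (\<lambda>d. if d \<in> B \<and> \<sigma> t \<in> cdom d
     then vector_derivative (\<lambda>s. V s d) (at t) + christoffel_term B g d (\<sigma> t) (velocity B \<sigma> t d) (V t d)
     else 0)"

text \<open>The Riemannian volume form; the right-hand side is the same in all (positively oriented)
  charts.\<close>

definition vol_form ::
    "('w, 3) chart set \<Rightarrow> ('w, 3) metric \<Rightarrow> 'w \<Rightarrow>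
     ('w, 3) tvec \<Rightarrow> ('w, 3) tvec \<Rightarrow> ('w, 3) tvec \<Rightarrow> real" where
  "vol_form B g q a b v = (THE r. \<forall>d\<in>B. q \<in> cdom d \<longrightarrow>
     r = sqrt (det (mcomp B g d (cmap d q))) * det (vector [a d, b d, v d] :: real^3^3))"

definition gcross ::
    "('w, 3) chart set \<Rightarrow> ('w, 3) metric \<Rightarrow> 'w \<Rightarrow> ('w, 3) tvec \<Rightarrow> ('w, 3) tvec \<Rightarrow> ('w, 3) tvec" where
  "gcross B g q a b = (THE w. w \<in> tangent_space B q \<and>
     (\<forall>v\<in>tangent_space B q. g q w v = vol_form B g q a b v))"

text \<open>The Gaussian curvature
  \<open>\<langle>R(\<partial>\<^sub>u, \<partial>\<^sub>v) \<partial>\<^sub>v, \<partial>\<^sub>u\<rangle> / (E G - F\<^sup>2)\<close> of a two-dimensional metric; \<open>curv_comp\<close> gives the components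
  of \<open>R(\<partial>\<^sub>u, \<partial>\<^sub>v) \<partial>\<^sub>v\<close> in a chart.\<close>

definition curv_comp ::
    "('m, 2) chart set \<Rightarrow> ('m, 2) metric \<Rightarrow> ('m, 2) chart \<Rightarrow> real^2 \<Rightarrow> 2 \<Rightarrow> real" where
  "curv_comp A h c z l =
     pderiv_at 1 (christoffel A h c l 2 2) z - pderiv_at 2 (christoffel A h c l 1 2) z +
     (\<Sum>m\<in>UNIV. christoffel A h c l 1 m z * christoffel A h c m 2 2 z
               - christoffel A h c l 2 m z * christoffel A h c m 1 2 z)"

definition gauss_curvature :: "('m, 2) chart set \<Rightarrow> ('m, 2) metric \<Rightarrow> 'm \<Rightarrow> real" where
  "gauss_curvature A h q = (THE k. \<forall>c\<in>A. q \<in> cdom c \<longrightarrow>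
     k = (\<Sum>l\<in>UNIV. curv_comp A h c (cmap c q) l * mcomp A h c (cmap c q) $ l $ 1)
         / det (mcomp A h c (cmap c q)))"


section \<open>Frontals and their singular points\<close>

definition first_form ::
    "('m, 2) chart set \<Rightarrow> ('w, 3) chart set \<Rightarrow> ('w, 3) metric \<Rightarrow> ('m \<Rightarrow> 'w) \<Rightarrow> ('m, 2) metric" where
  "first_form A B g f q a b = g (f q) (dmap A B f q a) (dmap A B f q b)"

definition singular_point ::
    "('m, 2) chart set \<Rightarrow> ('w, 3) chart set \<Rightarrow> ('m \<Rightarrow> 'w) \<Rightarrow> 'm \<Rightarrow> bool" where
  "singular_point A B f q \<longleftrightarrow>
     (\<exists>a\<in>tangent_space A q. a \<noteq> (\<lambda>_. 0) \<and> dmap A B f q a = (\<lambda>_. 0))"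

definition unit_normal_near ::
    "('m::topological_space, 2) chart set \<Rightarrow> ('w::topological_space, 3) chart set \<Rightarrow> ('w, 3) metric \<Rightarrow>
     ('m \<Rightarrow> 'w) \<Rightarrow> 'm \<Rightarrow> ('m \<Rightarrow> ('w, 3) tvec) \<Rightarrow> bool" where
  "unit_normal_near A B g f p \<nu> \<longleftrightarrow> (\<exists>U. p \<in> U \<and> vfield_along A B f U \<nu> \<and>
     (\<forall>q\<in>U. g (f q) (\<nu> q) (\<nu> q) = 1 \<and>
        (\<forall>a\<in>tangent_space A q. g (f q) (\<nu> q) (dmap A B f q a) = 0)))"

definition frontal ::
    "('m::topological_space, 2) chart set \<Rightarrow> ('w::topological_space, 3) chart set \<Rightarrow> ('w, 3) metric \<Rightarrow>
     ('m \<Rightarrow> 'w) \<Rightarrow> bool" where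
  "frontal A B g f \<longleftrightarrow> smooth_map A B f \<and> (\<forall>p. \<exists>\<nu>. unit_normal_near A B g f p \<nu>)"

definition area_density ::
    "('m, 2) chart set \<Rightarrow> ('w, 3) chart set \<Rightarrow> ('w, 3) metric \<Rightarrow> ('m \<Rightarrow> 'w) \<Rightarrow>
     ('m \<Rightarrow> ('w, 3) tvec) \<Rightarrow> ('m, 2) chart \<Rightarrow> 'm \<Rightarrow> real" where
  "area_density A B g f \<nu> c q =
     vol_form B g (f q) (dmap A B f q (cfield A c 1 q)) (dmap A B f q (cfield A c 2 q)) (\<nu> q)"

definition regular_points ::
    "('m, 2) chart set \<Rightarrow> ('w, 3) chart set \<Rightarrow> ('m \<Rightarrow> 'w) \<Rightarrow> 'm set" where
  "regular_points A B f = {q. \<not> singular_point A B f q}"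

text \<open>The Gaussian curvature of \<open>f\<close>; meaningful on \<open>regular_points A B f\<close>.\<close>

definition frontal_curvature ::
    "('m, 2) chart set \<Rightarrow> ('w, 3) chart set \<Rightarrow> ('w, 3) metric \<Rightarrow> ('m \<Rightarrow> 'w) \<Rightarrow> 'm \<Rightarrow> real" where
  "frontal_curvature A B g f = gauss_curvature A (first_form A B g f)"

text \<open>The choices of \<open>\<nu>\<close> and of the chart do not matter in the following definition.\<close>

definition nondegenerate_singular_point ::
    "('m::topological_space, 2) chart set \<Rightarrow> ('w::topological_space, 3) chart set \<Rightarrow> ('w, 3) metric \<Rightarrow>
     ('m \<Rightarrow> 'w) \<Rightarrow> 'm \<Rightarrow> bool" where
  "nondegenerate_singular_point A B g f p \<longleftrightarrow> singular_point A B f p \<and>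
     (\<exists>\<nu>. unit_normal_near A B g f p \<nu> \<and>
       (\<exists>c\<in>A. p \<in> cdom c \<and> (\<exists>a\<in>tangent_space A p. tderiv A p a (area_density A B g f \<nu> c) \<noteq> 0)))"

text \<open>A regular parametrization, with \<open>\<gamma> 0 = p\<close>, of the singular set near \<open>p\<close>.\<close>

definition singular_curve ::
    "('m::topological_space, 2) chart set \<Rightarrow> ('w, 3) chart set \<Rightarrow> ('m \<Rightarrow> 'w) \<Rightarrow> 'm \<Rightarrow>
     (real \<Rightarrow> 'm) \<Rightarrow> bool" where
  "singular_curve A B f p \<gamma> \<longleftrightarrow> \<gamma> 0 = p \<and>
     (\<exists>\<epsilon>>0. \<exists>W. open W \<and> smooth_curve_on A {-\<epsilon><..<\<epsilon>} \<gamma> \<and>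
        (\<forall>t\<in>{-\<epsilon><..<\<epsilon>}. velocity A \<gamma> t \<noteq> (\<lambda>_. 0)) \<and>
        \<gamma> ` {-\<epsilon><..<\<epsilon>} = {q\<in>W. singular_point A B f q})"

definition null_field_along ::
    "('m::topological_space, 2) chart set \<Rightarrow> ('w, 3) chart set \<Rightarrow> ('m \<Rightarrow> 'w) \<Rightarrow>
     (real \<Rightarrow> 'm) \<Rightarrow> (real \<Rightarrow> ('m, 2) tvec) \<Rightarrow> bool" where
  "null_field_along A B f \<gamma> \<eta> \<longleftrightarrow> (\<exists>\<epsilon>>0.
     (\<forall>t\<in>{-\<epsilon><..<\<epsilon>}. \<eta> t \<in> tangent_space A (\<gamma> t) \<and> \<eta> t \<noteq> (\<lambda>_. 0) \<and>
        dmap A B f (\<gamma> t) (\<eta> t) = (\<lambda>_. 0)) \<and>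
     (\<forall>c\<in>A. smooth_on ({-\<epsilon><..<\<epsilon>} \<inter> \<gamma> -` cdom c) (\<lambda>t. \<eta> t c)))"

definition first_kind ::
    "('m::topological_space, 2) chart set \<Rightarrow> ('w::topological_space, 3) chart set \<Rightarrow> ('w, 3) metric \<Rightarrow>
     ('m \<Rightarrow> 'w) \<Rightarrow> 'm \<Rightarrow> bool" where
  "first_kind A B g f p \<longleftrightarrow> nondegenerate_singular_point A B g f p \<and>
     (\<exists>\<gamma> \<eta>. singular_curve A B f p \<gamma> \<and> null_field_along A B f \<gamma> \<eta> \<and>
        tvec_indep (velocity A \<gamma> 0) (\<eta> 0))"

text \<open>A vector field \<open>\<eta>\<close> near \<open>\<gamma> 0\<close> that restricts to a null vector field along \<open>\<gamma>\<close>, with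
  \<open>{\<gamma>', \<eta>}\<close> positively oriented.\<close>

definition null_extension ::
    "('m::topological_space, 2) chart set \<Rightarrow> ('w, 3) chart set \<Rightarrow> ('m \<Rightarrow> 'w) \<Rightarrow>
     (real \<Rightarrow> 'm) \<Rightarrow> ('m \<Rightarrow> ('m, 2) tvec) \<Rightarrow> bool" where
  "null_extension A B f \<gamma> \<eta> \<longleftrightarrow>
     (\<exists>U. \<gamma> 0 \<in> U \<and> vfield_along A A id U \<eta>) \<and>
     null_field_along A B f \<gamma> (\<eta> \<circ> \<gamma>) \<and>
     (\<forall>\<^sub>F t in nhds 0. pos_oriented2 A (\<gamma> t) (velocity A \<gamma> t) (\<eta> (\<gamma> t)))"


section \<open>Curvatures along the singular curve\<close>

definition kappa_nu ::
    "('w, 3) chart set \<Rightarrow> ('w, 3) metric \<Rightarrow> ('m \<Rightarrow> 'w) \<Rightarrow> ('m \<Rightarrow> ('w, 3) tvec) \<Rightarrow>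
     (real \<Rightarrow> 'm) \<Rightarrow> real \<Rightarrow> real" where
  "kappa_nu B g f \<nu> \<gamma> t =
     (let \<sigma> = f \<circ> \<gamma>
      in g (\<sigma> t) (cov_curve B g \<sigma> (velocity B \<sigma>) t) (\<nu> (\<gamma> t)) / (gnorm g (\<sigma> t) (velocity B \<sigma> t))\<^sup>2)"

definition kappa_c ::
    "('m, 2) chart set \<Rightarrow> ('w, 3) chart set \<Rightarrow> ('w, 3) metric \<Rightarrow> ('m \<Rightarrow> 'w) \<Rightarrow>
     (real \<Rightarrow> 'm) \<Rightarrow> ('m \<Rightarrow> ('m, 2) tvec) \<Rightarrow> real \<Rightarrow> real" where
  "kappa_c A B g f \<gamma> \<eta> t =
     (let f1 = (\<lambda>q. dmap A B f q (\<eta> q));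
          f2 = (\<lambda>q. cov A B g f f1 q (\<eta> q));
          f3 = (\<lambda>q. cov A B g f f2 q (\<eta> q));
          q = \<gamma> t;
          w = velocity B (f \<circ> \<gamma>) t
      in gnorm g (f q) w powr (3/2) * vol_form B g (f q) w (f2 q) (f3 q)
         / gnorm g (f q) (gcross B g (f q) w (f2 q)) powr (5/2))"

definition kappa_Pi ::
    "('m, 2) chart set \<Rightarrow> ('w, 3) chart set \<Rightarrow> ('w, 3) metric \<Rightarrow> ('m \<Rightarrow> 'w) \<Rightarrow> ('m \<Rightarrow> ('w, 3) tvec) \<Rightarrow>
     (real \<Rightarrow> 'm) \<Rightarrow> ('m \<Rightarrow> ('m, 2) tvec) \<Rightarrow> real \<Rightarrow> real" where
  "kappa_Pi A B g f \<nu> \<gamma> \<eta> t = kappa_nu B g f \<nu> \<gamma> t * kappa_c A B g f \<gamma> \<eta> t"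

text \<open>The derivative with respect to the arclength parameter of \<open>f \<circ> \<gamma>\<close>, for an arbitrary
  regular parametrization.\<close>

definition arclength_deriv ::
    "('w, 3) chart set \<Rightarrow> ('w, 3) metric \<Rightarrow> (real \<Rightarrow> 'w) \<Rightarrow> (real \<Rightarrow> real) \<Rightarrow> real \<Rightarrow> real" where
  "arclength_deriv B g \<sigma> h t = deriv h t / gnorm g (\<sigma> t) (velocity B \<sigma> t)"

definition kappa_Pi' ::
    "('m, 2) chart set \<Rightarrow> ('w, 3) chart set \<Rightarrow> ('w, 3) metric \<Rightarrow> ('m \<Rightarrow> 'w) \<Rightarrow> ('m \<Rightarrow> ('w, 3) tvec) \<Rightarrow>
     (real \<Rightarrow> 'm) \<Rightarrow> ('m \<Rightarrow> ('m, 2) tvec) \<Rightarrow> real \<Rightarrow> real" where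
  "kappa_Pi' A B g f \<nu> \<gamma> \<eta> t =
     arclength_deriv B g (f \<circ> \<gamma>) (kappa_nu B g f \<nu> \<gamma>) t * kappa_c A B g f \<gamma> \<eta> t +
     kappa_nu B g f \<nu> \<gamma> t * arclength_deriv B g (f \<circ> \<gamma>) (kappa_c A B g f \<gamma> \<eta>) t"


section \<open>Adapted coordinate systems\<close>

definition centered_chart :: "('m, 2) chart set \<Rightarrow> 'm \<Rightarrow> ('m, 2) chart \<Rightarrow> bool" where
  "centered_chart A p c \<longleftrightarrow> c \<in> A \<and> p \<in> cdom c \<and> cmap c p = 0"

text \<open>The vector fields \<open>f\<^sub>u\<close> (\<open>i = 1\<close>), \<open>f\<^sub>v\<close> (\<open>i = 2\<close>) and \<open>f\<^sub>v\<^sub>v\<close> of the coordinate system \<open>c\<close>.\<close>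

definition f_coord ::
    "('m, 2) chart set \<Rightarrow> ('w, 3) chart set \<Rightarrow> ('m \<Rightarrow> 'w) \<Rightarrow> ('m, 2) chart \<Rightarrow> 2 \<Rightarrow> 'm \<Rightarrow> ('w, 3) tvec" where
  "f_coord A B f c i q = dmap A B f q (cfield A c i q)"

definition f_vv ::
    "('m, 2) chart set \<Rightarrow> ('w, 3) chart set \<Rightarrow> ('w, 3) metric \<Rightarrow> ('m \<Rightarrow> 'w) \<Rightarrow> ('m, 2) chart \<Rightarrow>
     'm \<Rightarrow> ('w, 3) tvec" where
  "f_vv A B g f c q = cov A B g f (f_coord A B f c 2) q (cfield A c 2 q)"

definition orthonormal3 ::
    "('w, 3) metric \<Rightarrow> 'w \<Rightarrow> ('w, 3) tvec \<Rightarrow> ('w, 3) tvec \<Rightarrow> ('w, 3) tvec \<Rightarrow> bool" where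
  "orthonormal3 g q a b v \<longleftrightarrow>
     g q a a = 1 \<and> g q b b = 1 \<and> g q v v = 1 \<and> g q a b = 0 \<and> g q a v = 0 \<and> g q b v = 0"

text \<open>Conditions along the \<open>u\<close>-axis are imposed near \<open>p\<close>.\<close>

definition adapted_chart ::
    "('m::topological_space, 2) chart set \<Rightarrow> ('w, 3) chart set \<Rightarrow> ('w, 3) metric \<Rightarrow> ('m \<Rightarrow> 'w) \<Rightarrow>
     ('m \<Rightarrow> ('w, 3) tvec) \<Rightarrow> 'm \<Rightarrow> ('m, 2) chart \<Rightarrow> bool" where
  "adapted_chart A B g f \<nu> p c \<longleftrightarrow> centered_chart A p c \<and>
     (\<forall>\<^sub>F q in nhds p. cmap c q $ 2 = 0 \<longrightarrow>
        gnorm g (f q) (f_coord A B f c 1 q) = 1 \<and> f_coord A B f c 2 q = (\<lambda>_. 0) \<and>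
        orthonormal3 g (f q) (f_coord A B f c 1 q) (f_vv A B g f c q) (\<nu> q))"

definition normalized_normal ::
    "('m::topological_space, 2) chart set \<Rightarrow> ('w, 3) chart set \<Rightarrow> ('w, 3) metric \<Rightarrow> ('m \<Rightarrow> 'w) \<Rightarrow>
     ('m \<Rightarrow> ('w, 3) tvec) \<Rightarrow> 'm \<Rightarrow> ('m, 2) chart \<Rightarrow> bool" where
  "normalized_normal A B g f \<nu> p c \<longleftrightarrow>
     (\<forall>\<^sub>F q in nhds p. cmap c q $ 2 = 0 \<longrightarrow>
        0 < vol_form B g (f q) (f_coord A B f c 1 q) (f_vv A B g f c q) (\<nu> q))"


section \<open>Blow up, rational boundedness and rational continuity\<close>

text \<open>The identification \<open>(r, \<theta>) \<sim> (-r, \<theta> + \<pi>)\<close> on \<open>\<real> \<times> S\<^sup>1\<close> with \<open>S\<^sup>1 = \<real>/2\<pi>\<int>\<close>, lifted to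
  \<open>\<real> \<times> \<real>\<close>; its square is the identification \<open>\<theta> \<sim> \<theta> + 2\<pi>\<close>.\<close>

definition blowup_rel :: "real \<times> real \<Rightarrow> real \<times> real \<Rightarrow> bool" where
  "blowup_rel x y \<longleftrightarrow> (\<exists>k::int. snd y = snd x + of_int k * pi \<and>
     fst y = (if even k then fst x else - fst x))"

lemma equivp_blowup_rel: "equivp blowup_rel"
proof (rule equivpI)
  show "reflp blowup_rel"
    by (rule reflpI) (auto simp: blowup_rel_def intro!: exI[of _ 0])
  show "symp blowup_rel"
  proof (rule sympI)
    fix x y assume "blowup_rel x y"
    then obtain k :: int where "snd y = snd x + of_int k * pi"
      "fst y = (if even k then fst x else - fst x)"
      by (auto simp: blowup_rel_def)
    then show "blowup_rel y x"
      unfolding blowup_rel_def by (intro exI[of _ "- k"]) auto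
  qed
  show "transp blowup_rel"
  proof (rule transpI)
    fix x y z assume "blowup_rel x y" "blowup_rel y z"
    then obtain k l :: int where "snd y = snd x + of_int k * pi"
      "fst y = (if even k then fst x else - fst x)" "snd z = snd y + of_int l * pi"
      "fst z = (if even l then fst y else - fst y)"
      by (auto simp: blowup_rel_def)
    then show "blowup_rel x z"
      unfolding blowup_rel_def by (intro exI[of _ "k + l"]) (auto simp: algebra_simps)
  qed
qed

quotient_type blowup = "real \<times> real" / blowup_rel
  by (rule equivp_blowup_rel)

lift_definition blowdown :: "blowup \<Rightarrow> real^2" is
  "\<lambda>x. vector [fst x * cos (snd x), fst x * sin (snd x)]"
proof -
  fix x y :: "real \<times> real" assume "blowup_rel x y"
  then obtain k :: int where k: "snd y = snd x + of_int k * pi"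
    "fst y = (if even k then fst x else - fst x)"
    by (auto simp: blowup_rel_def)
  have "sin (of_int k * pi) = 0"
    by (simp add: sin_zero_iff_int2)
  moreover have "cos (of_int k * pi) = (if even k then 1 else -1)"
    using cos_npi_int[of k] by (simp add: mult.commute)
  ultimately have "cos (snd y) = (if even k then 1 else -1) * cos (snd x)"
    "sin (snd y) = (if even k then 1 else -1) * sin (snd x)"
    by (auto simp: k cos_add sin_add)
  with k show "(vector [fst x * cos (snd x), fst x * sin (snd x)] :: real^2) =
      vector [fst y * cos (snd y), fst y * sin (snd y)]"
    by auto
qed

text \<open>The projection \<open>abs_blowup\<close> is a covering map, so smoothness on an open subset \<open>\<Omega>\<close> of the
  blow up is smoothness of the pullback to \<open>\<real> \<times> \<real>\<close>.\<close>

definition blowup_smooth_on :: "blowup set \<Rightarrow> (blowup \<Rightarrow> real) \<Rightarrow> bool" where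
  "blowup_smooth_on \<Omega> \<rho> \<longleftrightarrow> smooth_on (abs_blowup -` \<Omega>) (\<rho> \<circ> abs_blowup)"

text \<open>For a coordinate system \<open>c\<close> centered at \<open>p\<close> and \<open>W \<subseteq> cdom c\<close>, the part of the blow up at \<open>p\<close>
  over \<open>W\<close> is \<open>\<Phi>\<^sup>-\<^sup>1(W)\<close>, with \<open>\<Phi> = blowdown_at c\<close>.\<close>

definition blowdown_at :: "('m, 2) chart \<Rightarrow> blowup \<Rightarrow> 'm" where
  "blowdown_at c b = cinv c (blowdown b)"

definition blowup_over :: "('m, 2) chart \<Rightarrow> 'm set \<Rightarrow> blowup set" where
  "blowup_over c S = {b. blowdown b \<in> cmap c ` S}"

definition rational_witness ::
    "('m::topological_space, 2) chart set \<Rightarrow> ('m, 2) chart \<Rightarrow> 'm \<Rightarrow> 'm set \<Rightarrow> 'm set \<Rightarrow> ('m \<Rightarrow> real) \<Rightarrow>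
     (blowup \<Rightarrow> real) \<Rightarrow> (blowup \<Rightarrow> real) \<Rightarrow> bool" where
  "rational_witness A c p W Q \<phi> \<rho> \<psi> \<longleftrightarrow>
     open W \<and> p \<in> W \<and> W \<subseteq> cdom c \<and> open Q \<and> Q \<subseteq> W \<and> W \<subseteq> closure Q \<and> smooth_fun_on A Q \<phi> \<and>
     blowup_smooth_on (blowup_over c W) \<rho> \<and> blowup_smooth_on (blowup_over c W) \<psi> \<and>
     blowup_over c (Q - {p}) = blowup_over c (W - {p}) \<inter> {b. \<rho> b \<noteq> 0} \<and>
     finite {b \<in> blowup_over c {p}. \<rho> b = 0} \<and>
     (\<forall>b\<in>blowup_over c Q. \<psi> b = \<rho> b * \<phi> (blowdown_at c b))"

definition rationally_bounded ::
    "('m::topological_space, 2) chart set \<Rightarrow> ('m, 2) chart \<Rightarrow> 'm \<Rightarrow> 'm set \<Rightarrow> 'm set \<Rightarrow>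
     ('m \<Rightarrow> real) \<Rightarrow> bool" where
  "rationally_bounded A c p W Q \<phi> \<longleftrightarrow> (\<exists>\<rho> \<psi>. rational_witness A c p W Q \<phi> \<rho> \<psi>)"

definition rationally_continuous ::
    "('m::topological_space, 2) chart set \<Rightarrow> ('m, 2) chart \<Rightarrow> 'm \<Rightarrow> 'm set \<Rightarrow> 'm set \<Rightarrow>
     ('m \<Rightarrow> real) \<Rightarrow> bool" where
  "rationally_continuous A c p W Q \<phi> \<longleftrightarrow> (\<exists>\<rho> \<psi>. rational_witness A c p W Q \<phi> \<rho> \<psi> \<and>
     (\<exists>k. \<forall>b\<in>blowup_over c {p}. \<psi> b = k * \<rho> b))"

end

theory Submission
  imports Defs
begin

text \<open>Straighten the singular curve: choose coordinates with \<open>f\<^sub>v = v h\<close>, where \<open>f\<^sub>u\<close> and \<open>h\<close> are linearly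
  independent. The extrinsic part \<open>(\<ell> n - m\<^sup>2) / (E G - F\<^sup>2)\<close> of the Gauss equation then has a
  denominator \<open>v\<^sup>2 \<delta>\<close> with \<open>\<delta> > 0\<close>, while \<open>n\<close> and \<open>m\<close> are divisible by \<open>v\<close>; hence \<open>\<phi> = v K\<close> extends
  smoothly across the singular curve \<open>v = 0\<close>. A computation with the null field shows that
  \<open>\<kappa>\<^sub>\<Pi> = \<plusminus> 2 E\<^sup>-\<^sup>1\<^sup>/\<^sup>4 \<delta>\<^sup>1\<^sup>/\<^sup>4 \<phi>\<close> along that curve, the sign being fixed by the choice of the normal. All of
  \<open>E\<close>, \<open>\<delta>\<close> and \<open>\<phi>\<close> are limits of quantities determined by the first fundamental form, so \<open>\<kappa>\<^sub>\<Pi>\<close> and its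
  derivative are intrinsic. Boundedness of \<open>K = \<phi> / v\<close> amounts to divisibility of \<open>\<phi>\<close> by \<open>v\<close>. On the
  blow up, \<open>v\<close> and \<open>\<phi> - \<phi>(0)\<close> become \<open>r\<close> times smooth functions restricting to their differentials on
  the exceptional fibre, so \<open>K\<close> is rationally bounded iff \<open>\<phi>(0) = 0\<close>, and rationally continuous iff
  moreover \<open>d\<phi>\<close> is proportional to \<open>dv\<close> at \<open>p\<close>.\<close>

section \<open>Calculus of smooth maps\<close>

text \<open>Non-degeneracy enters in a single place: as \<open>f\<^sub>v = v h\<close>, the area
  density is \<open>v r\<close> with \<open>r = det(f\<^sub>u, h, \<nu>)\<close>, so its
  differential is nonzero iff r(p) is, and \<open>r\<^sup>2 = \<delta>\<close>. The factor 2 and the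
  exponents come from \<kappa>_\<nu> = \<ell>/E and \<kappa>_c = 2 sgn(r) N E^(3/4) \<delta>^(-3/4),
  where n = v N, combined with \<phi> = \<ell> N / \<delta> on the singular curve. K is undefined on
  that curve, so \<delta> and \<phi> of two isometric frontals can be compared only off it, as
  det/v^2 and v K; continuity does the rest. On the blow up the obstacle is a sign: the radius r
  changes sign under the identification, hence so do v/r and \<phi>/r. Their quotient K is therefore
  written with numerator and denominator multiplied by v/r. Once \<phi>(p) = 0, proportionality of
  d\<phi> and dv means that \<phi> has derivative zero along the curve, which is the vanishing of
  \<kappa>'_\<Pi>(p). The global notions are families over charts or definite descriptions, so each
  needs a chart-independence argument; the geometry itself takes place in coordinates, with the
  metric a matrix-valued function.\<close>

abbreviation dd :: "('a::real_normed_vector \<Rightarrow> 'b::real_normed_vector) \<Rightarrow> 'a \<Rightarrow> 'a \<Rightarrow> 'b" where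
  "dd f v x \<equiv> frechet_derivative f (at x) v"

lemma dd_eqI: "(f has_derivative f') (at x) \<Longrightarrow> dd f v x = f' v"
  using frechet_derivative_at by fastforce

text \<open>\<open>frechet_derivative\<close> is a choice from the set of derivatives, and the two
  sets coincide; so even the arbitrary value at a point of non-differentiability agrees.\<close>

lemma dd_cong:
  assumes "open S" "x \<in> S" "\<And>y. y \<in> S \<Longrightarrow> f y = g y"
  shows "dd f v x = dd g v x"
proof -
  have "(f has_derivative F) (at x) \<longleftrightarrow> (g has_derivative F) (at x)" for F
    using assms has_derivative_transform_within_open by metis
  then show ?thesis by (simp add: frechet_derivative_def)
qed

lemma differentiable_cong_open:
  assumes "open S" "x \<in> S" "\<And>y. y \<in> S \<Longrightarrow> f y = g y"
  shows "f differentiable (at x) \<longleftrightarrow> g differentiable (at x)"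
  using assms has_derivative_transform_within_open unfolding differentiable_def by metis

lemma Ck_on_subset: "Ck_on k S f \<Longrightarrow> T \<subseteq> S \<Longrightarrow> Ck_on k T f"
  by (induction k arbitrary: f) (auto intro: continuous_on_subset)

lemma Ck_on_cong:
  assumes "open S" "\<And>x. x \<in> S \<Longrightarrow> f x = g x"
  shows "Ck_on k S f \<longleftrightarrow> Ck_on k S g"
  using assms(2)
proof (induction k arbitrary: f g)
  case 0
  then show ?case by (simp cong: continuous_on_cong)
next
  case (Suc k)
  have "Ck_on k S (dd f v) \<longleftrightarrow> Ck_on k S (dd g v)" for v
    by (rule Suc.IH) (use Suc.prems assms(1) dd_cong in metis)
  moreover have "\<forall>x\<in>S. f differentiable (at x) \<longleftrightarrow> g differentiable (at x)"
    using Suc.prems assms(1) differentiable_cong_open by metis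
  ultimately show ?case by simp
qed

lemma Ck_on_cong_imp:
  "Ck_on k S f \<Longrightarrow> open S \<Longrightarrow> (\<And>x. x \<in> S \<Longrightarrow> g x = f x) \<Longrightarrow> Ck_on k S g"
  using Ck_on_cong[of S g f k] by blast

lemma Ck_on_SucD: "Ck_on (Suc k) S f \<Longrightarrow> Ck_on k S f"
proof (induction k arbitrary: f)
  case 0
  then show ?case
    by (auto intro!: continuous_at_imp_continuous_on differentiable_imp_continuous_within)
qed auto

lemma smooth_on_iff:
  "smooth_on S f \<longleftrightarrow> (\<forall>x\<in>S. f differentiable (at x)) \<and> (\<forall>v. smooth_on S (dd f v))"
proof
  assume "smooth_on S f"
  then have "Ck_on (Suc k) S f" for k by (auto simp: smooth_on_def simp del: Ck_on.simps)
  then show "(\<forall>x\<in>S. f differentiable (at x)) \<and> (\<forall>v. smooth_on S (dd f v))"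
    by (auto simp: smooth_on_def)
next
  assume "(\<forall>x\<in>S. f differentiable (at x)) \<and> (\<forall>v. smooth_on S (dd f v))"
  then have "Ck_on (Suc k) S f" for k by (auto simp: smooth_on_def)
  then show "smooth_on S f"
    unfolding smooth_on_def using Ck_on_SucD by blast
qed

lemma smooth_onD_diff: "smooth_on S f \<Longrightarrow> x \<in> S \<Longrightarrow> f differentiable (at x)"
  using smooth_on_iff by blast

lemma smooth_onD_deriv: "smooth_on S f \<Longrightarrow> x \<in> S \<Longrightarrow> (f has_derivative (\<lambda>v. dd f v x)) (at x)"
  using smooth_onD_diff frechet_derivative_works by blast

lemma smooth_on_dd: "smooth_on S f \<Longrightarrow> smooth_on S (dd f v)"
  using smooth_on_iff by blast

lemma smooth_on_imp_continuous_on: "smooth_on S f \<Longrightarrow> continuous_on S f"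
  by (metis Ck_on.simps(1) smooth_on_def)

lemma smooth_on_subset: "smooth_on S f \<Longrightarrow> T \<subseteq> S \<Longrightarrow> smooth_on T f"
  using Ck_on_subset unfolding smooth_on_def by blast

lemma smooth_on_cong:
  assumes "open S" "\<And>x. x \<in> S \<Longrightarrow> f x = g x"
  shows "smooth_on S f \<longleftrightarrow> smooth_on S g"
  unfolding smooth_on_def using Ck_on_cong[of S f g, OF assms(1)] assms(2) by presburger

lemma smooth_on_cong_imp:
  assumes "smooth_on S f" "open S" "\<And>x. x \<in> S \<Longrightarrow> g x = f x"
  shows "smooth_on S g"
  using smooth_on_cong[OF assms(2,3)] assms(1) by simp

lemma Ck_on_const: "Ck_on k S (\<lambda>x. c)"
  by (induction k arbitrary: c) auto

lemma Ck_on_bounded_linear: "bounded_linear f \<Longrightarrow> Ck_on k S f"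
proof (cases k)
  case 0
  assume "bounded_linear f"
  then show ?thesis using 0 by (simp add: linear_continuous_on)
next
  case (Suc j)
  assume bl: "bounded_linear f"
  then have "dd f v = (\<lambda>x. f v)" for v
    using dd_eqI[OF bounded_linear_imp_has_derivative] by fastforce
  then show ?thesis
    using Suc bl by (simp add: Ck_on_const bounded_linear_imp_differentiable)
qed

lemma Ck_on_add:
  assumes "open S" "Ck_on k S f" "Ck_on k S g"
  shows "Ck_on k S (\<lambda>x. f x + g x)"
  using assms(2,3)
proof (induction k arbitrary: f g)
  case 0
  then show ?case by (auto intro: continuous_intros)
next
  case (Suc k)
  have d: "dd (\<lambda>x. f x + g x) v x = dd f v x + dd g v x" if "x \<in> S" for x v
    using Suc.prems that
    by (intro dd_eqI[where f' = "\<lambda>v. dd f v x + dd g v x"] has_derivative_add)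
      (auto simp: frechet_derivative_works)
  have "Ck_on k S (dd (\<lambda>x. f x + g x) v)" for v
    using Ck_on_cong[OF assms(1) d] Suc by auto
  then show ?case using Suc.prems by auto
qed

lemma Ck_on_bilinear:
  assumes "bounded_bilinear p" "open S" "Ck_on k S f" "Ck_on k S g"
  shows "Ck_on k S (\<lambda>x. p (f x) (g x))"
  using assms(3,4)
proof (induction k arbitrary: f g)
  case 0
  then show ?case by (auto intro: bounded_bilinear.continuous_on[OF assms(1)])
next
  case (Suc k)
  have hd: "((\<lambda>x. p (f x) (g x)) has_derivative (\<lambda>v. p (f x) (dd g v x) + p (dd f v x) (g x))) (at x)"
    if "x \<in> S" for x
    using Suc.prems that
    by (intro bounded_bilinear.FDERIV[OF assms(1)]) (auto simp: frechet_derivative_works)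
  have "Ck_on k S (dd (\<lambda>x. p (f x) (g x)) v)" for v
    using Ck_on_cong[OF assms(2) dd_eqI[OF hd]] Suc Ck_on_SucD[OF Suc.prems(1)] Ck_on_SucD[OF Suc.prems(2)]
    by (auto intro!: Ck_on_add assms(2))
  then show ?case using hd by (auto simp: differentiable_def)
qed

lemma Ck_on_sum:
  assumes "open S" "finite I" "\<And>i. i \<in> I \<Longrightarrow> Ck_on k S (f i)"
  shows "Ck_on k S (\<lambda>x. \<Sum>i\<in>I. f i x)"
  using assms(2,3) by (induction I) (auto intro!: Ck_on_add Ck_on_const assms(1))

lemma linear_Basis_expansion:
  fixes h :: "'a::euclidean_space \<Rightarrow> 'b::real_vector"
  assumes "linear h"
  shows "h v = (\<Sum>b\<in>Basis. (v \<bullet> b) *\<^sub>R h b)"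
proof -
  have "h v = h (\<Sum>b\<in>Basis. (v \<bullet> b) *\<^sub>R b)" by (simp add: euclidean_representation)
  also have "\<dots> = (\<Sum>b\<in>Basis. (v \<bullet> b) *\<^sub>R h b)"
    by (simp add: linear_sum[OF assms] linear_scale[OF assms])
  finally show ?thesis .
qed

lemma linear_dd: "f differentiable (at x) \<Longrightarrow> linear (\<lambda>v. dd f v x)"
  by (metis (no_types) frechet_derivative_works has_derivative_linear)

lemma dd_Basis_expansion:
  fixes f :: "'a::euclidean_space \<Rightarrow> 'b::real_normed_vector"
  assumes "f differentiable (at x)"
  shows "dd f v x = (\<Sum>b\<in>Basis. (v \<bullet> b) *\<^sub>R dd f b x)"
  by (rule linear_Basis_expansion[OF linear_dd[OF assms]])

text \<open>\<open>Ck_on\<close> controls derivatives in fixed directions, whereas the chain rule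
  evaluates \<open>dd g\<close> in the moving direction \<open>dd f v x\<close>. Expanding that
  direction in the basis leaves a finite sum of products, to which the induction hypothesis
  applies.\<close>

lemma Ck_on_compose:
  fixes f :: "'a::euclidean_space \<Rightarrow> 'b::euclidean_space" and g :: "'b \<Rightarrow> 'c::real_normed_vector"
  assumes "open S" "f ` S \<subseteq> T" "Ck_on k S f" "Ck_on k T g"
  shows "Ck_on k S (\<lambda>x. g (f x))"
  using assms(2-4)
proof (induction k arbitrary: f g)
  case 0
  then show ?case by (auto intro: continuous_on_compose2)
next
  case (Suc k)
  have diffg: "g differentiable (at (f x))" if "x \<in> S" for x
    using Suc.prems that by auto
  have hd: "((\<lambda>x. g (f x)) has_derivative (\<lambda>v. dd g (dd f v x) (f x))) (at x)" if "x \<in> S" for x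
  proof -
    have "(f has_derivative (\<lambda>v. dd f v x)) (at x)" "(g has_derivative (\<lambda>v. dd g v (f x))) (at (f x))"
      using diffg[OF that] Suc.prems(2) that frechet_derivative_works by auto
    then show ?thesis using has_derivative_compose by blast
  qed
  have eq: "dd (\<lambda>x. g (f x)) v x = (\<Sum>b\<in>Basis. (dd f v x \<bullet> b) *\<^sub>R dd g b (f x))" if "x \<in> S" for x v
    by (rule trans[OF dd_eqI[OF hd[OF that]] dd_Basis_expansion[OF diffg[OF that]]])
  have 1: "Ck_on k S (\<lambda>x. dd g b (f x))" for b
    using Suc.IH[of f "dd g b"] Suc.prems(1,3) Ck_on_SucD[OF Suc.prems(2)] by auto
  have 2: "Ck_on k S (\<lambda>x. dd f v x \<bullet> b)" for v b
    using Suc.prems(2)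
    by (intro Ck_on_bilinear[OF bounded_bilinear_inner] assms(1) Ck_on_const) auto
  have sm: "Ck_on k S (\<lambda>x. \<Sum>b\<in>Basis. (dd f v x \<bullet> b) *\<^sub>R dd g b (f x))" for v
    by (intro Ck_on_sum assms(1) finite_Basis Ck_on_bilinear[OF bounded_bilinear_scaleR] 1 2)
  have "Ck_on k S (dd (\<lambda>x. g (f x)) v)" for v
    by (rule Ck_on_cong_imp[OF sm assms(1) eq])
  then show ?case using hd by (auto simp: differentiable_def)
qed

named_theorems smooth

lemma smooth_on_const [smooth]: "smooth_on S (\<lambda>x. c)"
  by (simp add: smooth_on_def Ck_on_const)

lemma smooth_on_bounded_linear: "bounded_linear f \<Longrightarrow> smooth_on S f"
  by (simp add: smooth_on_def Ck_on_bounded_linear)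

lemma smooth_on_id [smooth]: "smooth_on S (\<lambda>x. x)"
  by (simp add: smooth_on_bounded_linear bounded_linear_ident)

lemma smooth_on_add [smooth]:
  "open S \<Longrightarrow> smooth_on S f \<Longrightarrow> smooth_on S g \<Longrightarrow> smooth_on S (\<lambda>x. f x + g x)"
  by (simp add: smooth_on_def Ck_on_add)

lemma smooth_on_bilinear:
  "bounded_bilinear p \<Longrightarrow> open S \<Longrightarrow> smooth_on S f \<Longrightarrow> smooth_on S g \<Longrightarrow> smooth_on S (\<lambda>x. p (f x) (g x))"
  by (simp add: smooth_on_def Ck_on_bilinear)

lemmas smooth_on_scaleR [smooth] = smooth_on_bilinear[OF bounded_bilinear_scaleR]
lemmas smooth_on_mult [smooth] = smooth_on_bilinear[OF bounded_bilinear_mult]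
lemmas smooth_on_inner [smooth] = smooth_on_bilinear[OF bounded_bilinear_inner]

lemma smooth_on_uminus [smooth]: "open S \<Longrightarrow> smooth_on S f \<Longrightarrow> smooth_on S (\<lambda>x. - f x)"
  using smooth_on_scaleR[of S "\<lambda>x. -1" f] by (simp add: smooth_on_const)

lemma smooth_on_diff [smooth]:
  "open S \<Longrightarrow> smooth_on S f \<Longrightarrow> smooth_on S g \<Longrightarrow> smooth_on S (\<lambda>x. f x - g x)"
  using smooth_on_add[of S f "\<lambda>x. - g x"] by (simp add: smooth_on_uminus)

lemma smooth_on_sum [smooth]:
  "open S \<Longrightarrow> (\<And>i. i \<in> I \<Longrightarrow> smooth_on S (f i)) \<Longrightarrow> smooth_on S (\<lambda>x. \<Sum>i\<in>I. f i x)"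
  by (cases "finite I") (auto simp: smooth_on_def Ck_on_sum Ck_on_const)

lemma smooth_on_prod [smooth]:
  fixes f :: "'i \<Rightarrow> 'a::euclidean_space \<Rightarrow> real"
  assumes "open S" "\<And>i. i \<in> I \<Longrightarrow> smooth_on S (f i)"
  shows "smooth_on S (\<lambda>x. \<Prod>i\<in>I. f i x)"
proof (cases "finite I")
  case True
  then show ?thesis using assms(2)
    by (induction I) (simp_all add: smooth_on_const smooth_on_mult assms(1))
qed (simp add: smooth_on_const)

lemma smooth_on_power [smooth]:
  fixes f :: "'a::euclidean_space \<Rightarrow> real"
  shows "open S \<Longrightarrow> smooth_on S f \<Longrightarrow> smooth_on S (\<lambda>x. f x ^ n)"
  by (induction n) (simp_all add: smooth_on_const smooth_on_mult)

lemma smooth_on_compose: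
  fixes f :: "'a::euclidean_space \<Rightarrow> 'b::euclidean_space" and g :: "'b \<Rightarrow> 'c::real_normed_vector"
  assumes "smooth_on T g" "open S" "f ` S \<subseteq> T" "smooth_on S f"
  shows "smooth_on S (\<lambda>x. g (f x))"
  unfolding smooth_on_def
proof
  show "Ck_on k S (\<lambda>x. g (f x))" for k
    by (rule Ck_on_compose[OF assms(2,3)]) (use assms(1,4) in \<open>simp_all add: smooth_on_def\<close>)
qed

lemma smooth_on_linear:
  fixes f :: "'a::euclidean_space \<Rightarrow> 'b::euclidean_space"
  shows "bounded_linear L \<Longrightarrow> open S \<Longrightarrow> smooth_on S f \<Longrightarrow> smooth_on S (\<lambda>x. L (f x))"
  using smooth_on_compose[OF smooth_on_bounded_linear, of L S f UNIV] by auto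

lemma smooth_on_vec_nth [smooth]:
  fixes f :: "'a::euclidean_space \<Rightarrow> 'b::euclidean_space^'n"
  shows "open S \<Longrightarrow> smooth_on S f \<Longrightarrow> smooth_on S (\<lambda>x. f x $ i)"
  by (rule smooth_on_linear[OF bounded_linear_vec_nth])

lemma vec_eq_sum_axis: "x = (\<Sum>i\<in>UNIV. axis i (x $ i))" for x :: "'a::real_normed_vector^'n"
  by (simp add: vec_eq_iff axis_def if_distrib cong: if_cong)

lemma bounded_linear_axis: "bounded_linear (axis i :: 'a::euclidean_space \<Rightarrow> 'a^'n)"
  unfolding linear_conv_bounded_linear[symmetric]
  by (rule linearI) (auto simp: vec_eq_iff axis_def)

lemma smooth_on_vecI:
  fixes f :: "'a::euclidean_space \<Rightarrow> 'b::euclidean_space^'n"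
  assumes "open S" "\<And>i. smooth_on S (\<lambda>x. f x $ i)"
  shows "smooth_on S f"
proof -
  have "smooth_on S (\<lambda>x. \<Sum>i\<in>UNIV. axis i (f x $ i) :: 'b^'n)"
    by (intro smooth_on_sum smooth_on_linear[OF bounded_linear_axis] assms)
  then show ?thesis by (simp flip: vec_eq_sum_axis)
qed

lemma smooth_on_vec_lambda [smooth]:
  fixes f :: "'n::finite \<Rightarrow> 'a::euclidean_space \<Rightarrow> 'b::euclidean_space"
  assumes "open S" "\<And>i. smooth_on S (f i)"
  shows "smooth_on S (\<lambda>x. \<chi> i. f i x)"
  by (rule smooth_on_vecI) (use assms in auto)

lemma smooth_on_matrix_vector_mult [smooth]:
  fixes M :: "'a::euclidean_space \<Rightarrow> real^'n^'m"
  shows "open S \<Longrightarrow> smooth_on S M \<Longrightarrow> smooth_on S v \<Longrightarrow> smooth_on S (\<lambda>x. M x *v v x)"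
  unfolding matrix_vector_mult_def by (intro smooth)

lemma smooth_on_det [smooth]:
  fixes M :: "'a::euclidean_space \<Rightarrow> real^'n^'n"
  shows "open S \<Longrightarrow> smooth_on S M \<Longrightarrow> smooth_on S (\<lambda>x. det (M x))"
  unfolding det_def by (intro smooth)

lemma Ck_on_inverse: "Ck_on k (- {0}) (inverse :: real \<Rightarrow> real)"
proof (induction k)
  case 0
  then show ?case by (auto intro!: continuous_intros)
next
  case (Suc k)
  have hd: "((inverse :: real \<Rightarrow> real) has_derivative (\<lambda>h. - (inverse x * h * inverse x))) (at x)"
    if "x \<in> - {0}" for x
    using that has_derivative_inverse' by auto
  have "Ck_on k (- {0}) (\<lambda>x. - v * (inverse x * inverse x) :: real)" for v
    by (intro Ck_on_bilinear[OF bounded_bilinear_mult] Ck_on_const Suc) auto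
  then have "Ck_on k (- {0}) (dd (inverse :: real \<Rightarrow> real) v)" for v
    using Ck_on_cong[where f = "dd (inverse :: real \<Rightarrow> real) v" and g = "\<lambda>x. - v * (inverse x * inverse x)"
        and S = "- {0::real}" and k = k] dd_eqI[OF hd]
    by (auto simp: algebra_simps)
  then show ?case using hd by (auto simp: differentiable_def)
qed

lemma smooth_on_inverse [smooth]:
  fixes f :: "'a::euclidean_space \<Rightarrow> real"
  assumes "open S" "smooth_on S f" "\<And>x. x \<in> S \<Longrightarrow> f x \<noteq> 0"
  shows "smooth_on S (\<lambda>x. inverse (f x))"
  by (rule smooth_on_compose[of "- {0}"]) (use assms Ck_on_inverse in \<open>auto simp: smooth_on_def\<close>)

lemma smooth_on_divide [smooth]:
  fixes f :: "'a::euclidean_space \<Rightarrow> real"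
  assumes "open S" "smooth_on S f" "smooth_on S g" "\<And>x. x \<in> S \<Longrightarrow> g x \<noteq> 0"
  shows "smooth_on S (\<lambda>x. f x / g x)"
  unfolding divide_inverse by (intro smooth assms)

lemma smooth_on_sin_cos: "Ck_on k UNIV (sin :: real \<Rightarrow> real) \<and> Ck_on k UNIV (cos :: real \<Rightarrow> real)"
proof (induction k)
  case 0
  then show ?case by (auto intro!: continuous_intros)
next
  case (Suc k)
  have 1: "((sin :: real \<Rightarrow> real) has_derivative (\<lambda>h. h * cos x)) (at x)"
     "((cos :: real \<Rightarrow> real) has_derivative (\<lambda>h. - h * sin x)) (at x)" for x
    by (auto intro!: derivative_eq_intros)
  have "dd (sin :: real \<Rightarrow> real) v = (\<lambda>x. v * cos x)" "dd (cos :: real \<Rightarrow> real) v = (\<lambda>x. - v * sin x)" for v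
    using dd_eqI[OF 1(1)] dd_eqI[OF 1(2)] by auto
  moreover have "Ck_on k UNIV (\<lambda>x. v * cos x)" "Ck_on k UNIV (\<lambda>x. - v * sin x)" for v :: real
    by (intro Ck_on_bilinear[OF bounded_bilinear_mult] Ck_on_const open_UNIV; use Suc in simp)+
  moreover have "(sin :: real \<Rightarrow> real) differentiable (at x)" "(cos :: real \<Rightarrow> real) differentiable (at x)" for x
    using 1 differentiable_def by blast+
  ultimately show ?case by simp
qed

lemma smooth_on_sin [smooth]: "open S \<Longrightarrow> smooth_on S f \<Longrightarrow> smooth_on S (\<lambda>x. sin (f x :: real))"
  by (rule smooth_on_compose[of UNIV]) (use smooth_on_sin_cos in \<open>auto simp: smooth_on_def\<close>)

lemma smooth_on_cos [smooth]: "open S \<Longrightarrow> smooth_on S f \<Longrightarrow> smooth_on S (\<lambda>x. cos (f x :: real))"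
  by (rule smooth_on_compose[of UNIV]) (use smooth_on_sin_cos in \<open>auto simp: smooth_on_def\<close>)

lemma smooth_on_dd_field:
  assumes "open S" "smooth_on S f" "smooth_on S v"
  shows "smooth_on S (\<lambda>x. dd f (v x) x)"
proof -
  have "smooth_on S (\<lambda>x. \<Sum>b\<in>Basis. (v x \<bullet> b) *\<^sub>R dd f b x)"
    by (intro smooth assms smooth_on_dd)
  then show ?thesis
    by (rule smooth_on_cong_imp) (use assms in \<open>auto intro: dd_Basis_expansion smooth_onD_diff\<close>)
qed

lemma has_derivative_smooth_compose:
  assumes "smooth_on S F" "h s \<in> S" "(h has_derivative h') (at s)"
  shows "((\<lambda>s. F (h s)) has_derivative (\<lambda>r. dd F (h' r) (h s))) (at s)"
  using has_derivative_compose[OF assms(3), of F "\<lambda>v. dd F v (h s)"] smooth_onD_deriv[OF assms(1,2)] by blast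

section \<open>Smoothness of matrix inversion\<close>

lemma matrix_inv_mult:
  fixes A :: "real^'n^'n"
  assumes "det A \<noteq> 0"
  shows "A ** matrix_inv A = mat 1" "matrix_inv A ** A = mat 1"
proof -
  have "\<exists>A'. A ** A' = mat 1 \<and> A' ** A = mat 1"
    using assms invertible_det_nz[of A] unfolding invertible_def by blast
  then have "A ** matrix_inv A = mat 1 \<and> matrix_inv A ** A = mat 1"
    unfolding matrix_inv_def by (rule someI_ex)
  then show "A ** matrix_inv A = mat 1" "matrix_inv A ** A = mat 1" by auto
qed

text \<open>\<open>matrix_inv\<close> is defined by choice; Cramer's rule exhibits its entries as
  rational functions of the entries of \<open>A\<close>, which is what smoothness requires.\<close>

lemma matrix_inv_cramer:
  fixes A :: "real^'n^'n"
  assumes "det A \<noteq> 0"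
  shows "matrix_inv A $ k $ l = det (\<chi> i j. if j = k then (if i = l then 1 else 0) else A $ i $ j) / det A"
proof -
  have "A ** matrix_inv A = mat 1"
    by (rule matrix_inv_mult(1)[OF assms])
  then have "A *v (matrix_inv A *v axis l 1) = axis l 1"
    by (simp add: matrix_vector_mul_assoc)
  then have "matrix_inv A *v axis l 1 = (\<chi> k. det (\<chi> i j. if j = k then axis l 1 $ i else A $ i $ j) / det A)"
    using cramer[OF assms] by blast
  moreover have "(matrix_inv A *v axis l 1) $ k = matrix_inv A $ k $ l"
    by (simp add: matrix_vector_mult_def axis_def if_distrib cong: if_cong)
  moreover have "axis l 1 $ i = (if i = l then 1 else 0 :: real)" for i
    by (auto simp: axis_def)
  ultimately show ?thesis by (simp cong: if_cong)
qed

lemma smooth_on_matrix_inv [smooth]: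
  fixes M :: "'a::euclidean_space \<Rightarrow> real^'n^'n"
  assumes "open S" "smooth_on S M" "\<And>x. x \<in> S \<Longrightarrow> det (M x) \<noteq> 0"
  shows "smooth_on S (\<lambda>x. matrix_inv (M x))"
proof (intro smooth_on_vecI assms(1))
  fix k l
  have ent: "smooth_on S (\<lambda>x. if j = k then (if i = l then 1 else 0) else M x $ i $ j)" for i j
    by (cases "j = k") (simp_all add: smooth_on_const smooth_on_vec_nth assms(1,2))
  have "smooth_on S (\<lambda>x. det (\<chi> i j. if j = k then (if i = l then 1 else 0) else M x $ i $ j) / det (M x))"
    by (intro smooth_on_divide smooth_on_det smooth_on_vec_lambda ent assms)
  then show "smooth_on S (\<lambda>x. matrix_inv (M x) $ k $ l)"
    by (rule smooth_on_cong_imp[OF _ assms(1)]) (rule matrix_inv_cramer[OF assms(3)])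
qed

section \<open>Symmetry of second derivatives\<close>

lemma second_difference_mvt:
  fixes f :: "'a::euclidean_space \<Rightarrow> real"
  assumes "smooth_on S f" "0 < h"
    and sub: "\<And>s t. 0 \<le> s \<Longrightarrow> s \<le> h \<Longrightarrow> 0 \<le> t \<Longrightarrow> t \<le> h \<Longrightarrow> x + s *\<^sub>R v + t *\<^sub>R w \<in> S"
  shows "\<exists>s t. 0 \<le> s \<and> s \<le> h \<and> 0 \<le> t \<and> t \<le> h \<and>
    f (x + h *\<^sub>R v + h *\<^sub>R w) - f (x + h *\<^sub>R v) - f (x + h *\<^sub>R w) + f x
      = h * h * dd (dd f v) w (x + s *\<^sub>R v + t *\<^sub>R w)"
proof -
  have hd: "((\<lambda>s. F (y + s *\<^sub>R u)) has_derivative (\<lambda>r. r * dd F u (y + s *\<^sub>R u))) (at s)"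
    if "smooth_on S F" "y + s *\<^sub>R u \<in> S" for F :: "'a \<Rightarrow> real" and y u s
  proof -
    have "((\<lambda>s. F (y + s *\<^sub>R u)) has_derivative (\<lambda>r. dd F (r *\<^sub>R u) (y + s *\<^sub>R u))) (at s)"
      by (rule has_derivative_smooth_compose[where h = "\<lambda>s. y + s *\<^sub>R u", OF that])
        (auto intro!: derivative_eq_intros)
    then show ?thesis
      using linear_scale[OF linear_dd[OF smooth_onD_diff[OF that]]] by simp
  qed
  have D: "((\<lambda>s. F (y + s *\<^sub>R u)) has_real_derivative dd F u (y + s *\<^sub>R u)) (at s)"
    if "smooth_on S F" "y + s *\<^sub>R u \<in> S" for F :: "'a \<Rightarrow> real" and y u s
    using hd[OF that] unfolding has_field_derivative_def mult.commute[of "dd F u (y + s *\<^sub>R u)"] .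
  \<comment> \<open>The mean value theorem is used twice: for the increment \<open>G\<close> in the
    direction \<open>v\<close>, and for \<open>dd f v\<close> in the direction
    \<open>w\<close>.\<close>
  define G where "G s = f ((x + h *\<^sub>R w) + s *\<^sub>R v) - f (x + s *\<^sub>R v)" for s
  have "(G has_real_derivative (dd f v ((x + h *\<^sub>R w) + s *\<^sub>R v) - dd f v (x + s *\<^sub>R v))) (at s)"
    if "0 \<le> s" "s \<le> h" for s
    unfolding G_def
    by (intro DERIV_diff D assms(1)) (use sub[of s h] sub[of s 0] that assms(2) in \<open>auto simp: algebra_simps\<close>)
  from MVT2[OF assms(2) this] obtain s where s: "0 < s" "s < h"
    "G h - G 0 = h * (dd f v ((x + h *\<^sub>R w) + s *\<^sub>R v) - dd f v (x + s *\<^sub>R v))" by auto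
  have "((\<lambda>t. dd f v ((x + s *\<^sub>R v) + t *\<^sub>R w)) has_real_derivative
      dd (dd f v) w ((x + s *\<^sub>R v) + t *\<^sub>R w)) (at t)" if "0 \<le> t" "t \<le> h" for t
    by (rule D[OF smooth_on_dd[OF assms(1)]]) (use sub[of s t] that s in auto)
  from MVT2[OF assms(2) this] obtain t where t: "0 < t" "t < h"
    "dd f v ((x + s *\<^sub>R v) + h *\<^sub>R w) - dd f v (x + s *\<^sub>R v) = h * dd (dd f v) w ((x + s *\<^sub>R v) + t *\<^sub>R w)"
    by auto
  have "f (x + h *\<^sub>R v + h *\<^sub>R w) - f (x + h *\<^sub>R v) - f (x + h *\<^sub>R w) + f x = G h - G 0"
    by (simp add: G_def algebra_simps)
  also have "\<dots> = h * h * dd (dd f v) w (x + s *\<^sub>R v + t *\<^sub>R w)"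
    using s(3) t(3) by (simp add: algebra_simps)
  finally show ?thesis using s t by (intro exI[of _ s] exI[of _ t]) auto
qed

lemma second_difference_limit:
  fixes f :: "'a::euclidean_space \<Rightarrow> real"
  assumes "open S" "x \<in> S" "smooth_on S f"
  shows "((\<lambda>h. (f (x + h *\<^sub>R v + h *\<^sub>R w) - f (x + h *\<^sub>R v) - f (x + h *\<^sub>R w) + f x) / (h * h))
    \<longlongrightarrow> dd (dd f v) w x) (at_right 0)"
proof (rule tendstoI)
  fix e :: real assume "0 < e"
  have "continuous_on S (dd (dd f v) w)"
    by (intro smooth_on_imp_continuous_on smooth_on_dd assms)
  then have "(dd (dd f v) w \<longlongrightarrow> dd (dd f v) w x) (nhds x)"
    using assms(1,2) continuous_on_eq_continuous_at[OF assms(1)] continuous_at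
      tendsto_at_iff_tendsto_nhds by blast
  then have "\<forall>\<^sub>F y in nhds x. dist (dd (dd f v) w y) (dd (dd f v) w x) < e \<and> y \<in> S"
    by (intro eventually_conj tendstoD[OF _ \<open>0 < e\<close>] eventually_nhds_in_open assms)
  then obtain d where d: "0 < d" "\<And>y. dist y x < d \<Longrightarrow> dist (dd (dd f v) w y) (dd (dd f v) w x) < e \<and> y \<in> S"
    unfolding eventually_nhds_metric by blast
  define c where "c = d / (norm v + norm w + 1)"
  have "0 < c" unfolding c_def using d(1) by (intro divide_pos_pos) (auto intro: add_nonneg_pos)
  have close: "dist (x + s *\<^sub>R v + t *\<^sub>R w) x < d"
    if "0 \<le> s" "s \<le> h" "0 \<le> t" "t \<le> h" "0 < h" "h < c" for s t h
  proof -
    have "dist (x + s *\<^sub>R v + t *\<^sub>R w) x = norm (s *\<^sub>R v + t *\<^sub>R w)"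
      by (simp add: dist_norm algebra_simps)
    also have "\<dots> \<le> s * norm v + t * norm w"
      using norm_triangle_ineq[of "s *\<^sub>R v" "t *\<^sub>R w"] that by simp
    also have "\<dots> \<le> h * norm v + h * norm w"
      using that by (intro add_mono mult_right_mono) auto
    also have "\<dots> < h * (norm v + norm w + 1)" using that by (simp add: algebra_simps)
    also have "\<dots> < c * (norm v + norm w + 1)"
      using that by (intro mult_strict_right_mono) (auto intro: add_nonneg_pos)
    also have "\<dots> = d"
    proof -
      have "norm v + norm w + 1 \<noteq> 0" by (smt (verit) norm_ge_zero)
      then show ?thesis by (simp add: c_def)
    qed
    finally show ?thesis .
  qed
  have "dist ((f (x + h *\<^sub>R v + h *\<^sub>R w) - f (x + h *\<^sub>R v) - f (x + h *\<^sub>R w) + f x) / (h * h)) (dd (dd f v) w x) < e"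
    if h: "0 < h" "h < c" for h
  proof -
    obtain s t where st: "0 \<le> s" "s \<le> h" "0 \<le> t" "t \<le> h"
      "f (x + h *\<^sub>R v + h *\<^sub>R w) - f (x + h *\<^sub>R v) - f (x + h *\<^sub>R w) + f x
        = h * h * dd (dd f v) w (x + s *\<^sub>R v + t *\<^sub>R w)"
      using second_difference_mvt[OF assms(3) h(1), of x v w] close d(2) h by blast
    have "dist (dd (dd f v) w (x + s *\<^sub>R v + t *\<^sub>R w)) (dd (dd f v) w x) < e"
      using d(2) close st h by blast
    then show ?thesis using st(5) h by simp
  qed
  then show "\<forall>\<^sub>F h in at_right 0. dist ((f (x + h *\<^sub>R v + h *\<^sub>R w) - f (x + h *\<^sub>R v) - f (x + h *\<^sub>R w) + f x) / (h * h))
      (dd (dd f v) w x) < e"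
    using \<open>0 < c\<close> unfolding eventually_at_right_field by blast
qed

text \<open>The second difference is symmetric in \<open>v\<close> and \<open>w\<close>, so its
  limit equals both mixed derivatives.\<close>

lemma dd_commute_real:
  fixes f :: "'a::euclidean_space \<Rightarrow> real"
  assumes "open S" "x \<in> S" "smooth_on S f"
  shows "dd (dd f v) w x = dd (dd f w) v x"
proof -
  have "((\<lambda>h. (f (x + h *\<^sub>R v + h *\<^sub>R w) - f (x + h *\<^sub>R v) - f (x + h *\<^sub>R w) + f x) / (h * h))
    \<longlongrightarrow> dd (dd f w) v x) (at_right 0)"
    using second_difference_limit[OF assms, of w v] by (simp add: algebra_simps)
  from tendsto_unique[OF _ second_difference_limit[OF assms, of v w] this] show ?thesis by simp
qed

lemma dd_bounded_linear:
  assumes "f differentiable (at x)" "bounded_linear L"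
  shows "dd (\<lambda>x. L (f x)) v x = L (dd f v x)"
  by (rule dd_eqI[OF bounded_linear.has_derivative[OF assms(2)]]) (use assms(1) frechet_derivative_works in blast)

lemma dd_commute:
  fixes f :: "'a::euclidean_space \<Rightarrow> 'b::euclidean_space"
  assumes "open S" "x \<in> S" "smooth_on S f"
  shows "dd (dd f v) w x = dd (dd f w) v x"
proof (rule euclidean_eqI)
  fix b :: 'b assume "b \<in> Basis"
  have bl: "bounded_linear (\<lambda>y. y \<bullet> b)" by (rule bounded_linear_inner_left)
  have *: "dd (dd (\<lambda>y. f y \<bullet> b) v) w x = dd (dd f v) w x \<bullet> b" for v w
  proof -
    have "dd (dd (\<lambda>y. f y \<bullet> b) v) w x = dd (\<lambda>y. dd f v y \<bullet> b) w x"
      by (rule dd_cong[OF assms(1,2)]) (rule dd_bounded_linear[OF smooth_onD_diff[OF assms(3)] bl])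
    also have "\<dots> = dd (dd f v) w x \<bullet> b"
      by (rule dd_bounded_linear[OF smooth_onD_diff[OF smooth_on_dd[OF assms(3)] assms(2)] bl])
    finally show ?thesis .
  qed
  have "smooth_on S (\<lambda>y. f y \<bullet> b)" by (intro smooth_on_inner smooth_on_const assms)
  from dd_commute_real[OF assms(1,2) this, of v w] show "dd (dd f v) w x \<bullet> b = dd (dd f w) v x \<bullet> b"
    by (simp add: *)
qed

text \<open>Division of a smooth function vanishing on a coordinate hyperplane by that coordinate:
  \<open>f x = (x \<bullet> e) \<integral>\<^sub>0\<^sup>1 \<partial>\<^sub>e f (x - (1 - t) (x \<bullet> e) e) dt\<close>.\<close>

definition squeeze :: "'a::euclidean_space \<Rightarrow> real \<Rightarrow> 'a \<Rightarrow> 'a" where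
  "squeeze e t x = x - ((1 - t) * (x \<bullet> e)) *\<^sub>R e"

lemma bounded_linear_squeeze: "bounded_linear (squeeze e t)"
  unfolding squeeze_def linear_conv_bounded_linear[symmetric]
  by (rule linearI) (auto simp: inner_add_left algebra_simps)

lemma continuous_on_squeeze: "continuous_on (S \<times> T) (\<lambda>(x, t). squeeze e t x)"
  unfolding squeeze_def case_prod_beta by (intro continuous_intros)

text \<open>The weight \<open>t ^ m\<close> is there for the induction: \<open>squeeze e t\<close>
  scales the component along \<open>e\<close> by \<open>t\<close>, so differentiating the integrand
  raises \<open>m\<close> by one in that direction and leaves it unchanged in the orthogonal
  ones.\<close>

lemma Ck_on_squeeze_integral:
  fixes g :: "'a::euclidean_space \<Rightarrow> 'b::euclidean_space"
  assumes S: "open S" and sq: "\<And>x t. x \<in> S \<Longrightarrow> 0 \<le> t \<Longrightarrow> t \<le> 1 \<Longrightarrow> squeeze e t x \<in> S"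
  shows "smooth_on S g \<Longrightarrow> Ck_on k S (\<lambda>x. integral (cbox 0 1) (\<lambda>t::real. t ^ m *\<^sub>R g (squeeze e t x)))"
proof (induction k arbitrary: g m)
  case 0
  have "continuous_on (S \<times> cbox 0 1) (\<lambda>p. g (case p of (x, t) \<Rightarrow> squeeze e t x))"
    by (rule continuous_on_compose2[OF smooth_on_imp_continuous_on[OF 0] continuous_on_squeeze])
      (auto intro: sq)
  then have "continuous_on (S \<times> cbox 0 1) (\<lambda>p. snd p ^ m *\<^sub>R g (squeeze e (snd p) (fst p)))"
    by (intro continuous_intros) (auto simp: case_prod_beta)
  then show ?case
    unfolding Ck_on.simps by (intro integral_continuous_on_param) (simp only: case_prod_unfold)
next
  case (Suc k)
  define J where "J m g x = integral (cbox 0 1) (\<lambda>t::real. t ^ m *\<^sub>R g (squeeze e t x))" for m and g :: "'a \<Rightarrow> 'b" and x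
  \<comment> \<open>Differentiation under the integral asks for a derivative that is continuous as a
    map into the bounded linear maps; its continuity is checked on basis vectors below.\<close>
  define B where "B x t = Blinfun (\<lambda>v. t ^ m *\<^sub>R dd g (squeeze e t v) (squeeze e t x))" for x t
  have cont: "continuous_on (S \<times> cbox 0 1) (\<lambda>p. snd p ^ j *\<^sub>R h (squeeze e (snd p) (fst p)))"
    if "smooth_on S h" for h :: "'a \<Rightarrow> 'b" and j
  proof -
    have "continuous_on (S \<times> cbox 0 1) (\<lambda>p. h (case p of (x, t) \<Rightarrow> squeeze e t x))"
      by (rule continuous_on_compose2[OF smooth_on_imp_continuous_on[OF that] continuous_on_squeeze])
        (auto intro: sq)
    then show ?thesis by (intro continuous_intros) (auto simp: case_prod_beta)
  qed
  have hd: "((\<lambda>x. t ^ m *\<^sub>R g (squeeze e t x)) has_derivative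
      (\<lambda>v. t ^ m *\<^sub>R dd g (squeeze e t v) (squeeze e t x))) (at x)"
    if "x \<in> S" "t \<in> cbox 0 1" for x t
  proof -
    have "squeeze e t x \<in> S" using sq that by auto
    from has_derivative_smooth_compose[where h = "squeeze e t", OF Suc.prems this bounded_linear_imp_has_derivative[OF bounded_linear_squeeze]]
    show ?thesis by (rule has_derivative_scaleR_right)
  qed
  have B: "blinfun_apply (B x t) = (\<lambda>v. t ^ m *\<^sub>R dd g (squeeze e t v) (squeeze e t x))"
    if "x \<in> S" "t \<in> cbox 0 1" for x t
    unfolding B_def by (rule bounded_linear_Blinfun_apply[OF has_derivative_bounded_linear[OF hd[OF that]]])
  have split: "t ^ m *\<^sub>R dd g (squeeze e t v) (squeeze e t x) =
      t ^ m *\<^sub>R dd g (v - (v \<bullet> e) *\<^sub>R e) (squeeze e t x) + (v \<bullet> e) *\<^sub>R t ^ Suc m *\<^sub>R dd g e (squeeze e t x)"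
    if "x \<in> S" "t \<in> cbox 0 1" for x t v
  proof -
    have lin: "linear (\<lambda>v. dd g v (squeeze e t x))"
      using linear_dd[OF smooth_onD_diff[OF Suc.prems sq]] that by auto
    have "squeeze e t v = (v - (v \<bullet> e) *\<^sub>R e) + (t * (v \<bullet> e)) *\<^sub>R e"
      by (simp add: squeeze_def algebra_simps)
    then have "dd g (squeeze e t v) (squeeze e t x) =
      dd g (v - (v \<bullet> e) *\<^sub>R e) (squeeze e t x) + (t * (v \<bullet> e)) *\<^sub>R dd g e (squeeze e t x)"
      using linear_add[OF lin] linear_scale[OF lin] by simp
    then show ?thesis by (simp add: algebra_simps)
  qed
  have contB: "continuous_on (S \<times> cbox 0 1) (\<lambda>(x, t). B x t)"
  proof (rule continuous_on_blinfun_componentwise)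
    fix i :: 'a
    have "continuous_on (S \<times> cbox 0 1) (\<lambda>p. snd p ^ m *\<^sub>R dd g (i - (i \<bullet> e) *\<^sub>R e) (squeeze e (snd p) (fst p))
        + (i \<bullet> e) *\<^sub>R (snd p ^ Suc m *\<^sub>R dd g e (squeeze e (snd p) (fst p))))"
      by (intro continuous_on_add continuous_on_scaleR continuous_on_const cont smooth_on_dd Suc.prems)
    then show "continuous_on (S \<times> cbox 0 1) (\<lambda>p. blinfun_apply (case p of (x, t) \<Rightarrow> B x t) i)"
      by (rule continuous_on_eq) (auto simp: B split)
  qed
  have int: "(\<lambda>t. t ^ j *\<^sub>R h (squeeze e t x)) integrable_on cbox 0 1" if "smooth_on S h" "x \<in> S"
    for h :: "'a \<Rightarrow> 'b" and j x
  proof (rule integrable_continuous)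
    have "continuous_on (cbox 0 1) (\<lambda>t. (\<lambda>p. snd p ^ j *\<^sub>R h (squeeze e (snd p) (fst p))) (x, t))"
      by (rule continuous_on_compose2[OF cont[OF that(1)]]) (use that(2) in \<open>auto intro!: continuous_intros\<close>)
    then show "continuous_on (cbox 0 1) (\<lambda>t. t ^ j *\<^sub>R h (squeeze e t x))" by simp
  qed
  have deriv: "(J m g has_derivative (\<lambda>v. J m (dd g (v - (v \<bullet> e) *\<^sub>R e)) x + (v \<bullet> e) *\<^sub>R J (Suc m) (dd g e) x)) (at x)"
    if x: "x \<in> S" for x
  proof -
    obtain r where r: "0 < r" "ball x r \<subseteq> S" using S x open_contains_ball by blast
    have "((\<lambda>x. integral (cbox 0 1) (\<lambda>t. t ^ m *\<^sub>R g (squeeze e t x))) has_derivative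
        blinfun_apply (integral (cbox 0 1) (B x))) (at x within ball x r)"
    proof (rule leibniz_rule)
      show "((\<lambda>x. t ^ m *\<^sub>R g (squeeze e t x)) has_derivative blinfun_apply (B y t)) (at y within ball x r)"
        if "y \<in> ball x r" "t \<in> cbox 0 1" for y t
      proof -
        have y: "y \<in> S" using r that by blast
        show ?thesis
          unfolding B[OF y that(2)] by (rule has_derivative_at_withinI[OF hd[OF y that(2)]])
      qed
      show "(\<lambda>t. t ^ m *\<^sub>R g (squeeze e t y)) integrable_on cbox 0 1" if "y \<in> ball x r" for y
        using int[OF Suc.prems] r that by blast
      show "continuous_on (ball x r \<times> cbox 0 1) (\<lambda>(x, t). B x t)"
        by (rule continuous_on_subset[OF contB]) (use r in auto)
    qed (use r in auto)
    then have 1: "(J m g has_derivative blinfun_apply (integral (cbox 0 1) (B x))) (at x)"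
      using r unfolding J_def[abs_def] by (simp only: at_within_open[of x "ball x r"] centre_in_ball open_ball)
    have intB: "B x integrable_on cbox 0 1"
    proof (rule integrable_continuous)
      have "continuous_on (cbox 0 1) (\<lambda>t. (\<lambda>(x, t). B x t) (x, t))"
        by (rule continuous_on_compose2[OF contB]) (use x in \<open>auto intro!: continuous_intros\<close>)
      then show "continuous_on (cbox 0 1) (B x)" by simp
    qed
    have "blinfun_apply (integral (cbox 0 1) (B x)) v =
        J m (dd g (v - (v \<bullet> e) *\<^sub>R e)) x + (v \<bullet> e) *\<^sub>R J (Suc m) (dd g e) x" for v
    proof -
      have "blinfun_apply (integral (cbox 0 1) (B x)) v = integral (cbox 0 1) (\<lambda>t. blinfun_apply (B x t) v)"
        using integral_linear[OF intB blinfun.bounded_linear_left[of v]] by (simp add: o_def)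
      also have "\<dots> = integral (cbox 0 1) (\<lambda>t. t ^ m *\<^sub>R dd g (v - (v \<bullet> e) *\<^sub>R e) (squeeze e t x) +
          (v \<bullet> e) *\<^sub>R t ^ Suc m *\<^sub>R dd g e (squeeze e t x))"
        by (rule integral_cong) (simp only: B[OF x] split[OF x])
      also have "\<dots> = J m (dd g (v - (v \<bullet> e) *\<^sub>R e)) x + (v \<bullet> e) *\<^sub>R J (Suc m) (dd g e) x"
        unfolding J_def
        by (simp only: Henstock_Kurzweil_Integration.integral_cmul
            Henstock_Kurzweil_Integration.integral_add[OF int[OF smooth_on_dd[OF Suc.prems] x]
              integrable_cmul[OF int[OF smooth_on_dd[OF Suc.prems] x]]])
      finally show ?thesis .
    qed
    then have "blinfun_apply (integral (cbox 0 1) (B x)) =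
        (\<lambda>v. J m (dd g (v - (v \<bullet> e) *\<^sub>R e)) x + (v \<bullet> e) *\<^sub>R J (Suc m) (dd g e) x)" by blast
    with 1 show ?thesis by simp
  qed
  have J: "Ck_on k S (J j h)" if "smooth_on S h" for h j
    using Suc.IH[OF that, of j] unfolding J_def .
  have "Ck_on k S (dd (J m g) v)" for v
    by (rule Ck_on_cong_imp[OF _ S dd_eqI[OF deriv]])
      (intro Ck_on_add S J Ck_on_bilinear[OF bounded_bilinear_scaleR] Ck_on_const smooth_on_dd Suc.prems)
  then have "Ck_on (Suc k) S (J m g)"
    using deriv by (auto simp: differentiable_def)
  then show ?case unfolding J_def[abs_def] .
qed

text \<open>The fundamental theorem of calculus on the segment from the hyperplane to
  \<open>x\<close>. On the hyperplane \<open>squeeze\<close> is the identity and the integrand is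
  constant, whence the last property. It identifies the quotient of \<open>f\<^sub>v\<close> by
  \<open>v\<close> with the second derivative on the axis, and quotients by the radius with
  differentials on the exceptional fibre.\<close>

lemma smooth_division:
  fixes f :: "'a::euclidean_space \<Rightarrow> 'b::euclidean_space"
  assumes S: "open S" and e: "e \<bullet> e = 1" and f: "smooth_on S f"
    and sq: "\<And>x t. x \<in> S \<Longrightarrow> 0 \<le> t \<Longrightarrow> t \<le> 1 \<Longrightarrow> squeeze e t x \<in> S"
    and zero: "\<And>x. x \<in> S \<Longrightarrow> x \<bullet> e = 0 \<Longrightarrow> f x = 0"
  obtains h where "smooth_on S h" "\<And>x. x \<in> S \<Longrightarrow> f x = (x \<bullet> e) *\<^sub>R h x"
    "\<And>x. x \<in> S \<Longrightarrow> x \<bullet> e = 0 \<Longrightarrow> h x = dd f e x"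
proof
  define h where "h x = integral (cbox 0 1) (\<lambda>t::real. dd f e (squeeze e t x))" for x
  show "smooth_on S h"
    using Ck_on_squeeze_integral[OF S sq smooth_on_dd[OF f], where m = 0]
    unfolding smooth_on_def h_def by simp
  show "h x = dd f e x" if "x \<in> S" "x \<bullet> e = 0" for x
    using that by (simp add: h_def squeeze_def)
  show "f x = (x \<bullet> e) *\<^sub>R h x" if x: "x \<in> S" for x
  proof -
    have d: "((\<lambda>t. f (squeeze e t x)) has_vector_derivative (x \<bullet> e) *\<^sub>R dd f e (squeeze e t x)) (at t)"
      if "0 \<le> t" "t \<le> 1" for t
    proof -
      have 1: "((\<lambda>t. squeeze e t x) has_derivative (\<lambda>r. r *\<^sub>R (x \<bullet> e) *\<^sub>R e)) (at t)"
        unfolding squeeze_def by (auto intro!: derivative_eq_intros simp: algebra_simps)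
      have in_S: "squeeze e t x \<in> S" using sq x that by blast
      have "((\<lambda>t. f (squeeze e t x)) has_derivative (\<lambda>r. dd f (r *\<^sub>R (x \<bullet> e) *\<^sub>R e) (squeeze e t x))) (at t)"
        by (rule has_derivative_smooth_compose[where h = "\<lambda>t. squeeze e t x", OF f in_S 1])
      then show ?thesis
        unfolding has_vector_derivative_def
        using linear_scale[OF linear_dd[OF smooth_onD_diff[OF f in_S]]] by simp
    qed
    have "((\<lambda>t. (x \<bullet> e) *\<^sub>R dd f e (squeeze e t x)) has_integral f (squeeze e 1 x) - f (squeeze e 0 x)) {0..1}"
      by (rule fundamental_theorem_of_calculus) (auto intro: has_vector_derivative_at_within d)
    moreover have "f (squeeze e 0 x) = 0"
      using zero[OF sq[OF x, of 0]] e by (simp add: squeeze_def inner_diff_left)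
    moreover have "squeeze e 1 x = x" by (simp add: squeeze_def)
    ultimately have "((\<lambda>t. (x \<bullet> e) *\<^sub>R dd f e (squeeze e t x)) has_integral f x) {0..1}" by simp
    from integral_unique[OF this] show ?thesis by (simp add: h_def)
  qed
qed

section \<open>The inverse function theorem for smooth maps\<close>

lemma dd_matrix:
  fixes f :: "real^'n \<Rightarrow> real^'m"
  assumes "f differentiable (at x)"
  shows "dd f v x = matrix (\<lambda>v. dd f v x) *v v"
  by (rule matrix_works[symmetric]) (use linear_dd[OF assms] in \<open>simp add: linear_def scalar_mult_eq_scaleR\<close>)

lemma smooth_on_matrix_dd:
  fixes f :: "real^'n \<Rightarrow> real^'m"
  assumes "open S" "smooth_on S f"
  shows "smooth_on S (\<lambda>x. matrix (\<lambda>v. dd f v x))"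
  unfolding matrix_def by (intro smooth assms smooth_on_dd)

text \<open>Smoothness of the inverse is a bootstrap: its derivative is
  \<open>matrix_inv (M (g y)) *v v\<close>, a smooth function of \<open>g y\<close>, so
  \<open>g\<close> of class C^k has a derivative of class C^k.\<close>

lemma smooth_inverse_function:
  fixes f :: "real^'n \<Rightarrow> real^'n"
  assumes S: "open S" and f: "smooth_on S f" and x: "x \<in> S" and det: "det (matrix (\<lambda>v. dd f v x)) \<noteq> 0"
  obtains U V g where "open U" "U \<subseteq> S" "x \<in> U" "open V" "homeomorphism U V f g" "smooth_on V g"
    "\<And>z. z \<in> U \<Longrightarrow> det (matrix (\<lambda>v. dd f v z)) \<noteq> 0"
proof -
  define M where "M z = matrix (\<lambda>v. dd f v z)" for z
  have Msm: "smooth_on S M" unfolding M_def by (rule smooth_on_matrix_dd[OF S f])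
  define S' where "S' = {z \<in> S. det (M z) \<noteq> 0}"
  have "continuous_on S (\<lambda>z. det (M z))"
    by (intro smooth_on_imp_continuous_on smooth_on_det S Msm)
  then have "open (S \<inter> (\<lambda>z. det (M z)) -` (- {0}))"
    by (intro continuous_open_preimage S) auto
  moreover have "S' = S \<inter> (\<lambda>z. det (M z)) -` (- {0})" by (auto simp: S'_def)
  ultimately have S': "open S'" by simp
  have sub: "S' \<subseteq> S" by (auto simp: S'_def)
  define f' where "f' z = Blinfun (\<lambda>v. dd f v z)" for z
  have bl: "blinfun_apply (f' z) = (\<lambda>v. dd f v z)" if "z \<in> S" for z
    unfolding f'_def by (rule bounded_linear_Blinfun_apply[OF has_derivative_bounded_linear[OF smooth_onD_deriv[OF f that]]])
  have bij: "dd f v z = M z *v v" if "z \<in> S" for z v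
    unfolding M_def by (rule dd_matrix[OF smooth_onD_diff[OF f that]])
  define invf where "invf = Blinfun (\<lambda>v. matrix_inv (M x) *v v)"
  have blinv: "blinfun_apply invf = (\<lambda>v. matrix_inv (M x) *v v)"
    unfolding invf_def by (rule bounded_linear_Blinfun_apply) (simp add: matrix_vector_mul_bounded_linear)
  have D1: "(f has_derivative blinfun_apply (f' z)) (at z)" if "z \<in> S'" for z
    using bl smooth_onD_deriv[OF f] that sub by auto
  have "continuous_on S f'"
  proof (rule continuous_on_blinfun_componentwise)
    show "continuous_on S (\<lambda>z. blinfun_apply (f' z) i)" for i
      by (rule continuous_on_eq[OF smooth_on_imp_continuous_on[OF smooth_on_dd[OF f, of i]]]) (simp add: bl)
  qed
  then have D2: "continuous_on S' f'" using sub continuous_on_subset by blast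
  have D3: "x \<in> S'" using x det by (simp add: S'_def M_def)
  have D4: "invf o\<^sub>L f' x = id_blinfun"
    using matrix_inv_mult(2)[OF det[folded M_def]]
    by (intro blinfun_eqI) (simp add: blinv bl[OF x] bij[OF x] matrix_vector_mul_assoc)
  obtain U V g g' where UV: "open U" "U \<subseteq> S'" "x \<in> U" "open V" "f x \<in> V" "homeomorphism U V f g"
    "\<And>y. y \<in> V \<Longrightarrow> (g has_derivative (g' y)) (at y)"
    "\<And>y. y \<in> V \<Longrightarrow> g' y = inv (blinfun_apply (f' (g y)))"
    "\<And>y. y \<in> V \<Longrightarrow> bij (blinfun_apply (f' (g y)))"
    by (rule inverse_function_theorem[OF S' D1 D2 D3 D4]) (assumption | rule that)+
  have gU: "g y \<in> U" if "y \<in> V" for y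
    using UV(6) that unfolding homeomorphism_def by blast
  have g': "g' y v = matrix_inv (M (g y)) *v v" if "y \<in> V" for y v
  proof -
    have gS: "g y \<in> S'" using gU[OF that] UV(2) by blast
    then have 1: "blinfun_apply (f' (g y)) = (\<lambda>v. M (g y) *v v)"
      using bl bij sub by auto
    have d: "det (M (g y)) \<noteq> 0" using gS by (simp add: S'_def)
    have "inv (\<lambda>v. M (g y) *v v) v = matrix_inv (M (g y)) *v v"
    proof (rule inv_f_eq)
      show "inj (\<lambda>v. M (g y) *v v)" using UV(9)[OF that] 1 by (simp add: bij_def)
      show "M (g y) *v (matrix_inv (M (g y)) *v v) = v"
        using matrix_inv_mult(1)[OF d] by (simp add: matrix_vector_mul_assoc)
    qed
    then show ?thesis using UV(8)[OF that] 1 by simp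
  qed
  have minv: "smooth_on S' (\<lambda>z. matrix_inv (M z) *v v)" for v
    by (intro smooth_on_matrix_vector_mult smooth_on_matrix_inv S' smooth_on_const smooth_on_subset[OF Msm sub])
      (simp add: S'_def)
  have "Ck_on k V g" for k
  proof (induction k)
    case 0
    then show ?case using UV(6) by (simp add: homeomorphism_def)
  next
    case (Suc k)
    have "Ck_on k V (\<lambda>y. matrix_inv (M (g y)) *v v)" for v
      by (rule Ck_on_compose[OF UV(4) _ Suc, of S' "\<lambda>z. matrix_inv (M z) *v v"])
        (use gU UV(2) minv in \<open>auto simp: smooth_on_def\<close>)
    then have "Ck_on k V (dd g v)" for v
      by (rule Ck_on_cong_imp[OF _ UV(4)]) (simp add: dd_eqI[OF UV(7)] g')
    then show ?case using UV(7) by (auto simp: differentiable_def)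
  qed
  then have "smooth_on V g" by (simp add: smooth_on_def)
  moreover have "det (matrix (\<lambda>v. dd f v z)) \<noteq> 0" if "z \<in> U" for z
    using that UV(2) by (auto simp: S'_def M_def)
  moreover have "U \<subseteq> S" using UV(2) sub by blast
  ultimately show ?thesis using that[OF UV(1) _ UV(3,4,6)] by blast
qed

section \<open>Levi-Civita calculus in coordinates\<close>

definition mip :: "(real^'n \<Rightarrow> real^'n^'n) \<Rightarrow> real^'n \<Rightarrow> real^'n \<Rightarrow> real^'n \<Rightarrow> real" where
  "mip G y a b = a \<bullet> (G y *v b)"

text \<open>\<open>christoffel\<close> with the chart stripped off, so that local computations need
  nothing but a matrix-valued function.\<close>

definition chr :: "(real^'n \<Rightarrow> real^'n^'n) \<Rightarrow> 'n \<Rightarrow> 'n \<Rightarrow> 'n \<Rightarrow> real^'n \<Rightarrow> real" where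
  "chr G k i j z = (1/2) * (\<Sum>l\<in>UNIV. matrix_inv (G z) $ k $ l *
     (pderiv_at i (\<lambda>y. G y $ j $ l) z + pderiv_at j (\<lambda>y. G y $ i $ l) z
      - pderiv_at l (\<lambda>y. G y $ i $ j) z))"

definition gam :: "(real^'n \<Rightarrow> real^'n^'n) \<Rightarrow> real^'n \<Rightarrow> real^'n \<Rightarrow> real^'n \<Rightarrow> real^'n" where
  "gam G y a b = (\<chi> k. \<Sum>i\<in>UNIV. \<Sum>j\<in>UNIV. chr G k i j y * a $ i * b $ j)"

definition covd :: "(real^'n \<Rightarrow> real^'n^'n) \<Rightarrow> ('a::euclidean_space \<Rightarrow> real^'n) \<Rightarrow> ('a \<Rightarrow> real^'n) \<Rightarrow>
    'a \<Rightarrow> 'a \<Rightarrow> real^'n" where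
  "covd G F X w z = dd X w z + gam G (F z) (dd F w z) (X z)"

text \<open>R(a, b) x for constant-coefficient extensions of the three vectors, whose brackets
  vanish. The sign convention is that of \<open>covd_commutator\<close>: R(a, b) is the commutator
  of the derivatives along a and b, in this order.\<close>

definition riem :: "(real^'n \<Rightarrow> real^'n^'n) \<Rightarrow> real^'n \<Rightarrow> real^'n \<Rightarrow> real^'n \<Rightarrow> real^'n \<Rightarrow> real^'n" where
  "riem G y a b x = dd (\<lambda>y. gam G y b x) a y - dd (\<lambda>y. gam G y a x) b y
     + gam G y a (gam G y b x) - gam G y b (gam G y a x)"

lemma bilinear_gam: "bilinear (gam G y)"
  unfolding bilinear_def
  by (auto intro!: linearI simp: gam_def vec_eq_iff algebra_simps sum.distrib sum_distrib_left)

lemma bounded_bilinear_gam: "bounded_bilinear (gam G y)"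
  using bilinear_gam bilinear_conv_bounded_bilinear by blast

lemmas gam_add = bounded_bilinear.add_left[OF bounded_bilinear_gam]
  bounded_bilinear.add_right[OF bounded_bilinear_gam]
lemmas gam_scale = bounded_bilinear.scaleR_left[OF bounded_bilinear_gam]
  bounded_bilinear.scaleR_right[OF bounded_bilinear_gam]
lemmas gam_zero [simp] = bounded_bilinear.zero_left[OF bounded_bilinear_gam]
  bounded_bilinear.zero_right[OF bounded_bilinear_gam]

lemma mip_add: "mip G y (a + b) c = mip G y a c + mip G y b c"
  "mip G y c (a + b) = mip G y c a + mip G y c b"
  by (simp_all add: mip_def inner_add_left inner_add_right matrix_vector_right_distrib)

lemma mip_scale: "mip G y (r *\<^sub>R a) c = r * mip G y a c" "mip G y c (r *\<^sub>R a) = r * mip G y c a"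
  by (simp_all add: mip_def matrix_vector_mult_scaleR)

lemma mip_diff: "mip G y (a - b) c = mip G y a c - mip G y b c"
  "mip G y c (a - b) = mip G y c a - mip G y c b"
  by (simp_all add: mip_def inner_diff_left inner_diff_right matrix_vector_mult_diff_distrib)

lemma mip_zero [simp]: "mip G y 0 c = 0" "mip G y c 0 = 0"
  by (simp_all add: mip_def)

lemma mip_sum: "mip G y (\<Sum>i\<in>I. f i) c = (\<Sum>i\<in>I. mip G y (f i) c)"
  "mip G y c (\<Sum>i\<in>I. f i) = (\<Sum>i\<in>I. mip G y c (f i))"
  by (induction I rule: infinite_finite_induct; simp add: mip_add)+

lemma mip_expand: "mip G y a b = (\<Sum>i\<in>UNIV. \<Sum>j\<in>UNIV. G y $ i $ j * a $ i * b $ j)"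
  by (simp add: mip_def inner_vec_def matrix_vector_mult_def sum_distrib_left algebra_simps)

lemma smooth_on_Pair [smooth]:
  fixes f :: "'a::euclidean_space \<Rightarrow> 'b::euclidean_space" and g :: "'a \<Rightarrow> 'c::euclidean_space"
  assumes "open S" "smooth_on S f" "smooth_on S g"
  shows "smooth_on S (\<lambda>x. (f x, g x))"
proof -
  have "bounded_linear (\<lambda>x::'b. (x, 0::'c))" "bounded_linear (\<lambda>x::'c. (0::'b, x))"
    by (auto intro!: linearI simp flip: linear_conv_bounded_linear)
  then have "smooth_on S (\<lambda>x. (f x, 0::'c) + (0::'b, g x))"
    by (intro smooth_on_add assms(1) smooth_on_linear[OF _ assms(1,2)] smooth_on_linear[OF _ assms(1,3)])
  then show ?thesis by simp
qed

lemma smooth_on_fst [smooth]: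
  fixes f :: "'a::euclidean_space \<Rightarrow> 'b::euclidean_space \<times> 'c::euclidean_space"
  shows "open S \<Longrightarrow> smooth_on S f \<Longrightarrow> smooth_on S (\<lambda>x. fst (f x))"
  by (rule smooth_on_linear[OF bounded_linear_fst])

lemma smooth_on_snd [smooth]:
  fixes f :: "'a::euclidean_space \<Rightarrow> 'b::euclidean_space \<times> 'c::euclidean_space"
  shows "open S \<Longrightarrow> smooth_on S f \<Longrightarrow> smooth_on S (\<lambda>x. snd (f x))"
  by (rule smooth_on_linear[OF bounded_linear_snd])

lemma dd_compose:
  assumes "h differentiable (at z)" "F differentiable (at (h z))"
  shows "dd (\<lambda>z. F (h z)) w z = dd F (dd h w z) (h z)"
proof -
  have "(h has_derivative (\<lambda>v. dd h v z)) (at z)" "(F has_derivative (\<lambda>v. dd F v (h z))) (at (h z))"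
    using assms frechet_derivative_works by auto
  from has_derivative_compose[where f = h and g = F, OF this] show ?thesis by (rule dd_eqI)
qed

lemma dd_Pair:
  assumes "f differentiable (at z)" "g differentiable (at z)"
  shows "dd (\<lambda>z. (f z, g z)) w z = (dd f w z, dd g w z)"
  by (rule dd_eqI[OF has_derivative_Pair]) (use assms frechet_derivative_works in blast)+

lemma dd_add:
  assumes "f differentiable (at z)" "g differentiable (at z)"
  shows "dd (\<lambda>z. f z + g z) w z = dd f w z + dd g w z"
  by (rule dd_eqI[OF has_derivative_add]) (use assms frechet_derivative_works in blast)+

lemma dd_bilinear:
  assumes "bounded_bilinear p" "f differentiable (at z)" "g differentiable (at z)"
  shows "dd (\<lambda>z. p (f z) (g z)) w z = p (f z) (dd g w z) + p (dd f w z) (g z)"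
  by (rule dd_eqI[OF bounded_bilinear.FDERIV[OF assms(1)]]) (use assms frechet_derivative_works in blast)+

lemmas dd_scaleR = dd_bilinear[OF bounded_bilinear_scaleR]
lemmas dd_mult = dd_bilinear[OF bounded_bilinear_mult]

lemma dd_linear: "bounded_linear L \<Longrightarrow> dd L v x = L v"
  by (rule dd_eqI[OF bounded_linear_imp_has_derivative])

text \<open>Separates the variation of the base point from that of the vectors, since an expression
  like \<open>gam G y a b\<close> is linear in \<open>a\<close> and \<open>b\<close> but not in
  \<open>y\<close>.\<close>

lemma dd_two_slots:
  fixes H :: "'y::real_normed_vector \<times> 'x::real_normed_vector \<Rightarrow> 'b::real_normed_vector"
  assumes H: "H differentiable (at (f z, g z))"
    and fg: "f differentiable (at z)" "g differentiable (at z)"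
  shows "dd (\<lambda>z. H (f z, g z)) w z =
    dd (\<lambda>y. H (y, g z)) (dd f w z) (f z) + dd (\<lambda>x. H (f z, x)) (dd g w z) (g z)"
proof -
  have "dd (\<lambda>z. H (f z, g z)) w z = dd H (dd f w z, dd g w z) (f z, g z)"
    using dd_compose[of "\<lambda>z. (f z, g z)" z H w] dd_Pair[OF fg] H fg
    by (simp add: differentiable_Pair)
  also have "\<dots> = dd H (dd f w z, 0) (f z, g z) + dd H (0, dd g w z) (f z, g z)"
    using linear_add[OF linear_dd[OF H], of "(dd f w z, 0)" "(0, dd g w z)"] by simp
  also have "dd H (dd f w z, 0) (f z, g z) = dd (\<lambda>y. H (y, g z)) (dd f w z) (f z)"
    using dd_compose[of "\<lambda>y. (y, g z)" "f z" H "dd f w z"] dd_Pair[of "\<lambda>y. y" "f z" "\<lambda>y. g z"] H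
    by (simp add: differentiable_Pair)
  also have "dd H (0, dd g w z) (f z, g z) = dd (\<lambda>x. H (f z, x)) (dd g w z) (g z)"
    using dd_compose[of "\<lambda>x. (f z, x)" "g z" H "dd g w z"] dd_Pair[of "\<lambda>y. f z" "g z" "\<lambda>y. y"] H
    by (simp add: differentiable_Pair)
  finally show ?thesis .
qed

locale coord_metric =
  fixes V :: "(real^'n) set" and G :: "real^'n \<Rightarrow> real^'n^'n"
  assumes open_V: "open V" and smooth_G: "smooth_on V G"
    and sym_G: "y \<in> V \<Longrightarrow> G y $ i $ j = G y $ j $ i"
    and pos_G: "y \<in> V \<Longrightarrow> a \<noteq> 0 \<Longrightarrow> 0 < mip G y a a"
begin

lemma mip_commute: "y \<in> V \<Longrightarrow> mip G y a b = mip G y b a"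
  unfolding mip_expand by (subst sum.swap) (simp add: sym_G[of y] algebra_simps)

lemma det_G: assumes "y \<in> V" shows "det (G y) \<noteq> 0"
proof -
  have "inj ((*v) (G y))"
  proof (rule injI)
    fix a b assume "G y *v a = G y *v b"
    then have "mip G y (a - b) (a - b) = 0" by (simp add: mip_def matrix_vector_mult_diff_distrib)
    then show "a = b" using pos_G[OF assms, of "a - b"] by force
  qed
  then show ?thesis
    using matrix_left_invertible_injective[of "G y"] invertible_left_inverse[of "G y"] invertible_det_nz by blast
qed

lemma mip_eqI: "y \<in> V \<Longrightarrow> (\<And>c. mip G y a c = mip G y b c) \<Longrightarrow> a = b"
  using pos_G[of y "a - b"] by (force simp: mip_diff)

lemma dd_G_nth: "y \<in> V \<Longrightarrow> dd G a y $ i $ j = dd (\<lambda>y. G y $ i $ j) a y"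
proof -
  assume y: "y \<in> V"
  have "bounded_linear (\<lambda>M::real^'n^'n. M $ i $ j)"
    using bounded_linear_compose[OF bounded_linear_vec_nth bounded_linear_vec_nth] by blast
  from dd_bounded_linear[OF smooth_onD_diff[OF smooth_G y] this] show ?thesis by simp
qed

lemma pderiv_G: "y \<in> V \<Longrightarrow> pderiv_at k (\<lambda>y. G y $ i $ j) y = dd G (axis k 1) y $ i $ j"
  by (simp add: pderiv_at_def dd_G_nth)

lemma dd_G_expand:
  assumes "y \<in> V"
  shows "b \<bullet> (dd G a y *v c) =
    (\<Sum>i\<in>UNIV. \<Sum>j\<in>UNIV. \<Sum>k\<in>UNIV. a $ i * b $ j * c $ k * pderiv_at i (\<lambda>y. G y $ j $ k) y)"
proof -
  have "dd G a y = dd G (\<Sum>i\<in>UNIV. a $ i *\<^sub>R axis i 1) y"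
    using basis_expansion[of a] by (simp add: scalar_mult_eq_scaleR)
  also have "\<dots> = (\<Sum>i\<in>UNIV. a $ i *\<^sub>R dd G (axis i 1) y)"
    using linear_dd[OF smooth_onD_diff[OF smooth_G assms]] by (simp add: linear_sum linear_scale)
  finally have "dd G a y = (\<Sum>i\<in>UNIV. a $ i *\<^sub>R dd G (axis i 1) y)" .
  then have nth: "dd G a y $ j $ k = (\<Sum>i\<in>UNIV. a $ i * pderiv_at i (\<lambda>y. G y $ j $ k) y)" for j k
    by (simp add: pderiv_G[OF assms])
  have "b \<bullet> (dd G a y *v c) = (\<Sum>j\<in>UNIV. \<Sum>k\<in>UNIV. \<Sum>i\<in>UNIV. a $ i * b $ j * c $ k * pderiv_at i (\<lambda>y. G y $ j $ k) y)"
    unfolding inner_vec_def matrix_vector_mult_def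
    by (simp add: nth sum_distrib_left sum_distrib_right algebra_simps)
  also have "\<dots> = (\<Sum>j\<in>UNIV. \<Sum>i\<in>UNIV. \<Sum>k\<in>UNIV. a $ i * b $ j * c $ k * pderiv_at i (\<lambda>y. G y $ j $ k) y)"
    by (intro sum.cong refl sum.swap)
  also have "\<dots> = (\<Sum>i\<in>UNIV. \<Sum>j\<in>UNIV. \<Sum>k\<in>UNIV. a $ i * b $ j * c $ k * pderiv_at i (\<lambda>y. G y $ j $ k) y)"
    by (rule sum.swap)
  finally show ?thesis .
qed

text \<open>Contraction with \<open>G\<close> cancels the inverse matrix and leaves the symbols of
  the first kind, which involve derivatives of the metric alone.\<close>

lemma lower_chr:
  assumes "y \<in> V"
  shows "(\<Sum>k\<in>UNIV. G y $ m $ k * chr G k i j y) =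
    (pderiv_at i (\<lambda>y. G y $ j $ m) y + pderiv_at j (\<lambda>y. G y $ i $ m) y - pderiv_at m (\<lambda>y. G y $ i $ j) y) / 2"
proof -
  define q where "q l = pderiv_at i (\<lambda>y. G y $ j $ l) y + pderiv_at j (\<lambda>y. G y $ i $ l) y
    - pderiv_at l (\<lambda>y. G y $ i $ j) y" for l
  have "(\<Sum>k\<in>UNIV. G y $ m $ k * chr G k i j y) =
      (\<Sum>k\<in>UNIV. \<Sum>l\<in>UNIV. G y $ m $ k * matrix_inv (G y) $ k $ l * q l) / 2"
  proof -
    have "chr G k i j y = (\<Sum>l\<in>UNIV. matrix_inv (G y) $ k $ l * q l) / 2" for k
      by (simp add: chr_def q_def)
    then show ?thesis by (simp add: sum_distrib_left sum_divide_distrib mult.assoc)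
  qed
  also have "\<dots> = (\<Sum>l\<in>UNIV. (\<Sum>k\<in>UNIV. G y $ m $ k * matrix_inv (G y) $ k $ l) * q l) / 2"
    by (subst sum.swap) (simp add: sum_distrib_right)
  also have "\<dots> = (\<Sum>l\<in>UNIV. (G y ** matrix_inv (G y)) $ m $ l * q l) / 2"
    by (simp add: matrix_matrix_mult_def)
  also have "\<dots> = q m / 2"
    by (simp add: matrix_inv_mult[OF det_G[OF assms]] mat_def if_distrib[of "\<lambda>x. x * _"] cong: if_cong)
  finally show ?thesis by (simp add: q_def)
qed

text \<open>Koszul's formula for constant-coefficient fields. By non-degeneracy it characterizes
  \<open>gam\<close>, so metric compatibility, symmetry and the transformation law can be read off
  without touching the inverse matrix.\<close>

lemma koszul:
  assumes y: "y \<in> V"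
  shows "2 * mip G y (gam G y a b) c =
    b \<bullet> (dd G a y *v c) + a \<bullet> (dd G b y *v c) - a \<bullet> (dd G c y *v b)"
proof -
  let ?P = "\<lambda>i j k. pderiv_at i (\<lambda>y. G y $ j $ k) y"
  have "2 * mip G y (gam G y a b) c = 2 * mip G y c (gam G y a b)"
    by (simp add: mip_commute[OF y])
  also have "\<dots> = 2 * (\<Sum>m\<in>UNIV. \<Sum>k\<in>UNIV. \<Sum>i\<in>UNIV. \<Sum>j\<in>UNIV. c $ m * a $ i * b $ j * (G y $ m $ k * chr G k i j y))"
    unfolding mip_expand gam_def by (simp add: sum_distrib_left algebra_simps)
  also have "\<dots> = 2 * (\<Sum>m\<in>UNIV. \<Sum>i\<in>UNIV. \<Sum>j\<in>UNIV. \<Sum>k\<in>UNIV. c $ m * a $ i * b $ j * (G y $ m $ k * chr G k i j y))"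
  proof -
    have "(\<Sum>k\<in>UNIV. \<Sum>i\<in>UNIV. \<Sum>j\<in>UNIV. h k i j) = (\<Sum>i\<in>UNIV. \<Sum>j\<in>UNIV. \<Sum>k\<in>UNIV. h k i j)"
      for h :: "'n \<Rightarrow> 'n \<Rightarrow> 'n \<Rightarrow> real"
      by (subst sum.swap) (intro sum.cong refl sum.swap)
    note swap = this
    show ?thesis
      by (rule arg_cong[where f = "(*) 2"], rule sum.cong[OF refl], rule swap)
  qed
  also have "\<dots> = (\<Sum>m\<in>UNIV. \<Sum>i\<in>UNIV. \<Sum>j\<in>UNIV. c $ m * a $ i * b $ j * (?P i j m + ?P j i m - ?P m i j))"
  proof -
    have "(\<Sum>k\<in>UNIV. c $ m * a $ i * b $ j * (G y $ m $ k * chr G k i j y))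
        = (c $ m * a $ i * b $ j * (?P i j m + ?P j i m - ?P m i j)) / 2" for m i j
      by (simp add: lower_chr[OF y] flip: sum_distrib_left)
    then have "(\<Sum>m\<in>UNIV. \<Sum>i\<in>UNIV. \<Sum>j\<in>UNIV. \<Sum>k\<in>UNIV. c $ m * a $ i * b $ j * (G y $ m $ k * chr G k i j y))
        = (\<Sum>m\<in>UNIV. \<Sum>i\<in>UNIV. \<Sum>j\<in>UNIV. c $ m * a $ i * b $ j * (?P i j m + ?P j i m - ?P m i j)) / 2"
      by (simp only: sum_divide_distrib)
    then show ?thesis by simp
  qed
  also have "\<dots> = (\<Sum>m\<in>UNIV. \<Sum>i\<in>UNIV. \<Sum>j\<in>UNIV. a $ i * b $ j * c $ m * ?P i j m)
      + (\<Sum>m\<in>UNIV. \<Sum>i\<in>UNIV. \<Sum>j\<in>UNIV. b $ j * a $ i * c $ m * ?P j i m)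
      - (\<Sum>m\<in>UNIV. \<Sum>i\<in>UNIV. \<Sum>j\<in>UNIV. c $ m * a $ i * b $ j * ?P m i j)"
    by (simp add: algebra_simps sum.distrib sum_subtractf)
  also have "(\<Sum>m\<in>UNIV. \<Sum>i\<in>UNIV. \<Sum>j\<in>UNIV. a $ i * b $ j * c $ m * ?P i j m) = b \<bullet> (dd G a y *v c)"
  proof -
    have "(\<Sum>m\<in>UNIV. \<Sum>i\<in>UNIV. \<Sum>j\<in>UNIV. h m i j) = (\<Sum>i\<in>UNIV. \<Sum>j\<in>UNIV. \<Sum>m\<in>UNIV. h m i j)"
      for h :: "'n \<Rightarrow> 'n \<Rightarrow> 'n \<Rightarrow> real"
      by (subst sum.swap) (intro sum.cong refl sum.swap)
    then show ?thesis unfolding dd_G_expand[OF y] .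
  qed
  also have "(\<Sum>m\<in>UNIV. \<Sum>i\<in>UNIV. \<Sum>j\<in>UNIV. b $ j * a $ i * c $ m * ?P j i m) = a \<bullet> (dd G b y *v c)"
  proof -
    have "(\<Sum>m\<in>UNIV. \<Sum>i\<in>UNIV. \<Sum>j\<in>UNIV. h m i j) = (\<Sum>j\<in>UNIV. \<Sum>i\<in>UNIV. \<Sum>m\<in>UNIV. h m i j)"
      for h :: "'n \<Rightarrow> 'n \<Rightarrow> 'n \<Rightarrow> real"
    proof -
      have "(\<Sum>m\<in>UNIV. \<Sum>i\<in>UNIV. \<Sum>j\<in>UNIV. h m i j) = (\<Sum>m\<in>UNIV. \<Sum>j\<in>UNIV. \<Sum>i\<in>UNIV. h m i j)"
        by (intro sum.cong refl sum.swap)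
      also have "\<dots> = (\<Sum>j\<in>UNIV. \<Sum>m\<in>UNIV. \<Sum>i\<in>UNIV. h m i j)" by (rule sum.swap)
      also have "\<dots> = (\<Sum>j\<in>UNIV. \<Sum>i\<in>UNIV. \<Sum>m\<in>UNIV. h m i j)" by (intro sum.cong refl sum.swap)
      finally show ?thesis .
    qed
    then show ?thesis unfolding dd_G_expand[OF y] .
  qed
  also have "(\<Sum>m\<in>UNIV. \<Sum>i\<in>UNIV. \<Sum>j\<in>UNIV. c $ m * a $ i * b $ j * ?P m i j) = a \<bullet> (dd G c y *v b)"
    unfolding dd_G_expand[OF y] ..
  finally show ?thesis .
qed

lemma dd_G_sym: "y \<in> V \<Longrightarrow> b \<bullet> (dd G a y *v c) = c \<bullet> (dd G a y *v b)"
proof -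
  assume y: "y \<in> V"
  have "dd G a y $ i $ j = dd G a y $ j $ i" for i j
    unfolding dd_G_nth[OF y] by (rule dd_cong[OF open_V y]) (rule sym_G)
  then have "transpose (dd G a y) = dd G a y"
    by (simp add: transpose_def vec_eq_iff)
  then show ?thesis by (metis dot_lmul_matrix inner_commute vector_transpose_matrix)
qed

lemma gam_metric:
  assumes y: "y \<in> V"
  shows "b \<bullet> (dd G a y *v c) = mip G y (gam G y a b) c + mip G y b (gam G y a c)"
  using koszul[OF y, of a b c] koszul[OF y, of a c b] dd_G_sym[OF y, of b a c]
    mip_commute[OF y, of b "gam G y a c"] by linarith

lemma gam_commute: "y \<in> V \<Longrightarrow> gam G y a b = gam G y b a"
proof (rule mip_eqI)
  fix c assume y: "y \<in> V"
  show "mip G y (gam G y a b) c = mip G y (gam G y b a) c"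
    using koszul[OF y, of a b c] koszul[OF y, of b a c] dd_G_sym[OF y, of a c b] by linarith
qed

lemma gam_unique:
  assumes "y \<in> V"
    and "\<And>c. 2 * mip G y u c = b \<bullet> (dd G a y *v c) + a \<bullet> (dd G b y *v c) - a \<bullet> (dd G c y *v b)"
  shows "u = gam G y a b"
proof (rule mip_eqI[OF assms(1)])
  show "mip G y u c = mip G y (gam G y a b) c" for c
    using koszul[OF assms(1), of a b c] assms(2)[of c] by linarith
qed

lemma smooth_chr: "smooth_on V (chr G k i j)"
proof -
  have "smooth_on V (\<lambda>y. (1/2) * (\<Sum>l\<in>UNIV. matrix_inv (G y) $ k $ l *
     (dd G (axis i 1) y $ j $ l + dd G (axis j 1) y $ i $ l - dd G (axis l 1) y $ i $ j)))"
    by (intro smooth smooth_on_dd smooth_G open_V det_G)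
  then show ?thesis
    by (rule smooth_on_cong_imp[OF _ open_V]) (simp add: chr_def pderiv_G)
qed

lemma smooth_on_gam:
  fixes F X Y :: "'a::euclidean_space \<Rightarrow> real^'n"
  assumes U: "open U" and F: "smooth_on U F" "F ` U \<subseteq> V" and "smooth_on U X" "smooth_on U Y"
  shows "smooth_on U (\<lambda>z. gam G (F z) (X z) (Y z))"
  unfolding gam_def by (intro smooth U assms(4,5) smooth_on_compose[OF smooth_chr U F(2,1)])

lemma smooth_on_mip:
  fixes F X Y :: "'a::euclidean_space \<Rightarrow> real^'n"
  assumes U: "open U" and F: "smooth_on U F" "F ` U \<subseteq> V" and "smooth_on U X" "smooth_on U Y"
  shows "smooth_on U (\<lambda>z. mip G (F z) (X z) (Y z))"
  unfolding mip_def by (intro smooth U assms(4,5) smooth_on_compose[OF smooth_G U F(2,1)])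

lemma smooth_on_covd:
  fixes F X :: "'a::euclidean_space \<Rightarrow> real^'n"
  assumes U: "open U" and F: "smooth_on U F" "F ` U \<subseteq> V" and X: "smooth_on U X" and w: "smooth_on U w"
  shows "smooth_on U (\<lambda>z. covd G F X (w z) z)"
  unfolding covd_def by (intro smooth_on_add U smooth_on_gam F X smooth_on_dd_field w)

text \<open>Differentiating \<open>G (F z)\<close> yields the term evaluated by
  \<open>gam_metric\<close>, whose two halves are exactly the connection terms of the two covariant
  derivatives.\<close>

lemma dd_mip:
  fixes F X Y :: "'a::euclidean_space \<Rightarrow> real^'n"
  assumes "F differentiable (at z)" "F z \<in> V" "X differentiable (at z)" "Y differentiable (at z)"
  shows "dd (\<lambda>z. mip G (F z) (X z) (Y z)) w z =
    mip G (F z) (covd G F X w z) (Y z) + mip G (F z) (X z) (covd G F Y w z)"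
proof -
  have mv: "bounded_bilinear ((*v) :: real^'n^'n \<Rightarrow> real^'n \<Rightarrow> real^'n)"
    unfolding bilinear_conv_bounded_bilinear[symmetric] bilinear_def
    by (auto intro!: linearI simp: matrix_vector_right_distrib matrix_vector_mult_add_rdistrib
        matrix_vector_mult_scaleR scaleR_matrix_vector_assoc)
  have GF: "(\<lambda>z. G (F z)) differentiable (at z)"
    using differentiable_chain_at[OF assms(1) smooth_onD_diff[OF smooth_G assms(2)]] by (simp add: o_def)
  have GFY: "(\<lambda>z. G (F z) *v Y z) differentiable (at z)"
    using bounded_bilinear.FDERIV[OF mv] GF assms(4) unfolding differentiable_def by blast
  have "dd (\<lambda>z. mip G (F z) (X z) (Y z)) w z =
    X z \<bullet> (G (F z) *v dd Y w z + dd G (dd F w z) (F z) *v Y z) + dd X w z \<bullet> (G (F z) *v Y z)"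
    unfolding mip_def dd_bilinear[OF bounded_bilinear_inner assms(3) GFY] dd_bilinear[OF mv GF assms(4)]
      dd_compose[OF assms(1) smooth_onD_diff[OF smooth_G assms(2)]] ..
  also have "\<dots> = mip G (F z) (covd G F X w z) (Y z) + mip G (F z) (X z) (covd G F Y w z)"
    using gam_metric[OF assms(2), of "X z" "dd F w z" "Y z"]
    by (simp add: covd_def mip_add) (simp add: mip_def inner_add_right)
  finally show ?thesis .
qed

lemma covd_torsion_free:
  fixes F :: "'a::euclidean_space \<Rightarrow> real^'n"
  assumes "open U" "smooth_on U F" "z \<in> U" "F z \<in> V"
  shows "covd G F (dd F v) w z = covd G F (dd F w) v z"
  using dd_commute[OF assms(1,3,2), of v w] gam_commute[OF assms(4)] by (simp add: covd_def)

lemma dd_gam: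
  fixes F A X :: "'a::euclidean_space \<Rightarrow> real^'n"
  assumes "F differentiable (at z)" "F z \<in> V" "A differentiable (at z)" "X differentiable (at z)"
  shows "dd (\<lambda>z. gam G (F z) (A z) (X z)) w z =
    dd (\<lambda>y. gam G y (A z) (X z)) (dd F w z) (F z) + gam G (F z) (dd A w z) (X z) + gam G (F z) (A z) (dd X w z)"
proof -
  define H where "H = (\<lambda>p::(real^'n) \<times> (real^'n) \<times> (real^'n). gam G (fst p) (fst (snd p)) (snd (snd p)))"
  have op: "open (V \<times> (UNIV :: ((real^'n) \<times> (real^'n)) set))" by (intro open_Times open_V open_UNIV)
  have "smooth_on (V \<times> UNIV) H"
    unfolding H_def by (rule smooth_on_gam[OF op]) (auto intro!: smooth op)
  then have Hd: "H differentiable (at (F z, A z, X z))"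
    using smooth_onD_diff assms(2) by fastforce
  have AX: "(\<lambda>z. (A z, X z)) differentiable (at z)"
    using assms by (simp add: differentiable_Pair)
  have "dd (\<lambda>z. H (F z, A z, X z)) w z = dd (\<lambda>y. H (y, A z, X z)) (dd F w z) (F z)
      + dd (\<lambda>x. H (F z, x)) (dd A w z, dd X w z) (A z, X z)"
    using dd_two_slots[of H F z "\<lambda>z. (A z, X z)" w] Hd assms(1) AX dd_Pair[OF assms(3,4)] by simp
  also have "dd (\<lambda>x. H (F z, x)) (dd A w z, dd X w z) (A z, X z)
      = gam G (F z) (A z) (dd X w z) + gam G (F z) (dd A w z) (X z)"
    unfolding H_def fst_conv snd_conv
    using dd_bilinear[OF bounded_bilinear_gam, of fst "(A z, X z)" snd]
    by (simp add: dd_linear[OF bounded_linear_fst] dd_linear[OF bounded_linear_snd]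
        bounded_linear_imp_differentiable[OF bounded_linear_fst] bounded_linear_imp_differentiable[OF bounded_linear_snd])
  finally show ?thesis by (simp add: H_def)
qed

text \<open>In the expansion, everything symmetric in \<open>v\<close> and \<open>w\<close> cancels:
  the second derivatives of \<open>X\<close> and of \<open>F\<close>, and the sum of the two terms
  with one derivative of \<open>X\<close>. The remainder is \<open>riem\<close>.\<close>

lemma covd_commutator:
  fixes F X :: "'a::euclidean_space \<Rightarrow> real^'n"
  assumes U: "open U" and F: "smooth_on U F" "F ` U \<subseteq> V" and X: "smooth_on U X" and z: "z \<in> U"
  shows "covd G F (covd G F X v) w z - covd G F (covd G F X w) v z
    = riem G (F z) (dd F w z) (dd F v z) (X z)"
proof -
  have FV: "F z \<in> V" using F z by blast
  have dF: "F differentiable (at z)" and dX: "X differentiable (at z)"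
    using smooth_onD_diff F X z by blast+
  have d2: "dd F u differentiable (at z)" "dd X u differentiable (at z)" for u
    using smooth_onD_diff smooth_on_dd F X z by blast+
  have sg: "(\<lambda>z. gam G (F z) (dd F u z) (X z)) differentiable (at z)" for u
    by (rule smooth_onD_diff[OF smooth_on_gam[OF U F smooth_on_dd[OF F(1)] X] z])
  have "covd G F (covd G F X v) w z = dd (dd X v) w z
     + (dd (\<lambda>y. gam G y (dd F v z) (X z)) (dd F w z) (F z) + gam G (F z) (dd (dd F v) w z) (X z)
        + gam G (F z) (dd F v z) (dd X w z))
     + gam G (F z) (dd F w z) (dd X v z) + gam G (F z) (dd F w z) (gam G (F z) (dd F v z) (X z))" for v w
    unfolding covd_def dd_add[OF d2(2) sg] dd_gam[OF dF FV d2(1) dX] gam_add by simp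
  then show ?thesis
    using dd_commute[OF U z F(1), of v w] dd_commute[OF U z X, of v w] by (simp add: riem_def)
qed

lemma differentiable_gam_left: "y \<in> V \<Longrightarrow> (\<lambda>y. gam G y a b) differentiable (at y)"
  by (rule smooth_onD_diff[OF smooth_on_gam[OF open_V smooth_on_id]]) (auto intro: smooth)

lemma riem_antisym: "riem G y a b x = - riem G y b a x"
  by (simp add: riem_def)

lemma riem_add1: "y \<in> V \<Longrightarrow> riem G y (a + a') b x = riem G y a b x + riem G y a' b x"
  by (simp add: riem_def linear_add[OF linear_dd[OF differentiable_gam_left]] gam_add
      dd_add[OF differentiable_gam_left differentiable_gam_left])

lemma riem_scale1: "y \<in> V \<Longrightarrow> riem G y (r *\<^sub>R a) b x = r *\<^sub>R riem G y a b x"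
  by (simp add: riem_def linear_scale[OF linear_dd[OF differentiable_gam_left]] gam_scale
      dd_bounded_linear[OF differentiable_gam_left bounded_linear_scaleR_right] algebra_simps)

lemma riem_add3: "y \<in> V \<Longrightarrow> riem G y a b (x + x') = riem G y a b x + riem G y a b x'"
  by (simp add: riem_def gam_add dd_add[OF differentiable_gam_left differentiable_gam_left])

lemma riem_scale3: "y \<in> V \<Longrightarrow> riem G y a b (r *\<^sub>R x) = r *\<^sub>R riem G y a b x"
  by (simp add: riem_def gam_scale
      dd_bounded_linear[OF differentiable_gam_left bounded_linear_scaleR_right] algebra_simps)

lemma riem_scale2: "y \<in> V \<Longrightarrow> riem G y a (r *\<^sub>R b) x = r *\<^sub>R riem G y a b x"
  using riem_scale1[of y r b a x] riem_antisym[of y a "r *\<^sub>R b" x] riem_antisym[of y a b x] by simp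

lemma riem_add2: "y \<in> V \<Longrightarrow> riem G y a (b + b') x = riem G y a b x + riem G y a b' x"
  using riem_add1[of y b b' a x] riem_antisym[of y a "b + b'" x] riem_antisym[of y a b x] riem_antisym[of y a b' x]
  by simp

text \<open>Skew-symmetry: commuting the second derivatives of \<open>\<langle>x, x\<rangle>\<close> along the affine plane through
  \<open>y\<close> spanned by \<open>a\<close> and \<open>b\<close>.\<close>

lemma riem_skew:
  assumes y: "y \<in> V"
  shows "mip G y (riem G y a b x) x = 0"
proof -
  define F where "F p = y + fst p *\<^sub>R a + snd p *\<^sub>R b" for p :: "real \<times> real"
  define X where "X p = x" for p :: "real \<times> real"
  define U where "U = F -` V"
  have Fd: "(F has_derivative (\<lambda>p. fst p *\<^sub>R a + snd p *\<^sub>R b)) (at p)" for p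
    unfolding F_def by (auto intro!: derivative_eq_intros)
  have "continuous_on UNIV F" using Fd by (meson continuous_at_imp_continuous_on has_derivative_continuous)
  then have U: "open U" unfolding U_def by (rule open_vimage[OF open_V])
  have F: "smooth_on U F" "F ` U \<subseteq> V"
    unfolding F_def by (intro smooth U) (auto simp: U_def F_def)
  have X: "smooth_on U X" unfolding X_def by (rule smooth_on_const)
  have z: "0 \<in> U" using y by (simp add: U_def F_def)
  have ddF: "dd F (1, 0) 0 = a" "dd F (0, 1) 0 = b" "F 0 = y"
    using dd_eqI[OF Fd] by (auto simp: F_def)
  define N where "N p = mip G (F p) (X p) (X p)" for p
  have N: "smooth_on U N" unfolding N_def by (rule smooth_on_mip[OF U F X X])
  have cX: "smooth_on U (covd G F X u)" for u by (rule smooth_on_covd[OF U F X smooth_on_const])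
  have N1: "dd N u p = 2 * mip G (F p) (covd G F X u p) (X p)" if "p \<in> U" for u p
    unfolding N_def using dd_mip[of F p X X u] smooth_onD_diff[OF F(1) that] smooth_onD_diff[OF X that] F(2) that
      mip_commute[of "F p"] by auto
  have N2: "dd (dd N u) w 0 = 2 * (mip G y (covd G F (covd G F X u) w 0) x + mip G y (covd G F X u 0) (covd G F X w 0))" for u w
  proof -
    have "dd (dd N u) w 0 = dd (\<lambda>p. 2 * mip G (F p) (covd G F X u p) (X p)) w 0"
      by (rule dd_cong[OF U z N1])
    also have "\<dots> = 2 * dd (\<lambda>p. mip G (F p) (covd G F X u p) (X p)) w 0"
      by (rule dd_bounded_linear[OF smooth_onD_diff[OF smooth_on_mip[OF U F cX X] z] bounded_linear_mult_right])
    also have "dd (\<lambda>p. mip G (F p) (covd G F X u p) (X p)) w 0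
      = mip G y (covd G F (covd G F X u) w 0) x + mip G y (covd G F X u 0) (covd G F X w 0)"
      using dd_mip[of F 0 "covd G F X u" X w] smooth_onD_diff[OF F(1) z] smooth_onD_diff[OF X z]
        smooth_onD_diff[OF cX z] y by (simp add: ddF X_def)
    finally show ?thesis .
  qed
  have "mip G y (covd G F (covd G F X (0,1)) (1,0) 0 - covd G F (covd G F X (1,0)) (0,1) 0) x = 0"
    using dd_commute[OF U z N, of "(1,0)" "(0,1)"] mip_commute[OF y] unfolding N2 mip_diff by simp
  then show ?thesis
    unfolding covd_commutator[OF U F X z] ddF by (simp add: X_def)
qed

lemma riem_skew': "y \<in> V \<Longrightarrow> mip G y (riem G y a b x) x' = - mip G y (riem G y a b x') x"
  using riem_skew[of y a b "x + x'"] riem_skew[of y a b x] riem_skew[of y a b x']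
  by (simp add: riem_add3 mip_add)

text \<open>Antisymmetry in the first pair of arguments produces one factor of the determinant,
  skew-symmetry in the last pair the other.\<close>

lemma sectional_form_change:
  assumes y: "y \<in> V"
  shows "mip G y (riem G y (p *\<^sub>R a + q *\<^sub>R b) (r *\<^sub>R a + s *\<^sub>R b) (r *\<^sub>R a + s *\<^sub>R b)) (p *\<^sub>R a + q *\<^sub>R b)
    = (p * s - q * r)\<^sup>2 * mip G y (riem G y a b b) a"
proof -
  have z: "riem G y c c x = 0" for c x by (simp add: riem_def)
  have "riem G y (p *\<^sub>R a + q *\<^sub>R b) (r *\<^sub>R a + s *\<^sub>R b) x = (p * s) *\<^sub>R riem G y a b x + (q * r) *\<^sub>R riem G y b a x" for x
    by (simp add: riem_add1[OF y] riem_add2[OF y] riem_scale1[OF y] riem_scale2[OF y] z algebra_simps)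
  then have 1: "riem G y (p *\<^sub>R a + q *\<^sub>R b) (r *\<^sub>R a + s *\<^sub>R b) x = (p * s - q * r) *\<^sub>R riem G y a b x" for x
    unfolding riem_antisym[of y b a] by (simp add: algebra_simps)
  have "mip G y (riem G y a b (r *\<^sub>R a + s *\<^sub>R b)) (p *\<^sub>R a + q *\<^sub>R b)
      = (p * s - q * r) * mip G y (riem G y a b b) a"
    using riem_skew[OF y, of a b a] riem_skew[OF y, of a b b] riem_skew'[OF y, of a b a b]
    by (simp add: riem_add3[OF y] riem_scale3[OF y] mip_add mip_scale algebra_simps)
  then show ?thesis unfolding 1 mip_scale by (simp add: power2_eq_square)
qed

lemma smooth_on_riem:
  fixes F A B X :: "'a::euclidean_space \<Rightarrow> real^'n"
  assumes U: "open U" and F: "smooth_on U F" "F ` U \<subseteq> V"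
    and A: "smooth_on U A" and B: "smooth_on U B" and X: "smooth_on U X"
  shows "smooth_on U (\<lambda>z. riem G (F z) (A z) (B z) (X z))"
proof -
  have D: "smooth_on U (\<lambda>z. dd (\<lambda>y. gam G y (B z) (X z)) (A z) (F z))"
    if A: "smooth_on U A" and B: "smooth_on U B" for A B :: "'a \<Rightarrow> real^'n"
  proof -
    \<comment> \<open>Of the four slots (point, direction, two vectors) the second does not affect
      \<open>H\<close>; it carries the direction of differentiation along, so that the derivative
      becomes a smooth function of one variable \<open>p\<close>.\<close>
    define H where "H = (\<lambda>p::(real^'n) \<times> (real^'n) \<times> (real^'n) \<times> (real^'n). gam G (fst p) (fst (snd (snd p))) (snd (snd (snd p))))"
    let ?O = "V \<times> (UNIV :: ((real^'n) \<times> (real^'n) \<times> (real^'n)) set)"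
    have op: "open ?O" by (intro open_Times open_V open_UNIV)
    have H: "smooth_on ?O H"
      unfolding H_def by (rule smooth_on_gam[OF op]) (auto intro!: smooth op)
    have "smooth_on ?O (\<lambda>p. dd H (fst (snd p), 0, 0, 0) p)"
      by (rule smooth_on_dd_field[OF op H]) (intro smooth op)
    then have "smooth_on U (\<lambda>z. dd H (fst (snd (F z, A z, B z, X z)), 0, 0, 0) (F z, A z, B z, X z))"
      by (rule smooth_on_compose[OF _ U]) (use F in \<open>auto intro!: smooth U A B X\<close>)
    moreover have "dd H (fst (snd (F z, A z, B z, X z)), 0, 0, 0) (F z, A z, B z, X z)
       = dd (\<lambda>y. gam G y (B z) (X z)) (A z) (F z)" if "z \<in> U" for z
    proof -
      have Hd: "H differentiable (at (F z, A z, B z, X z))"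
        by (rule smooth_onD_diff[OF H]) (use F that in auto)
      have Pd: "((\<lambda>y. (y, A z, B z, X z)) has_derivative (\<lambda>v. (v, 0, 0, 0))) (at (F z))"
        by (auto intro!: derivative_eq_intros simp: zero_prod_def)
      have "dd (\<lambda>y. H (y, A z, B z, X z)) (A z) (F z) = dd H (A z, 0, 0, 0) (F z, A z, B z, X z)"
        using dd_compose[of "\<lambda>y. (y, A z, B z, X z)" "F z" H "A z"] Hd Pd dd_eqI[OF Pd]
        by (auto simp: differentiable_def)
      then show ?thesis by (simp add: H_def)
    qed
    ultimately show ?thesis using smooth_on_cong[OF U] by (metis (no_types, lifting))
  qed
  show ?thesis
    unfolding riem_def
    by (intro smooth_on_add smooth_on_diff U D A B smooth_on_gam F X)
qed

end

text \<open>The connection coefficients transform as they should, because both sides satisfy Koszul's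
  formula.\<close>

lemma gam_transform:
  fixes \<tau> :: "real^'n \<Rightarrow> real^'n"
  assumes G: "coord_metric V G" and G': "coord_metric V' G'"
    and D: "open D" "D \<subseteq> V" "smooth_on D \<tau>" "\<tau> ` D \<subseteq> V'" and y: "y \<in> D"
    and iso: "\<And>y a b. y \<in> D \<Longrightarrow> mip G y a b = mip G' (\<tau> y) (dd \<tau> a y) (dd \<tau> b y)"
    and surj: "surj (\<lambda>v. dd \<tau> v y)"
  shows "dd \<tau> (gam G y a b) y = covd G' \<tau> (dd \<tau> b) a y"
proof -
  interpret G: coord_metric V G by (rule G)
  interpret G': coord_metric V' G' by (rule G')
  define S where "S a b = covd G' \<tau> (dd \<tau> b) a y" for a b
  have yV: "y \<in> V" "\<tau> y \<in> V'" using y D by auto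
  have S_sym: "S a b = S b a" for a b
    unfolding S_def by (rule G'.covd_torsion_free[OF D(1,3) y yV(2)])
  have T: "b \<bullet> (dd G a y *v c) = mip G' (\<tau> y) (S a b) (dd \<tau> c y) + mip G' (\<tau> y) (dd \<tau> b y) (S a c)" for a b c
  proof -
    have "b \<bullet> (dd G a y *v c) = dd (\<lambda>y. mip G y b c) a y"
      using G.dd_mip[of "\<lambda>y. y" y "\<lambda>y. b" "\<lambda>y. c" a] G.gam_metric[OF yV(1)] yV by (simp add: covd_def)
    also have "\<dots> = dd (\<lambda>y. mip G' (\<tau> y) (dd \<tau> b y) (dd \<tau> c y)) a y"
      by (rule dd_cong[OF D(1) y iso])
    also have "\<dots> = mip G' (\<tau> y) (S a b) (dd \<tau> c y) + mip G' (\<tau> y) (dd \<tau> b y) (S a c)"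
      unfolding S_def
      by (rule G'.dd_mip[where F = \<tau> and X = "dd \<tau> b" and Y = "dd \<tau> c"])
        (intro smooth_onD_diff[OF _ y] smooth_on_dd D yV)+
    finally show ?thesis .
  qed
  obtain u where u: "dd \<tau> u y = S a b" using surj by (metis surjD)
  have "u = gam G y a b"
  proof (rule G.gam_unique[OF yV(1)])
    fix c
    show "2 * mip G y u c = b \<bullet> (dd G a y *v c) + a \<bullet> (dd G b y *v c) - a \<bullet> (dd G c y *v b)"
      unfolding T iso[OF y] u using S_sym G'.mip_commute[OF yV(2)] by simp
  qed
  then show ?thesis using u by (simp add: S_def)
qed

text \<open>The ordinary derivative of the transported field contains a second derivative of
  \<open>\<tau>\<close>, and by \<open>gam_transform\<close> this is the discrepancy between the two
  connection terms.\<close>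

lemma covd_transform:
  fixes \<tau> :: "real^'n \<Rightarrow> real^'n" and F X :: "'a::euclidean_space \<Rightarrow> real^'n"
  assumes G: "coord_metric V G" and G': "coord_metric V' G'"
    and D: "open D" "D \<subseteq> V" "smooth_on D \<tau>" "\<tau> ` D \<subseteq> V'"
    and iso: "\<And>y a b. y \<in> D \<Longrightarrow> mip G y a b = mip G' (\<tau> y) (dd \<tau> a y) (dd \<tau> b y)"
    and surj: "surj (\<lambda>v. dd \<tau> v (F z))"
    and Fz: "F z \<in> D" and F: "F differentiable (at z)" and X: "X differentiable (at z)"
  shows "covd G' (\<lambda>z. \<tau> (F z)) (\<lambda>z. dd \<tau> (X z) (F z)) w z = dd \<tau> (covd G F X w z) (F z)"
proof -
  have td: "\<tau> differentiable (at (F z))" by (rule smooth_onD_diff[OF D(3) Fz])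
  define H where "H p = dd \<tau> (snd p) (fst p)" for p :: "(real^'n) \<times> (real^'n)"
  have op: "open (D \<times> (UNIV :: (real^'n) set))" by (intro open_Times D open_UNIV)
  have "smooth_on (D \<times> UNIV) (\<lambda>p. \<Sum>b\<in>Basis. (snd p \<bullet> b) *\<^sub>R dd \<tau> b (fst p))"
    by (intro smooth op smooth_on_compose[OF smooth_on_dd[OF D(3)] op]) auto
  then have "smooth_on (D \<times> UNIV) H"
    by (rule smooth_on_cong_imp[OF _ op]) (use D(3) smooth_onD_diff in \<open>force simp: H_def intro: dd_Basis_expansion\<close>)
  then have Hd: "H differentiable (at (F z, X z))" using Fz smooth_onD_diff by fastforce
  have "dd (\<lambda>z. H (F z, X z)) w z =
      dd (\<lambda>y. H (y, X z)) (dd F w z) (F z) + dd (\<lambda>x. H (F z, x)) (dd X w z) (X z)"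
    by (rule dd_two_slots[OF Hd F X])
  moreover have "dd (\<lambda>x. dd \<tau> x (F z)) v x = dd \<tau> v (F z)" for v x
    by (rule dd_linear) (use linear_dd[OF td] in \<open>simp add: linear_conv_bounded_linear\<close>)
  ultimately have 1: "dd (\<lambda>z. dd \<tau> (X z) (F z)) w z = dd (dd \<tau> (X z)) (dd F w z) (F z) + dd \<tau> (dd X w z) (F z)"
    by (simp add: H_def)
  have "dd \<tau> (gam G (F z) (dd F w z) (X z)) (F z) = dd (dd \<tau> (X z)) (dd F w z) (F z)
      + gam G' (\<tau> (F z)) (dd \<tau> (dd F w z) (F z)) (dd \<tau> (X z) (F z))"
    using gam_transform[OF G G' D Fz iso surj, of "dd F w z" "X z"] by (simp add: covd_def)
  then show ?thesis
    unfolding covd_def 1 dd_compose[OF F td] linear_add[OF linear_dd[OF td]] by simp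
qed

section \<open>Volume forms and Gram determinants\<close>

lemma gram_det:
  fixes a b :: "'n \<Rightarrow> real^'n"
  shows "det (\<chi> i j. mip G y (a i) (b j)) = det (\<chi> i. a i) * det (G y) * det (\<chi> j. b j)"
proof -
  have "(\<chi> i j. mip G y (a i) (b j)) = (\<chi> i. a i) ** G y ** transpose (\<chi> j. b j)"
  proof (simp only: vec_eq_iff vec_lambda_beta, intro allI)
    fix i j
    have "((\<chi> i. a i) ** G y ** transpose (\<chi> j. b j)) $ i $ j
        = (\<Sum>l\<in>UNIV. \<Sum>k\<in>UNIV. a i $ k * G y $ k $ l * b j $ l)"
      by (simp add: matrix_matrix_mult_def transpose_def sum_distrib_right)
    also have "\<dots> = (\<Sum>k\<in>UNIV. \<Sum>l\<in>UNIV. a i $ k * G y $ k $ l * b j $ l)" by (rule sum.swap)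
    also have "\<dots> = mip G y (a i) (b j)" by (simp add: mip_expand mult_ac)
    finally show "mip G y (a i) (b j) = ((\<chi> i. a i) ** G y ** transpose (\<chi> j. b j)) $ i $ j" by simp
  qed
  then show ?thesis by (simp add: det_mul)
qed

definition vol3 :: "(real^3 \<Rightarrow> real^3^3) \<Rightarrow> real^3 \<Rightarrow> real^3 \<Rightarrow> real^3 \<Rightarrow> real^3 \<Rightarrow> real" where
  "vol3 G y a b c = sqrt (det (G y)) * det (vector [a, b, c] :: real^3^3)"

lemma vol3_add: "vol3 G y a (b + b') c = vol3 G y a b c + vol3 G y a b' c"
  "vol3 G y a b (c + c') = vol3 G y a b c + vol3 G y a b c'"
  by (simp_all add: vol3_def det_3 algebra_simps)

lemma vol3_scale: "vol3 G y (r *\<^sub>R a) b c = r * vol3 G y a b c"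
  "vol3 G y a (r *\<^sub>R b) c = r * vol3 G y a b c" "vol3 G y a b (r *\<^sub>R c) = r * vol3 G y a b c"
  by (simp_all add: vol3_def det_3 algebra_simps)

lemma vol3_same: "vol3 G y a a c = 0" "vol3 G y a b a = 0" "vol3 G y a b b = 0"
  by (simp_all add: vol3_def det_3 algebra_simps)

text \<open>Positive definiteness persists along the segment from the identity matrix to
  \<open>G y\<close>, so the determinant cannot vanish on the way and keeps the sign it has at the
  identity.\<close>

lemma (in coord_metric) det_G_pos:
  assumes y: "y \<in> V"
  shows "0 < det (G y)"
proof (rule ccontr)
  define M where "M t = (1 - t) *\<^sub>R mat 1 + t *\<^sub>R G y" for t :: real
  assume "\<not> 0 < det (G y)"
  then have "det (M 1) \<le> 0" "0 \<le> det (M 0)" by (simp_all add: M_def)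
  moreover have "continuous_on {0..1} (\<lambda>t. det (M t))"
  proof -
    have "smooth_on UNIV (\<lambda>t. det (M t))" unfolding M_def by (intro smooth open_UNIV)
    then show ?thesis using smooth_on_imp_continuous_on continuous_on_subset by blast
  qed
  ultimately obtain t where t: "0 \<le> t" "t \<le> 1" "det (M t) = 0"
    using IVT2'[of "\<lambda>t. det (M t)" 1 0 0] by auto
  then have "\<not> inj ((*v) (M t))"
    using matrix_left_invertible_injective[of "M t"] invertible_left_inverse[of "M t"] invertible_det_nz by blast
  then obtain b c where "b \<noteq> c" "M t *v b = M t *v c" unfolding inj_def by blast
  then obtain a where a: "a \<noteq> 0" "M t *v a = 0"
    using that[of "b - c"] by (simp add: matrix_vector_mult_diff_distrib)
  have "a \<bullet> (M t *v a) = (1 - t) * (a \<bullet> a) + t * mip G y a a"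
    by (simp add: M_def mip_def matrix_vector_mult_add_rdistrib scaleR_matrix_vector_assoc[symmetric] inner_add_right)
  moreover have "0 < (1 - t) * (a \<bullet> a) + t * mip G y a a"
  proof (cases "t = 0")
    case False
    then show ?thesis using t pos_G[OF y a(1)] by (intro add_nonneg_pos mult_nonneg_nonneg mult_pos_pos) auto
  qed (use a in simp)
  ultimately show False using a by simp
qed

locale coord_metric3 = coord_metric V G for V :: "(real^3) set" and G
begin

text \<open>A product of two volumes is a Gram determinant, here expanded along its rows. With a
  unit normal among the vectors it replaces the choice of an orthonormal frame.\<close>

lemma vol3_mult:
  assumes y: "y \<in> V"
  shows "vol3 G y a1 a2 a3 * vol3 G y b1 b2 b3 =
      mip G y a1 b1 * (mip G y a2 b2 * mip G y a3 b3 - mip G y a2 b3 * mip G y a3 b2)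
    - mip G y a1 b2 * (mip G y a2 b1 * mip G y a3 b3 - mip G y a2 b3 * mip G y a3 b1)
    + mip G y a1 b3 * (mip G y a2 b1 * mip G y a3 b2 - mip G y a2 b2 * mip G y a3 b1)"
proof -
  define a where "a i = (vector [a1, a2, a3] :: real^3^3) $ i" for i
  define b where "b i = (vector [b1, b2, b3] :: real^3^3) $ i" for i
  have ab: "(\<chi> i. a i) = vector [a1, a2, a3]" "(\<chi> i. b i) = vector [b1, b2, b3]"
    by (simp_all add: a_def b_def)
  have "vol3 G y a1 a2 a3 * vol3 G y b1 b2 b3 = det (\<chi> i j. mip G y (a i) (b j))"
    using det_G_pos[OF y] unfolding gram_det ab vol3_def by (simp add: mult.assoc)
  also have "\<dots> = mip G y a1 b1 * (mip G y a2 b2 * mip G y a3 b3 - mip G y a2 b3 * mip G y a3 b2)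
    - mip G y a1 b2 * (mip G y a2 b1 * mip G y a3 b3 - mip G y a2 b3 * mip G y a3 b1)
    + mip G y a1 b3 * (mip G y a2 b1 * mip G y a3 b2 - mip G y a2 b2 * mip G y a3 b1)"
    by (simp add: det_3 a_def b_def algebra_simps)
  finally show ?thesis .
qed

lemma vol3_normal_square:
  assumes y: "y \<in> V" and n: "mip G y n n = 1" "mip G y n a = 0" "mip G y n b = 0"
  shows "(vol3 G y a b n)\<^sup>2 = mip G y a a * mip G y b b - (mip G y a b)\<^sup>2"
  using vol3_mult[OF y, of a b n a b n] n mip_commute[OF y, of a n] mip_commute[OF y, of b n]
    mip_commute[OF y, of b a] by (simp add: power2_eq_square)

text \<open>After multiplication by the volume with \<open>n\<close> the claim is about a Gram
  determinant in which orthogonality of \<open>n\<close> leaves a single cofactor.\<close>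

lemma vol3_normal:
  assumes y: "y \<in> V" and n: "mip G y n n = 1" "mip G y n a = 0" "mip G y n b = 0"
    and r: "vol3 G y a b n \<noteq> 0"
  shows "vol3 G y a b x = mip G y x n * vol3 G y a b n"
proof -
  have "vol3 G y a b x * vol3 G y a b n = mip G y x n * (vol3 G y a b n)\<^sup>2"
    unfolding vol3_normal_square[OF y n] vol3_mult[OF y]
    using n mip_commute[OF y, of a n] mip_commute[OF y, of b n] mip_commute[OF y, of b a]
    by (simp add: power2_eq_square algebra_simps)
  then show ?thesis using r by (simp add: power2_eq_square)
qed

text \<open>The hypotheses on \<open>s\<close> and \<open>t\<close> say that
  \<open>s a + t b\<close> is the tangential part of \<open>x\<close>, so the left-hand side pairs
  \<open>w\<close> with the normal part. Both sides come from evaluating the product of the volumes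
  of \<open>a, b, w\<close> and \<open>a, b, x\<close> in two ways.\<close>

lemma normal_part:
  assumes y: "y \<in> V" and n: "mip G y n n = 1" "mip G y n a = 0" "mip G y n b = 0"
    and d: "mip G y a a * mip G y b b - (mip G y a b)\<^sup>2 \<noteq> 0"
    and t: "mip G y x a = mip G y a a * s + mip G y a b * t" "mip G y x b = mip G y a b * s + mip G y b b * t"
  shows "mip G y w x - mip G y w a * s - mip G y w b * t = mip G y w n * mip G y x n"
proof -
  have r: "vol3 G y a b n \<noteq> 0" using d vol3_normal_square[OF y n] by auto
  have "vol3 G y a b x = mip G y x n * vol3 G y a b n" "vol3 G y a b w = mip G y w n * vol3 G y a b n"
    using vol3_normal[OF y n r] by blast+
  then have "vol3 G y a b w * vol3 G y a b x
      = mip G y w n * mip G y x n * (mip G y a a * mip G y b b - (mip G y a b)\<^sup>2)"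
    unfolding vol3_normal_square[OF y n, symmetric] by (simp add: power2_eq_square)
  also have "vol3 G y a b w * vol3 G y a b x =
      (mip G y w x - mip G y w a * s - mip G y w b * t) * (mip G y a a * mip G y b b - (mip G y a b)\<^sup>2)"
    unfolding vol3_mult[OF y] mip_commute[OF y, of a x] mip_commute[OF y, of b x] t mip_commute[OF y, of b a]
    by (simp add: power2_eq_square algebra_simps)
  finally show ?thesis using d by simp
qed

end

section \<open>The Gauss equation\<close>

definition curvc :: "(real^2 \<Rightarrow> real^2^2) \<Rightarrow> real^2 \<Rightarrow> 2 \<Rightarrow> real" where
  "curvc h z l = pderiv_at 1 (chr h l 2 2) z - pderiv_at 2 (chr h l 1 2) z +
     (\<Sum>m\<in>UNIV. chr h l 1 m z * chr h m 2 2 z - chr h l 2 m z * chr h m 1 2 z)"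

definition kform :: "(real^2 \<Rightarrow> real^2^2) \<Rightarrow> real^2 \<Rightarrow> real" where
  "kform h z = (\<Sum>l\<in>UNIV. curvc h z l * h z $ l $ 1) / det (h z)"

lemma pderiv_at_cong:
  "open S \<Longrightarrow> z \<in> S \<Longrightarrow> (\<And>y. y \<in> S \<Longrightarrow> f y = g y) \<Longrightarrow> pderiv_at i f z = pderiv_at i g z"
  unfolding pderiv_at_def by (rule dd_cong)

lemma chr_cong:
  assumes "open S" "z \<in> S" "\<And>y. y \<in> S \<Longrightarrow> h y = h' y"
  shows "chr h k i j z = chr h' k i j z"
proof -
  have "pderiv_at a (\<lambda>y. h y $ b $ c) z = pderiv_at a (\<lambda>y. h' y $ b $ c) z" for a b c
    by (rule pderiv_at_cong[OF assms(1,2)]) (simp add: assms(3))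
  then show ?thesis by (simp add: chr_def assms(2,3))
qed

lemma kform_cong:
  assumes "open S" "z \<in> S" "\<And>y. y \<in> S \<Longrightarrow> h y = h' y"
  shows "kform h z = kform h' z"
proof -
  have "pderiv_at a (chr h k i j) z = pderiv_at a (chr h' k i j) z" for a k i j
    by (rule pderiv_at_cong[OF assms(1,2)]) (rule chr_cong[OF assms(1) _ assms(3)])
  then show ?thesis
    using chr_cong[OF assms] assms(2,3) by (simp add: kform_def curvc_def)
qed

lemma UNIV_2_sum: "(\<Sum>i\<in>(UNIV :: 2 set). f i) = f 1 + f 2"
  by (simp add: sum_2)

context coord_metric
begin

lemma gam_axis: "gam G y (axis i 1) (axis j 1) $ k = chr G k i j y"
proof -
  have "(\<Sum>i'\<in>UNIV. \<Sum>j'\<in>UNIV. chr G k i' j' y * axis i 1 $ i' * axis j 1 $ j') =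
      (\<Sum>i'\<in>UNIV. if i' = i then chr G k i' j y else 0)"
    by (intro sum.cong refl) (simp add: axis_def if_distrib cong: if_cong)
  then show ?thesis by (simp add: gam_def)
qed

lemma chr_commute: "y \<in> V \<Longrightarrow> chr G k i j y = chr G k j i y"
  using gam_commute[of y "axis i 1" "axis j 1"] by (metis gam_axis)

lemma smooth_pderiv_G: "y \<in> V \<Longrightarrow> pderiv_at i (\<lambda>y. G y $ j $ k) y =
   (\<Sum>m\<in>UNIV. G y $ k $ m * chr G m i j y) + (\<Sum>m\<in>UNIV. G y $ j $ m * chr G m i k y)"
proof -
  assume y: "y \<in> V"
  have "pderiv_at j (\<lambda>y. G y $ i $ k) y = pderiv_at j (\<lambda>y. G y $ k $ i) y"
    "pderiv_at i (\<lambda>y. G y $ j $ k) y = pderiv_at i (\<lambda>y. G y $ k $ j) y"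
    "pderiv_at k (\<lambda>y. G y $ i $ j) y = pderiv_at k (\<lambda>y. G y $ j $ i) y"
     "pderiv_at j (\<lambda>y. G y $ k $ i) y = pderiv_at j (\<lambda>y. G y $ i $ k) y"
     "pderiv_at k (\<lambda>y. G y $ j $ i) y = pderiv_at k (\<lambda>y. G y $ i $ j) y"
    by (rule pderiv_at_cong[OF open_V y], rule sym_G, assumption)+
  then show ?thesis unfolding lower_chr[OF y] by (simp add: field_simps)
qed

end

lemma pderiv_at_2:
  fixes f1 f2 g1 g2 :: "real^2 \<Rightarrow> real"
  assumes "f1 differentiable (at z)" "f2 differentiable (at z)" "g1 differentiable (at z)" "g2 differentiable (at z)"
  shows "pderiv_at i (\<lambda>z. f1 z * g1 z + f2 z * g2 z) z =
    f1 z * pderiv_at i g1 z + pderiv_at i f1 z * g1 z + (f2 z * pderiv_at i g2 z + pderiv_at i f2 z * g2 z)"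
  unfolding pderiv_at_def using assms by (simp add: dd_add dd_mult)

text \<open>Pulling the contraction with \<open>h\<close> under the derivatives produces symbols of
  the first kind, which for a pulled-back metric are inner products of second and first derivatives
  of the map. The correction terms are derivatives of \<open>h\<close>, again expressed by
  Christoffel symbols.\<close>

lemma intrinsic_curvature_lowered:
  assumes "coord_metric W h" and z: "z \<in> W"
  shows "(\<Sum>l\<in>UNIV. curvc h z l * h z $ l $ 1) =
      pderiv_at 1 (\<lambda>z. \<Sum>k\<in>UNIV. h z $ 1 $ k * chr h k 2 2 z) z
    - pderiv_at 2 (\<lambda>z. \<Sum>k\<in>UNIV. h z $ 1 $ k * chr h k 1 2 z) z
    - (\<Sum>l\<in>UNIV. (\<Sum>k\<in>UNIV. h z $ l $ k * chr h k 1 1 z) * chr h l 2 2 z)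
    + (\<Sum>l\<in>UNIV. (\<Sum>k\<in>UNIV. h z $ l $ k * chr h k 1 2 z) * chr h l 1 2 z)"
proof -
  interpret coord_metric W h by (rule assms(1))
  have d: "(\<lambda>z. h z $ i $ j) differentiable (at z)" "chr h k i j differentiable (at z)" for i j k
    by (rule smooth_onD_diff[OF _ z], intro smooth open_V smooth_G smooth_chr)+
  note [simp] = sym_G[OF z, of 2 1] chr_commute[OF z, of _ 2 1]
  show ?thesis
    unfolding UNIV_2_sum curvc_def pderiv_at_2[OF d(1) d(1) d(2) d(2)] smooth_pderiv_G[OF z]
    by (simp add: algebra_simps)
qed

definition pb :: "(real^'n \<Rightarrow> real^'n^'n) \<Rightarrow> (real^'k \<Rightarrow> real^'n) \<Rightarrow> real^'k \<Rightarrow> real^'k^'k" where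
  "pb G F z = (\<chi> i j. mip G (F z) (dd F (axis i 1) z) (dd F (axis j 1) z))"

text \<open>The Weingarten form of the second fundamental form. In contrast to \<langle>\<nabla>_b
  dF(a), n\<rangle>, it hands a scalar factor of \<open>dd F a\<close> on without differentiating
  it, which makes the divisibility by v visible.\<close>

definition sff :: "(real^'n \<Rightarrow> real^'n^'n) \<Rightarrow> (real^'k \<Rightarrow> real^'n) \<Rightarrow> (real^'k \<Rightarrow> real^'n) \<Rightarrow>
    real^'k \<Rightarrow> real^'k \<Rightarrow> real^'k \<Rightarrow> real" where
  "sff G F n a b z = - mip G (F z) (dd F a z) (covd G F n b z)"

lemma linear_vec_expand:
  fixes L :: "real^'n \<Rightarrow> 'b::real_vector"
  assumes "linear L"
  shows "L a = (\<Sum>i\<in>UNIV. a $ i *\<^sub>R L (axis i 1))"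
proof -
  have "L a = L (\<Sum>i\<in>UNIV. a $ i *\<^sub>R axis i 1)"
    using basis_expansion[of a] by (simp add: scalar_mult_eq_scaleR)
  then show ?thesis by (simp add: linear_sum[OF assms] linear_scale[OF assms])
qed

lemma mip_pb:
  assumes "F differentiable (at z)"
  shows "mip (pb G F) z a b = mip G (F z) (dd F a z) (dd F b z)"
proof -
  note l = linear_dd[OF assms]
  have "mip G (F z) (dd F a z) (dd F b z) =
      mip G (F z) (\<Sum>i\<in>UNIV. a $ i *\<^sub>R dd F (axis i 1) z) (\<Sum>j\<in>UNIV. b $ j *\<^sub>R dd F (axis j 1) z)"
    using linear_vec_expand[OF l, of a] linear_vec_expand[OF l, of b] by simp
  also have "\<dots> = mip (pb G F) z a b"
    unfolding mip_sum mip_scale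
    by (simp only: sum_distrib_left, subst sum.swap, simp add: mip_expand[of "pb G F"] pb_def algebra_simps)
  finally show ?thesis by simp
qed

locale coord_surface = coord_metric3 V G for V G +
  fixes U :: "(real^2) set" and F :: "real^2 \<Rightarrow> real^3"
  assumes open_U: "open U" and smooth_F: "smooth_on U F" and F_in: "F ` U \<subseteq> V"
begin

lemma F_V: "z \<in> U \<Longrightarrow> F z \<in> V"
  using F_in by blast

lemma F_diff: "z \<in> U \<Longrightarrow> F differentiable (at z)"
  by (rule smooth_onD_diff[OF smooth_F])

lemma smooth_pb: "smooth_on U (pb G F)"
  unfolding pb_def by (intro smooth open_U smooth_on_mip smooth_F F_in smooth_on_dd)

lemma pb_commute: "z \<in> U \<Longrightarrow> pb G F z $ i $ j = pb G F z $ j $ i"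
  by (simp add: pb_def mip_commute[OF F_V])

lemma pb_det: "z \<in> U \<Longrightarrow> det (pb G F z) =
    mip G (F z) (dd F (axis 1 1) z) (dd F (axis 1 1) z) * mip G (F z) (dd F (axis 2 1) z) (dd F (axis 2 1) z)
    - (mip G (F z) (dd F (axis 1 1) z) (dd F (axis 2 1) z))\<^sup>2"
  using mip_commute[OF F_V, of z "dd F (axis 1 1) z" "dd F (axis 2 1) z"]
  by (simp add: det_2 pb_def power2_eq_square)

text \<open>A vector annihilated by \<open>dd F\<close> is annihilated by the matrix
  \<open>pb G F\<close>. So a nonzero determinant makes \<open>F\<close> immersive, and the induced
  form inherits positivity from the ambient metric.\<close>

lemma pb_coord_metric: "coord_metric {z \<in> U. det (pb G F z) \<noteq> 0} (pb G F)"
proof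
  have "continuous_on U (\<lambda>z. det (pb G F z))"
    by (intro smooth_on_imp_continuous_on smooth_on_det open_U smooth_pb)
  then have "open (U \<inter> (\<lambda>z. det (pb G F z)) -` (- {0}))"
    by (intro continuous_open_preimage open_U) auto
  moreover have "{z \<in> U. det (pb G F z) \<noteq> 0} = U \<inter> (\<lambda>z. det (pb G F z)) -` (- {0})" by auto
  ultimately show "open {z \<in> U. det (pb G F z) \<noteq> 0}" by simp
  show "smooth_on {z \<in> U. det (pb G F z) \<noteq> 0} (pb G F)"
    by (rule smooth_on_subset[OF smooth_pb]) auto
  fix z assume "z \<in> {z \<in> U. det (pb G F z) \<noteq> 0}"
  then have z: "z \<in> U" "det (pb G F z) \<noteq> 0" by auto
  show "pb G F z $ i $ j = pb G F z $ j $ i" for i j by (rule pb_commute[OF z(1)])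
  fix a :: "real^2" assume a: "a \<noteq> 0"
  have "dd F a z \<noteq> 0"
  proof
    assume "dd F a z = 0"
    then have "c \<bullet> (pb G F z *v a) = 0" for c
      using mip_pb[OF F_diff[OF z(1)], of G c a] by (simp add: mip_def[of "pb G F"])
    then have "pb G F z *v a = 0" using inner_eq_zero_iff by blast
    then have "matrix_inv (pb G F z) *v (pb G F z *v a) = 0" by simp
    then show False using a matrix_inv_mult(2)[OF z(2)] by (simp add: matrix_vector_mul_assoc)
  qed
  then show "0 < mip (pb G F) z a a"
    using pos_G[OF F_V[OF z(1)]] mip_pb[OF F_diff[OF z(1)]] by simp
qed

lemma dd_mip_fields:
  assumes "z \<in> U" "smooth_on U X" "smooth_on U Y"
  shows "dd (\<lambda>z. mip G (F z) (X z) (Y z)) w z =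
    mip G (F z) (covd G F X w z) (Y z) + mip G (F z) (X z) (covd G F Y w z)"
  by (rule dd_mip[OF F_diff[OF assms(1)] F_V[OF assms(1)]]) (use assms smooth_onD_diff in blast)+

lemma smooth_covd: "smooth_on U X \<Longrightarrow> smooth_on U (covd G F X w)"
  by (rule smooth_on_covd[OF open_U smooth_F F_in _ smooth_on_const])

text \<open>The tangential part of the ambient derivative is the induced Levi-Civita derivative. Of
  the six inner products arising from the three derivatives of the metric, torsion-freeness cancels
  four and makes the other two equal.\<close>

lemma lower_chr_pb:
  assumes z: "z \<in> U" "det (pb G F z) \<noteq> 0"
  shows "(\<Sum>k\<in>UNIV. pb G F z $ m $ k * chr (pb G F) k i j z) =
    mip G (F z) (covd G F (dd F (axis j 1)) (axis i 1) z) (dd F (axis m 1) z)"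
proof -
  interpret h: coord_metric "{z \<in> U. det (pb G F z) \<noteq> 0}" "pb G F" by (rule pb_coord_metric)
  have p: "pderiv_at a (\<lambda>z. pb G F z $ b $ c) z =
      mip G (F z) (covd G F (dd F (axis b 1)) (axis a 1) z) (dd F (axis c 1) z) +
      mip G (F z) (dd F (axis b 1) z) (covd G F (dd F (axis c 1)) (axis a 1) z)" for a b c
    using dd_mip_fields[OF z(1) smooth_on_dd[OF smooth_F] smooth_on_dd[OF smooth_F]]
    by (simp add: pderiv_at_def pb_def)
  have t: "covd G F (dd F (axis a 1)) (axis b 1) z = covd G F (dd F (axis b 1)) (axis a 1) z" for a b
    by (rule covd_torsion_free[OF open_U smooth_F z(1) F_V[OF z(1)]])
  have c: "mip G (F z) x y = mip G (F z) y x" for x y by (rule mip_commute[OF F_V[OF z(1)]])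
  show ?thesis
    using h.lower_chr[of z m i j] z unfolding p
    using t[of i j] t[of i m] t[of j m] c[of "dd F (axis j 1) z" "covd G F (dd F (axis m 1)) (axis i 1) z"]
      c[of "dd F (axis i 1) z" "covd G F (dd F (axis m 1)) (axis j 1) z"]
      c[of "dd F (axis i 1) z" "covd G F (dd F (axis j 1)) (axis m 1) z"]
      c[of "dd F (axis m 1) z" "covd G F (dd F (axis j 1)) (axis i 1) z"]
    by simp
qed

end

locale coord_frontal = coord_surface V G U F for V G U F +
  fixes n :: "real^2 \<Rightarrow> real^3"
  assumes smooth_n: "smooth_on U n" and unit_n: "z \<in> U \<Longrightarrow> mip G (F z) (n z) (n z) = 1"
    and normal_n: "z \<in> U \<Longrightarrow> mip G (F z) (n z) (dd F a z) = 0"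
begin

lemma tangent_covd_normal:
  assumes z: "z \<in> U" and X: "smooth_on U X" "\<And>z. z \<in> U \<Longrightarrow> mip G (F z) (X z) (n z) = 0"
  shows "mip G (F z) (covd G F X b z) (n z) = - mip G (F z) (X z) (covd G F n b z)"
proof -
  have "dd (\<lambda>z. mip G (F z) (X z) (n z)) b z = dd (\<lambda>z. 0) b z"
    by (rule dd_cong[OF open_U z]) (rule X(2))
  then show ?thesis using dd_mip_fields[OF z X(1) smooth_n, of b] by simp
qed

lemma sff_covd: "z \<in> U \<Longrightarrow> sff G F n a b z = mip G (F z) (covd G F (dd F a) b z) (n z)"
  using tangent_covd_normal[of z "dd F a" b] smooth_on_dd[OF smooth_F, of a] normal_n[of _ a]
    mip_commute[OF F_V, of _ "dd F a _"]
  by (simp add: sff_def)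

lemma sff_commute: "z \<in> U \<Longrightarrow> sff G F n a b z = sff G F n b a z"
  using sff_covd[of z a b] sff_covd[of z b a] covd_torsion_free[OF open_U smooth_F _ F_V, of z a b] by simp

text \<open>In the lowered intrinsic curvature the third-order terms form a commutator of covariant
  derivatives, hence \<open>riem\<close>. The other terms are inner products of second derivatives
  with their tangential contributions subtracted; by \<open>normal_part\<close> they are products of
  normal components, that is, entries of the second fundamental form.\<close>

theorem gauss_equation:
  assumes z: "z \<in> U" and d: "det (pb G F z) \<noteq> 0"
  shows "kform (pb G F) z * det (pb G F z) =
    mip G (F z) (riem G (F z) (dd F (axis 1 1) z) (dd F (axis 2 1) z) (dd F (axis 2 1) z)) (dd F (axis 1 1) z)
    + sff G F n (axis 1 1) (axis 1 1) z * sff G F n (axis 2 1) (axis 2 1) z - (sff G F n (axis 1 1) (axis 2 1) z)\<^sup>2"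
proof -
  let ?W = "{z \<in> U. det (pb G F z) \<noteq> 0}"
  interpret h: coord_metric ?W "pb G F" by (rule pb_coord_metric)
  have zW: "z \<in> ?W" using z d by simp
  define e :: "2 \<Rightarrow> real^2" where "e i = axis i 1" for i
  define D where "D i j = covd G F (dd F (e j)) (e i)" for i j
  define f where "f i = dd F (e i) z" for i
  define \<Gamma> where "\<Gamma> k i j = chr (pb G F) k i j z" for k i j
  have sm: "smooth_on U (D i j)" "smooth_on U (dd F (e i))" for i j
    unfolding D_def by (intro smooth_covd smooth_on_dd smooth_F)+
  have D_sym: "D i j z = D j i z" for i j
    unfolding D_def by (rule covd_torsion_free[OF open_U smooth_F z F_V[OF z]])
  have low: "(\<Sum>k\<in>UNIV. pb G F y $ m $ k * chr (pb G F) k i j y) = mip G (F y) (D i j y) (dd F (e m) y)"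
    if "y \<in> ?W" for i j m y
    using lower_chr_pb[of y m i j] that by (simp add: D_def e_def)
  have pd: "pderiv_at a (\<lambda>y. \<Sum>k\<in>UNIV. pb G F y $ m $ k * chr (pb G F) k i j y) z
      = mip G (F z) (covd G F (D i j) (e a) z) (f m) + mip G (F z) (D i j z) (D a m z)" for a i j m
  proof -
    have "pderiv_at a (\<lambda>y. \<Sum>k\<in>UNIV. pb G F y $ m $ k * chr (pb G F) k i j y) z
      = pderiv_at a (\<lambda>y. mip G (F y) (D i j y) (dd F (e m) y)) z"
      by (rule pderiv_at_cong[OF h.open_V zW low])
    then show ?thesis
      using dd_mip_fields[OF z sm, of i j m "e a"] by (simp add: pderiv_at_def e_def D_def f_def)
  qed
  have R: "covd G F (D 2 2) (e 1) z - covd G F (D 1 2) (e 2) z = riem G (F z) (f 1) (f 2) (f 2)"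
    unfolding D_def f_def by (rule covd_commutator[OF open_U smooth_F F_in sm(2) z])
  have nF: "mip G (F z) (n z) (f i) = 0" for i unfolding f_def by (rule normal_n[OF z])
  have hdet: "mip G (F z) (f 1) (f 1) * mip G (F z) (f 2) (f 2) - (mip G (F z) (f 1) (f 2))\<^sup>2 \<noteq> 0"
    using pb_det[OF z] d by (simp add: f_def e_def)
  have low2: "mip G (F z) (D i j z) (f 1) = mip G (F z) (f 1) (f 1) * \<Gamma> 1 i j + mip G (F z) (f 1) (f 2) * \<Gamma> 2 i j"
    "mip G (F z) (D i j z) (f 2) = mip G (F z) (f 1) (f 2) * \<Gamma> 1 i j + mip G (F z) (f 2) (f 2) * \<Gamma> 2 i j" for i j
    using low[OF zW, of 1 i j] low[OF zW, of 2 i j] mip_commute[OF F_V[OF z], of "f 1" "f 2"]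
    by (simp_all add: UNIV_2_sum \<Gamma>_def pb_def f_def e_def)
  \<comment> \<open>By \<open>low2\<close> the numbers \<open>\<Gamma> 1 i j\<close> and
    \<open>\<Gamma> 2 i j\<close> are the coefficients of the tangential part of
    \<open>D i j z\<close>.\<close>
  have np: "mip G (F z) w (D i j z) - mip G (F z) w (f 1) * \<Gamma> 1 i j - mip G (F z) w (f 2) * \<Gamma> 2 i j
      = mip G (F z) w (n z) * mip G (F z) (D i j z) (n z)" for w i j
    by (rule normal_part[OF F_V[OF z] unit_n[OF z] nF nF hdet low2])
  have L: "sff G F n (e i) (e j) z = mip G (F z) (D j i z) (n z)" for i j
    unfolding sff_covd[OF z] D_def ..
  have "kform (pb G F) z * det (pb G F z) = (\<Sum>l\<in>UNIV. curvc (pb G F) z l * pb G F z $ l $ 1)"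
    using d by (simp add: kform_def)
  also have "\<dots> = mip G (F z) (covd G F (D 2 2) (e 1) z) (f 1) + mip G (F z) (D 2 2 z) (D 1 1 z)
      - (mip G (F z) (covd G F (D 1 2) (e 2) z) (f 1) + mip G (F z) (D 1 2 z) (D 2 1 z))
      - (\<Sum>l\<in>UNIV. mip G (F z) (D 1 1 z) (f l) * \<Gamma> l 2 2) + (\<Sum>l\<in>UNIV. mip G (F z) (D 1 2 z) (f l) * \<Gamma> l 1 2)"
    unfolding intrinsic_curvature_lowered[OF h.coord_metric_axioms zW] pd low[OF zW] \<Gamma>_def f_def ..
  also have "\<dots> = mip G (F z) (riem G (F z) (f 1) (f 2) (f 2)) (f 1)
      + (mip G (F z) (D 1 1 z) (D 2 2 z) - mip G (F z) (D 1 1 z) (f 1) * \<Gamma> 1 2 2 - mip G (F z) (D 1 1 z) (f 2) * \<Gamma> 2 2 2)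
      - (mip G (F z) (D 1 2 z) (D 1 2 z) - mip G (F z) (D 1 2 z) (f 1) * \<Gamma> 1 1 2 - mip G (F z) (D 1 2 z) (f 2) * \<Gamma> 2 1 2)"
    unfolding R[symmetric] mip_diff UNIV_2_sum
    using mip_commute[OF F_V[OF z], of "D 1 1 z" "D 2 2 z"] D_sym[of 1 2] by simp
  finally show ?thesis
    unfolding np using L[of 1 1] L[of 2 2] L[of 1 2] D_sym[of 1 2]
    by (simp add: f_def e_def power2_eq_square)
qed

end

text \<open>Both numerator and denominator of the Gauss equation scale with the squared Jacobian.\<close>

theorem kform_reparametrize:
  fixes \<tau> :: "real^2 \<Rightarrow> real^2"
  assumes cf: "coord_frontal V G U F n"
    and \<tau>: "open U'" "smooth_on U' \<tau>" "\<tau> ` U' \<subseteq> U" and z: "z \<in> U'"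
    and d: "det (matrix (\<lambda>v. dd \<tau> v z)) \<noteq> 0" and dp: "det (pb G F (\<tau> z)) \<noteq> 0"
  shows "kform (pb G (\<lambda>z. F (\<tau> z))) z = kform (pb G F) (\<tau> z)"
    and "det (pb G (\<lambda>z. F (\<tau> z)) z) = (det (matrix (\<lambda>v. dd \<tau> v z)))\<^sup>2 * det (pb G F (\<tau> z))"
proof -
  interpret F: coord_frontal V G U F n by (rule cf)
  let ?F = "\<lambda>z. F (\<tau> z)" and ?n = "\<lambda>z. n (\<tau> z)"
  have td: "\<tau> differentiable (at y)" if "y \<in> U'" for y by (rule smooth_onD_diff[OF \<tau>(2) that])
  have ddF: "dd ?F a y = dd F (dd \<tau> a y) (\<tau> y)" if "y \<in> U'" for a y
    by (rule dd_compose[OF td[OF that] F.F_diff]) (use \<tau> that in auto)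
  interpret F': coord_frontal V G U' ?F ?n
  proof
    show "smooth_on U' ?F" by (rule smooth_on_compose[OF F.smooth_F \<tau>(1,3,2)])
    show "smooth_on U' ?n" by (rule smooth_on_compose[OF F.smooth_n \<tau>(1,3,2)])
    show "?F ` U' \<subseteq> V" using \<tau> F.F_in by auto
    show "mip G (F (\<tau> y)) (?n y) (?n y) = 1" if "y \<in> U'" for y using that \<tau> F.unit_n by auto
    show "mip G (F (\<tau> y)) (?n y) (dd ?F a y) = 0" if "y \<in> U'" for y a
      using that \<tau> F.normal_n unfolding ddF[OF that] by auto
  qed (rule \<tau>)
  have tz: "\<tau> z \<in> U" using \<tau> z by auto
  define p q r s where "p = dd \<tau> (axis 1 1) z $ 1" "q = dd \<tau> (axis 1 1) z $ 2"
    "r = dd \<tau> (axis 2 1) z $ 1" "s = dd \<tau> (axis 2 1) z $ 2"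
  define e1 e2 :: "real^2" where "e1 = axis 1 1" "e2 = axis 2 1"
  have t: "dd \<tau> e1 z = p *\<^sub>R e1 + q *\<^sub>R e2" "dd \<tau> e2 z = r *\<^sub>R e1 + s *\<^sub>R e2"
    by (simp_all add: vec_eq_iff forall_2 p_q_r_s_def e1_e2_def axis_def)
  have J: "det (matrix (\<lambda>v. dd \<tau> v z)) = p * s - q * r"
    by (simp add: det_2 matrix_def p_q_r_s_def)
  note lF = linear_dd[OF F.F_diff[OF tz]]
  define f1 f2 where "f1 = dd F e1 (\<tau> z)" "f2 = dd F e2 (\<tau> z)"
  have F': "dd ?F e1 z = p *\<^sub>R f1 + q *\<^sub>R f2" "dd ?F e2 z = r *\<^sub>R f1 + s *\<^sub>R f2"
    unfolding ddF[OF z] t by (simp_all add: linear_add[OF lF] linear_scale[OF lF] f1_f2_def)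
  have cn: "covd G ?F ?n b z = covd G F n (dd \<tau> b z) (\<tau> z)" for b
    unfolding covd_def ddF[OF z]
    using dd_compose[OF td[OF z] smooth_onD_diff[OF F.smooth_n tz], of b] by simp
  have lc: "linear (\<lambda>b. covd G F n b (\<tau> z))"
    unfolding covd_def
    by (rule linearI) (simp_all add: linear_add[OF lF] linear_scale[OF lF] gam_add gam_scale algebra_simps
        linear_add[OF linear_dd[OF smooth_onD_diff[OF F.smooth_n tz]]]
        linear_scale[OF linear_dd[OF smooth_onD_diff[OF F.smooth_n tz]]])
  define L where "L a b = sff G F n a b (\<tau> z)" for a b
  have L12: "L e2 e1 = L e1 e2" unfolding L_def by (rule F.sff_commute[OF tz])
  have sff': "sff G ?F ?n a b z = L (dd \<tau> a z) (dd \<tau> b z)" for a b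
    unfolding sff_def cn ddF[OF z] L_def ..
  have Lbil: "L (x *\<^sub>R a + y *\<^sub>R b) (x' *\<^sub>R a + y' *\<^sub>R b) = x * x' * L a a + x * y' * L a b + y * x' * L b a + y * y' * L b b"
    for x y x' y' a b
    by (simp add: L_def sff_def linear_add[OF lF] linear_scale[OF lF] linear_add[OF lc] linear_scale[OF lc]
        mip_add mip_scale algebra_simps)
  have dF: "det (pb G F (\<tau> z)) = mip G (F (\<tau> z)) f1 f1 * mip G (F (\<tau> z)) f2 f2 - (mip G (F (\<tau> z)) f1 f2)\<^sup>2"
    unfolding F.pb_det[OF tz] f1_f2_def e1_e2_def ..
  have dF': "det (pb G ?F z) = (p * s - q * r)\<^sup>2 * det (pb G F (\<tau> z))"
    unfolding F'.pb_det[OF z] dF F'[unfolded e1_e2_def]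
    using F.mip_commute[OF F.F_V[OF tz], of f2 f1]
    by (simp add: mip_add mip_scale power2_eq_square algebra_simps)
  then show "det (pb G ?F z) = (det (matrix (\<lambda>v. dd \<tau> v z)))\<^sup>2 * det (pb G F (\<tau> z))" by (simp add: J)
  have j0: "(p * s - q * r)\<^sup>2 \<noteq> 0" using d J by simp
  have "kform (pb G ?F) z * det (pb G ?F z) = (p * s - q * r)\<^sup>2 * (kform (pb G F) (\<tau> z) * det (pb G F (\<tau> z)))"
  proof -
    have "kform (pb G ?F) z * det (pb G ?F z) =
      (p * s - q * r)\<^sup>2 * mip G (F (\<tau> z)) (riem G (F (\<tau> z)) f1 f2 f2) f1
      + (sff G ?F ?n e1 e1 z * sff G ?F ?n e2 e2 z - (sff G ?F ?n e1 e2 z)\<^sup>2)"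
      using F'.gauss_equation[OF z] dF' j0 dp F.sectional_form_change[OF F.F_V[OF tz], of p f1 q f2 r s]
      by (simp add: F'[unfolded e1_e2_def] e1_e2_def)
    also have "sff G ?F ?n e1 e1 z * sff G ?F ?n e2 e2 z - (sff G ?F ?n e1 e2 z)\<^sup>2 =
       (p * s - q * r)\<^sup>2 * (L e1 e1 * L e2 e2 - (L e1 e2)\<^sup>2)"
      unfolding sff' t Lbil L12 by (simp add: power2_eq_square algebra_simps)
    finally show ?thesis
      unfolding F.gauss_equation[OF tz dp] by (simp add: f1_f2_def e1_e2_def L_def algebra_simps)
  qed
  then show "kform (pb G ?F) z = kform (pb G F) (\<tau> z)"
    using dF' j0 dp by simp
qed

section \<open>Frontals near a straightened singular curve\<close>

abbreviation e1 :: "real^2" where "e1 \<equiv> axis 1 1"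
abbreviation e2 :: "real^2" where "e2 \<equiv> axis 2 1"

lemma dd_nth: "dd (\<lambda>z. z $ i) w z = w $ i" for z :: "real^'n"
  by (rule dd_linear[OF bounded_linear_vec_nth])

lemma inner_axis2: "z \<bullet> axis i (1::real) = z $ i"
  by (simp add: inner_axis)

lemma (in coord_surface) covd_add:
  assumes "z \<in> U" "smooth_on U X" "smooth_on U Y"
  shows "covd G F (\<lambda>z. X z + Y z) w z = covd G F X w z + covd G F Y w z"
  using assms by (simp add: covd_def dd_add smooth_onD_diff gam_add)

lemma (in coord_surface) covd_scale:
  assumes "z \<in> U" "smooth_on U f" "smooth_on U X"
  shows "covd G F (\<lambda>z. f z *\<^sub>R X z) w z = dd f w z *\<^sub>R X z + f z *\<^sub>R covd G F X w z"
  using assms by (simp add: covd_def dd_scaleR smooth_onD_diff gam_scale algebra_simps)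

lemma (in coord_surface) linear_covd:
  assumes "z \<in> U" "smooth_on U X"
  shows "linear (\<lambda>w. covd G F X w z)"
  using linear_dd[OF F_diff[OF assms(1)]] linear_dd[OF smooth_onD_diff[OF assms(2,1)]]
  unfolding covd_def
  by (intro linearI) (simp_all add: linear_add linear_scale gam_add gam_scale algebra_simps)

text \<open>\<open>H\<close> extends \<open>f\<^sub>v / v\<close> over the axis, and
  \<open>squeeze_U\<close> makes further functions that vanish on the axis divisible by
  \<open>v\<close> on the same domain.\<close>

locale straight_frontal = coord_frontal V G U F n for V G U F n +
  fixes H :: "real^2 \<Rightarrow> real^3"
  assumes squeeze_U: "z \<in> U \<Longrightarrow> 0 \<le> t \<Longrightarrow> t \<le> 1 \<Longrightarrow> squeeze e2 t z \<in> U"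
    and smooth_H: "smooth_on U H"
    and F2: "z \<in> U \<Longrightarrow> dd F e2 z = z $ 2 *\<^sub>R H z"
    and delta_pos: "z \<in> U \<Longrightarrow> 0 < mip G (F z) (dd F e1 z) (dd F e1 z) * mip G (F z) (H z) (H z)
      - (mip G (F z) (dd F e1 z) (H z))\<^sup>2"
begin

text \<open>\<open>\<delta>\<close> is the Gram determinant of \<open>f\<^sub>u\<close> and
  \<open>h\<close>, so the first fundamental form has determinant \<open>v\<^sup>2 \<delta>\<close>.
  \<open>L\<close> is the coefficient \<ell> of the second fundamental form, and \<open>N\<close> is
  the coefficient n with its factor v removed.\<close>

definition "E z = mip G (F z) (dd F e1 z) (dd F e1 z)"
definition "\<delta> z = E z * mip G (F z) (H z) (H z) - (mip G (F z) (dd F e1 z) (H z))\<^sup>2"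
definition "L z = sff G F n e1 e1 z"
definition "N z = - mip G (F z) (H z) (covd G F n e2 z)"
text \<open>The numerator of the Gauss equation with one \<open>v\<close> cancelled: \<ell> n
  contributes \<open>v L N\<close>, while m^2 and the ambient curvature term both carry
  \<open>v\<^sup>2\<close>.\<close>

definition "\<phi> z = (L z * N z + z $ 2 * (mip G (F z) (riem G (F z) (dd F e1 z) (H z) (H z)) (dd F e1 z)
   - (mip G (F z) (H z) (covd G F n e1 z))\<^sup>2)) / \<delta> z"
text \<open>A signed square root of \<open>\<delta>\<close>; its sign records how the normal is
  oriented relative to \<open>f\<^sub>u\<close> and \<open>h\<close>.\<close>

definition "r z = vol3 G (F z) (dd F e1 z) (H z) (n z)"

lemma \<delta>_pos: "z \<in> U \<Longrightarrow> 0 < \<delta> z"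
  using delta_pos by (simp add: \<delta>_def E_def)

lemma E_pos: assumes z: "z \<in> U" shows "0 < E z"
proof -
  have "dd F e1 z \<noteq> 0" using delta_pos[OF z] by auto
  then show ?thesis using pos_G[OF F_V[OF z]] by (simp add: E_def)
qed

lemma smooth_E: "smooth_on U E"
  unfolding E_def by (intro smooth_on_mip open_U smooth_F F_in smooth_on_dd)

lemma smooth_\<delta>: "smooth_on U \<delta>"
  unfolding \<delta>_def by (intro smooth open_U smooth_E smooth_on_mip smooth_F F_in smooth_on_dd smooth_H)

lemma smooth_L: "smooth_on U L"
  unfolding L_def sff_def by (intro smooth open_U smooth_on_mip smooth_F F_in smooth_on_dd smooth_covd smooth_n)

lemma smooth_N: "smooth_on U N"
  unfolding N_def by (intro smooth open_U smooth_on_mip smooth_F F_in smooth_covd smooth_n smooth_H)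

lemma smooth_\<phi>: "smooth_on U \<phi>"
proof -
  have "smooth_on U (\<lambda>z. mip G (F z) (riem G (F z) (dd F e1 z) (H z) (H z)) (dd F e1 z))"
    by (intro smooth_on_mip smooth_on_riem open_U smooth_F F_in smooth_on_dd smooth_H)
  moreover have "smooth_on U (\<lambda>z. mip G (F z) (H z) (covd G F n e1 z))"
    by (intro smooth_on_mip open_U smooth_F F_in smooth_covd smooth_n smooth_H)
  moreover have "\<delta> z \<noteq> 0" if "z \<in> U" for z using \<delta>_pos[OF that] by simp
  ultimately show ?thesis
    unfolding \<phi>_def by (intro smooth open_U smooth_L smooth_N smooth_\<delta>)
qed

lemma smooth_v: "smooth_on U (\<lambda>z. z $ 2)"
  by (intro smooth open_U)

lemma covd_v_scale:
  assumes "z \<in> U" "smooth_on U X"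
  shows "covd G F (\<lambda>z. z $ 2 *\<^sub>R X z) w z = w $ 2 *\<^sub>R X z + z $ 2 *\<^sub>R covd G F X w z"
  using covd_scale[OF assms(1) smooth_v assms(2), of w] by (simp add: dd_nth)

lemma covd_F2:
  assumes z: "z \<in> U"
  shows "covd G F (dd F e2) w z = w $ 2 *\<^sub>R H z + z $ 2 *\<^sub>R covd G F H w z"
proof -
  have "covd G F (dd F e2) w z = covd G F (\<lambda>z. z $ 2 *\<^sub>R H z) w z"
    unfolding covd_def using dd_cong[OF open_U z F2] F2[OF z] by simp
  then show ?thesis using covd_v_scale[OF z smooth_H] by simp
qed

text \<open>Off the axis one divides by \<open>v\<close>. On the axis \<open>h\<close> is \<nabla>_v
  \<open>f\<^sub>v\<close>, whose normal component is a coefficient of the second fundamental form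
  with \<open>f\<^sub>v\<close> = 0 in it.\<close>

lemma normal_H: assumes z: "z \<in> U" shows "mip G (F z) (n z) (H z) = 0"
proof (cases "z $ 2 = 0")
  case True
  have "mip G (F z) (covd G F (dd F e2) e2 z) (n z) = 0"
    using sff_covd[OF z, of e2 e2] F2[OF z] True by (simp add: sff_def)
  then show ?thesis using covd_F2[OF z, of e2] True mip_commute[OF F_V[OF z]] by simp
next
  case False
  then show ?thesis using normal_n[OF z, of e2] F2[OF z] by (simp add: mip_scale)
qed

lemma det_pb: "z \<in> U \<Longrightarrow> det (pb G F z) = (z $ 2)\<^sup>2 * \<delta> z"
  by (simp add: pb_det F2 mip_scale \<delta>_def E_def power2_eq_square algebra_simps)

lemma r_square: "z \<in> U \<Longrightarrow> (r z)\<^sup>2 = \<delta> z"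
  unfolding r_def \<delta>_def E_def by (rule vol3_normal_square[OF F_V unit_n normal_n normal_H])

lemma r_nz: "z \<in> U \<Longrightarrow> r z \<noteq> 0"
  using r_square \<delta>_pos by fastforce

lemma sff_axis2: "z \<in> U \<Longrightarrow> sff G F n e2 b z = - z $ 2 * mip G (F z) (H z) (covd G F n b z)"
  by (simp add: sff_def F2 mip_scale)

theorem curvature_singularity:
  assumes z: "z \<in> U" and v: "z $ 2 \<noteq> 0"
  shows "z $ 2 * kform (pb G F) z = \<phi> z"
proof -
  have d: "det (pb G F z) \<noteq> 0" using det_pb[OF z] \<delta>_pos[OF z] v by simp
  have y: "F z \<in> V" by (rule F_V[OF z])
  have "kform (pb G F) z * ((z $ 2)\<^sup>2 * \<delta> z) =
     (z $ 2)\<^sup>2 * mip G (F z) (riem G (F z) (dd F e1 z) (H z) (H z)) (dd F e1 z)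
     + L z * (z $ 2 * N z) - (z $ 2 * mip G (F z) (H z) (covd G F n e1 z))\<^sup>2"
    using gauss_equation[OF z d] sff_axis2[OF z, of e2] sff_axis2[OF z, of e1] sff_commute[OF z, of e1 e2]
    by (simp add: det_pb[OF z] F2[OF z] riem_scale2[OF y] riem_scale3[OF y] mip_scale L_def N_def
        power2_eq_square algebra_simps)
  also have "\<dots> = z $ 2 * (\<phi> z * \<delta> z)"
  proof -
    have e: "\<phi> z * \<delta> z = L z * N z + z $ 2 * (mip G (F z) (riem G (F z) (dd F e1 z) (H z) (H z)) (dd F e1 z)
      - (mip G (F z) (H z) (covd G F n e1 z))\<^sup>2)"
      using \<delta>_pos[OF z] by (simp add: \<phi>_def)
    show ?thesis unfolding e by (simp add: power2_eq_square algebra_simps)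
  qed
  finally have "(z $ 2 * \<delta> z) * (z $ 2 * kform (pb G F) z) = (z $ 2 * \<delta> z) * \<phi> z"
    by (simp add: power2_eq_square algebra_simps)
  then show ?thesis using v \<delta>_pos[OF z] by simp
qed

lemma \<phi>_axis: "z $ 2 = 0 \<Longrightarrow> \<phi> z = L z * N z / \<delta> z"
  by (simp add: \<phi>_def)

text \<open>Writing \<open>\<eta> = v a \<partial>\<^sub>u + b \<partial>\<^sub>v\<close>, one has \<open>f\<^sub>\<eta> = v X\<close> with \<open>X = a f\<^sub>u + b h\<close>, so on the axis
  \<open>f\<^sub>\<eta>\<^sub>\<eta> = b X\<close> and \<open>f\<^sub>\<eta>\<^sub>\<eta>\<^sub>\<eta> \<equiv> 2 b\<^sup>2 \<nabla>\<^sub>v X\<close> modulo \<open>X\<close>.\<close>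

lemma null_field_derivatives:
  assumes \<eta>: "smooth_on U \<eta>" "\<And>z. z \<in> U \<Longrightarrow> z $ 2 = 0 \<Longrightarrow> \<eta> z $ 1 = 0"
    and z: "z \<in> U" "z $ 2 = 0"
  defines "f1 \<equiv> \<lambda>z. dd F (\<eta> z) z"
  defines "f2 \<equiv> \<lambda>z. covd G F f1 (\<eta> z) z"
  defines "f3 \<equiv> \<lambda>z. covd G F f2 (\<eta> z) z"
  shows "vol3 G (F z) (dd F e1 z) (f2 z) (f3 z) = 2 * (\<eta> z $ 2) ^ 5 * N z * r z"
    and "vol3 G (F z) (dd F e1 z) (f2 z) (n z) = (\<eta> z $ 2)\<^sup>2 * r z"
    and "mip G (F z) (n z) (f2 z) = 0"
proof -
  have \<eta>1: "smooth_on U (\<lambda>z. \<eta> z $ 1)" and \<eta>2: "smooth_on U (\<lambda>z. \<eta> z $ 2)"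
    by (intro smooth open_U \<eta>)+
  have e2: "e2 \<bullet> e2 = 1" by (simp add: inner_axis_axis)
  have \<eta>0: "\<eta> z $ 1 = 0" if "z \<in> U" "z \<bullet> e2 = 0" for z using \<eta>(2) that by (simp add: inner_axis2)
  obtain a where a: "smooth_on U a" "\<And>z. z \<in> U \<Longrightarrow> \<eta> z $ 1 = (z \<bullet> e2) *\<^sub>R a z"
    by (rule smooth_division[OF open_U e2 \<eta>1 squeeze_U \<eta>0]) (assumption | rule that)+
  define X where "X z = a z *\<^sub>R dd F e1 z + \<eta> z $ 2 *\<^sub>R H z" for z
  have X: "smooth_on U X"
    unfolding X_def by (intro smooth open_U a \<eta>2 smooth_on_dd smooth_F smooth_H)
  have f1: "f1 z = z $ 2 *\<^sub>R X z" if "z \<in> U" for z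
  proof -
    have "f1 z = \<eta> z $ 1 *\<^sub>R dd F e1 z + \<eta> z $ 2 *\<^sub>R dd F e2 z"
      unfolding f1_def using linear_vec_expand[OF linear_dd[OF F_diff[OF that]], of "\<eta> z"] by (simp add: UNIV_2_sum)
    then show ?thesis using a(2)[OF that] F2[OF that] by (simp add: X_def inner_axis2 algebra_simps)
  qed
  have eqc: "covd G F Y w z = covd G F Y' w z" if "z \<in> U" "\<And>z. z \<in> U \<Longrightarrow> Y z = Y' z" for Y Y' w z
    unfolding covd_def using dd_cong[OF open_U that] that by simp
  define DX where "DX z = covd G F X (\<eta> z) z" for z
  have DX: "smooth_on U DX" unfolding DX_def by (rule smooth_on_covd[OF open_U smooth_F F_in X \<eta>(1)])
  have f2: "f2 z = \<eta> z $ 2 *\<^sub>R X z + z $ 2 *\<^sub>R DX z" if "z \<in> U" for z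
  proof -
    have "covd G F f1 (\<eta> z) z = covd G F (\<lambda>z. z $ 2 *\<^sub>R X z) (\<eta> z) z" by (rule eqc[OF that f1])
    then show ?thesis unfolding f2_def DX_def covd_v_scale[OF that X] .
  qed
  have s: "smooth_on U (\<lambda>z. \<eta> z $ 2 *\<^sub>R X z)" "smooth_on U (\<lambda>z. z $ 2 *\<^sub>R DX z)"
    by (intro smooth open_U \<eta>2 X DX)+
  have f3: "f3 z = dd (\<lambda>z. \<eta> z $ 2) (\<eta> z) z *\<^sub>R X z + (2 * \<eta> z $ 2) *\<^sub>R DX z"
  proof -
    have "f3 z = covd G F (\<lambda>z. \<eta> z $ 2 *\<^sub>R X z + z $ 2 *\<^sub>R DX z) (\<eta> z) z"
      unfolding f3_def by (rule eqc[OF z(1) f2])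
    also have "\<dots> = dd (\<lambda>z. \<eta> z $ 2) (\<eta> z) z *\<^sub>R X z + \<eta> z $ 2 *\<^sub>R DX z + \<eta> z $ 2 *\<^sub>R DX z"
      unfolding covd_add[OF z(1) s] covd_scale[OF z(1) \<eta>2 X] covd_v_scale[OF z(1) DX]
      by (simp only: z(2) DX_def scaleR_zero_left add_0_right add.assoc)
    finally show ?thesis by (simp only: mult_2 scaleR_left_distrib add.assoc)
  qed
  have \<eta>z: "\<eta> z = \<eta> z $ 2 *\<^sub>R e2"
    using \<eta>(2)[OF z] by (simp add: vec_eq_iff forall_2 axis_def)
  have DXz: "DX z = \<eta> z $ 2 *\<^sub>R covd G F X e2 z"
    unfolding DX_def by (subst \<eta>z) (rule linear_scale[OF linear_covd[OF z(1) X]])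
  have f2z: "f2 z = \<eta> z $ 2 *\<^sub>R X z" using f2[OF z(1)] z(2) by simp
  have Xn: "mip G (F z) (X z) (n z) = 0" if "z \<in> U" for z
    using normal_n[OF that, of e1] normal_H[OF that] mip_commute[OF F_V[OF that], of "dd F e1 z" "n z"]
      mip_commute[OF F_V[OF that], of "H z" "n z"]
    by (simp add: X_def mip_add mip_scale)
  \<comment> \<open>Symmetry of the second fundamental form trades this entry for one containing
    \<open>f\<^sub>v\<close>, which vanishes on the axis. Hence only the \<open>H\<close> part of
    \<open>X\<close> contributes to the normal component of its derivative.\<close>
  have "mip G (F z) (dd F e1 z) (covd G F n e2 z) = 0"
    using sff_commute[OF z(1), of e1 e2] sff_axis2[OF z(1), of e1] z(2) by (simp add: sff_def)
  then have N: "mip G (F z) (covd G F X e2 z) (n z) = \<eta> z $ 2 * N z"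
    using tangent_covd_normal[OF z(1) X, of e2, OF Xn] by (simp add: X_def[of z] N_def mip_add mip_scale)
  have vX: "vol3 G (F z) (dd F e1 z) (X z) y = \<eta> z $ 2 * vol3 G (F z) (dd F e1 z) (H z) y" for y
    by (simp add: X_def vol3_add vol3_scale vol3_def det_3 algebra_simps)
  show "vol3 G (F z) (dd F e1 z) (f2 z) (n z) = (\<eta> z $ 2)\<^sup>2 * r z"
    unfolding f2z vol3_scale vX r_def by (simp add: power2_eq_square)
  show "mip G (F z) (n z) (f2 z) = 0"
    using Xn[OF z(1)] mip_commute[OF F_V[OF z(1)], of "X z" "n z"] by (simp add: f2z mip_scale)
  have vn: "vol3 G (F z) (dd F e1 z) (H z) y = mip G (F z) y (n z) * r z" for y
    unfolding r_def
    by (rule vol3_normal[OF F_V[OF z(1)] unit_n[OF z(1)] normal_n[OF z(1)] normal_H[OF z(1)]])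
      (use r_nz[OF z(1)] in \<open>simp add: r_def\<close>)
  \<comment> \<open>The five factors b = \<open>\<eta> z $ 2\<close>: one in \<open>f2\<close>, two
    in the coefficient of \<nabla>_v X in \<open>f3\<close>, one from \<open>X\<close> in the second
    slot, and one from the normal component of \<nabla>_v X.\<close>
  have "vol3 G (F z) (dd F e1 z) (f2 z) (f3 z)
      = 2 * (\<eta> z $ 2) ^ 3 * vol3 G (F z) (dd F e1 z) (X z) (covd G F X e2 z)"
    unfolding f2z f3 DXz by (simp add: vol3_scale vol3_add vol3_same power3_eq_cube algebra_simps)
  also have "\<dots> = 2 * (\<eta> z $ 2) ^ 5 * N z * r z"
    unfolding vX vn N by (simp add: eval_nat_numeral)
  finally show "vol3 G (F z) (dd F e1 z) (f2 z) (f3 z) = 2 * (\<eta> z $ 2) ^ 5 * N z * r z" .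
qed

end

text \<open>The definition of \<kappa>_c is homogeneous of degree 0 in the speed \<open>s\<close>
  (3/2 + 1 - 5/2) and in the length \<open>b\<close> of the null vector (5 - 2 * 5/2), and of degree
  -3/2 in |r| (1 - 5/2). The condition on \<open>s * b\<close> turns \<open>s * b ^ 5\<close> into
  its absolute value, so that only the sign of \<open>r\<close> is left.\<close>

lemma cuspidal_normalization:
  fixes s b E N r :: real
  assumes "0 < s * b" "0 < E" "r \<noteq> 0"
  shows "(\<bar>s\<bar> * sqrt E) powr (3/2) * (s * (2 * b ^ 5 * N * r)) / (\<bar>s\<bar> * b\<^sup>2 * \<bar>r\<bar>) powr (5/2)
    = 2 * sgn r * N * E powr (3/4) * (r\<^sup>2) powr (- (3/4))"
proof -
  have nz: "s \<noteq> 0" "b \<noteq> 0" using assms(1) by auto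
  \<comment> \<open>In logarithms the identity is a comparison of exponents; the signs are treated
    separately.\<close>
  define x y w k where "x = ln \<bar>s\<bar>" "y = ln \<bar>b\<bar>" "w = ln \<bar>r\<bar>" "k = ln E"
  have e: "\<bar>s\<bar> = exp x" "\<bar>b\<bar> = exp y" "\<bar>r\<bar> = exp w" "E = exp k"
    using nz assms by (simp_all add: x_y_w_k_def)
  have "s * b ^ 5 = \<bar>s\<bar> * \<bar>b\<bar> ^ 5"
  proof -
    have b5: "c ^ 5 = c * c ^ 4" for c :: real by (simp add: eval_nat_numeral)
    have "s * b = \<bar>s\<bar> * \<bar>b\<bar>" using assms(1) by (simp flip: abs_mult)
    moreover have "b ^ 4 = \<bar>b\<bar> ^ 4" by simp
    ultimately show ?thesis unfolding b5 by (metis mult.assoc)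
  qed
  then have sb: "s * (2 * b ^ 5 * N * r) = 2 * N * r * (exp x * exp y ^ 5)"
    unfolding e by (simp add: algebra_simps)
  have r: "r = sgn r * exp w" using sgn_mult_abs[of r] e(3) by simp
  have p1: "(\<bar>s\<bar> * sqrt E) powr (3/2) = exp ((x + k / 2) * (3/2))"
  proof -
    have "sqrt E = exp (k / 2)" unfolding e using exp_double[of "k / 2"] by (intro real_sqrt_unique) simp_all
    then show ?thesis unfolding e by (simp add: powr_def exp_add[symmetric] mult.commute)
  qed
  have p2: "(\<bar>s\<bar> * b\<^sup>2 * \<bar>r\<bar>) powr (5/2) = exp ((x + 2 * y + w) * (5/2))"
  proof -
    have "b\<^sup>2 = \<bar>b\<bar>\<^sup>2" by simp
    also have "\<dots> = exp (2 * y)" unfolding e(2) by (simp only: exp_double)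
    finally have "b\<^sup>2 = exp (2 * y)" .
    then show ?thesis unfolding e by (simp add: powr_def exp_add[symmetric] mult.commute)
  qed
  have p3: "(r\<^sup>2) powr (- (3/4)) = exp (- (3/2) * w)"
  proof -
    have "r\<^sup>2 = \<bar>r\<bar>\<^sup>2" by simp
    also have "\<dots> = exp (2 * w)" unfolding e(3) by (simp only: exp_double)
    finally have "r\<^sup>2 = exp (2 * w)" .
    then show ?thesis by (simp add: powr_def)
  qed
  have p4: "E powr (3/4) = exp (3/4 * k)" unfolding e by (simp add: powr_def)
  have p5: "exp x * exp y ^ 5 = exp (x + 5 * y)"
  proof -
    have "exp (5 * y) = exp y ^ 5" using exp_of_nat_mult[of 5 y] by simp
    then show ?thesis by (simp add: exp_add)
  qed
  have "(\<bar>s\<bar> * sqrt E) powr (3/2) * (s * (2 * b ^ 5 * N * r)) / (\<bar>s\<bar> * b\<^sup>2 * \<bar>r\<bar>) powr (5/2)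
     = 2 * N * sgn r * (exp ((x + k / 2) * (3/2)) * exp (x + 5 * y) * exp w / exp ((x + 2 * y + w) * (5/2)))"
    unfolding sb p1 p2 p5 by (subst r) simp
  also have "exp ((x + k / 2) * (3/2)) * exp (x + 5 * y) * exp w / exp ((x + 2 * y + w) * (5/2))
     = exp (3/4 * k) * exp (- (3/2) * w)"
    by (simp add: exp_add[symmetric] exp_diff[symmetric] field_simps)
  finally show ?thesis unfolding p3 p4 by (simp add: algebra_simps)
qed

section \<open>Charts\<close>

lemma covd_cong:
  assumes "open S" "z \<in> S" "\<And>y. y \<in> S \<Longrightarrow> F y = F' y" "\<And>y. y \<in> S \<Longrightarrow> X y = X' y"
  shows "covd G F X w z = covd G F' X' w z"
  unfolding covd_def using dd_cong[OF assms(1,2,3)] dd_cong[OF assms(1,2,4)] assms(2-4) by simp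

locale omanifold =
  fixes A :: "('m::{t2_space,second_countable_topology}, 'n::finite) chart set"
  assumes A: "oriented_manifold A"
begin

lemma chart: "c \<in> A \<Longrightarrow> is_chart c"
  using conjunct1[OF A[unfolded oriented_manifold_def]] by blast

lemma atlas_covers: "\<Union>(cdom ` A) = UNIV"
  using conjunct1[OF conjunct2[OF A[unfolded oriented_manifold_def]]] .

lemma atlas_transition: "c \<in> A \<Longrightarrow> d \<in> A \<Longrightarrow> pos_transition c d"
  using conjunct1[OF conjunct2[OF conjunct2[OF A[unfolded oriented_manifold_def]]]] by blast

lemma atlas_maximal:
  "is_chart c \<Longrightarrow> (\<And>d. d \<in> A \<Longrightarrow> pos_transition c d) \<Longrightarrow> (\<And>d. d \<in> A \<Longrightarrow> pos_transition d c) \<Longrightarrow> c \<in> A"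
  using conjunct2[OF conjunct2[OF conjunct2[OF A[unfolded oriented_manifold_def]]]] by blast

lemma chart_homeo: "c \<in> A \<Longrightarrow> homeomorphism (cdom c) (cmap c ` cdom c) (cmap c) (cinv c)"
  using chart unfolding is_chart_def by blast

lemma open_cdom: "c \<in> A \<Longrightarrow> open (cdom c)"
  using chart unfolding is_chart_def by blast

lemma open_cimage: "c \<in> A \<Longrightarrow> open (cmap c ` cdom c)"
  using chart unfolding is_chart_def by blast

lemma cinv_cmap: "c \<in> A \<Longrightarrow> q \<in> cdom c \<Longrightarrow> cinv c (cmap c q) = q"
  using homeomorphism_apply1[OF chart_homeo] by blast

lemma cmap_cinv: "c \<in> A \<Longrightarrow> z \<in> cmap c ` cdom c \<Longrightarrow> cmap c (cinv c z) = z"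
  using homeomorphism_apply2[OF chart_homeo] by blast

lemma cinv_in: "z \<in> cmap c ` cdom c \<Longrightarrow> cinv c z \<in> cdom c"
  by (rule inv_into_into)

lemma ex_chart: "\<exists>c\<in>A. q \<in> cdom c"
  using atlas_covers by blast

lemma image_eq:
  assumes c: "c \<in> A"
  shows "cmap c ` (S \<inter> cdom c) = cmap c ` cdom c \<inter> cinv c -` S"
proof (intro equalityI subsetI)
  fix z assume "z \<in> cmap c ` (S \<inter> cdom c)"
  then obtain q where "q \<in> S" "q \<in> cdom c" "z = cmap c q" by blast
  then show "z \<in> cmap c ` cdom c \<inter> cinv c -` S" using cinv_cmap[OF c, of q] by simp
next
  fix z assume z: "z \<in> cmap c ` cdom c \<inter> cinv c -` S"
  then obtain q where q: "q \<in> cdom c" "z = cmap c q" by blast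
  then have "q \<in> S" using z cinv_cmap[OF c, of q] by simp
  then show "z \<in> cmap c ` (S \<inter> cdom c)" using q by blast
qed

lemma continuous_on_cmap: "c \<in> A \<Longrightarrow> continuous_on (cdom c) (cmap c)"
  using chart_homeo unfolding homeomorphism_def by blast

lemma continuous_on_cinv: "c \<in> A \<Longrightarrow> continuous_on (cmap c ` cdom c) (cinv c)"
  using chart_homeo unfolding homeomorphism_def by blast

lemma open_image:
  assumes "c \<in> A" "open S"
  shows "open (cmap c ` (S \<inter> cdom c))"
  unfolding image_eq[OF assms(1)]
  by (rule continuous_open_preimage[OF continuous_on_cinv open_cimage]) (use assms in blast)+

lemma open_overlap: "c \<in> A \<Longrightarrow> d \<in> A \<Longrightarrow> open (cmap c ` (cdom c \<inter> cdom d))"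
  using open_image[of c "cdom d"] open_cdom[of d] Int_commute[of "cdom c" "cdom d"] by metis

lemma tr_smooth: "c \<in> A \<Longrightarrow> d \<in> A \<Longrightarrow> smooth_on (cmap c ` (cdom c \<inter> cdom d)) (cmap d \<circ> cinv c)"
  using atlas_transition unfolding pos_transition_def Let_def by blast

lemma tr_det: "c \<in> A \<Longrightarrow> d \<in> A \<Longrightarrow> q \<in> cdom c \<Longrightarrow> q \<in> cdom d \<Longrightarrow>
    0 < det (matrix (\<lambda>w. dd (cmap d \<circ> cinv c) w (cmap c q)))"
  using atlas_transition unfolding pos_transition_def Let_def by blast

lemma tr_diff: "c \<in> A \<Longrightarrow> d \<in> A \<Longrightarrow> q \<in> cdom c \<Longrightarrow> q \<in> cdom d \<Longrightarrow>
    (cmap d \<circ> cinv c) differentiable (at (cmap c q))"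
  by (rule smooth_onD_diff[OF tr_smooth]) auto

lemma rep_change:
  fixes h :: "'m \<Rightarrow> 'b::real_normed_vector"
  assumes c: "c \<in> A" "c' \<in> A" and q: "q \<in> cdom c" "q \<in> cdom c'"
    and h: "(h \<circ> cinv c) differentiable (at (cmap c q))"
  shows "(h \<circ> cinv c') differentiable (at (cmap c' q))"
    and "dd (h \<circ> cinv c') w (cmap c' q) = dd (h \<circ> cinv c) (dd (cmap c \<circ> cinv c') w (cmap c' q)) (cmap c q)"
proof -
  let ?D = "cmap c' ` (cdom c' \<inter> cdom c)" and ?t = "cmap c \<circ> cinv c'"
  have D: "open ?D" "cmap c' q \<in> ?D" using open_overlap[OF c(2,1)] q by auto
  have eq: "(h \<circ> cinv c') y = (h \<circ> cinv c) (?t y)" if y: "y \<in> ?D" for y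
  proof -
    obtain x where "x \<in> cdom c'" "x \<in> cdom c" "y = cmap c' x" using y by blast
    then show ?thesis using cinv_cmap[OF c(1), of x] cinv_cmap[OF c(2), of x] by simp
  qed
  have t: "?t differentiable (at (cmap c' q))" "?t (cmap c' q) = cmap c q"
    using tr_diff[OF c(2,1) q(2,1)] by (simp_all add: cinv_cmap[OF c(2) q(2)])
  have "(\<lambda>y. (h \<circ> cinv c) (?t y)) differentiable (at (cmap c' q))"
    using differentiable_chain_at[OF t(1), of "h \<circ> cinv c"] h unfolding t(2) by (simp only: o_def)
  then show "(h \<circ> cinv c') differentiable (at (cmap c' q))"
    using differentiable_cong_open[of ?D "cmap c' q" "h \<circ> cinv c'" "\<lambda>y. (h \<circ> cinv c) (?t y)", OF D eq]
    by (simp only: simp_thms)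
  have "dd (h \<circ> cinv c') w (cmap c' q) = dd (\<lambda>y. (h \<circ> cinv c) (?t y)) w (cmap c' q)"
    by (rule dd_cong[OF D eq])
  also have "\<dots> = dd (h \<circ> cinv c) (dd ?t w (cmap c' q)) (?t (cmap c' q))"
    by (rule dd_compose[OF t(1)]) (unfold t(2), rule h)
  finally show "dd (h \<circ> cinv c') w (cmap c' q) = dd (h \<circ> cinv c) (dd ?t w (cmap c' q)) (cmap c q)"
    unfolding t(2) .
qed

lemma tr_chain:
  assumes "c \<in> A" "d \<in> A" "e \<in> A" "q \<in> cdom c" "q \<in> cdom d" "q \<in> cdom e"
  shows "dd (cmap e \<circ> cinv d) (dd (cmap d \<circ> cinv c) w (cmap c q)) (cmap d q) = dd (cmap e \<circ> cinv c) w (cmap c q)"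
  using rep_change(2)[of d c q "cmap e" w] tr_diff[of d e q] assms by simp

lemma tr_self:
  assumes c: "c \<in> A" "q \<in> cdom c"
  shows "dd (cmap c \<circ> cinv c) w (cmap c q) = w"
proof -
  have "dd (cmap c \<circ> cinv c) w (cmap c q) = dd (\<lambda>z. z) w (cmap c q)"
    by (rule dd_cong[OF open_cimage[OF c(1)]]) (use c in \<open>auto simp: cinv_cmap\<close>)
  then show ?thesis by simp
qed

lemma tr_surj:
  assumes "c \<in> A" "d \<in> A" "q \<in> cdom c" "q \<in> cdom d"
  shows "surj (\<lambda>w. dd (cmap d \<circ> cinv c) w (cmap c q))"
proof (rule surjI)
  show "dd (cmap d \<circ> cinv c) (dd (cmap c \<circ> cinv d) w (cmap d q)) (cmap c q) = w" for w
    using tr_chain[of d c d q w] tr_self[of d q w] assms by simp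
qed

lemma tangent_change:
  "a \<in> tangent_space A q \<Longrightarrow> c \<in> A \<Longrightarrow> d \<in> A \<Longrightarrow> q \<in> cdom c \<Longrightarrow> q \<in> cdom d \<Longrightarrow>
    a d = dd (cmap d \<circ> cinv c) (a c) (cmap c q)"
  unfolding tangent_space_def by blast

lemma tangent_zero: "a \<in> tangent_space A q \<Longrightarrow> \<not> (c \<in> A \<and> q \<in> cdom c) \<Longrightarrow> a c = 0"
  unfolding tangent_space_def by blast

lemma tangentI:
  assumes "\<And>c d. c \<in> A \<Longrightarrow> d \<in> A \<Longrightarrow> q \<in> cdom c \<Longrightarrow> q \<in> cdom d \<Longrightarrow>
      a d = dd (cmap d \<circ> cinv c) (a c) (cmap c q)"
    and "\<And>c. \<not> (c \<in> A \<and> q \<in> cdom c) \<Longrightarrow> a c = 0"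
  shows "a \<in> tangent_space A q"
  unfolding tangent_space_def using assms by blast

text \<open>The transformation law determines all components from one of them, and the value 0 at
  foreign indices makes the two families literally equal.\<close>

lemma tangent_eqI:
  assumes "a \<in> tangent_space A q" "b \<in> tangent_space A q" "c \<in> A" "q \<in> cdom c" "a c = b c"
  shows "a = b"
proof
  fix d
  show "a d = b d"
    using tangent_change[OF assms(1,3), of d] tangent_change[OF assms(2,3), of d] assms(4,5)
      tangent_zero[OF assms(1), of d] tangent_zero[OF assms(2), of d] by (cases "d \<in> A \<and> q \<in> cdom d") auto
qed

lemma coord_vec_self: "c \<in> A \<Longrightarrow> q \<in> cdom c \<Longrightarrow> coord_vec A c q w c = w"
  by (simp add: coord_vec_def tr_self)

lemma coord_vec_tangent: "c \<in> A \<Longrightarrow> q \<in> cdom c \<Longrightarrow> coord_vec A c q w \<in> tangent_space A q"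
proof (rule tangentI)
  assume c: "c \<in> A" "q \<in> cdom c"
  show "coord_vec A c q w e = dd (cmap e \<circ> cinv d) (coord_vec A c q w d) (cmap d q)"
    if "d \<in> A" "e \<in> A" "q \<in> cdom d" "q \<in> cdom e" for d e
    using tr_chain[OF c(1) that(1,2) c(2) that(3,4)] that by (simp add: coord_vec_def)
qed (auto simp: coord_vec_def)

lemma coord_vec_eta: "a \<in> tangent_space A q \<Longrightarrow> c \<in> A \<Longrightarrow> q \<in> cdom c \<Longrightarrow> coord_vec A c q (a c) = a"
  by (rule tangent_eqI[OF coord_vec_tangent]) (auto simp: coord_vec_self)

lemma cfield_tangent: "c \<in> A \<Longrightarrow> q \<in> cdom c \<Longrightarrow> cfield A c i q \<in> tangent_space A q"
  by (simp add: cfield_def coord_vec_tangent)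

lemma cfield_self: "c \<in> A \<Longrightarrow> q \<in> cdom c \<Longrightarrow> cfield A c i q c = axis i 1"
  by (simp add: cfield_def coord_vec_self)

lemma tangent_combination:
  assumes "a \<in> tangent_space A q" "b \<in> tangent_space A q"
  shows "(\<lambda>c. s *\<^sub>R a c + t *\<^sub>R b c) \<in> tangent_space A q"
proof (rule tangentI)
  fix c d assume cd: "c \<in> A" "d \<in> A" "q \<in> cdom c" "q \<in> cdom d"
  show "s *\<^sub>R a d + t *\<^sub>R b d = dd (cmap d \<circ> cinv c) (s *\<^sub>R a c + t *\<^sub>R b c) (cmap c q)"
    unfolding tangent_change[OF assms(1) cd] tangent_change[OF assms(2) cd]
    using linear_add[OF linear_dd[OF tr_diff[OF cd]]] linear_scale[OF linear_dd[OF tr_diff[OF cd]]] by simp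
next
  fix c assume "\<not> (c \<in> A \<and> q \<in> cdom c)"
  then have "a c = 0" "b c = 0" using tangent_zero[OF assms(1)] tangent_zero[OF assms(2)] by blast+
  then show "s *\<^sub>R a c + t *\<^sub>R b c = 0" by simp
qed

lemma zero_tangent: "(\<lambda>_. 0) \<in> tangent_space A q"
proof (rule tangentI)
  fix c d assume cd: "c \<in> A" "d \<in> A" "q \<in> cdom c" "q \<in> cdom d"
  show "0 = dd (cmap d \<circ> cinv c) 0 (cmap c q)"
    using linear_0[OF linear_dd[OF tr_diff[OF cd]]] by simp
qed auto

text \<open>By the chain rule this value is the same in all charts, so it satisfies the definite
  description; it is the only candidate because \<open>c\<close> is one of the charts quantified
  over.\<close>

lemma tderiv_eq:
  fixes h :: "'m \<Rightarrow> 'b::real_normed_vector"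
  assumes a: "a \<in> tangent_space A q" and c: "c \<in> A" "q \<in> cdom c"
    and h: "(h \<circ> cinv c) differentiable (at (cmap c q))"
  shows "tderiv A q a h = dd (h \<circ> cinv c) (a c) (cmap c q)"
  unfolding tderiv_def
proof (rule the_equality)
  show "\<forall>c'\<in>A. q \<in> cdom c' \<longrightarrow> dd (h \<circ> cinv c) (a c) (cmap c q) = dd (h \<circ> cinv c') (a c') (cmap c' q)"
  proof (intro ballI impI)
    fix c' assume c': "c' \<in> A" "q \<in> cdom c'"
    show "dd (h \<circ> cinv c) (a c) (cmap c q) = dd (h \<circ> cinv c') (a c') (cmap c' q)"
      unfolding rep_change(2)[OF c(1) c'(1) c(2) c'(2) h]
      using tangent_change[OF a c'(1) c(1) c'(2) c(2)] by simp
  qed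
qed (use c in blast)

end

section \<open>Riemannian metrics and volume forms in charts\<close>

locale riem_manifold = omanifold B for B :: "('w::{t2_space,second_countable_topology}, 'n::finite) chart set" +
  fixes g :: "('w, 'n) metric"
  assumes metric: "riemannian_metric B g"
begin

lemma g_sym: "a \<in> tangent_space B q \<Longrightarrow> b \<in> tangent_space B q \<Longrightarrow> g q a b = g q b a"
  using metric unfolding riemannian_metric_def by meson

lemma g_pos: "a \<in> tangent_space B q \<Longrightarrow> a \<noteq> (\<lambda>_. 0) \<Longrightarrow> 0 < g q a a"
  using metric unfolding riemannian_metric_def by meson

lemma g_lin: "a \<in> tangent_space B q \<Longrightarrow> b \<in> tangent_space B q \<Longrightarrow> v \<in> tangent_space B q \<Longrightarrow>
    g q (\<lambda>c. s *\<^sub>R a c + b c) v = s * g q a v + g q b v"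
  using metric unfolding riemannian_metric_def by meson

lemma linear_g:
  assumes d: "d \<in> B" "q \<in> cdom d" and v: "v \<in> tangent_space B q"
  shows "linear (\<lambda>w. g q (coord_vec B d q w) v)"
proof -
  have l: "coord_vec B d q (s *\<^sub>R w + w') = (\<lambda>c. s *\<^sub>R coord_vec B d q w c + coord_vec B d q w' c)" for s w w'
  proof -
    have "(\<lambda>c. s *\<^sub>R coord_vec B d q w c + coord_vec B d q w' c) \<in> tangent_space B q"
      using tangent_combination[OF coord_vec_tangent[OF d, of w] coord_vec_tangent[OF d, of w'], of s 1] by simp
    then show ?thesis
      by (rule tangent_eqI[OF coord_vec_tangent[OF d] _ d]) (simp add: coord_vec_self d)
  qed
  have lg: "g q (coord_vec B d q (s *\<^sub>R w + w')) v = s * g q (coord_vec B d q w) v + g q (coord_vec B d q w') v" for s w w'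
    unfolding l by (rule g_lin[OF coord_vec_tangent[OF d] coord_vec_tangent[OF d] v])
  have z: "g q (coord_vec B d q 0) v = 0" using lg[of 1 0 0] by simp
  show ?thesis
  proof (rule linearI)
    show "g q (coord_vec B d q (x + y)) v = g q (coord_vec B d q x) v + g q (coord_vec B d q y) v" for x y
      using lg[of 1 x y] by simp
    show "g q (coord_vec B d q (s *\<^sub>R x)) v = s *\<^sub>R g q (coord_vec B d q x) v" for s x
      using lg[of s x 0] z by simp
  qed
qed

lemma g_mip:
  assumes d: "d \<in> B" "q \<in> cdom d" and a: "a \<in> tangent_space B q" and b: "b \<in> tangent_space B q"
  shows "g q a b = mip (mcomp B g d) (cmap d q) (a d) (b d)"
proof -
  have e: "cfield B d i q = coord_vec B d q (axis i 1)" for i by (simp add: cfield_def)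
  have t: "coord_vec B d q w \<in> tangent_space B q" for w by (rule coord_vec_tangent[OF d])
  have "g q a b = g q (coord_vec B d q (a d)) b" by (simp add: coord_vec_eta[OF a d])
  also have "\<dots> = (\<Sum>i\<in>UNIV. a d $ i * g q (coord_vec B d q (axis i 1)) b)"
    using linear_vec_expand[OF linear_g[OF d b], of "a d"] by simp
  also have "\<dots> = (\<Sum>i\<in>UNIV. a d $ i * (\<Sum>j\<in>UNIV. b d $ j * g q (coord_vec B d q (axis i 1)) (coord_vec B d q (axis j 1))))"
  proof (intro sum.cong refl arg_cong2[where f = "(*)"])
    fix i
    have "g q (coord_vec B d q (axis i 1)) b = g q (coord_vec B d q (b d)) (coord_vec B d q (axis i 1))"
      unfolding coord_vec_eta[OF b d] by (rule g_sym[OF t b])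
    also have "\<dots> = (\<Sum>j\<in>UNIV. b d $ j * g q (coord_vec B d q (axis j 1)) (coord_vec B d q (axis i 1)))"
      using linear_vec_expand[OF linear_g[OF d t], of "b d"] by simp
    finally show "g q (coord_vec B d q (axis i 1)) b
      = (\<Sum>j\<in>UNIV. b d $ j * g q (coord_vec B d q (axis i 1)) (coord_vec B d q (axis j 1)))"
      using g_sym[OF t t] by simp
  qed
  also have "\<dots> = mip (mcomp B g d) (cmap d q) (a d) (b d)"
    using d by (simp add: mip_expand mcomp_def cinv_cmap e sum_distrib_left algebra_simps)
  finally show ?thesis .
qed

lemma chart_metric: "d \<in> B \<Longrightarrow> coord_metric (cmap d ` cdom d) (mcomp B g d)"
proof
  assume d: "d \<in> B"
  show "open (cmap d ` cdom d)" by (rule open_cimage[OF d])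
  show "smooth_on (cmap d ` cdom d) (mcomp B g d)"
    using metric d by (simp add: riemannian_metric_def)
  fix y assume "y \<in> cmap d ` cdom d"
  then obtain q where q: "q \<in> cdom d" "y = cmap d q" by auto
  have t: "coord_vec B d q w \<in> tangent_space B q" for w by (rule coord_vec_tangent[OF d q(1)])
  show "mcomp B g d y $ i $ j = mcomp B g d y $ j $ i" for i j
    using g_sym[OF t t] by (simp add: mcomp_def cfield_def q cinv_cmap[OF d q(1)])
  fix a :: "real^'n" assume "a \<noteq> 0"
  then have "coord_vec B d q a \<noteq> (\<lambda>_. 0)" using coord_vec_self[OF d q(1), of a] by auto
  then show "0 < mip (mcomp B g d) y a a"
    using g_mip[OF d q(1) t t, of a a] g_pos[OF t, of a] by (simp add: q coord_vec_self[OF d q(1)])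
qed

lemma tr_isometry:
  assumes "d \<in> B" "e \<in> B" and y: "y \<in> cmap d ` (cdom d \<inter> cdom e)"
  shows "mip (mcomp B g d) y a b = mip (mcomp B g e) ((cmap e \<circ> cinv d) y)
    (dd (cmap e \<circ> cinv d) a y) (dd (cmap e \<circ> cinv d) b y)"
proof -
  obtain q where q: "q \<in> cdom d" "q \<in> cdom e" "y = cmap d q" using y by auto
  have t: "coord_vec B d q w \<in> tangent_space B q" for w by (rule coord_vec_tangent[OF assms(1) q(1)])
  have ee: "coord_vec B d q w e = dd (cmap e \<circ> cinv d) w y" for w using assms q by (simp add: coord_vec_def)
  show ?thesis
    using g_mip[OF assms(1) q(1) t t, of a b] g_mip[OF assms(2) q(2) t t, of a b]
    by (simp add: ee q(3) coord_vec_self assms(1) q(1) cinv_cmap)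
qed

end

locale riem_manifold3 = riem_manifold B g for B :: "('w::{t2_space,second_countable_topology}, 3) chart set" and g
begin

lemma chart_metric3: "d \<in> B \<Longrightarrow> coord_metric3 (cmap d ` cdom d) (mcomp B g d)"
  unfolding coord_metric3_def by (rule chart_metric)

text \<open>With J the Jacobian of the coordinate change, the metric matrix is conjugated by J as a
  bilinear form, so the root of its determinant acquires the factor det J, without absolute value
  because J is positive. The determinant of the components acquires the inverse factor.\<close>

lemma vol3_change:
  assumes de: "d \<in> B" "e \<in> B" and q: "q \<in> cdom d" "q \<in> cdom e"
    and abc: "a \<in> tangent_space B q" "b \<in> tangent_space B q" "c \<in> tangent_space B q"
  shows "vol3 (mcomp B g d) (cmap d q) (a d) (b d) (c d) = vol3 (mcomp B g e) (cmap e q) (a e) (b e) (c e)"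
proof -
  define J where "J = matrix (\<lambda>w. dd (cmap e \<circ> cinv d) w (cmap d q))"
  have J: "dd (cmap e \<circ> cinv d) w (cmap d q) = J *v w" for w
    unfolding J_def by (rule dd_matrix[OF tr_diff[OF de q]])
  have Jp: "0 < det J" unfolding J_def by (rule tr_det[OF de q])
  have eqm: "mcomp B g d (cmap d q) = transpose J ** mcomp B g e (cmap e q) ** J"
  proof -
    have "a \<bullet> (mcomp B g d (cmap d q) *v b) = a \<bullet> ((transpose J ** mcomp B g e (cmap e q) ** J) *v b)" for a b
    proof -
      have "a \<bullet> (mcomp B g d (cmap d q) *v b) = (J *v a) \<bullet> (mcomp B g e (cmap e q) *v (J *v b))"
        using tr_isometry[OF de, of "cmap d q" a b] q de by (simp add: mip_def J cinv_cmap)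
      also have "\<dots> = a \<bullet> (transpose J *v (mcomp B g e (cmap e q) *v (J *v b)))"
        by (metis dot_lmul_matrix vector_transpose_matrix transpose_transpose)
      finally show ?thesis by (simp add: matrix_vector_mul_assoc matrix_mul_assoc)
    qed
    then have "mcomp B g d (cmap d q) *v b = (transpose J ** mcomp B g e (cmap e q) ** J) *v b" for b
      using vector_eq_ldot by blast
    then show ?thesis by (simp add: matrix_eq)
  qed
  have "det (mcomp B g d (cmap d q)) = (det J)\<^sup>2 * det (mcomp B g e (cmap e q))"
    unfolding eqm by (simp add: det_mul power2_eq_square)
  then have s: "sqrt (det (mcomp B g d (cmap d q))) = det J * sqrt (det (mcomp B g e (cmap e q)))"
    using Jp by (simp add: real_sqrt_mult)
  have "(vector [a e, b e, c e] :: real^3^3) = vector [a d, b d, c d] ** transpose J"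
    using tangent_change[OF abc(1) de q] tangent_change[OF abc(2) de q] tangent_change[OF abc(3) de q]
    by (simp add: J vec_eq_iff forall_3 matrix_matrix_mult_def matrix_vector_mult_def transpose_def mult.commute)
  then have "det (vector [a e, b e, c e] :: real^3^3) = det (vector [a d, b d, c d] :: real^3^3) * det J"
    by (simp add: det_mul)
  then show ?thesis by (simp add: vol3_def s)
qed

lemma vol_form_eq:
  assumes d: "d \<in> B" "q \<in> cdom d"
    and abc: "a \<in> tangent_space B q" "b \<in> tangent_space B q" "c \<in> tangent_space B q"
  shows "vol_form B g q a b c = vol3 (mcomp B g d) (cmap d q) (a d) (b d) (c d)"
  unfolding vol_form_def
proof (rule the_equality)
  show "\<forall>e\<in>B. q \<in> cdom e \<longrightarrow> vol3 (mcomp B g d) (cmap d q) (a d) (b d) (c d) =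
      sqrt (det (mcomp B g e (cmap e q))) * det (vector [a e, b e, c e] :: real^3^3)"
    using vol3_change[OF d(1) _ d(2) _ abc] by (simp add: vol3_def)
qed (use d in \<open>auto simp: vol3_def\<close>)

text \<open>\<open>n\<close> is a unit normal to \<open>a\<close> and \<open>b\<close>, so by
  \<open>vol3_normal\<close> the volume of \<open>a, b, v\<close> is \<langle>r n, v\<rangle> with r
  the volume of \<open>a, b, n\<close>. Hence r n is the cross product.\<close>

lemma gnorm_gcross:
  assumes n: "n \<in> tangent_space B q" "g q n n = 1" "g q n a = 0" "g q n b = 0"
    and ab: "a \<in> tangent_space B q" "b \<in> tangent_space B q" and nz: "vol_form B g q a b n \<noteq> 0"
  shows "gnorm g q (gcross B g q a b) = \<bar>vol_form B g q a b n\<bar>"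
proof -
  obtain d where d: "d \<in> B" "q \<in> cdom d" using ex_chart by blast
  interpret G: coord_metric3 "cmap d ` cdom d" "mcomp B g d" by (rule chart_metric3[OF d(1)])
  have y: "cmap d q \<in> cmap d ` cdom d" using d by auto
  define r where "r = vol_form B g q a b n"
  define w where "w = (\<lambda>c. r *\<^sub>R n c)"
  have w: "w \<in> tangent_space B q" unfolding w_def using tangent_combination[OF n(1) n(1), of r 0] by simp
  have gw: "g q w v = r * g q n v" if "v \<in> tangent_space B q" for v
    unfolding g_mip[OF d w that] g_mip[OF d n(1) that] by (simp add: mip_scale w_def)
  have n': "mip (mcomp B g d) (cmap d q) (n d) (n d) = 1" "mip (mcomp B g d) (cmap d q) (n d) (a d) = 0"
    "mip (mcomp B g d) (cmap d q) (n d) (b d) = 0"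
    using n g_mip[OF d n(1)] ab by simp_all
  have vol: "vol_form B g q a b v = g q w v" if v: "v \<in> tangent_space B q" for v
    using G.vol3_normal[OF y n', of "v d"] nz
    unfolding gw[OF v] vol_form_eq[OF d ab v] vol_form_eq[OF d ab n(1)] r_def g_sym[OF n(1) v] g_mip[OF d v n(1)]
    by simp
  have "gcross B g q a b = w"
    unfolding gcross_def
  proof (rule the_equality)
    show "w \<in> tangent_space B q \<and> (\<forall>v\<in>tangent_space B q. g q w v = vol_form B g q a b v)"
      using w vol by simp
    fix w' assume w': "w' \<in> tangent_space B q \<and> (\<forall>v\<in>tangent_space B q. g q w' v = vol_form B g q a b v)"
    have "mip (mcomp B g d) (cmap d q) (w' d) x = mip (mcomp B g d) (cmap d q) (w d) x" for x
    proof -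
      have t: "coord_vec B d q x \<in> tangent_space B q" by (rule coord_vec_tangent[OF d])
      have "g q w' (coord_vec B d q x) = g q w (coord_vec B d q x)" using w' vol[OF t] t by simp
      then show ?thesis
        using g_mip[OF d conjunct1[OF w'] t] g_mip[OF d w t] by (simp add: coord_vec_self[OF d])
    qed
    then have "w' d = w d" by (rule G.mip_eqI[OF y])
    then show "w' = w" using tangent_eqI[OF _ w d] w' by blast
  qed
  moreover have "g q w w = r\<^sup>2"
    using gw[OF w] gw[OF n(1)] g_sym[OF n(1) w] n(2) by (simp add: power2_eq_square)
  ultimately show ?thesis by (simp add: gnorm_def r_def)
qed

end

section \<open>Maps and covariant derivatives in charts\<close>

locale smooth_mapping = S: omanifold A + T: riem_manifold B g
  for A :: "('m::{t2_space,second_countable_topology}, 'k::finite) chart set"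
    and B :: "('w::{t2_space,second_countable_topology}, 'n::finite) chart set" and g +
  fixes f :: "'m \<Rightarrow> 'w"
  assumes f: "smooth_map A B f"
begin

definition "rep c d = (\<lambda>z. cmap d (f (cinv c z)))"
definition "rdom c d = cmap c ` (f -` cdom d \<inter> cdom c)"

lemma open_vimage: "open S \<Longrightarrow> open (f -` S)"
  using f open_vimage by (auto simp: smooth_map_def)

lemma open_rdom: "c \<in> A \<Longrightarrow> d \<in> B \<Longrightarrow> open (rdom c d)"
  unfolding rdom_def by (rule S.open_image) (auto intro: open_vimage T.open_cdom)

lemma rep_smooth: "c \<in> A \<Longrightarrow> d \<in> B \<Longrightarrow> smooth_on (rdom c d) (rep c d)"
  using f by (simp add: smooth_map_def smooth_fun_on_def rdom_def rep_def o_def)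

lemma rdomI: "q \<in> cdom c \<Longrightarrow> f q \<in> cdom d \<Longrightarrow> cmap c q \<in> rdom c d"
  by (auto simp: rdom_def)

lemma rep_in: "c \<in> A \<Longrightarrow> rep c d ` rdom c d \<subseteq> cmap d ` cdom d"
  by (auto simp: rep_def rdom_def S.cinv_cmap)

lemma rep_cmap: "c \<in> A \<Longrightarrow> q \<in> cdom c \<Longrightarrow> rep c d (cmap c q) = cmap d (f q)"
  by (simp add: rep_def S.cinv_cmap)

lemma rep_diff: "c \<in> A \<Longrightarrow> d \<in> B \<Longrightarrow> q \<in> cdom c \<Longrightarrow> f q \<in> cdom d \<Longrightarrow> rep c d differentiable (at (cmap c q))"
  by (rule smooth_onD_diff[OF rep_smooth rdomI])

lemma rep_o: "(cmap d \<circ> f) \<circ> cinv c = rep c d"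
  by (simp add: rep_def o_def)

lemma dmap_eq:
  assumes "a \<in> tangent_space A q" "c \<in> A" "d \<in> B" "q \<in> cdom c" "f q \<in> cdom d"
  shows "dmap A B f q a d = dd (rep c d) (a c) (cmap c q)"
  using S.tderiv_eq[OF assms(1,2,4), of "cmap d \<circ> f"] rep_diff[OF assms(2-5)] assms
  by (simp add: dmap_def rep_o)

lemma rep_change_target:
  assumes c: "c \<in> A" "d \<in> B" "e \<in> B" and q: "q \<in> cdom c" "f q \<in> cdom d" "f q \<in> cdom e"
  shows "dd (rep c e) w (cmap c q) = dd (cmap e \<circ> cinv d) (dd (rep c d) w (cmap c q)) (cmap d (f q))"
proof -
  let ?D = "rdom c d \<inter> rdom c e"
  have D: "open ?D" "cmap c q \<in> ?D"
    using open_rdom[OF c(1,2)] open_rdom[OF c(1,3)] rdomI[OF q(1,2)] rdomI[OF q(1,3)] by auto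
  have "rep c e y = (cmap e \<circ> cinv d) (rep c d y)" if "y \<in> ?D" for y
  proof -
    obtain x where "x \<in> cdom c" "f x \<in> cdom d" "y = cmap c x" using \<open>y \<in> ?D\<close> by (auto simp: rdom_def)
    then show ?thesis using c by (simp add: rep_def S.cinv_cmap T.cinv_cmap)
  qed
  then have "dd (rep c e) w (cmap c q) = dd (\<lambda>y. (cmap e \<circ> cinv d) (rep c d y)) w (cmap c q)"
    by (rule dd_cong[OF D])
  also have "\<dots> = dd (cmap e \<circ> cinv d) (dd (rep c d) w (cmap c q)) (rep c d (cmap c q))"
    by (rule dd_compose[OF rep_diff[OF c(1,2) q(1,2)]])
      (unfold rep_cmap[OF c(1) q(1)], rule T.tr_diff[OF c(2,3) q(2,3)])
  finally show ?thesis using c q by (simp add: rep_cmap)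
qed

lemma dmap_tangent:
  assumes a: "a \<in> tangent_space A q"
  shows "dmap A B f q a \<in> tangent_space B (f q)"
proof -
  obtain c where c: "c \<in> A" "q \<in> cdom c" using S.ex_chart by blast
  show ?thesis
  proof (rule T.tangentI)
    fix d e assume de: "d \<in> B" "e \<in> B" "f q \<in> cdom d" "f q \<in> cdom e"
    show "dmap A B f q a e = dd (cmap e \<circ> cinv d) (dmap A B f q a d) (cmap d (f q))"
      unfolding dmap_eq[OF a c(1) de(1) c(2) de(3)] dmap_eq[OF a c(1) de(2) c(2) de(4)]
      by (rule rep_change_target[OF c(1) de(1,2) c(2) de(3,4)])
  qed (auto simp: dmap_def)
qed

lemma christoffel_term_eq:
  "christoffel_term B g d y v w = gam (mcomp B g d) (cmap d y) v w"
  by (simp add: christoffel_term_def gam_def christoffel_def chr_def)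

lemma vfield_smooth:
  assumes "vfield_along A B f W X" "c \<in> A" "d \<in> B"
  shows "smooth_on (cmap c ` (W \<inter> f -` cdom d \<inter> cdom c)) (\<lambda>z. X (cinv c z) d)"
    and "open (cmap c ` (W \<inter> f -` cdom d \<inter> cdom c))"
proof -
  have "smooth_fun_on A (W \<inter> f -` cdom d) (\<lambda>q. X q d)"
    using assms by (simp add: vfield_along_def)
  then show "smooth_on (cmap c ` (W \<inter> f -` cdom d \<inter> cdom c)) (\<lambda>z. X (cinv c z) d)"
    "open (cmap c ` (W \<inter> f -` cdom d \<inter> cdom c))"
    using assms(2) by (auto simp: smooth_fun_on_def o_def intro: S.open_image)
qed

lemma vfield_diff:
  assumes "vfield_along A B f W X" "c \<in> A" "d \<in> B" "q \<in> W" "q \<in> cdom c" "f q \<in> cdom d"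
  shows "(\<lambda>z. X (cinv c z) d) differentiable (at (cmap c q))"
  by (rule smooth_onD_diff[OF vfield_smooth(1)[OF assms(1-3)]]) (use assms in auto)

lemma cov_eq:
  assumes X: "vfield_along A B f W X" and q: "q \<in> W" and a: "a \<in> tangent_space A q"
    and c: "c \<in> A" "d \<in> B" "q \<in> cdom c" "f q \<in> cdom d"
  shows "cov A B g f X q a d = covd (mcomp B g d) (rep c d) (\<lambda>z. X (cinv c z) d) (a c) (cmap c q)"
proof -
  have "tderiv A q a (\<lambda>x. X x d) = dd (\<lambda>z. X (cinv c z) d) (a c) (cmap c q)"
    using S.tderiv_eq[OF a c(1,3), of "\<lambda>x. X x d"] vfield_diff[OF X c(1,2) q c(3,4)] by (simp add: o_def)
  then show ?thesis
    using c by (simp add: cov_def covd_def christoffel_term_eq dmap_eq[OF a c] rep_cmap S.cinv_cmap)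
qed

text \<open>\<open>covd_transform\<close> for the coordinate changes of the target. It makes
  \<nabla>V a vector field along \<open>f\<close> again, so that the definition can be iterated up
  to \<open>f\<^sub>\<eta>\<^sub>\<eta>\<^sub>\<eta>\<close>.\<close>

lemma cov_tangent:
  assumes X: "vfield_along A B f W X" and q: "q \<in> W" and a: "a \<in> tangent_space A q"
  shows "cov A B g f X q a \<in> tangent_space B (f q)"
proof -
  obtain c where c: "c \<in> A" "q \<in> cdom c" using S.ex_chart by blast
  have W: "open W" using X by (simp add: vfield_along_def)
  show ?thesis
  proof (rule T.tangentI)
    fix d e assume de: "d \<in> B" "e \<in> B" "f q \<in> cdom d" "f q \<in> cdom e"
    let ?t = "cmap e \<circ> cinv d" and ?z = "cmap c q"
    let ?O = "cmap c ` ((W \<inter> f -` cdom d \<inter> f -` cdom e) \<inter> cdom c)"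
    have O: "open ?O" "?z \<in> ?O"
      using c de q W by (auto intro!: S.open_image open_Int open_vimage T.open_cdom)
    have "covd (mcomp B g e) (\<lambda>z. ?t (rep c d z)) (\<lambda>z. dd ?t (X (cinv c z) d) (rep c d z)) (a c) ?z
      = dd ?t (covd (mcomp B g d) (rep c d) (\<lambda>z. X (cinv c z) d) (a c) ?z) (rep c d ?z)"
    proof (rule covd_transform[OF T.chart_metric[OF de(1)] T.chart_metric[OF de(2)] T.open_overlap[OF de(1,2)] _
          T.tr_smooth[OF de(1,2)]])
      show "cmap d ` (cdom d \<inter> cdom e) \<subseteq> cmap d ` cdom d" by auto
      show "?t ` (cmap d ` (cdom d \<inter> cdom e)) \<subseteq> cmap e ` cdom e" using de by (auto simp: T.cinv_cmap)
      show "surj (\<lambda>v. dd ?t v (rep c d ?z))" unfolding rep_cmap[OF c] by (rule T.tr_surj[OF de])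
      show "rep c d ?z \<in> cmap d ` (cdom d \<inter> cdom e)" using c de by (simp add: rep_cmap)
      show "rep c d differentiable (at ?z)" by (rule rep_diff[OF c(1) de(1) c(2) de(3)])
      show "(\<lambda>z. X (cinv c z) d) differentiable (at ?z)" by (rule vfield_diff[OF X c(1) de(1) q c(2) de(3)])
    qed (rule T.tr_isometry[OF de(1,2)])
    moreover have "covd (mcomp B g e) (\<lambda>z. ?t (rep c d z)) (\<lambda>z. dd ?t (X (cinv c z) d) (rep c d z)) (a c) ?z
      = covd (mcomp B g e) (rep c e) (\<lambda>z. X (cinv c z) e) (a c) ?z"
    proof (rule covd_cong[OF O])
      fix y assume "y \<in> ?O"
      then obtain x where x: "x \<in> W" "f x \<in> cdom d" "f x \<in> cdom e" "x \<in> cdom c" "y = cmap c x" by auto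
      show "?t (rep c d y) = rep c e y" using c de x by (simp add: rep_cmap T.cinv_cmap)
      have "X x \<in> tangent_space B (f x)" using X x by (simp add: vfield_along_def)
      from T.tangent_change[OF this de(1,2) x(2,3)]
      show "dd ?t (X (cinv c y) d) (rep c d y) = X (cinv c y) e"
        using c x by (simp add: rep_cmap S.cinv_cmap)
    qed
    ultimately show "cov A B g f X q a e = dd ?t (cov A B g f X q a d) (cmap d (f q))"
      unfolding cov_eq[OF X q a c(1) de(1) c(2) de(3)] cov_eq[OF X q a c(1) de(2) c(2) de(4)]
      using c by (simp add: rep_cmap)
  qed (auto simp: cov_def)
qed

lemma vfield_alongI:
  assumes "open W" "\<And>q. q \<in> W \<Longrightarrow> X q \<in> tangent_space B (f q)"
    and "\<And>c d. c \<in> A \<Longrightarrow> d \<in> B \<Longrightarrow> smooth_on (cmap c ` (W \<inter> f -` cdom d \<inter> cdom c)) (\<lambda>z. X (cinv c z) d)"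
  shows "vfield_along A B f W X"
  using assms open_vimage T.open_cdom by (auto simp: vfield_along_def smooth_fun_on_def o_def)

lemma tangent_field_smooth:
  assumes "vfield_along A A id W \<eta>" "c \<in> A"
  shows "smooth_on (cmap c ` (W \<inter> cdom c)) (\<lambda>z. \<eta> (cinv c z) c)"
proof -
  have "smooth_fun_on A (W \<inter> id -` cdom c) (\<lambda>q. \<eta> q c)"
    using assms unfolding vfield_along_def by blast
  then have "smooth_on (cmap c ` (W \<inter> id -` cdom c \<inter> cdom c)) ((\<lambda>q. \<eta> q c) \<circ> cinv c)"
    using assms(2) unfolding smooth_fun_on_def by blast
  moreover have "W \<inter> id -` cdom c \<inter> cdom c = W \<inter> cdom c" by auto
  ultimately show ?thesis by (simp add: o_def)
qed

lemma vfield_dmap: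
  assumes \<eta>: "vfield_along A A id W \<eta>"
  shows "vfield_along A B f W (\<lambda>q. dmap A B f q (\<eta> q))"
proof (rule vfield_alongI)
  show W: "open W" using \<eta> by (simp add: vfield_along_def)
  have t: "\<eta> q \<in> tangent_space A q" if "q \<in> W" for q using \<eta> that by (simp add: vfield_along_def)
  then show "dmap A B f q (\<eta> q) \<in> tangent_space B (f q)" if "q \<in> W" for q using that by (simp add: dmap_tangent)
  fix c d assume cd: "c \<in> A" "d \<in> B"
  let ?O = "cmap c ` (W \<inter> f -` cdom d \<inter> cdom c)"
  have O: "open ?O" using cd W by (auto intro!: S.open_image open_Int open_vimage T.open_cdom)
  have "smooth_on ?O (\<lambda>z. dd (rep c d) (\<eta> (cinv c z) c) z)"
    by (rule smooth_on_dd_field[OF O smooth_on_subset[OF rep_smooth[OF cd]]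
          smooth_on_subset[OF tangent_field_smooth[OF \<eta> cd(1)]]]) (auto simp: rdom_def)
  then show "smooth_on ?O (\<lambda>z. dmap A B f (cinv c z) (\<eta> (cinv c z)) d)"
    by (rule smooth_on_cong_imp[OF _ O]) (use cd t in \<open>auto simp: S.cinv_cmap dmap_eq\<close>)
qed

lemma vfield_cov:
  assumes X: "vfield_along A B f W X" and \<eta>: "vfield_along A A id W \<eta>"
  shows "vfield_along A B f W (\<lambda>q. cov A B g f X q (\<eta> q))"
proof (rule vfield_alongI)
  show W: "open W" using \<eta> by (simp add: vfield_along_def)
  have t: "\<eta> q \<in> tangent_space A q" if "q \<in> W" for q using \<eta> that by (simp add: vfield_along_def)
  then show "cov A B g f X q (\<eta> q) \<in> tangent_space B (f q)" if "q \<in> W" for q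
    using cov_tangent[OF X that] that by simp
  fix c d assume cd: "c \<in> A" "d \<in> B"
  interpret G: coord_metric "cmap d ` cdom d" "mcomp B g d" by (rule T.chart_metric[OF cd(2)])
  let ?O = "cmap c ` (W \<inter> f -` cdom d \<inter> cdom c)"
  have O: "open ?O" using cd W by (auto intro!: S.open_image open_Int open_vimage T.open_cdom)
  have sub: "?O \<subseteq> rdom c d" by (auto simp: rdom_def)
  have "smooth_on ?O (\<lambda>z. covd (mcomp B g d) (rep c d) (\<lambda>z. X (cinv c z) d) (\<eta> (cinv c z) c) z)"
    by (rule G.smooth_on_covd[OF O smooth_on_subset[OF rep_smooth[OF cd] sub] _ vfield_smooth(1)[OF X cd]
          smooth_on_subset[OF tangent_field_smooth[OF \<eta> cd(1)]]]) (rule subset_trans[OF image_mono[OF sub] rep_in[OF cd(1)]], blast)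
  then show "smooth_on ?O (\<lambda>z. cov A B g f X (cinv c z) (\<eta> (cinv c z)) d)"
  proof (rule smooth_on_cong_imp[OF _ O])
    fix z assume "z \<in> ?O"
    then obtain q where q: "q \<in> W" "f q \<in> cdom d" "q \<in> cdom c" "z = cmap c q" by auto
    show "cov A B g f X (cinv c z) (\<eta> (cinv c z)) d
      = covd (mcomp B g d) (rep c d) (\<lambda>z. X (cinv c z) d) (\<eta> (cinv c z) c) z"
      using cov_eq[OF X q(1) t[OF q(1)] cd q(3,2)] cd q by (simp add: S.cinv_cmap)
  qed
qed

end

lemma Ck_on_sqrt: "Ck_on k {0<..} sqrt"
proof (induction k)
  case 0
  then show ?case by (auto intro!: continuous_intros)
next
  case (Suc k)
  have hd: "(sqrt has_derivative (\<lambda>h. h * (inverse (sqrt x) / 2))) (at x)" if "x \<in> {0<..}" for x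
  proof -
    have "(*) (inverse (sqrt x) / 2) = (\<lambda>h. h * (inverse (sqrt x) / 2))" by (rule ext) (rule mult.commute)
    then show ?thesis using DERIV_real_sqrt[of x] that unfolding has_field_derivative_def by simp
  qed
  have inv: "Ck_on k {0<..} (\<lambda>x. inverse (sqrt x))"
    by (rule Ck_on_compose[OF _ _ Suc Ck_on_inverse]) auto
  have sm: "Ck_on k {0<..} (\<lambda>x. (v / 2) * inverse (sqrt x))" for v
    by (intro Ck_on_bilinear[OF bounded_bilinear_mult] Ck_on_const inv open_greaterThan)
  have "Ck_on k {0<..} (dd sqrt v)" for v
    by (rule Ck_on_cong_imp[OF sm[of v]]) (auto simp: dd_eqI[OF hd])
  moreover have "sqrt differentiable (at x)" if "x \<in> {0<..}" for x
    using hd[OF that] differentiable_def by blast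
  ultimately show ?case by simp
qed

lemma smooth_on_sqrt:
  assumes "open S" "smooth_on S f" "\<And>x. x \<in> S \<Longrightarrow> 0 < f x"
  shows "smooth_on S (\<lambda>x. sqrt (f x))"
  by (rule smooth_on_compose[of "{0<..}"]) (use assms Ck_on_sqrt in \<open>auto simp: smooth_on_def\<close>)

lemma (in coord_metric3) smooth_on_vol3:
  fixes F X Y Z :: "'a::euclidean_space \<Rightarrow> real^3"
  assumes U: "open U" and F: "smooth_on U F" "F ` U \<subseteq> V"
    and "smooth_on U X" "smooth_on U Y" "smooth_on U Z"
  shows "smooth_on U (\<lambda>z. vol3 G (F z) (X z) (Y z) (Z z))"
proof -
  have "smooth_on U (\<lambda>z. sqrt (det (G (F z))))"
  proof (rule smooth_on_sqrt[OF U])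
    show "smooth_on U (\<lambda>z. det (G (F z)))"
      by (rule smooth_on_det[OF U smooth_on_compose[OF smooth_G U F(2,1)]])
    show "0 < det (G (F z))" if "z \<in> U" for z using det_G_pos F(2) that by blast
  qed
  moreover have "smooth_on U (\<lambda>z. det (vector [X z, Y z, Z z] :: real^3^3))"
    unfolding det_3 vector_3
    by (intro smooth_on_mult smooth_on_add smooth_on_diff smooth_on_vec_nth U assms(4-))
  ultimately show ?thesis unfolding vol3_def by (rule smooth_on_mult[OF U])
qed

section \<open>New charts in a maximal oriented atlas\<close>

context omanifold
begin

text \<open>\<open>\<psi>\<close> leads from the new coordinates to the old ones, so the new
  coordinate map is \<open>h\<close> after \<open>cmap c\<close>. Membership in \<open>A\<close>
  rests on maximality: the transitions to and from any \<open>d\<close> factor through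
  \<open>c\<close>, and the Jacobian of \<open>h\<close> is positive because it is reciprocal to
  that of \<open>\<psi>\<close>.\<close>

lemma new_chart:
  assumes c: "c \<in> A" and UV: "open U" "open V" "homeomorphism U V \<psi> h" "V \<subseteq> cmap c ` cdom c"
    and sm: "smooth_on U \<psi>" "smooth_on V h"
    and pos: "\<And>z. z \<in> U \<Longrightarrow> 0 < det (matrix (\<lambda>w. dd \<psi> w z))"
  defines "c' \<equiv> (cinv c ` V, \<lambda>q. h (cmap c q))"
  shows "c' \<in> A" and "cmap c' ` cdom c' = U" and "\<And>z. z \<in> U \<Longrightarrow> cinv c' z = cinv c (\<psi> z)"
proof -
  have [simp]: "cdom c' = cinv c ` V" "cmap c' = (\<lambda>q. h (cmap c q))" unfolding c'_def by (rule fst_conv, rule snd_conv)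
  have h\<psi>: "h (\<psi> z) = z" "\<psi> z \<in> V" if "z \<in> U" for z
    using homeomorphism_apply1[OF UV(3) that] homeomorphism_image1[OF UV(3)] that by auto
  have \<psi>h: "\<psi> (h y) = y" "h y \<in> U" if "y \<in> V" for y
    using homeomorphism_apply2[OF UV(3) that] homeomorphism_image2[OF UV(3)] that by auto
  have Vc: "cmap c (cinv c y) = y" "cinv c y \<in> cdom c" if "y \<in> V" for y
    using cmap_cinv[OF c subsetD[OF UV(4) that]] cinv_in[OF subsetD[OF UV(4) that]] by auto
  have dom_eq: "cinv c ` V = cdom c \<inter> cmap c -` V"
  proof (intro equalityI subsetI)
    fix q assume "q \<in> cdom c \<inter> cmap c -` V"
    then have "q = cinv c (cmap c q)" "cmap c q \<in> V" using cinv_cmap[OF c, of q] by auto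
    then show "q \<in> cinv c ` V" by blast
  qed (use Vc in auto)
  have odom: "open (cdom c')"
    unfolding \<open>cdom c' = cinv c ` V\<close> dom_eq
    by (rule continuous_open_preimage[OF continuous_on_cmap[OF c] open_cdom[OF c] UV(2)])
  have img: "cmap c' ` cdom c' = U"
  proof (intro equalityI subsetI)
    fix z assume z: "z \<in> U"
    then have "z = h (cmap c (cinv c (\<psi> z)))" using Vc(1)[OF h\<psi>(2)[OF z]] h\<psi>(1)[OF z] by simp
    then show "z \<in> cmap c' ` cdom c'" using h\<psi>(2)[OF z] by auto
  qed (use Vc \<psi>h in auto)
  have inj: "inj_on (cmap c') (cdom c')"
  proof (rule inj_onI)
    fix q q' assume "q \<in> cdom c'" "q' \<in> cdom c'" and e: "cmap c' q = cmap c' q'"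
    then obtain y y' where y: "y \<in> V" "y' \<in> V" "q = cinv c y" "q' = cinv c y'" by auto
    then have "h y = h y'" using e Vc by simp
    then have "y = y'" using \<psi>h(1) y by metis
    then show "q = q'" using y by simp
  qed
  have cinv': "cinv c' z = cinv c (\<psi> z)" if z: "z \<in> U" for z
  proof (rule inv_into_f_eq[OF inj])
    show "cinv c (\<psi> z) \<in> cdom c'" using h\<psi>(2)[OF z] by simp
    show "cmap c' (cinv c (\<psi> z)) = z" using Vc(1)[OF h\<psi>(2)[OF z]] h\<psi>(1)[OF z] by simp
  qed
  have cont\<psi>: "continuous_on U \<psi>" "continuous_on V h" using UV(3) unfolding homeomorphism_def by blast+
  have is_chart': "is_chart c'"
    unfolding is_chart_def
  proof (intro conjI odom)
    show "open (cmap c' ` cdom c')" unfolding img by (rule UV(1))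
    have "continuous_on (cdom c') (cmap c')"
    proof -
      have "continuous_on (cinv c ` V) (cmap c)"
        by (rule continuous_on_subset[OF continuous_on_cmap[OF c]]) (use Vc in auto)
      then show ?thesis
        by (simp, intro continuous_on_compose2[OF cont\<psi>(2)]) (use Vc in auto)
    qed
    moreover have "continuous_on U (cinv c')"
    proof -
      have "continuous_on U (\<lambda>z. cinv c (\<psi> z))"
        by (rule continuous_on_compose2[OF continuous_on_cinv[OF c] cont\<psi>(1)]) (use h\<psi> UV(4) in auto)
      then show ?thesis by (rule continuous_on_eq) (rule cinv'[symmetric])
    qed
    ultimately show "homeomorphism (cdom c') (cmap c' ` cdom c') (cmap c') (cinv c')"
      unfolding homeomorphism_def using img
        inv_into_image_cancel[OF inj subset_refl] inv_into_f_f[OF inj] f_inv_into_f[of _ "cmap c'" "cdom c'"]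
      by metis
  qed
  have "c' \<in> A"
  proof (rule atlas_maximal[OF is_chart'])
    fix d assume d: "d \<in> A"
    let ?D = "cmap c' ` (cdom c' \<inter> cdom d)" and ?E = "cmap c ` (cdom c \<inter> cdom d)"
    have D_eq: "?D = U \<inter> \<psi> -` ?E"
    proof (intro equalityI subsetI)
      fix z assume "z \<in> ?D"
      then obtain y where y: "y \<in> V" "cinv c y \<in> cdom d" "z = h (cmap c (cinv c y))" by auto
      have "z \<in> U" "\<psi> z = cmap c (cinv c y)" using y Vc(1) \<psi>h by auto
      then show "z \<in> U \<inter> \<psi> -` ?E" using y Vc(2) by auto
    next
      fix z assume "z \<in> U \<inter> \<psi> -` ?E"
      then obtain q where q: "z \<in> U" "q \<in> cdom c" "q \<in> cdom d" "\<psi> z = cmap c q" by auto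
      have "q = cinv c (\<psi> z)" using cinv_cmap[OF c q(2)] q(4) by simp
      moreover have "\<psi> z \<in> V" by (rule h\<psi>(2)[OF q(1)])
      ultimately have "q \<in> cdom c' \<inter> cdom d" "z = cmap c' q" using q h\<psi>(1)[OF q(1)] by auto
      then show "z \<in> ?D" by blast
    qed
    have D: "open ?D"
      unfolding D_eq by (rule continuous_open_preimage[OF cont\<psi>(1) UV(1) open_overlap[OF c d]])
    have DU: "?D \<subseteq> U" "\<psi> ` ?D \<subseteq> ?E" unfolding D_eq by auto
    have t: "(cmap d \<circ> cinv c') z = (cmap d \<circ> cinv c) (\<psi> z)" if "z \<in> ?D" for z
    proof -
      have "z \<in> U" using DU(1) that by blast
      then show ?thesis by (simp only: o_apply cinv')
    qed
    have s1: "smooth_on ?D (\<lambda>z. (cmap d \<circ> cinv c) (\<psi> z))"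
      by (rule smooth_on_compose[OF tr_smooth[OF c d] D DU(2) smooth_on_subset[OF sm(1) DU(1)]])
    have "0 < det (matrix (dd' (cmap d \<circ> cinv c') z))" if z: "z \<in> ?D" and dd': "dd' = (\<lambda>F z w. dd F w z)" for z dd'
    proof -
      obtain q where q: "q \<in> cdom c" "q \<in> cdom d" "\<psi> z = cmap c q" using DU(2) z by blast
      have zU: "z \<in> U" using DU z by blast
      have pd: "\<psi> differentiable (at z)" by (rule smooth_onD_diff[OF sm(1) zU])
      have td: "(cmap d \<circ> cinv c) differentiable (at (\<psi> z))" unfolding q(3) by (rule tr_diff[OF c d q(1,2)])
      have "dd (cmap d \<circ> cinv c') w z = dd (cmap d \<circ> cinv c) (dd \<psi> w z) (\<psi> z)" for w
        by (rule trans[OF dd_cong[OF D z t] dd_compose[OF pd td]])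
      then have "matrix (\<lambda>w. dd (cmap d \<circ> cinv c') w z) =
          matrix ((\<lambda>w. dd (cmap d \<circ> cinv c) w (\<psi> z)) \<circ> (\<lambda>w. dd \<psi> w z))"
        by (simp add: o_def)
      also have "\<dots> = matrix (\<lambda>w. dd (cmap d \<circ> cinv c) w (\<psi> z)) ** matrix (\<lambda>w. dd \<psi> w z)"
        by (rule matrix_compose) (use linear_dd[OF pd] linear_dd[OF td] in auto)
      finally show ?thesis
        using pos[OF zU] tr_det[OF c d q(1,2)] unfolding dd' by (simp add: det_mul q(3))
    qed
    then show "pos_transition c' d"
      unfolding pos_transition_def Let_def using smooth_on_cong_imp[OF s1 D t] by blast
    let ?D' = "cmap d ` (cdom d \<inter> cdom c')" and ?E' = "cmap d ` (cdom d \<inter> cdom c)"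
    have D': "open ?D'" using open_image[OF d odom] by (simp only: Int_commute)
    have sub: "?D' \<subseteq> ?E'" using Vc by auto
    have inV: "(cmap c \<circ> cinv d) ` ?D' \<subseteq> V"
    proof
      fix y assume "y \<in> (cmap c \<circ> cinv d) ` ?D'"
      then obtain q where q: "q \<in> cdom d" "q \<in> cdom c'" "y = cmap c (cinv d (cmap d q))" by auto
      then have "y = cmap c q" using cinv_cmap[OF d] by simp
      then show "y \<in> V" using q(2) dom_eq by auto
    qed
    have s2: "smooth_on ?D' (\<lambda>z. h ((cmap c \<circ> cinv d) z))"
      by (rule smooth_on_compose[OF sm(2) D' inV smooth_on_subset[OF tr_smooth[OF d c] sub]])
    then have s3: "smooth_on ?D' (cmap c' \<circ> cinv d)" by (simp add: o_def)
    have "0 < det (matrix (\<lambda>w. dd (cmap c' \<circ> cinv d) w z))" if z: "z \<in> ?D'" for z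
    proof -
      obtain q where q: "q \<in> cdom d" "q \<in> cdom c" "z = cmap d q" using sub z by blast
      let ?y = "(cmap c \<circ> cinv d) z"
      have yV: "?y \<in> V" using inV z by blast
      have hd: "h differentiable (at ?y)" by (rule smooth_onD_diff[OF sm(2) yV])
      have td: "(cmap c \<circ> cinv d) differentiable (at z)" unfolding q(3) by (rule tr_diff[OF d c q(1,2)])
      have pd: "\<psi> differentiable (at (h ?y))" by (rule smooth_onD_diff[OF sm(1) \<psi>h(2)[OF yV]])
      have "dd (cmap c' \<circ> cinv d) w z = dd h (dd (cmap c \<circ> cinv d) w z) ?y" for w
        using dd_compose[OF td hd, of w] by (simp add: o_def)
      then have "matrix (\<lambda>w. dd (cmap c' \<circ> cinv d) w z) =
          matrix ((\<lambda>w. dd h w ?y) \<circ> (\<lambda>w. dd (cmap c \<circ> cinv d) w z))" by (simp only: o_def)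
      also have "\<dots> = matrix (\<lambda>w. dd h w ?y) ** matrix (\<lambda>w. dd (cmap c \<circ> cinv d) w z)"
        by (rule matrix_compose[OF linear_dd[OF td] linear_dd[OF hd]])
      finally have 1: "det (matrix (\<lambda>w. dd (cmap c' \<circ> cinv d) w z)) =
         det (matrix (\<lambda>w. dd h w ?y)) * det (matrix (\<lambda>w. dd (cmap c \<circ> cinv d) w z))" by (simp only: det_mul)
      have "dd (\<lambda>y. \<psi> (h y)) w ?y = dd (\<lambda>y. y) w ?y" for w
        by (rule dd_cong[OF UV(2) yV]) (rule \<psi>h)
      then have "dd \<psi> (dd h w ?y) (h ?y) = w" for w using dd_compose[OF hd pd, of w] by simp
      then have "matrix ((\<lambda>w. dd \<psi> w (h ?y)) \<circ> (\<lambda>w. dd h w ?y)) = mat 1"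
        by (simp add: o_def matrix_id_mat_1[unfolded id_def])
      then have "matrix (\<lambda>w. dd \<psi> w (h ?y)) ** matrix (\<lambda>w. dd h w ?y) = mat 1"
        by (simp only: matrix_compose[OF linear_dd[OF hd] linear_dd[OF pd]])
      then have "det (matrix (\<lambda>w. dd \<psi> w (h ?y))) * det (matrix (\<lambda>w. dd h w ?y)) = 1"
        by (metis det_I det_mul)
      then have "0 < det (matrix (\<lambda>w. dd h w ?y))"
        using pos[OF \<psi>h(2)[OF yV]] by (metis zero_less_mult_pos zero_less_one)
      then show ?thesis unfolding 1 using tr_det[OF d c q(1,2)] q(3) by simp
    qed
    then show "pos_transition d c'"
      unfolding pos_transition_def Let_def using s3 by blast
  qed
  then show "c' \<in> A" "cmap c' ` cdom c' = U" "\<And>z. z \<in> U \<Longrightarrow> cinv c' z = cinv c (\<psi> z)"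
    using img cinv' by blast+
qed

end

section \<open>Frontals and their Gaussian curvature in charts\<close>

locale frontal_map = smooth_mapping A B g f + T: riem_manifold3 B g
  for A :: "('m::{t2_space,second_countable_topology}, 2) chart set"
    and B :: "('w::{t2_space,second_countable_topology}, 3) chart set" and g f +
  assumes frontal: "frontal A B g f"
begin

text \<open>\<open>unit_normal_near\<close> with its domain made explicit, so that it can be
  intersected with chart domains.\<close>

definition "normal_on W \<nu> \<longleftrightarrow> vfield_along A B f W \<nu> \<and>
     (\<forall>q\<in>W. g (f q) (\<nu> q) (\<nu> q) = 1 \<and> (\<forall>a\<in>tangent_space A q. g (f q) (\<nu> q) (dmap A B f q a) = 0))"

definition "ndom W c d = cmap c ` (W \<inter> f -` cdom d \<inter> cdom c)"

lemma unit_normal_nearE: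
  assumes "unit_normal_near A B g f p \<nu>"
  obtains W where "p \<in> W" "open W" "normal_on W \<nu>"
  using assms unfolding unit_normal_near_def normal_on_def vfield_along_def by blast

lemma ndom_rdom: "ndom W c d \<subseteq> rdom c d"
  by (auto simp: ndom_def rdom_def)

lemma open_ndom: "open W \<Longrightarrow> c \<in> A \<Longrightarrow> d \<in> B \<Longrightarrow> open (ndom W c d)"
  unfolding ndom_def by (intro S.open_image open_Int open_vimage T.open_cdom)

lemma normal_tangent: "normal_on W \<nu> \<Longrightarrow> q \<in> W \<Longrightarrow> \<nu> q \<in> tangent_space B (f q)"
  unfolding normal_on_def vfield_along_def by blast

lemma coord_surface_rep:
  assumes c: "c \<in> A" "d \<in> B" and S: "open S" "S \<subseteq> rdom c d"
  shows "coord_surface (cmap d ` cdom d) (mcomp B g d) S (rep c d)"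
proof -
  interpret G: coord_metric3 "cmap d ` cdom d" "mcomp B g d" by (rule T.chart_metric3[OF c(2)])
  show ?thesis
    by unfold_locales
      (use S smooth_on_subset[OF rep_smooth[OF c] S(2)] subset_trans[OF image_mono[OF S(2)] rep_in[OF c(1)]] in auto)
qed

lemma coord_frontal_rep:
  assumes n: "normal_on W \<nu>" "open W" and c: "c \<in> A" "d \<in> B"
  shows "coord_frontal (cmap d ` cdom d) (mcomp B g d) (ndom W c d) (rep c d) (\<lambda>z. \<nu> (cinv c z) d)"
proof -
  interpret C: coord_surface "cmap d ` cdom d" "mcomp B g d" "ndom W c d" "rep c d"
    by (rule coord_surface_rep[OF c open_ndom[OF n(2) c] ndom_rdom])
  have v: "vfield_along A B f W \<nu>" using n unfolding normal_on_def by blast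
  show ?thesis
  proof
    show "smooth_on (ndom W c d) (\<lambda>z. \<nu> (cinv c z) d)"
      unfolding ndom_def by (rule vfield_smooth(1)[OF v c])
    fix z assume "z \<in> ndom W c d"
    then obtain q where q: "q \<in> W" "q \<in> cdom c" "f q \<in> cdom d" "z = cmap c q" by (auto simp: ndom_def)
    have t: "\<nu> q \<in> tangent_space B (f q)" by (rule normal_tangent[OF n(1) q(1)])
    have "g (f q) (\<nu> q) (\<nu> q) = 1" using n q(1) unfolding normal_on_def by blast
    then show "mip (mcomp B g d) (rep c d z) (\<nu> (cinv c z) d) (\<nu> (cinv c z) d) = 1"
      using T.g_mip[OF c(2) q(3) t t] c q by (simp add: rep_cmap S.cinv_cmap)
    fix a :: "real^2"
    have ta: "coord_vec A c q a \<in> tangent_space A q" by (rule S.coord_vec_tangent[OF c(1) q(2)])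
    then have "g (f q) (\<nu> q) (dmap A B f q (coord_vec A c q a)) = 0" using n q(1) unfolding normal_on_def by blast
    then show "mip (mcomp B g d) (rep c d z) (\<nu> (cinv c z) d) (dd (rep c d) a z) = 0"
      using T.g_mip[OF c(2) q(3) t dmap_tangent[OF ta]] dmap_eq[OF ta c q(2,3)] c q
      by (simp add: rep_cmap S.cinv_cmap S.coord_vec_self)
  qed
qed

lemma mcomp_first_form:
  assumes c: "c \<in> A" "d \<in> B" and z: "z \<in> rdom c d"
  shows "mcomp A (first_form A B g f) c z = pb (mcomp B g d) (rep c d) z"
proof -
  obtain q where q: "q \<in> cdom c" "f q \<in> cdom d" "z = cmap c q" using z by (auto simp: rdom_def)
  have t: "cfield A c i q \<in> tangent_space A q" for i by (rule S.cfield_tangent[OF c(1) q(1)])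
  have "mcomp A (first_form A B g f) c z $ i $ j = pb (mcomp B g d) (rep c d) z $ i $ j" for i j
    using T.g_mip[OF c(2) q(2) dmap_tangent[OF t, of i] dmap_tangent[OF t, of j]]
      dmap_eq[OF t c q(1,2)] c q
    by (simp add: mcomp_def pb_def first_form_def S.cinv_cmap rep_cmap S.cfield_self)
  then show ?thesis by (simp add: vec_eq_iff)
qed

text \<open>The Gram matrix and the differential have the same kernel, since the ambient metric is
  definite.\<close>

lemma regular_iff:
  assumes c: "c \<in> A" "d \<in> B" and q: "q \<in> cdom c" "f q \<in> cdom d"
  shows "q \<in> regular_points A B f \<longleftrightarrow> det (pb (mcomp B g d) (rep c d) (cmap c q)) \<noteq> 0"
proof -
  interpret C: coord_surface "cmap d ` cdom d" "mcomp B g d" "rdom c d" "rep c d"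
    by (rule coord_surface_rep[OF c open_rdom[OF c]]) simp
  let ?z = "cmap c q" and ?M = "pb (mcomp B g d) (rep c d) (cmap c q)"
  have z: "?z \<in> rdom c d" by (rule rdomI[OF q])
  have "singular_point A B f q \<longleftrightarrow> (\<exists>w. w \<noteq> 0 \<and> dd (rep c d) w ?z = 0)"
  proof
    assume "singular_point A B f q"
    then obtain a where a: "a \<in> tangent_space A q" "a \<noteq> (\<lambda>_. 0)" "dmap A B f q a = (\<lambda>_. 0)"
      unfolding singular_point_def by blast
    have "a c \<noteq> 0" using S.tangent_eqI[OF a(1) S.zero_tangent c(1) q(1)] a(2) by blast
    moreover have "dd (rep c d) (a c) ?z = 0" using dmap_eq[OF a(1) c q] a(3) by simp
    ultimately show "\<exists>w. w \<noteq> 0 \<and> dd (rep c d) w ?z = 0" by blast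
  next
    assume "\<exists>w. w \<noteq> 0 \<and> dd (rep c d) w ?z = 0"
    then obtain w where w: "w \<noteq> 0" "dd (rep c d) w ?z = 0" by blast
    let ?a = "coord_vec A c q w"
    have a: "?a \<in> tangent_space A q" "?a c = w"
      by (rule S.coord_vec_tangent[OF c(1) q(1)], rule S.coord_vec_self[OF c(1) q(1)])
    have "dmap A B f q ?a d = 0" using dmap_eq[OF a(1) c q] a(2) w(2) by simp
    then have "dmap A B f q ?a = (\<lambda>_. 0)"
      using T.tangent_eqI[OF dmap_tangent[OF a(1)] T.zero_tangent c(2) q(2)] by blast
    moreover have "?a \<noteq> (\<lambda>_. 0)" using a(2) w(1) by (metis (no_types))
    ultimately show "singular_point A B f q" unfolding singular_point_def using a(1) by blast
  qed
  also have "\<dots> \<longleftrightarrow> det ?M = 0"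
  proof
    assume "\<exists>w. w \<noteq> 0 \<and> dd (rep c d) w ?z = 0"
    then obtain w where w: "w \<noteq> 0" "dd (rep c d) w ?z = 0" by blast
    show "det ?M = 0"
    proof (rule ccontr)
      assume "det ?M \<noteq> 0"
      then have "0 < mip (pb (mcomp B g d) (rep c d)) ?z w w"
        using coord_metric.pos_G[OF C.pb_coord_metric _ w(1), of ?z] z by simp
      then show False using mip_pb[OF C.F_diff[OF z], of "mcomp B g d" w w] w(2) by simp
    qed
  next
    assume "det ?M = 0"
    then have "\<not> inj ((*v) ?M)"
      using matrix_left_invertible_injective[of ?M] invertible_left_inverse[of ?M] invertible_det_nz[of ?M] by blast
    then obtain b b' where "b \<noteq> b'" "?M *v b = ?M *v b'" unfolding inj_def by blast
    then have w: "b - b' \<noteq> 0" "?M *v (b - b') = 0" by (simp_all add: matrix_vector_mult_diff_distrib)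
    then have "mip (mcomp B g d) (rep c d ?z) (dd (rep c d) (b - b') ?z) (dd (rep c d) (b - b') ?z) = 0"
      using mip_pb[OF C.F_diff[OF z], of "mcomp B g d" "b - b'" "b - b'"]
      by (simp add: mip_def[of "pb (mcomp B g d) (rep c d)"])
    then have "dd (rep c d) (b - b') ?z = 0" using C.pos_G[OF C.F_V[OF z]] by fastforce
    then show "\<exists>w. w \<noteq> 0 \<and> dd (rep c d) w ?z = 0" using w(1) by blast
  qed
  finally show ?thesis by (simp add: regular_points_def)
qed

lemma curv_comp_eq: "curv_comp A h c z l = curvc (mcomp A h c) z l"
proof -
  have e: "christoffel A h c k i j = chr (mcomp A h c) k i j" for k i j
    by (rule ext) (simp add: christoffel_def chr_def)
  show ?thesis by (simp add: curv_comp_def curvc_def e)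
qed

text \<open>At a regular point \<open>kform_reparametrize\<close> makes the coordinate expression
  independent of the source chart, so the definite description in \<open>gauss_curvature\<close> has
  exactly this value.\<close>

lemma frontal_curvature_eq:
  assumes c: "c \<in> A" "d \<in> B" and q: "q \<in> cdom c" "f q \<in> cdom d" and reg: "q \<in> regular_points A B f"
  shows "frontal_curvature A B g f q = kform (pb (mcomp B g d) (rep c d)) (cmap c q)"
proof -
  let ?h = "first_form A B g f" and ?G = "mcomp B g d"
  obtain \<nu> W where W: "q \<in> W" "open W" "normal_on W \<nu>"
    using frontal unit_normal_nearE unfolding frontal_def by metis
  have k: "kform (mcomp A ?h c') (cmap c' q) = kform (pb ?G (rep c' d)) (cmap c' q)" if "c' \<in> A" "q \<in> cdom c'" for c'
    by (rule kform_cong[OF open_rdom[OF that(1) c(2)] rdomI[OF that(2) q(2)] mcomp_first_form[OF that(1) c(2)]])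
  have inv: "kform (pb ?G (rep c' d)) (cmap c' q) = kform (pb ?G (rep c d)) (cmap c q)" if c': "c' \<in> A" "q \<in> cdom c'" for c'
  proof -
    let ?t = "cmap c \<circ> cinv c'"
    let ?O = "cmap c' ` ((W \<inter> f -` cdom d \<inter> cdom c) \<inter> cdom c')"
    have O: "open ?O"
      by (intro S.open_image[OF c'(1)] open_Int W open_vimage T.open_cdom c S.open_cdom)
    have z: "cmap c' q \<in> ?O" using W q c' by blast
    have tz: "?t (cmap c' q) = cmap c q" using S.cinv_cmap[OF c'] by simp
    have "kform (pb ?G (\<lambda>z. rep c d (?t z))) (cmap c' q) = kform (pb ?G (rep c d)) (?t (cmap c' q))"
    proof (rule kform_reparametrize(1)[OF coord_frontal_rep[OF W(3,2) c] O _ _ z])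
      show "smooth_on ?O ?t" by (rule smooth_on_subset[OF S.tr_smooth[OF c'(1) c(1)]]) auto
      show "?t ` ?O \<subseteq> ndom W c d"
      proof
        fix y assume "y \<in> ?t ` ?O"
        then obtain x where x: "x \<in> W" "f x \<in> cdom d" "x \<in> cdom c" "x \<in> cdom c'" "y = ?t (cmap c' x)" by blast
        then have "y = cmap c x" using S.cinv_cmap[OF c'(1) x(4)] by simp
        then show "y \<in> ndom W c d" using x by (auto simp: ndom_def)
      qed
      show "det (matrix (\<lambda>v. dd ?t v (cmap c' q))) \<noteq> 0"
        using S.tr_det[OF c'(1) c(1) c'(2) q(1)] by simp
      show "det (pb ?G (rep c d) (?t (cmap c' q))) \<noteq> 0"
        unfolding tz using regular_iff[OF c q] reg by simp
    qed
    moreover have "kform (pb ?G (rep c' d)) (cmap c' q) = kform (pb ?G (\<lambda>z. rep c d (?t z))) (cmap c' q)"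
    proof (rule kform_cong[OF O z])
      fix y assume y: "y \<in> ?O"
      have e: "rep c' d x = rep c d (?t x)" if x: "x \<in> ?O" for x
      proof -
        obtain x' where x': "x' \<in> cdom c" "x' \<in> cdom c'" "x = cmap c' x'" using x by blast
        then show ?thesis using S.cinv_cmap[OF c'(1) x'(2)] S.cinv_cmap[OF c(1) x'(1)] by (simp add: rep_def)
      qed
      show "pb ?G (rep c' d) y = pb ?G (\<lambda>z. rep c d (?t z)) y"
        unfolding pb_def using dd_cong[OF O y e] e[OF y] by simp
    qed
    ultimately show ?thesis unfolding tz by simp
  qed
  show ?thesis
    unfolding frontal_curvature_def gauss_curvature_def curv_comp_eq
  proof (rule the_equality)
    show "\<forall>c'\<in>A. q \<in> cdom c' \<longrightarrow> kform (pb ?G (rep c d)) (cmap c q) =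
      (\<Sum>l\<in>UNIV. curvc (mcomp A ?h c') (cmap c' q) l * mcomp A ?h c' (cmap c' q) $ l $ 1) / det (mcomp A ?h c' (cmap c' q))"
      using k inv unfolding kform_def[of "mcomp A _ _"] by simp
    fix x assume "\<forall>c'\<in>A. q \<in> cdom c' \<longrightarrow> x =
      (\<Sum>l\<in>UNIV. curvc (mcomp A ?h c') (cmap c' q) l * mcomp A ?h c' (cmap c' q) $ l $ 1) / det (mcomp A ?h c' (cmap c' q))"
    then have "x = kform (mcomp A ?h c) (cmap c q)" unfolding kform_def using c q by blast
    then show "x = kform (pb ?G (rep c d)) (cmap c q)" using k[OF c(1) q(1)] by simp
  qed
qed

end

section \<open>Straightening charts\<close>

lemma coord_frontal_compose:
  assumes cf: "coord_frontal V G U F n"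
    and \<tau>: "open U'" "smooth_on U' \<tau>" "\<tau> ` U' \<subseteq> U"
  shows "coord_frontal V G U' (\<lambda>z. F (\<tau> z)) (\<lambda>z. n (\<tau> z))"
proof -
  interpret F: coord_frontal V G U F n by (rule cf)
  have \<tau>U: "\<tau> z \<in> U" if "z \<in> U'" for z using \<tau>(3) that by blast
  have ddF: "dd (\<lambda>z. F (\<tau> z)) a z = dd F (dd \<tau> a z) (\<tau> z)" if "z \<in> U'" for a z
    by (rule dd_compose[OF smooth_onD_diff[OF \<tau>(2) that] F.F_diff[OF \<tau>U[OF that]]])
  show ?thesis
  proof
    show "smooth_on U' (\<lambda>z. F (\<tau> z))" by (rule smooth_on_compose[OF F.smooth_F \<tau>(1,3,2)])
    show "smooth_on U' (\<lambda>z. n (\<tau> z))" by (rule smooth_on_compose[OF F.smooth_n \<tau>(1,3,2)])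
    show "(\<lambda>z. F (\<tau> z)) ` U' \<subseteq> V" using \<tau>U F.F_V by blast
    show "mip G (F (\<tau> z)) (n (\<tau> z)) (n (\<tau> z)) = 1" if "z \<in> U'" for z by (rule F.unit_n[OF \<tau>U[OF that]])
    show "mip G (F (\<tau> z)) (n (\<tau> z)) (dd (\<lambda>z. F (\<tau> z)) a z) = 0" if "z \<in> U'" for z a
      unfolding ddF[OF that] by (rule F.normal_n[OF \<tau>U[OF that]])
  qed (rule \<tau>)
qed

lemma coord_frontal_subset:
  assumes "coord_frontal V G U F n" "open S" "S \<subseteq> U"
  shows "coord_frontal V G S F n"
  using coord_frontal_compose[OF assms(1,2), of "\<lambda>z. z"] assms(3) by (simp add: smooth_on_id image_subset_iff subset_iff)

text \<open>Only the component along \<open>e\<close> is shortened. Balls around the origin are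
  therefore admissible domains for \<open>smooth_division\<close>.\<close>

lemma norm_squeeze_le:
  assumes "e \<bullet> e = 1" "0 \<le> t" "t \<le> 1"
  shows "norm (squeeze e t x) \<le> norm x"
proof -
  have "squeeze e t x \<bullet> squeeze e t x = x \<bullet> x - (1 - t) * (1 + t) * (x \<bullet> e)\<^sup>2"
    unfolding squeeze_def
    by (simp add: inner_diff_left inner_diff_right inner_commute[of e x] assms(1) power2_eq_square algebra_simps)
  also have "\<dots> \<le> x \<bullet> x" using assms by simp
  finally show ?thesis by (simp add: norm_le)
qed

lemma e2_inner: "e2 \<bullet> e2 = 1"
  by (simp add: inner_axis_axis)

lemma squeeze_ball:
  assumes "z \<in> ball 0 R" "0 \<le> t" "t \<le> 1"
  shows "squeeze e2 t z \<in> ball 0 R"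
  using norm_squeeze_le[OF e2_inner assms(2,3), of z] assms(1) by simp

text \<open>The Gram determinant of \<open>f\<^sub>u\<close> and \<open>f\<^sub>v\<^sub>v\<close> at
  the origin. In a straight chart the plain second derivative is the covariant one, because
  \<open>f\<^sub>v\<close> vanishes there; it also avoids fixing an extension \<open>H\<close> in
  advance.\<close>

definition straight_gram :: "(real^3 \<Rightarrow> real^3^3) \<Rightarrow> (real^2 \<Rightarrow> real^3) \<Rightarrow> real" where
  "straight_gram G F = mip G (F 0) (dd F e1 0) (dd F e1 0) * mip G (F 0) (dd (dd F e2) e2 0) (dd (dd F e2) e2 0)
    - (mip G (F 0) (dd F e1 0) (dd (dd F e2) e2 0))\<^sup>2"

lemma straight_gram_cong:
  assumes "open S" "0 \<in> S" "\<And>z. z \<in> S \<Longrightarrow> F z = F' z"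
  shows "straight_gram G F = straight_gram G F'"
proof -
  have d: "dd F a z = dd F' a z" if "z \<in> S" for a z by (rule dd_cong[OF assms(1) that assms(3)])
  have "dd (dd F e2) e2 0 = dd (dd F' e2) e2 0" by (rule dd_cong[OF assms(1,2) d])
  then show ?thesis unfolding straight_gram_def d[OF assms(2)] assms(3)[OF assms(2)] by simp
qed

text \<open>The normal component of \<nabla>_v \<open>f\<^sub>v\<close> is
  -\<langle>\<open>f\<^sub>v\<close>, \<nabla>_v n\<rangle>, and \<open>f\<^sub>v\<close> vanishes
  at this point.\<close>

lemma (in coord_frontal) normal_second_derivative:
  assumes z: "z \<in> U" and F2: "dd F e2 z = 0"
  shows "mip G (F z) (n z) (dd (dd F e2) e2 z) = 0"
proof -
  have "covd G F (dd F e2) e2 z = dd (dd F e2) e2 z" by (simp add: covd_def F2)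
  then show ?thesis
    using sff_covd[OF z, of e2 e2] mip_commute[OF F_V[OF z], of "n z" "dd (dd F e2) e2 z"]
    by (simp add: sff_def F2)
qed

lemma (in coord_frontal) straight_gram_square:
  assumes z: "0 \<in> U" and F2: "dd F e2 0 = 0"
  shows "straight_gram G F = (vol3 G (F 0) (dd F e1 0) (dd (dd F e2) e2 0) (n 0))\<^sup>2"
  unfolding straight_gram_def
  by (rule vol3_normal_square[symmetric, OF F_V[OF z] unit_n[OF z] normal_n[OF z] normal_second_derivative[OF z F2]])

lemma vol3_change_basis:
  "vol3 G y (p *\<^sub>R a + q *\<^sub>R b) (r *\<^sub>R a + s *\<^sub>R b) c = (p * s - q * r) * vol3 G y a b c"
proof -
  have "det (vector [p *\<^sub>R a + q *\<^sub>R b, r *\<^sub>R a + s *\<^sub>R b, c] :: real^3^3)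
    = (p * s - q * r) * det (vector [a, b, c] :: real^3^3)"
    by (simp add: det_3 algebra_simps)
  then show ?thesis by (simp add: vol3_def)
qed

text \<open>Off the axis the area density is \<open>v det(f\<^sub>u, h, \<nu>)\<close> with \<open>h\<close> the extension of \<open>f\<^sub>v\<^sub>v\<close>, so its
  derivative at the origin is \<open>det(f\<^sub>u, f\<^sub>v\<^sub>v, \<nu>) dv\<close>.\<close>

lemma straight_gram_pos:
  assumes cf: "coord_frontal V G U F n"
    and nd: "dd (\<lambda>z. vol3 G (F z) (dd F e1 z) (dd F e2 z) (n z)) a (\<Psi> 0) \<noteq> 0"
    and \<Psi>: "open S" "0 \<in> S" "smooth_on S \<Psi>" "\<Psi> ` S \<subseteq> U" "det (matrix (\<lambda>w. dd \<Psi> w 0)) \<noteq> 0"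
    and axis: "\<And>z. z \<in> S \<Longrightarrow> z $ 2 = 0 \<Longrightarrow> dd (\<lambda>z. F (\<Psi> z)) e2 z = 0"
  shows "0 < straight_gram G (\<lambda>z. F (\<Psi> z))"
proof (rule ccontr)
  assume neg: "\<not> 0 < straight_gram G (\<lambda>z. F (\<Psi> z))"
  interpret F: coord_frontal V G U F n by (rule cf)
  define F0 where "F0 = (\<lambda>z. F (\<Psi> z))"
  define n0 where "n0 = (\<lambda>z. n (\<Psi> z))"
  obtain R where R: "0 < R" "ball 0 R \<subseteq> S" using \<Psi>(1,2) open_contains_ball by blast
  have sm\<Psi>: "smooth_on (ball 0 R) \<Psi>" "\<Psi> ` ball 0 R \<subseteq> U"
    using smooth_on_subset[OF \<Psi>(3) R(2)] \<Psi>(4) R(2) by auto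
  interpret C: coord_frontal V G "ball 0 R" F0 n0
    unfolding F0_def n0_def by (rule coord_frontal_compose[OF cf open_ball sm\<Psi>])
  have zero: "0 \<in> ball (0 :: real^2) R" using R by simp
  have axis0: "dd F0 e2 z = 0" if "z \<in> ball 0 R" "z \<bullet> e2 = 0" for z
    using axis[of z] that R(2) unfolding F0_def inner_axis2 by blast
  obtain H where H: "smooth_on (ball 0 R) H" "\<And>z. z \<in> ball 0 R \<Longrightarrow> dd F0 e2 z = (z \<bullet> e2) *\<^sub>R H z"
     "\<And>z. z \<in> ball 0 R \<Longrightarrow> z \<bullet> e2 = 0 \<Longrightarrow> H z = dd (dd F0 e2) e2 z"
    by (rule smooth_division[OF open_ball e2_inner smooth_on_dd[OF C.smooth_F] squeeze_ball axis0]) (assumption | rule that)+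
  define ar where "ar z = vol3 G (F z) (dd F e1 z) (dd F e2 z) (n z)" for z
  define r where "r z = vol3 G (F0 z) (dd F0 e1 z) (H z) (n0 z)" for z
  define M where "M z = det (matrix (\<lambda>w. dd \<Psi> w z))" for z
  have sm_r: "smooth_on (ball 0 R) r"
    unfolding r_def by (intro F.smooth_on_vol3 open_ball C.smooth_F C.F_in smooth_on_dd H(1) C.smooth_n)
  have sm_l: "smooth_on U ar"
    unfolding ar_def by (intro F.smooth_on_vol3 F.open_U F.smooth_F F.F_in smooth_on_dd F.smooth_n)
  have sm_M: "smooth_on (ball 0 R) M"
    unfolding M_def by (intro smooth_on_det smooth_on_matrix_dd open_ball sm\<Psi>)
  \<comment> \<open>Two readings of one area density: directly, with \<open>dd F0 e2\<close>
    divisible by \<open>v\<close>, and through the chain rule for \<open>\<Psi>\<close>, which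
    contributes the Jacobian.\<close>
  have area: "z $ 2 * r z = M z * ar (\<Psi> z)" if z: "z \<in> ball 0 R" for z
  proof -
    have \<Psi>z: "\<Psi> z \<in> U" using sm\<Psi>(2) z by blast
    note l = linear_dd[OF F.F_diff[OF \<Psi>z]]
    have e: "dd F0 w z = (dd \<Psi> w z $ 1) *\<^sub>R dd F e1 (\<Psi> z) + (dd \<Psi> w z $ 2) *\<^sub>R dd F e2 (\<Psi> z)" for w
      unfolding F0_def dd_compose[OF smooth_onD_diff[OF sm\<Psi>(1) z] F.F_diff[OF \<Psi>z]]
      using linear_vec_expand[OF l, of "dd \<Psi> w z"] by (simp only: UNIV_2_sum)
    have "z $ 2 * r z = vol3 G (F0 z) (dd F0 e1 z) (dd F0 e2 z) (n0 z)"
      unfolding r_def H(2)[OF z] inner_axis2 vol3_scale ..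
    also have "\<dots> = M z * ar (\<Psi> z)"
      unfolding e vol3_change_basis unfolding M_def ar_def F0_def n0_def
      by (simp add: det_2 matrix_def mult.commute)
    finally show ?thesis .
  qed
  have "straight_gram G F0 = (vol3 G (F0 0) (dd F0 e1 0) (dd (dd F0 e2) e2 0) (n0 0))\<^sup>2"
    by (rule C.straight_gram_square[OF zero axis0[OF zero]]) simp
  then have "vol3 G (F0 0) (dd F0 e1 0) (dd (dd F0 e2) e2 0) (n0 0) = 0"
    using neg unfolding F0_def[symmetric] by simp
  then have r0: "r 0 = 0" unfolding r_def using H(3)[OF zero] by simp
  have l0: "ar (\<Psi> 0) = 0" using area[OF zero] \<Psi>(5) by (simp add: M_def)
  \<comment> \<open>As \<open>r 0 = 0\<close>, the product \<open>v r\<close> vanishes to second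
    order at the origin. By \<open>area\<close> and invertibility of the derivative of
    \<open>\<Psi>\<close>, so does the density at \<open>\<Psi> 0\<close>, against
    \<open>nd\<close>.\<close>
  have "dd (\<lambda>z. z $ 2 * r z) w 0 = 0" for w
    using dd_mult[of "\<lambda>z. z $ 2" "0 :: real^2" r w] smooth_onD_diff[OF sm_r zero]
      bounded_linear_imp_differentiable[OF bounded_linear_vec_nth, of 2 "at (0 :: real^2)"] by (simp add: r0)
  moreover have "dd (\<lambda>z. z $ 2 * r z) w 0 = dd (\<lambda>z. M z * ar (\<Psi> z)) w 0" for w
    by (rule dd_cong[OF open_ball zero area])
  moreover have "dd (\<lambda>z. M z * ar (\<Psi> z)) w 0 = M 0 * dd ar (dd \<Psi> w 0) (\<Psi> 0)" for w
  proof -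
    have \<Psi>0: "\<Psi> 0 \<in> U" using sm\<Psi>(2) zero by blast
    have d: "\<Psi> differentiable (at 0)" "ar differentiable (at (\<Psi> 0))"
      by (rule smooth_onD_diff[OF sm\<Psi>(1) zero], rule smooth_onD_diff[OF sm_l \<Psi>0])
    have d2: "(\<lambda>z. ar (\<Psi> z)) differentiable (at 0)"
      by (rule smooth_onD_diff[OF smooth_on_compose[OF sm_l open_ball sm\<Psi>(2,1)] zero])
    have "dd (\<lambda>z. M z * ar (\<Psi> z)) w 0 = M 0 * dd (\<lambda>z. ar (\<Psi> z)) w 0 + dd M w 0 * ar (\<Psi> 0)"
      by (rule dd_mult[OF smooth_onD_diff[OF sm_M zero] d2])
    also have "dd (\<lambda>z. ar (\<Psi> z)) w 0 = dd ar (dd \<Psi> w 0) (\<Psi> 0)" by (rule dd_compose[OF d])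
    finally show ?thesis using l0 by simp
  qed
  ultimately have van: "dd ar (dd \<Psi> w 0) (\<Psi> 0) = 0" for w using \<Psi>(5) by (simp add: M_def)
  have "dd \<Psi> (matrix_inv (matrix (\<lambda>w. dd \<Psi> w 0)) *v a) 0 = a"
    using dd_matrix[OF smooth_onD_diff[OF sm\<Psi>(1) zero], of "matrix_inv (matrix (\<lambda>w. dd \<Psi> w 0)) *v a"]
      matrix_inv_mult(1)[OF \<Psi>(5)] by (simp only: matrix_vector_mul_assoc matrix_vector_mul_lid)
  then have "dd ar a (\<Psi> 0) = 0" using van by metis
  then show False using nd unfolding ar_def by simp
qed

section \<open>Curves and coordinate fields in charts\<close>

lemma vector_derivative_dd:
  assumes "f differentiable (at t)"
  shows "vector_derivative f (at t) = dd f 1 t"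
  using frechet_derivative_eq_vector_derivative[OF assms] by simp

context omanifold
begin

lemma curve_rep:
  assumes "smooth_curve_on A I \<gamma>" "c \<in> A"
  shows "open (I \<inter> \<gamma> -` cdom c)" "smooth_on (I \<inter> \<gamma> -` cdom c) (cmap c \<circ> \<gamma>)"
  using assms continuous_open_preimage[of I \<gamma> "cdom c"] open_cdom[OF assms(2)]
  unfolding smooth_curve_on_def by blast+

lemma velocity_comp:
  assumes \<gamma>: "smooth_curve_on A I \<gamma>" and t: "t \<in> I" and c: "c \<in> A" "\<gamma> t \<in> cdom c"
  shows "velocity A \<gamma> t c = dd (cmap c \<circ> \<gamma>) 1 t"
proof -
  have "(cmap c \<circ> \<gamma>) differentiable (at t)"
    by (rule smooth_onD_diff[OF curve_rep(2)[OF \<gamma> c(1)]]) (use t c in auto)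
  from vector_derivative_dd[OF this] show ?thesis using c by (simp add: velocity_def)
qed

lemma velocity_tangent:
  assumes \<gamma>: "smooth_curve_on A I \<gamma>" and t: "t \<in> I"
  shows "velocity A \<gamma> t \<in> tangent_space A (\<gamma> t)"
proof (rule tangentI)
  fix c d assume cd: "c \<in> A" "d \<in> A" "\<gamma> t \<in> cdom c" "\<gamma> t \<in> cdom d"
  let ?J = "(I \<inter> \<gamma> -` cdom c) \<inter> (I \<inter> \<gamma> -` cdom d)"
  have J: "open ?J" "t \<in> ?J" using curve_rep(1)[OF \<gamma> cd(1)] curve_rep(1)[OF \<gamma> cd(2)] t cd by auto
  have e: "(cmap d \<circ> \<gamma>) s = (cmap d \<circ> cinv c) ((cmap c \<circ> \<gamma>) s)" if "s \<in> ?J" for s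
    using that cinv_cmap[OF cd(1), of "\<gamma> s"] by simp
  have d1: "(cmap c \<circ> \<gamma>) differentiable (at t)"
    by (rule smooth_onD_diff[OF curve_rep(2)[OF \<gamma> cd(1)]]) (use t cd in auto)
  have ct: "(cmap c \<circ> \<gamma>) t = cmap c (\<gamma> t)" by simp
  have d2: "(cmap d \<circ> cinv c) differentiable (at ((cmap c \<circ> \<gamma>) t))"
    unfolding ct by (rule tr_diff[OF cd])
  have "dd (cmap d \<circ> \<gamma>) 1 t = dd (cmap d \<circ> cinv c) (dd (cmap c \<circ> \<gamma>) 1 t) ((cmap c \<circ> \<gamma>) t)"
    by (rule trans[OF dd_cong[OF J e] dd_compose[OF d1 d2]])
  then show "velocity A \<gamma> t d = dd (cmap d \<circ> cinv c) (velocity A \<gamma> t c) (cmap c (\<gamma> t))"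
    unfolding velocity_comp[OF \<gamma> t cd(1,3)] velocity_comp[OF \<gamma> t cd(2,4)] ct .
qed (auto simp: velocity_def)

lemma cfield_vfield:
  assumes c: "c \<in> A"
  shows "vfield_along A A id (cdom c) (cfield A c i)"
  unfolding vfield_along_def smooth_fun_on_def
proof (intro conjI ballI)
  show o: "open (cdom c)" by (rule open_cdom[OF c])
  show "cfield A c i q \<in> tangent_space A (id q)" if "q \<in> cdom c" for q
    using cfield_tangent[OF c that] by simp
  fix d assume d: "d \<in> A"
  show od: "open (cdom c \<inter> id -` cdom d)" using o open_cdom[OF d] by (simp add: open_Int)
  fix c' assume c': "c' \<in> A"
  let ?O = "cmap c' ` (cdom c \<inter> id -` cdom d \<inter> cdom c')" and ?t = "cmap c \<circ> cinv c'"
  have O: "open ?O" by (rule open_image[OF c' od])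
  have 1: "smooth_on ?O ?t" by (rule smooth_on_subset[OF tr_smooth[OF c' c]]) auto
  have 2: "smooth_on ?O (\<lambda>z. dd (cmap d \<circ> cinv c) (axis i 1) (?t z))"
  proof (rule smooth_on_compose[OF smooth_on_dd[OF tr_smooth[OF c d]] O _ 1])
    show "?t ` ?O \<subseteq> cmap c ` (cdom c \<inter> cdom d)"
    proof
      fix y assume "y \<in> ?t ` ?O"
      then obtain x where x: "x \<in> cdom c" "x \<in> cdom d" "x \<in> cdom c'" "y = ?t (cmap c' x)" by auto
      then have "y = cmap c x" using cinv_cmap[OF c' x(3)] by simp
      then show "y \<in> cmap c ` (cdom c \<inter> cdom d)" using x by blast
    qed
  qed
  show "smooth_on ?O ((\<lambda>q. cfield A c i q d) \<circ> cinv c')"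
  proof (rule smooth_on_cong_imp[OF 2 O])
    fix z assume "z \<in> ?O"
    then obtain x where x: "x \<in> cdom c" "x \<in> cdom d" "x \<in> cdom c'" "z = cmap c' x" by auto
    show "((\<lambda>q. cfield A c i q d) \<circ> cinv c') z = dd (cmap d \<circ> cinv c) (axis i 1) (?t z)"
      using x d cinv_cmap[OF c' x(3)] by (simp add: cfield_def coord_vec_def)
  qed
qed

end

context smooth_mapping
begin

lemma f_coord_rep:
  assumes c: "c \<in> A" "d \<in> B" and q: "q \<in> cdom c" "f q \<in> cdom d"
  shows "dmap A B f q (cfield A c i q) d = dd (rep c d) (axis i 1) (cmap c q)"
  using dmap_eq[OF S.cfield_tangent[OF c(1) q(1)] c q] by (simp add: S.cfield_self[OF c(1) q(1)])

lemma cov_f_coord: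
  assumes c: "c \<in> A" "d \<in> B" and q: "q \<in> cdom c" "f q \<in> cdom d"
  shows "cov A B g f (\<lambda>q. dmap A B f q (cfield A c i q)) q (cfield A c j q) d
    = covd (mcomp B g d) (rep c d) (dd (rep c d) (axis i 1)) (axis j 1) (cmap c q)"
proof -
  have v: "vfield_along A B f (cdom c) (\<lambda>q. dmap A B f q (cfield A c i q))"
    by (rule vfield_dmap[OF S.cfield_vfield[OF c(1)]])
  have "cov A B g f (\<lambda>q. dmap A B f q (cfield A c i q)) q (cfield A c j q) d
    = covd (mcomp B g d) (rep c d) (\<lambda>z. dmap A B f (cinv c z) (cfield A c i (cinv c z)) d) (axis j 1) (cmap c q)"
    using cov_eq[OF v q(1) S.cfield_tangent[OF c(1) q(1)] c q, of j] by (simp add: S.cfield_self[OF c(1) q(1)])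
  also have "\<dots> = covd (mcomp B g d) (rep c d) (dd (rep c d) (axis i 1)) (axis j 1) (cmap c q)"
  proof (rule covd_cong[OF open_rdom[OF c] rdomI[OF q] refl])
    fix y assume "y \<in> rdom c d"
    then obtain x where x: "x \<in> cdom c" "f x \<in> cdom d" "y = cmap c x" by (auto simp: rdom_def)
    show "dmap A B f (cinv c y) (cfield A c i (cinv c y)) d = dd (rep c d) (axis i 1) y"
      unfolding x(3) S.cinv_cmap[OF c(1) x(1)] by (rule f_coord_rep[OF c x(1,2)])
  qed
  finally show ?thesis .
qed

end

context frontal_map
begin

text \<open>What remains of an adapted chart without any normalization of lengths: \<partial>_v is a
  null direction along the u-axis.\<close>

definition "straight_chart p c \<longleftrightarrow> centered_chart A p c \<and>
  (\<forall>\<^sub>F q in nhds p. cmap c q $ 2 = 0 \<longrightarrow> f_coord A B f c 2 q = (\<lambda>_. 0))"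

lemma area_density_rep:
  assumes n: "normal_on W \<nu>" and c: "c \<in> A" "d \<in> B" and q: "q \<in> W" "q \<in> cdom c" "f q \<in> cdom d"
  shows "area_density A B g f \<nu> c q = vol3 (mcomp B g d) (rep c d (cmap c q))
    (dd (rep c d) e1 (cmap c q)) (dd (rep c d) e2 (cmap c q)) (\<nu> q d)"
proof -
  have t: "dmap A B f q (cfield A c i q) \<in> tangent_space B (f q)" for i
    by (rule dmap_tangent[OF S.cfield_tangent[OF c(1) q(2)]])
  show ?thesis
    unfolding area_density_def T.vol_form_eq[OF c(2) q(3) t t normal_tangent[OF n q(1)]]
      f_coord_rep[OF c q(2,3)] rep_cmap[OF c(1) q(2)] ..
qed

end

lemma plane_independent:
  fixes a b :: "real^2"
  assumes "\<And>s t. s *\<^sub>R a + t *\<^sub>R b = 0 \<Longrightarrow> s = 0 \<and> t = (0::real)"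
  shows "a $ 1 * b $ 2 - b $ 1 * a $ 2 \<noteq> 0"
proof
  assume e: "a $ 1 * b $ 2 - b $ 1 * a $ 2 = 0"
  have "b $ 2 *\<^sub>R a + (- a $ 2) *\<^sub>R b = 0" using e by (simp add: vec_eq_iff forall_2 algebra_simps)
  then have 1: "b $ 2 = 0 \<and> - a $ 2 = 0" by (rule assms)
  have "b $ 1 *\<^sub>R a + (- a $ 1) *\<^sub>R b = 0" using e by (simp add: vec_eq_iff forall_2 algebra_simps)
  then have 2: "b $ 1 = 0 \<and> - a $ 1 = 0" by (rule assms)
  have "1 *\<^sub>R a + 1 *\<^sub>R b = 0" using 1 2 by (simp add: vec_eq_iff forall_2)
  then show False using assms[of 1 1] by simp
qed

context frontal_map
begin

text \<open>The chart is \<open>(s, t) \<mapsto> \<gamma>(s) + t \<eta>(s)\<close>, read in a chart around \<open>p\<close>.\<close>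

lemma straight_chart_exists:
  assumes fk: "first_kind A B g f p"
  shows "\<exists>c. straight_chart p c \<and> (\<forall>d\<in>B. f p \<in> cdom d \<longrightarrow> 0 < straight_gram (mcomp B g d) (rep c d))"
proof -
  obtain \<nu> c a where c: "c \<in> A" "p \<in> cdom c" and a: "a \<in> tangent_space A p"
    "tderiv A p a (area_density A B g f \<nu> c) \<noteq> 0" and un: "unit_normal_near A B g f p \<nu>"
    using fk unfolding first_kind_def nondegenerate_singular_point_def by blast
  obtain W where W: "p \<in> W" "open W" "normal_on W \<nu>" by (rule unit_normal_nearE[OF un])
  obtain \<gamma> \<eta> where g: "singular_curve A B f p \<gamma>" "null_field_along A B f \<gamma> \<eta>"
    "tvec_indep (velocity A \<gamma> 0) (\<eta> 0)"
    using fk unfolding first_kind_def by blast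
  obtain \<epsilon>1 where \<epsilon>1: "0 < \<epsilon>1" "smooth_curve_on A {-\<epsilon>1<..<\<epsilon>1} \<gamma>" and \<gamma>0: "\<gamma> 0 = p"
    using g(1) unfolding singular_curve_def by blast
  obtain \<epsilon>2 where \<epsilon>2: "0 < \<epsilon>2" "\<forall>c\<in>A. smooth_on ({-\<epsilon>2<..<\<epsilon>2} \<inter> \<gamma> -` cdom c) (\<lambda>t. \<eta> t c)"
    and \<eta>: "\<And>t. t \<in> {-\<epsilon>2<..<\<epsilon>2} \<Longrightarrow> \<eta> t \<in> tangent_space A (\<gamma> t) \<and> dmap A B f (\<gamma> t) (\<eta> t) = (\<lambda>_. 0)"
    using g(2) unfolding null_field_along_def by blast
  define J where "J = ({-\<epsilon>1<..<\<epsilon>1} \<inter> \<gamma> -` cdom c) \<inter> {-\<epsilon>2<..<\<epsilon>2}"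
  have J: "open J" unfolding J_def using S.curve_rep(1)[OF \<epsilon>1(2) c(1)] by auto
  have J0: "0 \<in> J" unfolding J_def using \<epsilon>1 \<epsilon>2 \<gamma>0 c by simp
  define \<gamma>' where "\<gamma>' = cmap c \<circ> \<gamma>"
  have sm\<gamma>: "smooth_on J \<gamma>'"
    unfolding \<gamma>'_def by (rule smooth_on_subset[OF S.curve_rep(2)[OF \<epsilon>1(2) c(1)]]) (auto simp: J_def)
  have sm\<eta>: "smooth_on J (\<lambda>t. \<eta> t c)"
    by (rule smooth_on_subset[OF bspec[OF \<epsilon>2(2) c(1)]]) (auto simp: J_def)
  define v w where "v = dd \<gamma>' 1 0" and "w = \<eta> 0 c"
  have vel: "velocity A \<gamma> 0 c = v"
    unfolding v_def \<gamma>'_def by (rule S.velocity_comp[OF \<epsilon>1(2) _ c(1)]) (use \<epsilon>1 \<gamma>0 c in auto)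
  have velt: "velocity A \<gamma> 0 \<in> tangent_space A (\<gamma> 0)" by (rule S.velocity_tangent[OF \<epsilon>1(2)]) (use \<epsilon>1 in simp)
  have \<eta>t: "\<eta> 0 \<in> tangent_space A (\<gamma> 0)" using \<eta>[of 0] \<epsilon>2 by simp
  have c\<gamma>: "\<gamma> 0 \<in> cdom c" using \<gamma>0 c by simp
  have dne: "v $ 1 * w $ 2 - w $ 1 * v $ 2 \<noteq> 0"
  proof (rule plane_independent)
    fix s t :: real assume e: "s *\<^sub>R v + t *\<^sub>R w = 0"
    have "(\<lambda>c. s *\<^sub>R velocity A \<gamma> 0 c + t *\<^sub>R \<eta> 0 c) = (\<lambda>_. 0)"
      by (rule S.tangent_eqI[OF S.tangent_combination[OF velt \<eta>t] S.zero_tangent c(1) c\<gamma>])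
        (use e in \<open>simp add: vel w_def\<close>)
    then show "s = 0 \<and> t = 0" using g(3) unfolding tvec_indep_def by blast
  qed
  \<comment> \<open>The sign makes the frame of velocity and null vector positive, so that the new
    chart can belong to the oriented atlas.\<close>
  define \<sigma> where "\<sigma> = sgn (v $ 1 * w $ 2 - w $ 1 * v $ 2)"
  define \<Psi> where "\<Psi> x = \<gamma>' (x $ 1) + x $ 2 *\<^sub>R (\<sigma> *\<^sub>R \<eta> (x $ 1) c)" for x :: "real^2"
  define S0 where "S0 = (\<lambda>x::real^2. x $ 1) -` J"
  have S0: "open S0" unfolding S0_def by (rule Topological_Spaces.open_vimage[OF J]) (intro continuous_intros)
  have nth: "smooth_on S0 (\<lambda>x. x $ i)" for i by (intro smooth_on_vec_nth S0 smooth_on_id)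
  have comp: "smooth_on S0 (\<lambda>x. \<gamma>' (x $ 1))" "smooth_on S0 (\<lambda>x. \<sigma> *\<^sub>R \<eta> (x $ 1) c)"
    by (rule smooth_on_compose[OF sm\<gamma> S0 _ nth], simp add: S0_def image_subset_iff)
      (intro smooth_on_scaleR S0 smooth_on_const smooth_on_compose[OF sm\<eta> S0 _ nth], simp add: S0_def image_subset_iff)
  have sm\<Psi>: "smooth_on S0 \<Psi>"
    unfolding \<Psi>_def by (intro smooth_on_add smooth_on_scaleR[of S0 "\<lambda>x. x $ 2"] S0 comp nth)
  have z0: "0 \<in> S0" using J0 by (simp add: S0_def)
  have dd\<Psi>: "dd \<Psi> u x = dd \<gamma>' (u $ 1) (x $ 1) + (x $ 2 *\<^sub>R dd (\<lambda>x. \<sigma> *\<^sub>R \<eta> (x $ 1) c) u x + u $ 2 *\<^sub>R (\<sigma> *\<^sub>R \<eta> (x $ 1) c))"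
    if x: "x \<in> S0" for u x
  proof -
    have bl: "(\<lambda>x::real^2. x $ i) differentiable (at x)" for i
      by (rule bounded_linear_imp_differentiable[OF bounded_linear_vec_nth])
    have d3: "(\<lambda>x. x $ 2 *\<^sub>R (\<sigma> *\<^sub>R \<eta> (x $ 1) c)) differentiable (at x)"
      by (rule smooth_onD_diff[OF smooth_on_scaleR[OF S0 nth comp(2)] x])
    have "dd (\<lambda>x. \<gamma>' (x $ 1)) u x = dd \<gamma>' (u $ 1) (x $ 1)"
      using dd_compose[OF bl smooth_onD_diff[OF sm\<gamma>], of 1 u] x by (simp add: S0_def dd_nth)
    then show ?thesis
      unfolding \<Psi>_def dd_add[OF smooth_onD_diff[OF comp(1) x] d3] dd_scaleR[OF bl smooth_onD_diff[OF comp(2) x]]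
      by (simp add: dd_nth)
  qed
  have detM: "0 < det (matrix (\<lambda>u. dd \<Psi> u 0))"
  proof -
    have l: "dd \<gamma>' 0 0 = 0" using linear_0[OF linear_dd[OF smooth_onD_diff[OF sm\<gamma> J0]]] .
    have "dd \<Psi> e1 0 = v" "dd \<Psi> e2 0 = \<sigma> *\<^sub>R w"
      unfolding dd\<Psi>[OF z0] using l by (simp_all add: v_def w_def axis_def)
    then have "det (matrix (\<lambda>u. dd \<Psi> u 0)) = \<sigma> * (v $ 1 * w $ 2 - w $ 1 * v $ 2)"
      by (simp add: det_2 matrix_def algebra_simps)
    also have "\<dots> = \<bar>v $ 1 * w $ 2 - w $ 1 * v $ 2\<bar>" unfolding \<sigma>_def by (simp add: abs_sgn mult.commute)
    finally show ?thesis using dne by simp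
  qed
  \<comment> \<open>The restrictions demanded by \<open>new_chart\<close>: positive Jacobian, and
    image inside the chart \<open>c\<close>.\<close>
  define S1 where "S1 = S0 \<inter> (\<lambda>x. det (matrix (\<lambda>u. dd \<Psi> u x))) -` {0<..} \<inter> (S0 \<inter> \<Psi> -` (cmap c ` cdom c))"
  have S1: "open S1"
    unfolding S1_def
    by (intro open_Int continuous_open_preimage S0 S.open_cimage c open_greaterThan smooth_on_imp_continuous_on
        smooth_on_det smooth_on_matrix_dd sm\<Psi>)
  have S1S0: "S1 \<subseteq> S0" by (auto simp: S1_def)
  have \<Psi>axis: "\<Psi> x = \<gamma>' (x $ 1)" if "x $ 2 = 0" for x using that by (simp add: \<Psi>_def)
  have \<Psi>0: "\<Psi> 0 = cmap c p" using \<Psi>axis[of 0] \<gamma>0 by (simp add: \<gamma>'_def)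
  have z1: "0 \<in> S1" unfolding S1_def using z0 detM \<Psi>0 c by auto
  obtain U V h where U: "open U" "U \<subseteq> S1" "0 \<in> U" "open V" "homeomorphism U V \<Psi> h" "smooth_on V h"
    by (rule smooth_inverse_function[OF S1 smooth_on_subset[OF sm\<Psi> S1S0] z1]) (use detM that in auto)
  have VV: "V \<subseteq> cmap c ` cdom c" using homeomorphism_image1[OF U(5)] U(2) by (auto simp: S1_def)
  have pos: "0 < det (matrix (\<lambda>u. dd \<Psi> u z))" if "z \<in> U" for z using that U(2) by (auto simp: S1_def)
  have smU: "smooth_on U \<Psi>" by (rule smooth_on_subset[OF sm\<Psi>]) (use U(2) S1S0 in blast)
  define c' where "c' = (cinv c ` V, \<lambda>q. h (cmap c q))"
  have c': "c' \<in> A" "cmap c' ` cdom c' = U" "\<And>z. z \<in> U \<Longrightarrow> cinv c' z = cinv c (\<Psi> z)"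
    unfolding c'_def by (rule S.new_chart[OF c(1) U(1,4,5) VV smU U(6) pos]; assumption)+
  have p': "cinv c' 0 = p" using c'(3)[OF U(3)] \<Psi>0 S.cinv_cmap[OF c] by simp
  have pc': "p \<in> cdom c'" using S.cinv_in[of 0 c'] c'(2) U(3) p' by simp
  have p0: "cmap c' p = 0" using S.cmap_cinv[OF c'(1), of 0] c'(2) U(3) p' by simp
  \<comment> \<open>By construction the coordinate field \<partial>_v at a point of the axis is
    \<open>\<sigma> *\<^sub>R \<eta>\<close>, hence null.\<close>
  have straight: "f_coord A B f c' 2 q = (\<lambda>_. 0)" if q: "q \<in> cdom c'" "cmap c' q $ 2 = 0" for q
  proof -
    let ?z = "cmap c' q"
    have zU: "?z \<in> U" using c'(2) q(1) by blast
    have zS: "?z \<in> S0" using zU U(2) S1S0 by blast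
    define s where "s = ?z $ 1"
    have sJ: "s \<in> J" using zS by (simp add: S0_def s_def)
    then have sc: "\<gamma> s \<in> cdom c" "s \<in> {-\<epsilon>2<..<\<epsilon>2}" by (auto simp: J_def)
    have "q = cinv c (\<Psi> ?z)" using c'(3)[OF zU] S.cinv_cmap[OF c'(1) q(1)] by simp
    then have qs: "q = \<gamma> s" using \<Psi>axis[OF q(2)] S.cinv_cmap[OF c(1) sc(1)] by (simp add: \<gamma>'_def s_def)
    have tr: "(cmap c \<circ> cinv c') z = \<Psi> z" if "z \<in> U" for z
    proof -
      have "\<Psi> z \<in> cmap c ` cdom c" using that U(2) by (auto simp: S1_def)
      then show ?thesis using c'(3)[OF that] S.cmap_cinv[OF c(1)] by simp
    qed
    have "cfield A c' 2 q c = dd (cmap c \<circ> cinv c') e2 ?z"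
      using c qs sc(1) by (simp add: cfield_def coord_vec_def)
    also have "\<dots> = dd \<Psi> e2 ?z" by (rule dd_cong[OF U(1) zU tr])
    also have "\<dots> = \<sigma> *\<^sub>R \<eta> s c"
      using dd\<Psi>[OF zS, of e2] q(2) linear_0[OF linear_dd[OF smooth_onD_diff[OF sm\<gamma> sJ]]]
      by (simp add: s_def[symmetric] axis_def)
    finally have cf: "cfield A c' 2 q c = \<sigma> *\<^sub>R \<eta> s c" .
    have t: "cfield A c' 2 q \<in> tangent_space A q" by (rule S.cfield_tangent[OF c'(1) q(1)])
    have \<eta>s: "\<eta> s \<in> tangent_space A q" "dmap A B f q (\<eta> s) = (\<lambda>_. 0)" using \<eta>[OF sc(2)] qs by auto
    obtain d where d: "d \<in> B" "f q \<in> cdom d" using T.ex_chart by blast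
    have qc: "q \<in> cdom c" using qs sc(1) by simp
    have "dmap A B f q (cfield A c' 2 q) d = dd (rep c d) (\<sigma> *\<^sub>R \<eta> s c) (cmap c q)"
      unfolding dmap_eq[OF t c(1) d(1) qc d(2)] cf ..
    also have "\<dots> = \<sigma> *\<^sub>R dmap A B f q (\<eta> s) d"
      unfolding dmap_eq[OF \<eta>s(1) c(1) d(1) qc d(2)]
      by (rule linear_scale[OF linear_dd[OF rep_diff[OF c(1) d(1) qc d(2)]]])
    finally have "dmap A B f q (cfield A c' 2 q) d = 0" using \<eta>s(2) by simp
    then show ?thesis
      unfolding f_coord_def by (intro T.tangent_eqI[OF dmap_tangent[OF t] T.zero_tangent d])
  qed
  have sch: "straight_chart p c'"
    unfolding straight_chart_def centered_chart_def
  proof (intro conjI c' pc' p0)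
    have "\<forall>\<^sub>F q in nhds p. q \<in> cdom c'" by (rule eventually_nhds_in_open[OF S.open_cdom[OF c'(1)] pc'])
    then show "\<forall>\<^sub>F q in nhds p. cmap c' q $ 2 = 0 \<longrightarrow> f_coord A B f c' 2 q = (\<lambda>_. 0)"
      by (rule eventually_mono) (use straight in blast)
  qed
  \<comment> \<open>Non-degeneracy is given in the chart \<open>c\<close>;
    \<open>straight_gram_pos\<close> carries it along \<open>\<Psi>\<close> to the new
    coordinates.\<close>
  moreover have "0 < straight_gram (mcomp B g d) (rep c' d)" if d: "d \<in> B" "f p \<in> cdom d" for d
  proof -
    let ?G = "mcomp B g d" and ?F = "rep c d" and ?U = "ndom W c d"
    let ?l = "\<lambda>z. vol3 ?G (?F z) (dd ?F e1 z) (dd ?F e2 z) (\<nu> (cinv c z) d)"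
    have oU: "open ?U" by (rule open_ndom[OF W(2) c(1) d(1)])
    have pU: "cmap c p \<in> ?U" using W(1) c d by (auto simp: ndom_def)
    have cf: "coord_frontal (cmap d ` cdom d) ?G ?U ?F (\<lambda>z. \<nu> (cinv c z) d)"
      by (rule coord_frontal_rep[OF W(3,2) c(1) d(1)])
    interpret C: coord_frontal "cmap d ` cdom d" ?G ?U ?F "\<lambda>z. \<nu> (cinv c z) d" by (rule cf)
    have sml: "smooth_on ?U ?l"
      by (intro C.smooth_on_vol3 C.open_U C.smooth_F C.F_in smooth_on_dd C.smooth_n)
    have area: "(area_density A B g f \<nu> c \<circ> cinv c) z = ?l z" if z: "z \<in> ?U" for z
    proof -
      obtain q where q: "q \<in> W" "q \<in> cdom c" "f q \<in> cdom d" "z = cmap c q" using z by (auto simp: ndom_def)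
      show ?thesis
        using area_density_rep[OF W(3) c(1) d(1) q(1,2,3)] by (simp add: q(4) S.cinv_cmap[OF c(1) q(2)])
    qed
    have "(area_density A B g f \<nu> c \<circ> cinv c) differentiable (at (cmap c p))"
      using differentiable_cong_open[of ?U "cmap c p" "area_density A B g f \<nu> c \<circ> cinv c" ?l, OF oU pU area]
        smooth_onD_diff[OF sml pU] by simp
    from S.tderiv_eq[OF a(1) c this] have "dd (area_density A B g f \<nu> c \<circ> cinv c) (a c) (cmap c p) \<noteq> 0"
      using a(2) by simp
    moreover have "dd (area_density A B g f \<nu> c \<circ> cinv c) (a c) (cmap c p) = dd ?l (a c) (cmap c p)"
      by (rule dd_cong[OF oU pU area])
    ultimately have nd: "dd ?l (a c) (\<Psi> 0) \<noteq> 0" unfolding \<Psi>0 by (simp only: not_False_eq_True)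
    define O1 where "O1 = U \<inter> \<Psi> -` ?U"
    have O1: "open O1" unfolding O1_def
      by (rule continuous_open_preimage[OF smooth_on_imp_continuous_on[OF smU] U(1) oU])
    have z: "0 \<in> O1" using U(3) pU \<Psi>0 by (simp add: O1_def)
    have FF: "rep c' d z = ?F (\<Psi> z)" if "z \<in> O1" for z
      using c'(3)[of z] that by (simp add: rep_def O1_def)
    have "0 < straight_gram ?G (\<lambda>z. ?F (\<Psi> z))"
    proof (rule straight_gram_pos[where \<Psi> = \<Psi>, OF cf nd O1 z])
      show "smooth_on O1 \<Psi>" by (rule smooth_on_subset[OF smU]) (auto simp: O1_def)
      show "\<Psi> ` O1 \<subseteq> ?U" by (auto simp: O1_def)
      show "det (matrix (\<lambda>w. dd \<Psi> w 0)) \<noteq> 0" using detM by simp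
      fix z assume zz: "z \<in> O1" "z $ 2 = 0"
      have "z \<in> cmap c' ` cdom c'" using zz(1) c'(2) by (simp add: O1_def)
      then obtain q where q: "q \<in> cdom c'" "z = cmap c' q" by blast
      have "cinv c (\<Psi> z) = q" using c'(3)[of z] S.cinv_cmap[OF c'(1) q(1)] zz(1) q(2) by (simp add: O1_def)
      moreover have "cinv c (\<Psi> z) \<in> f -` cdom d"
      proof -
        have "\<Psi> z \<in> ?U" using zz(1) by (simp add: O1_def)
        then obtain x where "x \<in> cdom c" "f x \<in> cdom d" "\<Psi> z = cmap c x" by (auto simp: ndom_def)
        then show ?thesis using S.cinv_cmap[OF c(1)] by simp
      qed
      ultimately have fq: "f q \<in> cdom d" by simp
      have "dd (rep c' d) e2 z = 0"
        using f_coord_rep[OF c'(1) d(1) q(1) fq, of 2] straight[OF q(1)] zz(2) q(2) by (simp add: f_coord_def)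
      then show "dd (\<lambda>z. ?F (\<Psi> z)) e2 z = 0" using dd_cong[OF O1 zz(1) FF] by simp
    qed
    then show ?thesis using straight_gram_cong[OF O1 z FF] by simp
  qed
  ultimately show ?thesis by blast
qed

end

section \<open>Curvatures along the singular curve in a straightening chart\<close>

locale straight_data = frontal_map A B g f
  for A :: "('m::{t2_space,second_countable_topology}, 2) chart set"
    and B :: "('w::{t2_space,second_countable_topology}, 3) chart set" and g f +
  fixes p :: 'm and \<nu> :: "'m \<Rightarrow> ('w, 3) tvec" and W :: "'m set" and c :: "('m, 2) chart"
    and d :: "('w, 3) chart" and R :: real and H :: "real^2 \<Rightarrow> real^3"
  assumes normal: "normal_on W \<nu>" and open_W: "open W" and c: "c \<in> A" and d: "d \<in> B"
    and p_dom: "p \<in> cdom c" and p_zero: "cmap c p = 0" and R_pos: "0 < R"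
    and ball_sub: "ball 0 R \<subseteq> ndom W c d"
    and straight: "straight_frontal (cmap d ` cdom d) (mcomp B g d) (ball 0 R) (rep c d) (\<lambda>z. \<nu> (cinv c z) d) H"

lemma (in straight_frontal) straight_frontal_ball:
  assumes "ball 0 R \<subseteq> U"
  shows "straight_frontal V G (ball 0 R) F n H"
proof -
  interpret B: coord_frontal V G "ball 0 R" F n
    by (rule coord_frontal_subset[OF coord_frontal_axioms open_ball assms])
  show ?thesis
    by unfold_locales
      (use assms squeeze_ball smooth_on_subset[OF smooth_H assms] F2 delta_pos in blast)+
qed

context frontal_map
begin

lemma straight_data_exists:
  assumes n: "normal_on W \<nu>" "open W" "p \<in> W" and sc: "straight_chart p c"
    and d: "d \<in> B" "f p \<in> cdom d" and gram: "0 < straight_gram (mcomp B g d) (rep c d)"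
  shows "\<exists>R H. straight_data A B g f p \<nu> W c d R H"
proof -
  have c: "c \<in> A" "p \<in> cdom c" "cmap c p = 0"
    using sc unfolding straight_chart_def centered_chart_def by blast+
  obtain N where N: "open N" "p \<in> N" "\<And>q. q \<in> N \<Longrightarrow> cmap c q $ 2 = 0 \<Longrightarrow> f_coord A B f c 2 q = (\<lambda>_. 0)"
    using sc unfolding straight_chart_def eventually_nhds by blast
  let ?G = "mcomp B g d" and ?F = "rep c d" and ?n = "\<lambda>z. \<nu> (cinv c z) d"
  let ?U = "ndom (W \<inter> N) c d"
  have oU: "open ?U" by (rule open_ndom[OF open_Int[OF n(2) N(1)] c(1) d(1)])
  have sub: "?U \<subseteq> ndom W c d" by (auto simp: ndom_def)
  interpret C: coord_frontal "cmap d ` cdom d" ?G ?U ?F ?n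
    by (rule coord_frontal_subset[OF coord_frontal_rep[OF n(1,2) c(1) d(1)] oU sub])
  have z0: "0 \<in> ?U"
  proof -
    have "cmap c p \<in> ?U" using n(3) N(2) c(2) d(2) by (auto simp: ndom_def)
    then show ?thesis using c(3) by simp
  qed
  have F2: "dd ?F e2 z = 0" if z: "z \<in> ?U" "z \<bullet> e2 = 0" for z
  proof -
    obtain q where q: "q \<in> N" "q \<in> cdom c" "f q \<in> cdom d" "z = cmap c q" using z(1) by (auto simp: ndom_def)
    have "cmap c q $ 2 = 0" using z(2) q(4) by (simp add: inner_axis2)
    then show ?thesis
      using f_coord_rep[OF c(1) d(1) q(2,3), of 2] N(3)[OF q(1)] q(4) by (simp add: f_coord_def)
  qed
  obtain R1 where R1: "0 < R1" "ball 0 R1 \<subseteq> ?U" using oU z0 open_contains_ball by blast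
  have zb: "0 \<in> ball (0::real^2) R1" using R1 by simp
  have F2b: "dd ?F e2 z = 0" if "z \<in> ball 0 R1" "z \<bullet> e2 = 0" for z using F2 that R1(2) by blast
  obtain H where H: "smooth_on (ball 0 R1) H" "\<And>z. z \<in> ball 0 R1 \<Longrightarrow> dd ?F e2 z = (z \<bullet> e2) *\<^sub>R H z"
    "\<And>z. z \<in> ball 0 R1 \<Longrightarrow> z \<bullet> e2 = 0 \<Longrightarrow> H z = dd (dd ?F e2) e2 z"
    by (rule smooth_division[OF open_ball e2_inner smooth_on_dd[OF smooth_on_subset[OF C.smooth_F R1(2)]]
          squeeze_ball F2b]) (assumption | rule that)+
  define D where "D z = mip ?G (?F z) (dd ?F e1 z) (dd ?F e1 z) * mip ?G (?F z) (H z) (H z)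
      - (mip ?G (?F z) (dd ?F e1 z) (H z))\<^sup>2" for z
  have FB: "smooth_on (ball 0 R1) ?F" "?F ` ball 0 R1 \<subseteq> cmap d ` cdom d"
    using smooth_on_subset[OF C.smooth_F R1(2)] C.F_in R1(2) by auto
  have "smooth_on (ball 0 R1) D"
    unfolding D_def
    by (intro smooth_on_diff smooth_on_mult smooth_on_power open_ball C.smooth_on_mip FB smooth_on_dd H(1))
  then have contD: "continuous_on (ball 0 R1) D" by (rule smooth_on_imp_continuous_on)
  \<comment> \<open>On the axis \<open>H\<close> is the second derivative of the map, so
    \<open>D 0\<close> is \<open>straight_gram\<close>. By continuity positivity persists on a
    smaller ball.\<close>
  have D0: "0 < D 0" using gram H(3)[OF zb] by (simp add: D_def straight_gram_def)
  have "open (ball 0 R1 \<inter> D -` {0<..})" by (rule continuous_open_preimage[OF contD open_ball open_greaterThan])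
  moreover have "0 \<in> ball 0 R1 \<inter> D -` {0<..}" using D0 zb by blast
  ultimately obtain R where R: "0 < R" "ball 0 R \<subseteq> ball 0 R1 \<inter> D -` {0<..}"
    unfolding open_contains_ball by blast
  have RU: "ball 0 R \<subseteq> ?U" "ball (0 :: real^2) R \<subseteq> ball 0 R1" using R R1 by blast+
  interpret K: coord_frontal "cmap d ` cdom d" ?G "ball 0 R" ?F ?n
    by (rule coord_frontal_subset[OF C.coord_frontal_axioms open_ball RU(1)])
  have "straight_frontal (cmap d ` cdom d) ?G (ball 0 R) ?F ?n H"
  proof
    show "squeeze e2 t z \<in> ball 0 R" if "z \<in> ball 0 R" "0 \<le> t" "t \<le> 1" for z t by (rule squeeze_ball[OF that])
    show "smooth_on (ball 0 R) H" by (rule smooth_on_subset[OF H(1) RU(2)])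
    show "dd ?F e2 z = z $ 2 *\<^sub>R H z" if "z \<in> ball 0 R" for z
      using H(2)[of z] that RU(2) unfolding inner_axis2 by blast
    show "0 < mip ?G (?F z) (dd ?F e1 z) (dd ?F e1 z) * mip ?G (?F z) (H z) (H z)
      - (mip ?G (?F z) (dd ?F e1 z) (H z))\<^sup>2" if "z \<in> ball 0 R" for z
    proof -
      have "z \<in> D -` {0<..}" using R(2) that by blast
      then show ?thesis by (simp add: D_def)
    qed
  qed
  moreover have "ball 0 R \<subseteq> ndom W c d" using RU(1) sub by blast
  ultimately have "straight_data A B g f p \<nu> W c d R H"
    using frontal_map_axioms n(1,2) c d(1) R(1)
    unfolding straight_data_def straight_data_axioms_def by blast
  then show ?thesis by blast
qed

end

section \<open>The singular curve as a parametrization of the axis\<close>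

text \<open>The derivative at 0 yields values of both signs arbitrarily close to 0, and the
  intermediate value theorem fills the interval between them.\<close>

lemma increasing_covers:
  fixes u :: "real \<Rightarrow> real"
  assumes J: "open J" "0 \<in> J" "continuous_on J u" "u 0 = 0" and du: "(u has_real_derivative s) (at 0)" "0 < s"
  shows "\<exists>\<rho>>0. \<forall>x. \<bar>x\<bar> < \<rho> \<longrightarrow> (\<exists>t\<in>J. u t = x)"
proof -
  obtain k where k: "0 < k" "cball 0 k \<subseteq> J" using J(1,2) open_contains_cball by blast
  obtain k1 where k1: "0 < k1" "\<And>h. 0 < h \<Longrightarrow> h < k1 \<Longrightarrow> u 0 < u (0 + h)"
    using DERIV_pos_inc_right[OF du] by blast
  obtain k2 where k2: "0 < k2" "\<And>h. 0 < h \<Longrightarrow> h < k2 \<Longrightarrow> u (0 - h) < u 0"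
    using DERIV_pos_inc_left[OF du] by blast
  define h where "h = min k (min (k1 / 2) (k2 / 2))"
  have h: "0 < h" "h \<le> k" "h < k1" "h < k2" using k(1) k1(1) k2(1) by (auto simp: h_def)
  have up: "0 < u h" "u (- h) < 0" using k1(2)[OF h(1,3)] k2(2)[OF h(1,4)] J(4) by auto
  have sub: "{- h..h} \<subseteq> J" using k(2) h by (auto simp: subset_eq dist_real_def)
  have cont: "continuous_on {- h..h} u" by (rule continuous_on_subset[OF J(3) sub])
  show ?thesis
  proof (intro exI[of _ "min (u h) (- u (- h))"] conjI allI impI)
    show "0 < min (u h) (- u (- h))" using up by simp
    fix x assume "\<bar>x\<bar> < min (u h) (- u (- h))"
    then have "u (- h) \<le> x" "x \<le> u h" by auto
    then obtain t where "- h \<le> t" "t \<le> h" "u t = x" using IVT'[of u "- h" x h] cont h(1) by auto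
    then show "\<exists>t\<in>J. u t = x" using sub by auto
  qed
qed

lemma regular_covers:
  fixes u :: "real \<Rightarrow> real"
  assumes J: "open J" "0 \<in> J" "continuous_on J u" "u 0 = 0" and du: "(u has_real_derivative s) (at 0)" "s \<noteq> 0"
  shows "\<exists>\<rho>>0. \<forall>x. \<bar>x\<bar> < \<rho> \<longrightarrow> (\<exists>t\<in>J. u t = x)"
proof (cases "0 < s")
  case True
  then show ?thesis using increasing_covers[OF J du(1)] by blast
next
  case False
  have "continuous_on J (\<lambda>t. - u t)" "- u 0 = 0" "((\<lambda>t. - u t) has_real_derivative - s) (at 0)" "0 < - s"
    using J du False by (auto intro!: continuous_intros derivative_intros)
  from increasing_covers[OF J(1,2) this] obtain \<rho> where \<rho>: "0 < \<rho>" "\<And>x. \<bar>x\<bar> < \<rho> \<Longrightarrow> \<exists>t\<in>J. - u t = x" by blast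
  have "\<exists>t\<in>J. u t = x" if "\<bar>x\<bar> < \<rho>" for x
  proof -
    have "\<bar>- x\<bar> < \<rho>" using that by simp
    from \<rho>(2)[OF this] show ?thesis by simp
  qed
  then show ?thesis using \<rho>(1) by blast
qed

context straight_data
begin

sublocale L: straight_frontal "cmap d ` cdom d" "mcomp B g d" "ball 0 R" "rep c d" "\<lambda>z. \<nu> (cinv c z) d" H
  by (rule straight)

lemma ball_point:
  assumes "z \<in> ball 0 R"
  obtains q where "q \<in> W" "q \<in> cdom c" "f q \<in> cdom d" "z = cmap c q" "cinv c z = q"
proof -
  obtain q where q: "q \<in> W" "q \<in> cdom c" "f q \<in> cdom d" "z = cmap c q"
    using subsetD[OF ball_sub assms] by (auto simp: ndom_def)
  then show ?thesis using that S.cinv_cmap[OF c q(2)] by simp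
qed

lemma zero_ball: "0 \<in> ball (0 :: real^2) R"
  using R_pos by simp

lemma cinv_zero: "cinv c 0 = p"
  using S.cinv_cmap[OF c p_dom] p_zero by simp

lemma regular_v: "z \<in> ball 0 R \<Longrightarrow> cinv c z \<in> regular_points A B f \<longleftrightarrow> z $ 2 \<noteq> 0"
proof -
  assume z: "z \<in> ball 0 R"
  obtain q where q: "q \<in> W" "q \<in> cdom c" "f q \<in> cdom d" "z = cmap c q" "cinv c z = q" by (rule ball_point[OF z])
  show ?thesis
    using regular_iff[OF c d q(2,3)] L.det_pb[OF z] L.\<delta>_pos[OF z] q(4,5) by simp
qed

lemma curvature_v:
  assumes z: "z \<in> ball 0 R" "z $ 2 \<noteq> 0"
  shows "z $ 2 * frontal_curvature A B g f (cinv c z) = L.\<phi> z"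
proof -
  obtain q where q: "q \<in> W" "q \<in> cdom c" "f q \<in> cdom d" "z = cmap c q" "cinv c z = q" by (rule ball_point[OF z(1)])
  have "q \<in> regular_points A B f" using regular_v[OF z(1)] z(2) q(5) by simp
  from frontal_curvature_eq[OF c d q(2,3) this] show ?thesis
    using L.curvature_singularity[OF z] q(4,5) by simp
qed

lemma open_ball_preimage: "open {q \<in> cdom c. cmap c q \<in> ball 0 r}"
proof -
  have "{q \<in> cdom c. cmap c q \<in> ball 0 r} = cdom c \<inter> cmap c -` ball 0 r" by auto
  then show ?thesis using continuous_open_preimage[OF S.continuous_on_cmap[OF c] S.open_cdom[OF c] open_ball] by simp
qed

text \<open>Points off the axis are regular by \<open>regular_v\<close>, so a curve of singular
  points stays on the axis. Its velocity is then a multiple of \<open>e1\<close>, and a nonzero one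
  since the parametrization is regular.\<close>

lemma singular_curve_rep:
  assumes sc: "singular_curve A B f p \<gamma>" and N: "open N" "p \<in> N"
  obtains I J where "smooth_curve_on A I \<gamma>" "open J" "0 \<in> J" "J \<subseteq> I" "smooth_on J (cmap c \<circ> \<gamma>)" "(cmap c \<circ> \<gamma>) 0 = 0"
    "\<And>t. t \<in> J \<Longrightarrow> \<gamma> t \<in> N \<and> \<gamma> t \<in> cdom c \<and> (cmap c \<circ> \<gamma>) t \<in> ball 0 R \<and> (cmap c \<circ> \<gamma>) t $ 2 = 0 \<and>
       cinv c ((cmap c \<circ> \<gamma>) t) = \<gamma> t"
    "\<And>t. t \<in> J \<Longrightarrow> dd (cmap c \<circ> \<gamma>) 1 t = (dd (cmap c \<circ> \<gamma>) 1 t $ 1) *\<^sub>R e1 \<and> dd (cmap c \<circ> \<gamma>) 1 t $ 1 \<noteq> 0"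
proof -
  obtain \<epsilon> W' where e: "0 < \<epsilon>" "smooth_curve_on A {-\<epsilon><..<\<epsilon>} \<gamma>" and vel: "\<forall>t\<in>{-\<epsilon><..<\<epsilon>}. velocity A \<gamma> t \<noteq> (\<lambda>_. 0)"
    and sing: "\<gamma> ` {-\<epsilon><..<\<epsilon>} = {q\<in>W'. singular_point A B f q}" and \<gamma>0: "\<gamma> 0 = p"
    using sc unfolding singular_curve_def by blast
  let ?I = "{-\<epsilon><..<\<epsilon>}" and ?Z = "cmap c \<circ> \<gamma>"
  define O1 where "O1 = N \<inter> {q \<in> cdom c. cmap c q \<in> ball 0 R}"
  have O1: "open O1" unfolding O1_def using N(1) open_ball_preimage by (rule open_Int)
  have pO: "p \<in> O1" using N(2) p_dom p_zero R_pos by (simp add: O1_def)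
  define J where "J = ?I \<inter> \<gamma> -` O1"
  have cg: "continuous_on ?I \<gamma>" using e(2) unfolding smooth_curve_on_def by blast
  have J: "open J" unfolding J_def by (rule continuous_open_preimage[OF cg open_greaterThanLessThan O1])
  have J0: "0 \<in> J" using e(1) \<gamma>0 pO by (simp add: J_def)
  have JI: "J \<subseteq> ?I" by (auto simp: J_def)
  have JO: "\<gamma> t \<in> N" "\<gamma> t \<in> cdom c" "?Z t \<in> ball 0 R" if "t \<in> J" for t
    using that by (auto simp: J_def O1_def)
  have inv: "cinv c (?Z t) = \<gamma> t" if "t \<in> J" for t using S.cinv_cmap[OF c JO(2)[OF that]] by simp
  have smZ: "smooth_on J ?Z"
    by (rule smooth_on_subset[OF S.curve_rep(2)[OF e(2) c]]) (auto simp: J_def O1_def)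
  have axis: "?Z t $ 2 = 0" if t: "t \<in> J" for t
  proof -
    have "\<gamma> t \<in> \<gamma> ` ?I" using t JI by blast
    then have "singular_point A B f (\<gamma> t)" unfolding sing by blast
    then have "\<gamma> t \<notin> regular_points A B f" by (simp add: regular_points_def)
    then show ?thesis using regular_v[OF JO(3)[OF t]] unfolding inv[OF t] by blast
  qed
  have d2: "dd ?Z 1 t $ 2 = 0" if t: "t \<in> J" for t
  proof -
    have "dd ?Z 1 t $ 2 = dd (\<lambda>t. ?Z t $ 2) 1 t"
      by (rule dd_bounded_linear[OF smooth_onD_diff[OF smZ t] bounded_linear_vec_nth, symmetric])
    also have "\<dots> = dd (\<lambda>t. 0) 1 t" by (rule dd_cong[OF J t axis])
    finally show ?thesis by simp
  qed
  have d1: "dd ?Z 1 t = (dd ?Z 1 t $ 1) *\<^sub>R e1" if t: "t \<in> J" for t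
    using d2[OF t] by (simp add: vec_eq_iff forall_2 axis_def)
  have d0: "dd ?Z 1 t $ 1 \<noteq> 0" if t: "t \<in> J" for t
  proof
    assume "dd ?Z 1 t $ 1 = 0"
    then have "dd ?Z 1 t = 0" using d2[OF t] by (simp add: vec_eq_iff forall_2)
    then have "velocity A \<gamma> t c = 0" using S.velocity_comp[OF e(2) subsetD[OF JI t] c JO(2)[OF t]] by simp
    then have "velocity A \<gamma> t = (\<lambda>_. 0)"
      by (intro S.tangent_eqI[OF S.velocity_tangent[OF e(2) subsetD[OF JI t]] S.zero_tangent c JO(2)[OF t]])
    then show False using vel subsetD[OF JI t] by blast
  qed
  show ?thesis
    by (rule that[OF e(2) J J0 JI smZ]) (use \<gamma>0 p_zero JO axis inv d1 d0 in simp_all)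
qed

text \<open>By the chain rule a curve along the axis with coordinate speed s contributes powers of s
  and, to the acceleration, a tangential term with the derivative of s. The latter is orthogonal to
  the normal and disappears from \<kappa>_\<nu>. Both equations are checked in every target chart,
  as tangent vectors are families over charts.\<close>

lemma curve_image_velocity:
  assumes J: "open J" "smooth_on J (cmap c \<circ> \<gamma>)"
    and \<gamma>: "\<And>t. t \<in> J \<Longrightarrow> \<gamma> t \<in> cdom c"
    and v: "\<And>t. t \<in> J \<Longrightarrow> dd (cmap c \<circ> \<gamma>) 1 t = (dd (cmap c \<circ> \<gamma>) 1 t $ 1) *\<^sub>R e1"
    and t: "t \<in> J"
  shows "velocity B (f \<circ> \<gamma>) t = (\<lambda>d. dd (cmap c \<circ> \<gamma>) 1 t $ 1 *\<^sub>R f_coord A B f c 1 (\<gamma> t) d)"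
    and "cov_curve B g (f \<circ> \<gamma>) (velocity B (f \<circ> \<gamma>)) t =
      (\<lambda>d. (dd (cmap c \<circ> \<gamma>) 1 t $ 1)\<^sup>2 *\<^sub>R cov A B g f (f_coord A B f c 1) (\<gamma> t) (cfield A c 1 (\<gamma> t)) d
        + dd (\<lambda>t. dd (cmap c \<circ> \<gamma>) 1 t $ 1) 1 t *\<^sub>R f_coord A B f c 1 (\<gamma> t) d)"
proof -
  let ?Z = "cmap c \<circ> \<gamma>" and ?s = "\<lambda>t. dd (cmap c \<circ> \<gamma>) 1 t $ 1"
  have fc: "f_coord A B f c 1 = (\<lambda>q. dmap A B f q (cfield A c 1 q))" by (rule ext) (simp add: f_coord_def)
  have vel: "velocity B (f \<circ> \<gamma>) t e = ?s t *\<^sub>R dd (rep c e) e1 (?Z t)"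
    if t: "t \<in> J" and e: "e \<in> B" "f (\<gamma> t) \<in> cdom e" for t e
  proof -
    have eq: "(cmap e \<circ> (f \<circ> \<gamma>)) t = rep c e (?Z t)" if "t \<in> J" for t
      using rep_cmap[OF c \<gamma>[OF that], of e] by simp
    have dZ: "?Z differentiable (at t)" by (rule smooth_onD_diff[OF J(2) t])
    have dr: "rep c e differentiable (at (?Z t))" using rep_diff[OF c e(1) \<gamma>[OF t] e(2)] by simp
    have df: "(cmap e \<circ> (f \<circ> \<gamma>)) differentiable (at t)"
      using differentiable_cong_open[of J t "cmap e \<circ> (f \<circ> \<gamma>)" "\<lambda>t. rep c e (?Z t)", OF J(1) t eq]
        differentiable_chain_at[OF dZ dr] by (simp add: o_def)
    have "velocity B (f \<circ> \<gamma>) t e = dd (cmap e \<circ> (f \<circ> \<gamma>)) 1 t"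
      using e vector_derivative_dd[OF df] by (simp add: velocity_def)
    also have "\<dots> = dd (\<lambda>t. rep c e (?Z t)) 1 t" by (rule dd_cong[OF J(1) t eq])
    also have "\<dots> = dd (rep c e) (dd ?Z 1 t) (?Z t)" by (rule dd_compose[OF dZ dr])
    also have "\<dots> = dd (rep c e) (?s t *\<^sub>R e1) (?Z t)" using v[OF t] by metis
    also have "\<dots> = ?s t *\<^sub>R dd (rep c e) e1 (?Z t)" by (rule linear_scale[OF linear_dd[OF dr]])
    finally show ?thesis .
  qed
  show "velocity B (f \<circ> \<gamma>) t = (\<lambda>d. ?s t *\<^sub>R f_coord A B f c 1 (\<gamma> t) d)"
  proof
    fix e
    show "velocity B (f \<circ> \<gamma>) t e = ?s t *\<^sub>R f_coord A B f c 1 (\<gamma> t) e"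
    proof (cases "e \<in> B \<and> f (\<gamma> t) \<in> cdom e")
      case True
      then show ?thesis using vel[OF t] f_coord_rep[OF c _ \<gamma>[OF t], of e 1] by (simp add: fc)
    next
      case False
      then show ?thesis by (auto simp: velocity_def f_coord_def dmap_def)
    qed
  qed
  show "cov_curve B g (f \<circ> \<gamma>) (velocity B (f \<circ> \<gamma>)) t = (\<lambda>d. (?s t)\<^sup>2 *\<^sub>R cov A B g f (f_coord A B f c 1) (\<gamma> t) (cfield A c 1 (\<gamma> t)) d
        + dd ?s 1 t *\<^sub>R f_coord A B f c 1 (\<gamma> t) d)"
  proof
    fix e
    show "cov_curve B g (f \<circ> \<gamma>) (velocity B (f \<circ> \<gamma>)) t e =
      (?s t)\<^sup>2 *\<^sub>R cov A B g f (f_coord A B f c 1) (\<gamma> t) (cfield A c 1 (\<gamma> t)) e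
        + dd ?s 1 t *\<^sub>R f_coord A B f c 1 (\<gamma> t) e"
    proof (cases "e \<in> B \<and> f (\<gamma> t) \<in> cdom e")
      case False
      then show ?thesis by (auto simp: cov_curve_def cov_def f_coord_def dmap_def)
    next
      case True
      then have e: "e \<in> B" "f (\<gamma> t) \<in> cdom e" by auto
      let ?X = "dd (rep c e) e1"
      define J' where "J' = J \<inter> ?Z -` rdom c e"
      have J': "open J'" unfolding J'_def
        by (rule continuous_open_preimage[OF smooth_on_imp_continuous_on[OF J(2)] J(1) open_rdom[OF c e(1)]])
      have tJ': "t \<in> J'" using t rdomI[OF \<gamma>[OF t] e(2)] by (simp add: J'_def)
      have Zt: "?Z t = cmap c (\<gamma> t)" by simp
      have fd: "f (\<gamma> s) \<in> cdom e" if s: "s \<in> J'" for s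
      proof -
        have "cmap c (\<gamma> s) \<in> rdom c e" using s by (simp add: J'_def)
        then obtain x where x: "cmap c (\<gamma> s) = cmap c x" "x \<in> f -` cdom e \<inter> cdom c"
          unfolding rdom_def by (rule imageE)
        have "\<gamma> s = cinv c (cmap c x)" using S.cinv_cmap[OF c \<gamma>, of s] s x(1) by (simp add: J'_def)
        also have "\<dots> = x" using S.cinv_cmap[OF c] x(2) by simp
        finally show ?thesis using x(2) by simp
      qed
      have eq: "velocity B (f \<circ> \<gamma>) s e = ?s s *\<^sub>R ?X (?Z s)" if "s \<in> J'" for s
        by (rule vel[OF _ e(1) fd[OF that]]) (use that in \<open>simp add: J'_def\<close>)
      have sms: "smooth_on J ?s" by (rule smooth_on_vec_nth[OF J(1) smooth_on_dd[OF J(2)]])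
      have dZ: "?Z differentiable (at t)" and ds: "?s differentiable (at t)"
        by (rule smooth_onD_diff[OF J(2) t], rule smooth_onD_diff[OF sms t])
      have Zr: "?Z t \<in> rdom c e" using tJ' by (simp add: J'_def)
      have dX: "?X differentiable (at (?Z t))" and dr: "rep c e differentiable (at (?Z t))"
        by (rule smooth_onD_diff[OF smooth_on_dd[OF rep_smooth[OF c e(1)]] Zr],
            rule smooth_onD_diff[OF rep_smooth[OF c e(1)] Zr])
      have dXZ: "(\<lambda>s. ?X (?Z s)) differentiable (at t)"
        using differentiable_chain_at[OF dZ dX] by (simp add: o_def)
      have dsX: "(\<lambda>s. ?s s *\<^sub>R ?X (?Z s)) differentiable (at t)"
        using bounded_bilinear.FDERIV[OF bounded_bilinear_scaleR] ds dXZ unfolding differentiable_def by blast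
      have dV: "(\<lambda>s. velocity B (f \<circ> \<gamma>) s e) differentiable (at t)"
        using differentiable_cong_open[of J' t "\<lambda>s. velocity B (f \<circ> \<gamma>) s e" "\<lambda>s. ?s s *\<^sub>R ?X (?Z s)", OF J' tJ' eq] dsX
        by simp
      have "vector_derivative (\<lambda>s. velocity B (f \<circ> \<gamma>) s e) (at t) = dd (\<lambda>s. velocity B (f \<circ> \<gamma>) s e) 1 t"
        by (rule vector_derivative_dd[OF dV])
      also have "\<dots> = dd (\<lambda>s. ?s s *\<^sub>R ?X (?Z s)) 1 t" by (rule dd_cong[OF J' tJ' eq])
      also have "\<dots> = ?s t *\<^sub>R dd (\<lambda>s. ?X (?Z s)) 1 t + dd ?s 1 t *\<^sub>R ?X (?Z t)"
        by (rule dd_scaleR[OF ds dXZ])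
      also have "dd (\<lambda>s. ?X (?Z s)) 1 t = dd ?X (dd ?Z 1 t) (?Z t)" by (rule dd_compose[OF dZ dX])
      also have "\<dots> = dd ?X (?s t *\<^sub>R e1) (?Z t)" using v[OF t] by metis
      also have "\<dots> = ?s t *\<^sub>R dd ?X e1 (?Z t)" by (rule linear_scale[OF linear_dd[OF dX]])
      finally have vd: "vector_derivative (\<lambda>s. velocity B (f \<circ> \<gamma>) s e) (at t)
        = (?s t)\<^sup>2 *\<^sub>R dd ?X e1 (?Z t) + dd ?s 1 t *\<^sub>R ?X (?Z t)"
        unfolding scaleR_scaleR power2_eq_square .
      have F1: "f_coord A B f c 1 (\<gamma> t) e = ?X (?Z t)"
        using f_coord_rep[OF c e(1) \<gamma>[OF t] e(2), of 1] by (simp add: fc)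
      have C1: "cov A B g f (f_coord A B f c 1) (\<gamma> t) (cfield A c 1 (\<gamma> t)) e
        = covd (mcomp B g e) (rep c e) ?X e1 (?Z t)"
        unfolding fc using cov_f_coord[OF c e(1) \<gamma>[OF t] e(2), of 1 1] by simp
      have "cov_curve B g (f \<circ> \<gamma>) (velocity B (f \<circ> \<gamma>)) t e
        = vector_derivative (\<lambda>s. velocity B (f \<circ> \<gamma>) s e) (at t)
          + gam (mcomp B g e) (cmap e (f (\<gamma> t))) (velocity B (f \<circ> \<gamma>) t e) (velocity B (f \<circ> \<gamma>) t e)"
        using e by (simp add: cov_curve_def christoffel_term_eq)
      also have "\<dots> = (?s t)\<^sup>2 *\<^sub>R covd (mcomp B g e) (rep c e) ?X e1 (?Z t) + dd ?s 1 t *\<^sub>R ?X (?Z t)"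
        unfolding vd eq[OF tJ'] covd_def gam_scale rep_cmap[OF c \<gamma>[OF t], of e, folded Zt]
        by (simp add: power2_eq_square algebra_simps)
      finally show ?thesis unfolding F1 C1 .
    qed
  qed
qed

end

locale curve_data = straight_data A B g f p \<nu> W c d R H
  for A :: "('m::{t2_space,second_countable_topology}, 2) chart set"
    and B :: "('w::{t2_space,second_countable_topology}, 3) chart set" and g f p \<nu> W c d R H +
  fixes \<gamma> :: "real \<Rightarrow> 'm" and I J :: "real set"
  assumes curve: "smooth_curve_on A I \<gamma>" and open_J: "open J" and zero_J: "0 \<in> J" and J_I: "J \<subseteq> I"
    and smooth_Z: "smooth_on J (cmap c \<circ> \<gamma>)" and Z_zero: "(cmap c \<circ> \<gamma>) 0 = 0"
    and curve_in: "t \<in> J \<Longrightarrow> \<gamma> t \<in> W \<and> \<gamma> t \<in> cdom c \<and> (cmap c \<circ> \<gamma>) t \<in> ball 0 R \<and>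
      (cmap c \<circ> \<gamma>) t $ 2 = 0 \<and> cinv c ((cmap c \<circ> \<gamma>) t) = \<gamma> t"
    and curve_axis: "t \<in> J \<Longrightarrow> dd (cmap c \<circ> \<gamma>) 1 t = (dd (cmap c \<circ> \<gamma>) 1 t $ 1) *\<^sub>R e1 \<and>
      dd (cmap c \<circ> \<gamma>) 1 t $ 1 \<noteq> 0"
begin

definition "Z = cmap c \<circ> \<gamma>"
definition "s t = dd Z 1 t $ 1"

lemma Z_curve:
  assumes "t \<in> J"
  shows "\<gamma> t \<in> W" "\<gamma> t \<in> cdom c" "f (\<gamma> t) \<in> cdom d" "Z t \<in> ball 0 R" "Z t $ 2 = 0" "cinv c (Z t) = \<gamma> t"
    "cmap c (\<gamma> t) = Z t" "s t \<noteq> 0" "dd Z 1 t = s t *\<^sub>R e1"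
proof -
  show 1: "\<gamma> t \<in> W" "\<gamma> t \<in> cdom c" "Z t \<in> ball 0 R" "Z t $ 2 = 0" "cinv c (Z t) = \<gamma> t"
    "cmap c (\<gamma> t) = Z t" "s t \<noteq> 0"
    using curve_in[OF assms] curve_axis[OF assms] by (simp_all add: Z_def s_def)
  show "dd Z 1 t = s t *\<^sub>R e1" using curve_axis[OF assms] unfolding Z_def s_def by blast
  show "f (\<gamma> t) \<in> cdom d" by (rule ball_point[OF 1(3)]) (use 1 in simp)
qed

lemma smooth_on_Z: "smooth_on J Z" and smooth_on_s: "smooth_on J s"
proof -
  show *: "smooth_on J Z" using smooth_Z by (simp add: Z_def)
  show "smooth_on J s"
    unfolding s_def[abs_def] by (rule smooth_on_vec_nth[OF open_J smooth_on_dd[OF *]])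
qed

lemma velocity_image: "t \<in> J \<Longrightarrow> velocity B (f \<circ> \<gamma>) t = (\<lambda>d. s t *\<^sub>R f_coord A B f c 1 (\<gamma> t) d)"
  and cov_curve_image: "t \<in> J \<Longrightarrow> cov_curve B g (f \<circ> \<gamma>) (velocity B (f \<circ> \<gamma>)) t =
      (\<lambda>d. (s t)\<^sup>2 *\<^sub>R cov A B g f (f_coord A B f c 1) (\<gamma> t) (cfield A c 1 (\<gamma> t)) d
        + dd s 1 t *\<^sub>R f_coord A B f c 1 (\<gamma> t) d)"
  using curve_image_velocity[OF open_J smooth_Z conjunct1[OF conjunct2[OF curve_in]] conjunct1[OF curve_axis]]
  unfolding s_def[abs_def] Z_def by blast+

lemma f_coord_eq: "f_coord A B f c i = (\<lambda>q. dmap A B f q (cfield A c i q))"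
  by (rule ext) (simp add: f_coord_def)

lemma f_coord_tangent: "q \<in> cdom c \<Longrightarrow> f_coord A B f c i q \<in> tangent_space B (f q)"
  unfolding f_coord_def by (rule dmap_tangent[OF S.cfield_tangent[OF c]])

lemma f_coord_1:
  assumes "t \<in> J"
  shows "f_coord A B f c 1 (\<gamma> t) d = dd (rep c d) e1 (Z t)"
  using f_coord_rep[OF c d Z_curve(2,3)[OF assms], of 1] Z_curve(7)[OF assms] by (simp add: f_coord_def)

lemma velocity_tangent_B:
  assumes t: "t \<in> J"
  shows "velocity B (f \<circ> \<gamma>) t \<in> tangent_space B (f (\<gamma> t))"
  unfolding velocity_image[OF t]
  using T.tangent_combination[OF f_coord_tangent[OF Z_curve(2)[OF t], of 1] T.zero_tangent, of "s t" 0] by simp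

lemma g_rep:
  assumes "t \<in> J" "a \<in> tangent_space B (f (\<gamma> t))" "b \<in> tangent_space B (f (\<gamma> t))"
  shows "g (f (\<gamma> t)) a b = mip (mcomp B g d) (rep c d (Z t)) (a d) (b d)"
  using T.g_mip[OF d Z_curve(3)[OF assms(1)] assms(2,3)] rep_cmap[OF c Z_curve(2)[OF assms(1)], of d]
    Z_curve(7)[OF assms(1)] by simp

lemma gnorm_velocity:
  assumes t: "t \<in> J"
  shows "gnorm g (f (\<gamma> t)) (velocity B (f \<circ> \<gamma>) t) = \<bar>s t\<bar> * sqrt (L.E (Z t))"
proof -
  have "g (f (\<gamma> t)) (velocity B (f \<circ> \<gamma>) t) (velocity B (f \<circ> \<gamma>) t) = (s t)\<^sup>2 * L.E (Z t)"
    unfolding g_rep[OF t velocity_tangent_B[OF t] velocity_tangent_B[OF t]]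
    unfolding velocity_image[OF t] f_coord_1[OF t] mip_scale L.E_def by (simp add: power2_eq_square)
  then show ?thesis by (simp add: gnorm_def real_sqrt_mult)
qed

lemma kappa_nu_eq:
  assumes t: "t \<in> J"
  shows "kappa_nu B g f \<nu> \<gamma> t = L.L (Z t) / L.E (Z t)"
proof -
  let ?K = "cov A B g f (f_coord A B f c 1) (\<gamma> t) (cfield A c 1 (\<gamma> t))"
  let ?F = "f_coord A B f c 1 (\<gamma> t)"
  have vf: "vfield_along A B f (cdom c) (f_coord A B f c 1)"
    unfolding f_coord_eq by (rule vfield_dmap[OF S.cfield_vfield[OF c]])
  have K: "?K \<in> tangent_space B (f (\<gamma> t))"
    by (rule cov_tangent[OF vf Z_curve(2)[OF t] S.cfield_tangent[OF c Z_curve(2)[OF t]]])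
  note F = f_coord_tangent[OF Z_curve(2)[OF t], of 1]
  note n = normal_tangent[OF normal Z_curve(1)[OF t]]
  have Kd: "?K d = covd (mcomp B g d) (rep c d) (dd (rep c d) e1) e1 (Z t)"
    unfolding f_coord_eq using cov_f_coord[OF c d Z_curve(2,3)[OF t], of 1 1] Z_curve(7)[OF t] by simp
  have nd: "\<nu> (\<gamma> t) d = \<nu> (cinv c (Z t)) d" using Z_curve(6)[OF t] by simp
  have "g (f (\<gamma> t)) (cov_curve B g (f \<circ> \<gamma>) (velocity B (f \<circ> \<gamma>)) t) (\<nu> (\<gamma> t)) = (s t)\<^sup>2 * L.L (Z t)"
    unfolding cov_curve_image[OF t] g_rep[OF t T.tangent_combination[OF K F] n] Kd f_coord_1[OF t] nd
      mip_add mip_scale L.L_def L.sff_covd[OF Z_curve(4)[OF t]]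
      L.mip_commute[OF L.F_V[OF Z_curve(4)[OF t]], of "dd (rep c d) e1 (Z t)"]
      L.normal_n[OF Z_curve(4)[OF t]] by simp
  moreover have "(gnorm g (f (\<gamma> t)) (velocity B (f \<circ> \<gamma>) t))\<^sup>2 = (s t)\<^sup>2 * L.E (Z t)"
    unfolding gnorm_velocity[OF t] using L.E_pos[OF Z_curve(4)[OF t]] by (simp add: power_mult_distrib)
  ultimately show ?thesis using Z_curve(8)[OF t] by (simp add: kappa_nu_def)
qed

text \<open>Nullity of \<open>\<eta>\<close> and vanishing of \<kappa>_\<Pi> are known only at
  points of the curve; this lemma transfers such information to all points of the axis near the
  origin.\<close>

lemma Z_covers:
  assumes K: "open K" "0 \<in> K" "K \<subseteq> J"
  shows "\<exists>\<rho>>0. \<forall>z. norm z < \<rho> \<longrightarrow> z $ 2 = 0 \<longrightarrow> (\<exists>t\<in>K. Z t = z)"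
proof -
  have sm: "smooth_on K Z" by (rule smooth_on_subset[OF smooth_on_Z K(3)])
  have cont: "continuous_on K (\<lambda>t. Z t $ 1)"
    by (rule smooth_on_imp_continuous_on[OF smooth_on_vec_nth[OF K(1) sm]])
  have dif: "(\<lambda>t. Z t $ 1) differentiable (at 0)"
    by (rule smooth_onD_diff[OF smooth_on_vec_nth[OF K(1) sm] K(2)])
  have ddZ: "dd (\<lambda>t. Z t $ 1) 1 0 = s 0"
    unfolding s_def by (rule dd_bounded_linear[OF smooth_onD_diff[OF sm K(2)] bounded_linear_vec_nth])
  have "((\<lambda>t. Z t $ 1) has_real_derivative vector_derivative (\<lambda>t. Z t $ 1) (at 0)) (at 0)"
    using dif vector_derivative_works has_real_derivative_iff_has_vector_derivative by blast
  then have "((\<lambda>t. Z t $ 1) has_real_derivative s 0) (at 0)" unfolding vector_derivative_dd[OF dif] ddZ .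
  moreover have "Z 0 $ 1 = 0" using Z_zero by (simp add: Z_def)
  ultimately obtain \<rho> where \<rho>: "0 < \<rho>" "\<And>x. \<bar>x\<bar> < \<rho> \<Longrightarrow> \<exists>t\<in>K. Z t $ 1 = x"
    using regular_covers[OF K(1,2) cont _ _ Z_curve(8)[OF zero_J]] by blast
  have "\<exists>t\<in>K. Z t = z" if z: "norm z < \<rho>" "z $ 2 = 0" for z
  proof -
    have "\<bar>z $ 1\<bar> < \<rho>" using component_le_norm_cart[of z 1] z(1) by simp
    then obtain t where t: "t \<in> K" "Z t $ 1 = z $ 1" using \<rho>(2) by blast
    moreover have "Z t $ 2 = z $ 2" using Z_curve(5)[of t] t(1) K(3) z(2) by auto
    ultimately show ?thesis by (auto simp: vec_eq_iff forall_2)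
  qed
  then show ?thesis using \<rho>(1) by blast
qed

text \<open>The volumes in the definition are given by \<open>null_field_derivatives\<close>, and
  \<open>cuspidal_normalization\<close> removes speed and length of the null vector. A whole
  neighbourhood of 0 is needed because \<kappa>_c is differentiated later.\<close>

lemma kappa_c_eq:
  assumes ne: "null_extension A B f \<gamma> \<eta>"
  shows "\<exists>K. open K \<and> 0 \<in> K \<and> K \<subseteq> J \<and> (\<forall>t\<in>K. kappa_c A B g f \<gamma> \<eta> t =
    2 * sgn (L.r (Z t)) * L.N (Z t) * L.E (Z t) powr (3/4) * L.\<delta> (Z t) powr (- (3/4)))"
proof -
  let ?G = "mcomp B g d" and ?F = "rep c d" and ?n = "\<lambda>z. \<nu> (cinv c z) d"
  obtain X where X: "\<gamma> 0 \<in> X" "vfield_along A A id X \<eta>"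
    using ne unfolding null_extension_def by blast
  have oX: "open X" using X(2) by (simp add: vfield_along_def)
  have \<eta>T: "\<eta> q \<in> tangent_space A q" if "q \<in> X" for q using X(2) that by (simp add: vfield_along_def)
  have nf: "null_field_along A B f \<gamma> (\<eta> \<circ> \<gamma>)" using ne unfolding null_extension_def by blast
  obtain \<epsilon> where \<epsilon>: "0 < \<epsilon>" "\<And>t. t \<in> {-\<epsilon><..<\<epsilon>} \<Longrightarrow> dmap A B f (\<gamma> t) (\<eta> (\<gamma> t)) = (\<lambda>_. 0)"
    using nf unfolding null_field_along_def o_def by blast
  have "\<forall>\<^sub>F t in nhds 0. pos_oriented2 A (\<gamma> t) (velocity A \<gamma> t) (\<eta> (\<gamma> t))"
    using ne unfolding null_extension_def by blast
  then obtain P where P: "open P" "0 \<in> P" "\<And>t. t \<in> P \<Longrightarrow> pos_oriented2 A (\<gamma> t) (velocity A \<gamma> t) (\<eta> (\<gamma> t))"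
    unfolding eventually_nhds by blast
  define J1 where "J1 = J \<inter> {-\<epsilon><..<\<epsilon>}"
  have J1: "open J1" "0 \<in> J1" "J1 \<subseteq> J" using open_J zero_J \<epsilon>(1) by (auto simp: J1_def)
  obtain \<rho> where \<rho>: "0 < \<rho>" "\<And>z. norm z < \<rho> \<Longrightarrow> z $ 2 = 0 \<Longrightarrow> \<exists>t\<in>J1. Z t = z"
    using Z_covers[OF J1] by blast
  have "open (cmap c ` (X \<inter> cdom c) \<inter> ball 0 R)"
    using S.open_image[OF c, of "X \<inter> cdom c"] oX S.open_cdom[OF c] by auto
  moreover have "0 \<in> cmap c ` (X \<inter> cdom c) \<inter> ball 0 R"
  proof -
    have "\<gamma> 0 = p" using Z_curve(6)[OF zero_J] cinv_zero Z_zero by (simp add: Z_def)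
    then have "0 \<in> cmap c ` (X \<inter> cdom c)" using X(1) p_dom p_zero by force
    then show ?thesis using zero_ball by blast
  qed
  ultimately obtain R0 where R0: "0 < R0" "ball 0 R0 \<subseteq> cmap c ` (X \<inter> cdom c) \<inter> ball 0 R"
    unfolding open_contains_ball by blast
  define R' where "R' = min R0 \<rho>"
  define U where "U = ball (0 :: real^2) R'"
  have R': "0 < R'" "U \<subseteq> cmap c ` (X \<inter> cdom c)" "U \<subseteq> ball 0 R" "R' \<le> \<rho>"
    using R0 \<rho>(1) subset_ball[of R' R0 "0::real^2"] by (auto simp: R'_def U_def)
  have oU: "open U" by (simp add: U_def)
  interpret L': straight_frontal "cmap d ` cdom d" ?G U ?F ?n H
    unfolding U_def by (rule L.straight_frontal_ball) (use R'(3) in \<open>simp add: U_def\<close>)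
  define h where "h z = \<eta> (cinv c z) c" for z
  have pt: "cinv c z \<in> X \<and> cinv c z \<in> cdom c \<and> f (cinv c z) \<in> cdom d \<and> cmap c (cinv c z) = z" if z: "z \<in> U" for z
  proof -
    obtain x where x: "x \<in> X" "x \<in> cdom c" "z = cmap c x" using R'(2) z by blast
    obtain q where q: "q \<in> W" "q \<in> cdom c" "f q \<in> cdom d" "z = cmap c q" "cinv c z = q"
      by (rule ball_point[OF subsetD[OF R'(3) z]])
    have "q = x" using q(5) S.cinv_cmap[OF c x(2)] x(3) by simp
    then show ?thesis using x q by simp
  qed
  have sm_h: "smooth_on U h"
    unfolding h_def by (rule smooth_on_subset[OF tangent_field_smooth[OF X(2) c] R'(2)])
  \<comment> \<open>In the null equation the \<partial>_v part drops out, because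
    \<open>f\<^sub>v\<close> vanishes on the axis, and \<open>f\<^sub>u\<close> is nonzero.\<close>
  have h0: "h z $ 1 = 0" if z: "z \<in> U" "z $ 2 = 0" for z
  proof -
    have "norm z < \<rho>" using z(1) R'(4) by (simp add: U_def)
    then obtain t where t: "t \<in> J1" "Z t = z" using \<rho>(2) z(2) by blast
    have q: "cinv c z = \<gamma> t" using Z_curve(6)[of t] t by (auto simp: J1_def)
    have "dmap A B f (cinv c z) (\<eta> (cinv c z)) = (\<lambda>_. 0)" using \<epsilon>(2)[of t] t(1) unfolding q by (simp add: J1_def)
    moreover have "dmap A B f (cinv c z) (\<eta> (cinv c z)) d = dd ?F (h z) z"
      using dmap_eq[OF \<eta>T c d, of "cinv c z"] pt[OF z(1)] by (simp add: h_def)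
    ultimately have "dd ?F (h z) z = 0" by simp
    moreover have "dd ?F (h z) z = h z $ 1 *\<^sub>R dd ?F e1 z + h z $ 2 *\<^sub>R dd ?F e2 z"
      using linear_vec_expand[OF linear_dd[OF smooth_onD_diff[OF L'.smooth_F z(1)]], of "h z"]
      by (simp only: UNIV_2_sum)
    moreover have "dd ?F e2 z = 0" using L'.F2[OF z(1)] z(2) by simp
    moreover have "dd ?F e1 z \<noteq> 0" using L'.E_pos[OF z(1)] by (auto simp: L'.E_def)
    ultimately show ?thesis by simp
  qed
  define f1 where "f1 = (\<lambda>z. dd ?F (h z) z)"
  define f2 where "f2 = (\<lambda>z. covd ?G ?F f1 (h z) z)"
  define f3 where "f3 = (\<lambda>z. covd ?G ?F f2 (h z) z)"
  define V1 where "V1 q = dmap A B f q (\<eta> q)" for q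
  define V2 where "V2 q = cov A B g f V1 q (\<eta> q)" for q
  define V3 where "V3 q = cov A B g f V2 q (\<eta> q)" for q
  have vV1: "vfield_along A B f X V1" unfolding V1_def[abs_def] by (rule vfield_dmap[OF X(2)])
  have vV2: "vfield_along A B f X V2" unfolding V2_def[abs_def] by (rule vfield_cov[OF vV1 X(2)])
  have vV3: "vfield_along A B f X V3" unfolding V3_def[abs_def] by (rule vfield_cov[OF vV2 X(2)])
  have h1: "V1 (cinv c z) d = f1 z" if "z \<in> U" for z
    using dmap_eq[OF \<eta>T c d, of "cinv c z"] pt[OF that] by (simp add: h_def V1_def f1_def)
  have h2: "V2 (cinv c z) d = f2 z" if z: "z \<in> U" for z
  proof -
    have "V2 (cinv c z) d = covd ?G ?F (\<lambda>z. V1 (cinv c z) d) (h z) z"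
      using cov_eq[OF vV1 _ \<eta>T c d, of "cinv c z"] pt[OF z] by (simp add: h_def V2_def)
    also have "\<dots> = f2 z" unfolding f2_def by (rule covd_cong[OF oU z refl h1])
    finally show ?thesis .
  qed
  have h3: "V3 (cinv c z) d = f3 z" if z: "z \<in> U" for z
  proof -
    have "V3 (cinv c z) d = covd ?G ?F (\<lambda>z. V2 (cinv c z) d) (h z) z"
      using cov_eq[OF vV2 _ \<eta>T c d, of "cinv c z"] pt[OF z] by (simp add: h_def V3_def)
    also have "\<dots> = f3 z" unfolding f3_def by (rule covd_cong[OF oU z refl h2])
    finally show ?thesis .
  qed
  define K where "K = (J1 \<inter> P) \<inter> (J1 \<inter> Z -` U)"
  have contZ: "continuous_on J1 Z"
    by (rule smooth_on_imp_continuous_on[OF smooth_on_subset[OF smooth_on_Z J1(3)]])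
  have K: "open K" "K \<subseteq> J" unfolding K_def
    using open_Int[OF open_Int[OF J1(1) P(1)] continuous_open_preimage[OF contZ J1(1) oU]] J1(3) by auto
  have K0: "0 \<in> K" using J1(2) P(2) Z_zero R'(1) by (simp add: K_def U_def Z_def)
  have "kappa_c A B g f \<gamma> \<eta> t =
    2 * sgn (L.r (Z t)) * L.N (Z t) * L.E (Z t) powr (3/4) * L.\<delta> (Z t) powr (- (3/4))" if t: "t \<in> K" for t
  proof -
    have tJ: "t \<in> J" using t K(2) by blast
    have zU: "Z t \<in> U" using t by (simp add: K_def)
    note zc = Z_curve[OF tJ]
    let ?q = "\<gamma> t" and ?z = "Z t" and ?w = "velocity B (f \<circ> \<gamma>) t" and ?b = "h (Z t) $ 2"
    have qX: "?q \<in> X" using pt[OF zU] zc(6) by simp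
    have T: "V2 ?q \<in> tangent_space B (f ?q)" "V3 ?q \<in> tangent_space B (f ?q)" "\<nu> ?q \<in> tangent_space B (f ?q)"
      using vV2 vV3 qX normal_tangent[OF normal zc(1)] by (simp_all add: vfield_along_def)
    note wT = velocity_tangent_B[OF tJ]
    have comp: "V2 ?q d = f2 ?z" "V3 ?q d = f3 ?z" "\<nu> ?q d = ?n ?z" "?w d = s t *\<^sub>R dd ?F e1 ?z"
      using h2[OF zU] h3[OF zU] zc(6) velocity_image[OF tJ] f_coord_1[OF tJ] by simp_all
    have vf: "vol_form B g (f ?q) a b e = vol3 ?G (?F ?z) (a d) (b d) (e d)"
      if "a \<in> tangent_space B (f ?q)" "b \<in> tangent_space B (f ?q)" "e \<in> tangent_space B (f ?q)" for a b e
      using T.vol_form_eq[OF d zc(3) that] rep_cmap[OF c zc(2), of d] zc(7) by simp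
    have nfd: "vol3 ?G (?F ?z) (dd ?F e1 ?z) (f2 ?z) (f3 ?z) = 2 * ?b ^ 5 * L.N ?z * L.r ?z"
      "vol3 ?G (?F ?z) (dd ?F e1 ?z) (f2 ?z) (?n ?z) = ?b\<^sup>2 * L.r ?z" "mip ?G (?F ?z) (?n ?z) (f2 ?z) = 0"
      unfolding f3_def f2_def f1_def
      by (rule L'.null_field_derivatives[OF sm_h h0 zU zc(5)]; assumption)+
    have "pos_oriented2 A ?q (velocity A \<gamma> t) (\<eta> ?q)" using P(3) t by (simp add: K_def)
    then have "0 < det (vector [velocity A \<gamma> t c, \<eta> ?q c] :: real^2^2)" using c zc(2) by (simp add: pos_oriented2_def)
    moreover have "velocity A \<gamma> t c = s t *\<^sub>R e1"
      using S.velocity_comp[OF curve subsetD[OF J_I tJ] c zc(2)] zc(9) by (simp add: Z_def)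
    moreover have "\<eta> ?q c = h ?z" using zc(6) by (simp add: h_def)
    \<comment> \<open>The velocity is a multiple of \<open>e1\<close>, so orientation of the pair
      \<open>{\<gamma>', \<eta>}\<close> reduces to the sign of one product, the sign condition of
      \<open>cuspidal_normalization\<close>.\<close>
    ultimately have sb: "0 < s t * ?b" by (simp add: det_2 axis_def)
    have E: "0 < L.E ?z" and r: "L.r ?z \<noteq> 0" "(L.r ?z)\<^sup>2 = L.\<delta> ?z"
      using L.E_pos[OF zc(4)] L.r_nz[OF zc(4)] L.r_square[OF zc(4)] by simp_all
    have v1: "vol_form B g (f ?q) ?w (V2 ?q) (V3 ?q) = s t * (2 * ?b ^ 5 * L.N ?z * L.r ?z)"
      unfolding vf[OF wT T(1,2)] comp vol3_scale nfd(1) ..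
    have v2: "vol_form B g (f ?q) ?w (V2 ?q) (\<nu> ?q) = s t * (?b\<^sup>2 * L.r ?z)"
      unfolding vf[OF wT T(1,3)] comp vol3_scale nfd(2) ..
    have "gnorm g (f ?q) (gcross B g (f ?q) ?w (V2 ?q)) = \<bar>vol_form B g (f ?q) ?w (V2 ?q) (\<nu> ?q)\<bar>"
    proof (rule T.gnorm_gcross[OF T(3) _ _ _ wT T(1)])
      show "g (f ?q) (\<nu> ?q) (\<nu> ?q) = 1" "g (f ?q) (\<nu> ?q) ?w = 0" "g (f ?q) (\<nu> ?q) (V2 ?q) = 0"
        unfolding g_rep[OF tJ T(3) T(3)] g_rep[OF tJ T(3) wT] g_rep[OF tJ T(3,1)] comp mip_scale
        using nfd(3) L.unit_n[OF zc(4)] L.normal_n[OF zc(4)] by simp_all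
      show "vol_form B g (f ?q) ?w (V2 ?q) (\<nu> ?q) \<noteq> 0" unfolding v2 using sb r by auto
    qed
    then have cr: "gnorm g (f ?q) (gcross B g (f ?q) ?w (V2 ?q)) = \<bar>s t\<bar> * ?b\<^sup>2 * \<bar>L.r ?z\<bar>"
      unfolding v2 by (simp add: abs_mult)
    have "kappa_c A B g f \<gamma> \<eta> t = gnorm g (f ?q) ?w powr (3/2) * vol_form B g (f ?q) ?w (V2 ?q) (V3 ?q)
         / gnorm g (f ?q) (gcross B g (f ?q) ?w (V2 ?q)) powr (5/2)"
      by (simp add: kappa_c_def Let_def V1_def[abs_def] V2_def[abs_def] V3_def[abs_def])
    also have "\<dots> = 2 * sgn (L.r ?z) * L.N ?z * L.E ?z powr (3/4) * L.\<delta> ?z powr (- (3/4))"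
      unfolding cr v1 gnorm_velocity[OF tJ] cuspidal_normalization[OF sb E r(1)] r(2) ..
    finally show ?thesis .
  qed
  then show ?thesis using K K0 by blast
qed

text \<open>The positive factor between \<kappa>_\<Pi> and \<open>\<phi>\<close> up to sign. From
  \<open>L / E\<close>, \<open>2 N E\<^sup>3\<^sup>/\<^sup>4
  \<delta>\<^sup>-\<^sup>3\<^sup>/\<^sup>4\<close> and \<open>L N = \<phi> \<delta>\<close> on the
  axis, the exponents are 3/4 - 1 for E and 1 - 3/4 for \<delta>.\<close>

definition "\<omega> z = 2 * L.E z powr (- (1/4)) * L.\<delta> z powr (1/4)"

lemma omega_pos: "z \<in> ball 0 R \<Longrightarrow> 0 < \<omega> z"
  using L.E_pos[of z] L.\<delta>_pos[of z] by (simp add: \<omega>_def)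

text \<open>\<open>r\<close> has no zero on the ball, which is connected; so a single sign serves
  the whole curve.\<close>

lemma sgn_r: assumes z: "z \<in> ball 0 R" shows "sgn (L.r z) = sgn (L.r 0)"
proof -
  have sm: "smooth_on (ball 0 R) L.r"
    unfolding L.r_def[abs_def]
    by (intro L.smooth_on_vol3 open_ball L.smooth_F L.F_in smooth_on_dd L.smooth_H L.smooth_n)
  have con: "connected (L.r ` ball 0 R)"
    by (rule connected_continuous_image[OF smooth_on_imp_continuous_on[OF sm] connected_ball])
  have nz: "0 \<notin> L.r ` ball 0 R" using L.r_nz by auto
  have "L.r z \<in> L.r ` ball 0 R" "L.r 0 \<in> L.r ` ball 0 R" using z zero_ball by blast+
  then show ?thesis
    using connectedD_interval[OF con, of "L.r z" "L.r 0" 0] connectedD_interval[OF con, of "L.r 0" "L.r z" 0]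
      nz L.r_nz[OF z] L.r_nz[OF zero_ball] by (auto simp: sgn_if)
qed

lemma kappa_Pi_eq:
  assumes ne: "null_extension A B f \<gamma> \<eta>"
  shows "\<forall>\<^sub>F t in nhds 0. t \<in> J \<and> kappa_Pi A B g f \<nu> \<gamma> \<eta> t = sgn (L.r 0) * L.\<phi> (Z t) * \<omega> (Z t)"
proof -
  obtain K where K: "open K" "0 \<in> K" "K \<subseteq> J" "\<And>t. t \<in> K \<Longrightarrow> kappa_c A B g f \<gamma> \<eta> t =
    2 * sgn (L.r (Z t)) * L.N (Z t) * L.E (Z t) powr (3/4) * L.\<delta> (Z t) powr (- (3/4))"
    using kappa_c_eq[OF ne] by blast
  have "kappa_Pi A B g f \<nu> \<gamma> \<eta> t = sgn (L.r 0) * L.\<phi> (Z t) * \<omega> (Z t)" if t: "t \<in> K" for t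
  proof -
    note zc = Z_curve[OF subsetD[OF K(3) t]]
    have e: "L.E (Z t) powr (3/4) = L.E (Z t) * L.E (Z t) powr (- (1/4))"
      "L.\<delta> (Z t) powr (- (3/4)) = L.\<delta> (Z t) powr (1/4) / L.\<delta> (Z t)"
      using powr_add[of "L.E (Z t)" 1 "- (1/4)"] powr_diff[of "L.\<delta> (Z t)" "1/4" 1] L.E_pos[OF zc(4)] L.\<delta>_pos[OF zc(4)]
      by simp_all
    show ?thesis
      unfolding kappa_Pi_def kappa_nu_eq[OF subsetD[OF K(3) t]] K(4)[OF t] sgn_r[OF zc(4)] L.\<phi>_axis[OF zc(5)] \<omega>_def e
      using L.E_pos[OF zc(4)] by simp
  qed
  then show ?thesis using K(1-3) eventually_nhds by blast
qed

lemma composite_derivative: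
  assumes "smooth_on (ball 0 R) h"
  shows "((\<lambda>t. h (Z t)) has_real_derivative s 0 * dd h e1 0) (at 0)"
proof -
  have Z0: "Z 0 = 0" using Z_zero by (simp add: Z_def)
  have dZ: "Z differentiable (at 0)" by (rule smooth_onD_diff[OF smooth_on_Z zero_J])
  have dh: "h differentiable (at (Z 0))" unfolding Z0 by (rule smooth_onD_diff[OF assms zero_ball])
  have dif: "(\<lambda>t. h (Z t)) differentiable (at 0)"
    using differentiable_chain_at[OF dZ dh] by (simp add: o_def)
  have "dd (\<lambda>t. h (Z t)) 1 0 = dd h (dd Z 1 0) (Z 0)" by (rule dd_compose[OF dZ dh])
  also have "\<dots> = s 0 * dd h e1 0"
    using linear_scale[OF linear_dd[OF dh]] Z0 Z_curve(9)[OF zero_J] by simp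
  finally have "vector_derivative (\<lambda>t. h (Z t)) (at 0) = s 0 * dd h e1 0" unfolding vector_derivative_dd[OF dif] .
  moreover have "((\<lambda>t. h (Z t)) has_real_derivative vector_derivative (\<lambda>t. h (Z t)) (at 0)) (at 0)"
    using dif vector_derivative_works has_real_derivative_iff_has_vector_derivative by blast
  ultimately show ?thesis by simp
qed

text \<open>The product rule for \<open>deriv\<close> requires differentiable factors, and
  differentiability of both curvatures is drawn from their coordinate formulas. The denominator is
  the speed of the image curve.\<close>

lemma kappa_Pi'_eq:
  assumes ne: "null_extension A B f \<gamma> \<eta>"
  shows "kappa_Pi' A B g f \<nu> \<gamma> \<eta> 0 = deriv (kappa_Pi A B g f \<nu> \<gamma> \<eta>) 0 / (\<bar>s 0\<bar> * sqrt (L.E 0))"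
proof -
  obtain K where K: "open K" "0 \<in> K" "K \<subseteq> J" "\<And>t. t \<in> K \<Longrightarrow> kappa_c A B g f \<gamma> \<eta> t =
    2 * sgn (L.r (Z t)) * L.N (Z t) * L.E (Z t) powr (3/4) * L.\<delta> (Z t) powr (- (3/4))"
    using kappa_c_eq[OF ne] by blast
  have Z0: "Z 0 = 0" using Z_zero by (simp add: Z_def)
  note dE = composite_derivative[OF L.smooth_E] and dL = composite_derivative[OF L.smooth_L]
    and dN = composite_derivative[OF L.smooth_N] and dd = composite_derivative[OF L.smooth_\<delta>]
  have pos: "0 < L.E (Z 0)" "0 < L.\<delta> (Z 0)" unfolding Z0 using L.E_pos[OF zero_ball] L.\<delta>_pos[OF zero_ball] by simp_all
  obtain D where D: "((\<lambda>t. L.L (Z t) / L.E (Z t)) has_real_derivative D) (at 0)"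
    using DERIV_divide[OF dL dE] pos(1) by force
  obtain D' where D': "((\<lambda>t. (2 * sgn (L.r 0)) * (L.N (Z t) * (L.E (Z t) powr (3/4) * L.\<delta> (Z t) powr (- (3/4)))))
      has_real_derivative D') (at 0)"
    using DERIV_cmult[OF DERIV_mult[OF dN DERIV_mult[OF DERIV_fun_powr[OF dE pos(1)] DERIV_fun_powr[OF dd pos(2)]]]]
    by blast
  have "(kappa_nu B g f \<nu> \<gamma> has_real_derivative D) (at 0)"
    by (rule has_field_derivative_transform_within_open[OF D K(1,2)]) (use K(3) kappa_nu_eq in auto)
  moreover have "(kappa_c A B g f \<gamma> \<eta> has_real_derivative D') (at 0)"
  proof (rule has_field_derivative_transform_within_open[OF D' K(1,2)])
    fix t assume t: "t \<in> K"
    show "(2 * sgn (L.r 0)) * (L.N (Z t) * (L.E (Z t) powr (3/4) * L.\<delta> (Z t) powr (- (3/4)))) = kappa_c A B g f \<gamma> \<eta> t"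
      unfolding K(4)[OF t] sgn_r[OF Z_curve(4)[OF subsetD[OF K(3) t]]] by simp
  qed
  ultimately have fd: "kappa_nu B g f \<nu> \<gamma> field_differentiable at 0" "kappa_c A B g f \<gamma> \<eta> field_differentiable at 0"
    unfolding field_differentiable_def by blast+
  have dP: "deriv (kappa_Pi A B g f \<nu> \<gamma> \<eta>) 0 = kappa_nu B g f \<nu> \<gamma> 0 * deriv (kappa_c A B g f \<gamma> \<eta>) 0
     + deriv (kappa_nu B g f \<nu> \<gamma>) 0 * kappa_c A B g f \<gamma> \<eta> 0"
    unfolding kappa_Pi_def[abs_def] using deriv_mult[OF fd] by simp
  have gn: "gnorm g ((f \<circ> \<gamma>) 0) (velocity B (f \<circ> \<gamma>) 0) = \<bar>s 0\<bar> * sqrt (L.E 0)"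
    using gnorm_velocity[OF zero_J] Z0 by simp
  show ?thesis
    unfolding kappa_Pi'_def arclength_deriv_def gn dP by (simp add: add_divide_distrib)
qed

lemma kappa_Pi_zero_iff:
  assumes ne: "null_extension A B f \<gamma> \<eta>"
  shows "kappa_Pi A B g f \<nu> \<gamma> \<eta> 0 = 0 \<longleftrightarrow> L.\<phi> 0 = 0"
proof -
  have "kappa_Pi A B g f \<nu> \<gamma> \<eta> 0 = sgn (L.r 0) * L.\<phi> (Z 0) * \<omega> (Z 0)"
    using eventually_nhds_x_imp_x[OF kappa_Pi_eq[OF ne]] by blast
  then show ?thesis
    using omega_pos[OF zero_ball] L.r_nz[OF zero_ball] Z_zero by (simp add: Z_def sgn_zero_iff)
qed

text \<open>As \<open>\<phi>\<close> vanishes at the origin, the derivative of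
  \<open>\<omega>\<close> drops out of the product rule; every other factor beside
  \<open>dd L.\<phi> e1 0\<close> is nonzero.\<close>

lemma kappa_Pi'_zero_iff:
  assumes ne: "null_extension A B f \<gamma> \<eta>" and z: "L.\<phi> 0 = 0"
  shows "kappa_Pi' A B g f \<nu> \<gamma> \<eta> 0 = 0 \<longleftrightarrow> dd L.\<phi> e1 0 = 0"
proof -
  have Z0: "Z 0 = 0" using Z_zero by (simp add: Z_def)
  note dE = composite_derivative[OF L.smooth_E] and dd = composite_derivative[OF L.smooth_\<delta>]
    and dphi = composite_derivative[OF L.smooth_\<phi>]
  have pos: "0 < L.E (Z 0)" "0 < L.\<delta> (Z 0)" unfolding Z0 using L.E_pos[OF zero_ball] L.\<delta>_pos[OF zero_ball] by simp_all
  obtain D where "((\<lambda>t. \<omega> (Z t)) has_real_derivative D) (at 0)"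
    using DERIV_mult[OF DERIV_cmult[OF DERIV_fun_powr[OF dE pos(1)]] DERIV_fun_powr[OF dd pos(2)]]
    unfolding \<omega>_def by blast
  from DERIV_mult[OF DERIV_cmult[OF dphi, of "sgn (L.r 0)"] this]
  have "((\<lambda>t. sgn (L.r 0) * L.\<phi> (Z t) * \<omega> (Z t)) has_real_derivative sgn (L.r 0) * (s 0 * dd L.\<phi> e1 0) * \<omega> 0) (at 0)"
    unfolding Z0 z by simp
  then have "deriv (\<lambda>t. sgn (L.r 0) * L.\<phi> (Z t) * \<omega> (Z t)) 0 = sgn (L.r 0) * (s 0 * dd L.\<phi> e1 0) * \<omega> 0"
    by (rule DERIV_imp_deriv)
  moreover have "deriv (kappa_Pi A B g f \<nu> \<gamma> \<eta>) 0 = deriv (\<lambda>t. sgn (L.r 0) * L.\<phi> (Z t) * \<omega> (Z t)) 0"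
    by (rule deriv_cong_ev[OF eventually_mono[OF kappa_Pi_eq[OF ne]] refl]) blast
  ultimately show ?thesis
    unfolding kappa_Pi'_eq[OF ne]
    using omega_pos[OF zero_ball] L.r_nz[OF zero_ball] Z_curve(8)[OF zero_J] L.E_pos[OF zero_ball] by (simp add: sgn_zero_iff)
qed

text \<open>At each parameter \<kappa>_\<Pi> is a nonzero multiple of \<open>\<phi>\<close>. From
  left to right the curve must reach every nearby point of the axis; the converse uses continuity of
  \<open>Z\<close>.\<close>

lemma kappa_Pi_eventually_zero_iff:
  assumes ne: "null_extension A B f \<gamma> \<eta>"
  shows "(\<forall>\<^sub>F t in nhds 0. kappa_Pi A B g f \<nu> \<gamma> \<eta> t = 0) \<longleftrightarrow> (\<exists>\<rho>>0. \<forall>z. norm z < \<rho> \<longrightarrow> z $ 2 = 0 \<longrightarrow> L.\<phi> z = 0)"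
    (is "?l \<longleftrightarrow> ?r")
proof -
  obtain K where K: "open K" "0 \<in> K" "\<And>t. t \<in> K \<Longrightarrow> t \<in> J \<and>
      kappa_Pi A B g f \<nu> \<gamma> \<eta> t = sgn (L.r 0) * L.\<phi> (Z t) * \<omega> (Z t)"
    using kappa_Pi_eq[OF ne] unfolding eventually_nhds by blast
  have iff: "kappa_Pi A B g f \<nu> \<gamma> \<eta> t = 0 \<longleftrightarrow> L.\<phi> (Z t) = 0" if "t \<in> K" for t
    using K(3)[OF that] omega_pos[of "Z t"] Z_curve(4)[of t] L.r_nz[OF zero_ball] by (simp add: sgn_zero_iff)
  show ?thesis
  proof
    assume ?l
    then obtain K' where K': "open K'" "0 \<in> K'" "\<And>t. t \<in> K' \<Longrightarrow> kappa_Pi A B g f \<nu> \<gamma> \<eta> t = 0"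
      unfolding eventually_nhds by blast
    have KK: "open (K \<inter> K')" "0 \<in> K \<inter> K'" "K \<inter> K' \<subseteq> J" using K K' by blast+
    obtain \<rho> where \<rho>: "0 < \<rho>" "\<And>z. norm z < \<rho> \<Longrightarrow> z $ 2 = 0 \<Longrightarrow> \<exists>t\<in>K \<inter> K'. Z t = z"
      using Z_covers[OF KK] by blast
    have "L.\<phi> z = 0" if z: "norm z < \<rho>" "z $ 2 = 0" for z
    proof -
      obtain t where t: "t \<in> K" "t \<in> K'" "Z t = z" using \<rho>(2)[OF z] by blast
      then show ?thesis using iff[OF t(1)] K'(3)[OF t(2)] by simp
    qed
    then show ?r using \<rho>(1) by blast
  next
    assume ?r
    then obtain \<rho> where \<rho>: "0 < \<rho>" "\<And>z. norm z < \<rho> \<Longrightarrow> z $ 2 = 0 \<Longrightarrow> L.\<phi> z = 0" by blast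
    have cont: "continuous_on J Z" by (rule smooth_on_imp_continuous_on[OF smooth_on_Z])
    have o: "open (K \<inter> (J \<inter> Z -` ball 0 \<rho>))"
      using K(1) continuous_open_preimage[OF cont open_J open_ball] by (rule open_Int)
    have "0 \<in> K \<inter> (J \<inter> Z -` ball 0 \<rho>)" using K(2) zero_J Z_zero \<rho>(1) by (simp add: Z_def)
    moreover have "kappa_Pi A B g f \<nu> \<gamma> \<eta> t = 0" if t: "t \<in> K \<inter> (J \<inter> Z -` ball 0 \<rho>)" for t
      using iff[of t] \<rho>(2)[of "Z t"] Z_curve(5)[of t] t by simp
    ultimately show ?l using o unfolding eventually_nhds by blast
  qed
qed

end

section \<open>Quotients of smooth functions on the blow up\<close>

definition polar :: "real \<times> real \<Rightarrow> real^2" where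
  "polar x = (fst x * cos (snd x)) *\<^sub>R e1 + (fst x * sin (snd x)) *\<^sub>R e2"

lemma blowdown_abs: "blowdown (abs_blowup x) = polar x"
  unfolding blowdown.abs_eq polar_def by (simp add: vec_eq_iff forall_2 axis_def)

lemma norm_polar [simp]: "norm (polar x) = \<bar>fst x\<bar>"
proof -
  have "(norm (polar x))\<^sup>2 = (fst x * cos (snd x))\<^sup>2 + (fst x * sin (snd x))\<^sup>2"
    unfolding power2_norm_eq_inner polar_def by (simp add: inner_vec_def sum_2 axis_def power2_eq_square)
  also have "\<dots> = (fst x)\<^sup>2 * ((cos (snd x))\<^sup>2 + (sin (snd x))\<^sup>2)"
    by (simp only: power_mult_distrib distrib_left)
  finally have "(norm (polar x))\<^sup>2 = \<bar>fst x\<bar>\<^sup>2" by simp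
  then show ?thesis by (rule power2_eq_imp_eq) simp_all
qed

lemma polar_eq_zero: "polar x = 0 \<longleftrightarrow> fst x = 0"
  using norm_polar[of x] norm_eq_zero[of "polar x"] by simp

definition "strip R = {x :: real \<times> real. \<bar>fst x\<bar> < R}"

lemma open_strip: "open (strip R)"
proof -
  have "strip R = fst -` {-R<..<R}" by (auto simp: strip_def)
  then show ?thesis by (simp add: open_vimage_fst)
qed

lemma polar_strip: "polar x \<in> ball 0 R \<longleftrightarrow> x \<in> strip R"
  by (simp add: strip_def)

lemma smooth_on_polar: "smooth_on (strip R) polar"
  unfolding polar_def[abs_def] by (intro smooth open_strip)

lemma dd_polar: "dd polar (1, 0) (0, \<theta>) = polar (1, \<theta>)"
proof -
  have "(polar has_derivative (\<lambda>h. (fst h * cos \<theta>) *\<^sub>R e1 + (fst h * sin \<theta>) *\<^sub>R e2)) (at (0, \<theta>))"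
    unfolding polar_def[abs_def] by (auto intro!: derivative_eq_intros)
  from dd_eqI[OF this] show ?thesis by (simp add: polar_def)
qed

lemma polar_shift: "blowup_rel x y \<Longrightarrow> polar y = polar x"
  using blowdown_abs[of x] blowdown_abs[of y] blowup.abs_eq_iff[of x y] by simp

text \<open>\<open>\<sigma>\<close> is the sign (-1)^k of the identification, written as a cosine so
  that it depends on \<open>x\<close> and \<open>y\<close> alone.\<close>

lemma blowup_rel_sign:
  assumes "blowup_rel x y"
  obtains \<sigma> :: real where "\<sigma> = cos (snd y - snd x)" "\<sigma> * \<sigma> = 1" "fst y = \<sigma> * fst x"
    "polar (1, snd y) = \<sigma> *\<^sub>R polar (1, snd x)"
proof -
  obtain k :: int where k: "snd y = snd x + of_int k * pi" "fst y = (if even k then fst x else - fst x)"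
    using assms by (auto simp: blowup_rel_def)
  have s: "sin (of_int k * pi) = 0" by (simp add: sin_zero_iff_int2)
  have c: "cos (of_int k * pi) = (if even k then 1 else -1)"
    using cos_npi_int[of k] by (simp add: mult.commute)
  show ?thesis
    by (rule that[of "cos (of_int k * pi)"])
      (use k s in \<open>simp_all add: polar_def c cos_add sin_add algebra_simps\<close>)
qed

text \<open>Along each ray \<open>h\<close> is divisible by the signed radius, which changes sign
  under the identification; so \<open>w\<close> does too. It is no function on the blow up, but a
  product of two such quotients is.\<close>

lemma polar_division:
  fixes h :: "real^2 \<Rightarrow> real"
  assumes R: "0 < R" and h: "smooth_on (ball 0 R) h" "h 0 = 0"
  obtains w where "smooth_on (strip R) w" "\<And>x. x \<in> strip R \<Longrightarrow> h (polar x) = fst x * w x"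
    "\<And>\<theta>. w (0, \<theta>) = dd h (polar (1, \<theta>)) 0"
    "\<And>x y. x \<in> strip R \<Longrightarrow> blowup_rel x y \<Longrightarrow> w y = cos (snd y - snd x) * w x"
proof -
  have e: "(1 :: real, 0 :: real) \<bullet> (1, 0) = 1" by simp
  have sm: "smooth_on (strip R) (\<lambda>x. h (polar x))"
    by (rule smooth_on_compose[OF h(1) open_strip _ smooth_on_polar]) (use polar_strip in blast)
  have sq: "squeeze (1 :: real, 0 :: real) t x \<in> strip R" if "x \<in> strip R" "0 \<le> t" "t \<le> 1" for x t
  proof -
    have "fst (squeeze (1 :: real, 0 :: real) t x) = t * fst x"
      by (cases x) (simp add: squeeze_def algebra_simps)
    moreover have "\<bar>t * fst x\<bar> \<le> 1 * \<bar>fst x\<bar>" unfolding abs_mult by (rule mult_right_mono) (use that in auto)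
    ultimately show ?thesis using that(1) by (simp add: strip_def)
  qed
  have z: "h (polar x) = 0" if "x \<in> strip R" "x \<bullet> (1 :: real, 0 :: real) = 0" for x
  proof -
    have "polar x = 0" using that(2) by (cases x) (simp add: polar_eq_zero)
    then show ?thesis using h(2) by simp
  qed
  obtain w where w: "smooth_on (strip R) w" "\<And>x. x \<in> strip R \<Longrightarrow> h (polar x) = (x \<bullet> (1, 0)) *\<^sub>R w x"
    "\<And>x. x \<in> strip R \<Longrightarrow> x \<bullet> (1, 0) = 0 \<Longrightarrow> w x = dd (\<lambda>x. h (polar x)) (1, 0) x"
    by (rule smooth_division[OF open_strip e sm sq z]) (assumption | rule that)+
  have w2: "h (polar x) = fst x * w x" if "x \<in> strip R" for x using w(2)[OF that] by (cases x) simp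
  have dh: "h differentiable (at 0)" by (rule smooth_onD_diff[OF h(1)]) (use R in simp)
  have w3: "w (0, \<theta>) = dd h (polar (1, \<theta>)) 0" for \<theta>
  proof -
    have in_s: "(0, \<theta>) \<in> strip R" using R by (simp add: strip_def)
    have p0: "polar (0, \<theta>) = 0" by (simp add: polar_eq_zero)
    have "w (0, \<theta>) = dd (\<lambda>x. h (polar x)) (1, 0) (0, \<theta>)" by (rule w(3)[OF in_s]) simp
    also have "\<dots> = dd h (dd polar (1, 0) (0, \<theta>)) (polar (0, \<theta>))"
      by (rule dd_compose[OF smooth_onD_diff[OF smooth_on_polar in_s]]) (use dh p0 in simp)
    finally show ?thesis unfolding dd_polar p0 .
  qed
  have "w y = cos (snd y - snd x) * w x" if x: "x \<in> strip R" and r: "blowup_rel x y" for x y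
  proof -
    obtain \<sigma> where \<sigma>: "\<sigma> = cos (snd y - snd x)" "\<sigma> * \<sigma> = 1" "fst y = \<sigma> * fst x"
      "polar (1, snd y) = \<sigma> *\<^sub>R polar (1, snd x)" by (rule blowup_rel_sign[OF r])
    have y: "y \<in> strip R" using x polar_shift[OF r] polar_strip[of x R] polar_strip[of y R] by simp
    show ?thesis
    proof (cases "fst x = 0")
      case True
      then have "x = (0, snd x)" "y = (0, snd y)" using \<sigma>(3) by (auto simp: prod_eq_iff)
      then have "w x = dd h (polar (1, snd x)) 0" "w y = dd h (polar (1, snd y)) 0" using w3 by metis+
      then show ?thesis using \<sigma>(1,4) linear_scale[OF linear_dd[OF dh]] by simp
    next
      case False
      have "fst x * (\<sigma> * w y) = fst y * w y" by (simp add: \<sigma>(3))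
      also have "\<dots> = h (polar x)" using w2[OF y] polar_shift[OF r] by simp
      also have "\<dots> = fst x * w x" by (rule w2[OF x])
      finally have *: "\<sigma> * w y = w x" using False by simp
      have "w y = \<sigma> * \<sigma> * w y" using \<sigma>(2) by simp
      also have "\<dots> = \<sigma> * w x" unfolding mult.assoc * ..
      finally show ?thesis unfolding \<sigma>(1) .
    qed
  qed
  then show ?thesis using that w(1) w2 w3 by blast
qed

lemma polar_linear:
  fixes T :: "real^2 \<Rightarrow> real"
  assumes "linear T"
  shows "T (polar (1, \<theta>)) = cos \<theta> * T e1 + sin \<theta> * T e2"
  by (simp add: polar_def linear_add[OF assms] linear_scale[OF assms])

text \<open>A nonzero linear form on the plane vanishes on a single line, that is, at one angle of a
  half-open half turn.\<close>

lemma finite_polar_zeros: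
  fixes T :: "real^2 \<Rightarrow> real"
  assumes T: "linear T" "T u \<noteq> 0"
  shows "finite {\<theta> \<in> {0..<pi}. T (polar (1, \<theta>)) = 0}"
proof (cases "\<exists>\<theta>. \<theta> \<in> {0..<pi} \<and> T (polar (1, \<theta>)) = 0")
  case True
  then obtain a where a: "a \<in> {0..<pi}" "cos a * T e1 + sin a * T e2 = 0" using polar_linear[OF T(1)] by auto
  have "b = a" if b: "b \<in> {0..<pi}" "cos b * T e1 + sin b * T e2 = 0" for b
  proof -
    have nz: "T e1 \<noteq> 0 \<or> T e2 \<noteq> 0"
      using linear_vec_expand[OF T(1), of u] T(2) by (auto simp: UNIV_2_sum)
    \<comment> \<open>At two zeros both right-hand sides vanish, and \<open>T\<close> is nonzero on
      one of the basis vectors, so the two angles agree modulo \<pi>.\<close>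
    have 1: "sin (b - a) * T e1 = sin b * (cos a * T e1 + sin a * T e2) - sin a * (cos b * T e1 + sin b * T e2)"
      by (simp add: sin_diff algebra_simps)
    have 2: "sin (b - a) * T e2 = cos a * (cos b * T e1 + sin b * T e2) - cos b * (cos a * T e1 + sin a * T e2)"
      by (simp add: sin_diff algebra_simps)
    have "sin (b - a) = 0" using 1 2 nz a(2) b(2) by auto
    moreover have "- pi < b - a" "b - a < pi" using a(1) b(1) by auto
    ultimately show ?thesis using sin_gt_zero[of "b - a"] sin_gt_zero[of "a - b"] sin_minus[of "b - a"]
      by (cases "b - a" "0::real" rule: linorder_cases) auto
  qed
  then have "{\<theta> \<in> {0..<pi}. T (polar (1, \<theta>)) = 0} \<subseteq> {a}" using polar_linear[OF T(1)] by auto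
  then show ?thesis by (rule finite_subset) simp
next
  case False
  then have e: "{\<theta> \<in> {0..<pi}. T (polar (1, \<theta>)) = 0} = {}" by blast
  show ?thesis unfolding e by simp
qed

lemma tendsto_eventually_eq:
  fixes a b :: "real \<Rightarrow> real"
  assumes "(a \<longlongrightarrow> l) (at 0)" "(b \<longlongrightarrow> m) (at 0)" "\<forall>\<^sub>F r in at 0. a r = b r"
  shows "l = m"
proof -
  have "(b \<longlongrightarrow> l) (at 0)" using assms(1) tendsto_cong[OF assms(3)] by simp
  from tendsto_unique[OF _ this assms(2)] show ?thesis by simp
qed

text \<open>Multiplying by \<open>V\<close> and cancelling the radius turns the relation between \<open>\<psi>\<close> and \<open>\<rho>\<close> into one
  that extends continuously to the exceptional fibre.\<close>

lemma polar_quotient: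
  fixes V F :: "real^2 \<Rightarrow> real"
  assumes R: "0 < R" and V: "smooth_on (ball 0 R) V" "V 0 = 0" "dd V u 0 \<noteq> 0" and F: "smooth_on (ball 0 R) F"
    and cont: "continuous_on (strip R) \<rho>" "continuous_on (strip R) \<psi>"
    and eq: "\<And>x. x \<in> strip R \<Longrightarrow> V (polar x) \<noteq> 0 \<Longrightarrow> V (polar x) * \<psi> x = \<rho> x * F (polar x)"
    and fin: "finite {\<theta> \<in> {0..<pi}. \<rho> (0, \<theta>) = 0}"
  shows "F 0 = 0" and "(\<And>\<theta>. \<psi> (0, \<theta>) = k * \<rho> (0, \<theta>)) \<Longrightarrow> dd F v 0 = k * dd V v 0"
proof -
  have z: "0 \<in> ball (0 :: real^2) R" using R by simp
  have lV: "linear (\<lambda>v. dd V v 0)" and lF: "linear (\<lambda>v. dd F v 0)"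
    by (rule linear_dd[OF smooth_onD_diff[OF V(1) z]], rule linear_dd[OF smooth_onD_diff[OF F z]])
  obtain w where w: "smooth_on (strip R) w" "\<And>x. x \<in> strip R \<Longrightarrow> V (polar x) = fst x * w x"
    "\<And>\<theta>. w (0, \<theta>) = dd V (polar (1, \<theta>)) 0"
    by (rule polar_division[OF R V(1,2)]) (rule that)
  \<comment> \<open>The directions in which neither \<open>\<rho>\<close> nor the differential of
    \<open>V\<close> vanishes. Only finitely many angles are excluded.\<close>
  define X where "X = {\<theta> \<in> {0..<pi}. \<rho> (0, \<theta>) \<noteq> 0 \<and> dd V (polar (1, \<theta>)) 0 \<noteq> 0}"
  have inf: "infinite X"
  proof
    assume "finite X"
    then have "finite (X \<union> {\<theta> \<in> {0..<pi}. \<rho> (0, \<theta>) = 0} \<union> {\<theta> \<in> {0..<pi}. dd V (polar (1, \<theta>)) 0 = 0})"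
      using fin finite_polar_zeros[OF lV V(3)] by blast
    moreover have "{0..<pi} \<subseteq> X \<union> {\<theta> \<in> {0..<pi}. \<rho> (0, \<theta>) = 0} \<union> {\<theta> \<in> {0..<pi}. dd V (polar (1, \<theta>)) 0 = 0}"
      by (auto simp: X_def)
    ultimately have "finite {0..<pi}" by (rule rev_finite_subset)
    then show False using infinite_Ico[OF pi_gt_zero] by blast
  qed
  have zs: "(0, \<theta>) \<in> strip R" for \<theta> using R by (simp add: strip_def)
  have ray: "((\<lambda>r. h (r, \<theta>)) \<longlongrightarrow> h (0, \<theta>)) (at 0)" if h: "continuous_on (strip R) h" for h :: "real \<times> real \<Rightarrow> real" and \<theta>
  proof -
    have "isCont h (0, \<theta>)"
      using h continuous_on_eq_continuous_at[OF open_strip] zs by blast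
    moreover have "((\<lambda>r. (r, \<theta>)) \<longlongrightarrow> (0, \<theta>)) (at (0::real))" by (intro tendsto_intros)
    ultimately show ?thesis by (rule isCont_tendsto_compose)
  qed
  have near: "\<forall>\<^sub>F r in at 0. (r, \<theta>) \<in> strip R \<and> r \<noteq> 0 \<and> V (polar (r, \<theta>)) \<noteq> 0" if "\<theta> \<in> X" for \<theta>
  proof -
    have "w (0, \<theta>) \<noteq> 0" using that w(3) by (simp add: X_def)
    then have "\<forall>\<^sub>F r in at 0. w (r, \<theta>) \<noteq> 0"
      using tendsto_imp_eventually_ne[OF ray[OF smooth_on_imp_continuous_on[OF w(1)]]] by blast
    moreover have "\<forall>\<^sub>F r in at (0::real). \<bar>r\<bar> < R \<and> r \<noteq> 0"
      unfolding eventually_at by (rule exI[of _ R]) (use R in \<open>auto simp: dist_real_def\<close>)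
    ultimately show ?thesis
    proof eventually_elim
      case (elim r)
      then have r: "(r, \<theta>) \<in> strip R" "r \<noteq> 0" "w (r, \<theta>) \<noteq> 0" by (simp_all add: strip_def)
      moreover have "V (polar (r, \<theta>)) = r * w (r, \<theta>)" using w(2)[OF r(1)] by simp
      ultimately show ?case by simp
    qed
  qed
  have cF: "continuous_on (strip R) (\<lambda>x. F (polar x))" and cV: "continuous_on (strip R) (\<lambda>x. V (polar x))"
    by (rule smooth_on_imp_continuous_on[OF smooth_on_compose[OF _ open_strip _ smooth_on_polar]],
        rule F V(1), use polar_strip in blast)+
  \<comment> \<open>Along this ray the left-hand side of the relation tends to 0 with
    \<open>V\<close>, while \<open>\<rho>\<close> stays nonzero in the limit; this forces
    \<open>F 0 = 0\<close>.\<close>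
  obtain \<theta>0 where \<theta>0: "\<theta>0 \<in> X" using inf by fastforce
  have "((\<lambda>r. V (polar (r, \<theta>0)) * \<psi> (r, \<theta>0)) \<longlongrightarrow> V (polar (0, \<theta>0)) * \<psi> (0, \<theta>0)) (at 0)"
    by (intro tendsto_mult ray cV cont)
  moreover have "((\<lambda>r. \<rho> (r, \<theta>0) * F (polar (r, \<theta>0))) \<longlongrightarrow> \<rho> (0, \<theta>0) * F (polar (0, \<theta>0))) (at 0)"
    by (intro tendsto_mult ray cF cont)
  moreover have "\<forall>\<^sub>F r in at 0. V (polar (r, \<theta>0)) * \<psi> (r, \<theta>0) = \<rho> (r, \<theta>0) * F (polar (r, \<theta>0))"
    using near[OF \<theta>0] by eventually_elim (use eq in blast)
  ultimately have "V (polar (0, \<theta>0)) * \<psi> (0, \<theta>0) = \<rho> (0, \<theta>0) * F (polar (0, \<theta>0))"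
    by (rule tendsto_eventually_eq)
  moreover have "polar (0, \<theta>0) = 0" by (simp add: polar_eq_zero)
  ultimately show F0: "F 0 = 0" using V(2) \<theta>0 by (simp add: X_def)
  obtain w' where w': "smooth_on (strip R) w'" "\<And>x. x \<in> strip R \<Longrightarrow> F (polar x) = fst x * w' x"
    "\<And>\<theta>. w' (0, \<theta>) = dd F (polar (1, \<theta>)) 0"
    by (rule polar_division[OF R F F0]) (rule that)
  have lim: "w (0, \<theta>) * \<psi> (0, \<theta>) = \<rho> (0, \<theta>) * w' (0, \<theta>)" if "\<theta> \<in> X" for \<theta>
  proof -
    have "((\<lambda>r. w (r, \<theta>) * \<psi> (r, \<theta>)) \<longlongrightarrow> w (0, \<theta>) * \<psi> (0, \<theta>)) (at 0)"
      by (intro tendsto_mult ray cont smooth_on_imp_continuous_on[OF w(1)])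
    moreover have "((\<lambda>r. \<rho> (r, \<theta>) * w' (r, \<theta>)) \<longlongrightarrow> \<rho> (0, \<theta>) * w' (0, \<theta>)) (at 0)"
      by (intro tendsto_mult ray cont smooth_on_imp_continuous_on[OF w'(1)])
    moreover have "\<forall>\<^sub>F r in at 0. w (r, \<theta>) * \<psi> (r, \<theta>) = \<rho> (r, \<theta>) * w' (r, \<theta>)"
      using near[OF that]
    proof eventually_elim
      case (elim r)
      then have "r * (w (r, \<theta>) * \<psi> (r, \<theta>)) = r * (\<rho> (r, \<theta>) * w' (r, \<theta>))"
        using eq[of "(r, \<theta>)"] w(2)[of "(r, \<theta>)"] w'(2)[of "(r, \<theta>)"] by (simp add: algebra_simps)
      then show ?case using elim by simp
    qed
    ultimately show ?thesis by (rule tendsto_eventually_eq)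
  qed
  assume k: "\<And>\<theta>. \<psi> (0, \<theta>) = k * \<rho> (0, \<theta>)"
  \<comment> \<open>The difference of the two sides is a linear form that vanishes at the infinitely
    many angles of \<open>X\<close>.\<close>
  show "dd F v 0 = k * dd V v 0"
  proof (rule ccontr)
    assume "dd F v 0 \<noteq> k * dd V v 0"
    moreover have "linear (\<lambda>v. dd F v 0 - k * dd V v 0)"
      using lF lV by (intro linearI) (simp_all add: linear_add linear_scale algebra_simps)
    ultimately have "finite {\<theta> \<in> {0..<pi}. dd F (polar (1, \<theta>)) 0 - k * dd V (polar (1, \<theta>)) 0 = 0}"
      using finite_polar_zeros by fastforce
    moreover have "dd F (polar (1, \<theta>)) 0 - k * dd V (polar (1, \<theta>)) 0 = 0" if t: "\<theta> \<in> X" for \<theta>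
    proof -
      have "\<rho> (0, \<theta>) \<noteq> 0" using t by (simp add: X_def)
      moreover have "\<rho> (0, \<theta>) * (dd V (polar (1, \<theta>)) 0 * k) = \<rho> (0, \<theta>) * dd F (polar (1, \<theta>)) 0"
        using lim[OF t] unfolding k w(3) w'(3) by (simp only: mult_ac)
      ultimately show ?thesis by (simp add: mult.commute)
    qed
    then have "X \<subseteq> {\<theta> \<in> {0..<pi}. dd F (polar (1, \<theta>)) 0 - k * dd V (polar (1, \<theta>)) 0 = 0}"
      unfolding X_def by blast
    ultimately show False using inf finite_subset by blast
  qed
qed

text \<open>Angles in \<open>{0..<pi}\<close> label the points of the exceptional fibre; injectivity
  turns finiteness of a set of fibre points into finiteness of a set of angles.\<close>

lemma abs_blowup_inj:
  assumes "a \<in> {0..<pi}" "b \<in> {0..<pi}" "abs_blowup (0, a) = abs_blowup (0, b)"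
  shows "a = b"
proof -
  obtain k :: int where k: "b = a + of_int k * pi"
    using assms(3) unfolding blowup.abs_eq_iff blowup_rel_def by auto
  have "\<bar>of_int k * pi\<bar> < 1 * pi" using k assms(1,2) by auto
  then have "\<bar>of_int k\<bar> < (1 :: real)" by (simp add: abs_mult)
  then have "k = 0" by linarith
  then show ?thesis using k by simp
qed

lemma exceptional_rep:
  assumes "fst x = 0"
  obtains \<theta> where "\<theta> \<in> {0..<pi}" "abs_blowup x = abs_blowup (0, \<theta>)"
proof -
  define k where "k = \<lfloor>snd x / pi\<rfloor>"
  define \<theta> where "\<theta> = snd x - of_int k * pi"
  have "of_int k \<le> snd x / pi" "snd x / pi < of_int k + 1" unfolding k_def by linarith+
  then have "of_int k * pi \<le> snd x" "snd x < (of_int k + 1) * pi" by (simp_all add: field_simps)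
  then have "\<theta> \<in> {0..<pi}" by (simp add: \<theta>_def algebra_simps)
  moreover have "blowup_rel x (0, \<theta>)"
    unfolding blowup_rel_def by (rule exI[of _ "- k"]) (use assms in \<open>simp add: \<theta>_def\<close>)
  ultimately show ?thesis using that blowup.abs_eq_iff by blast
qed

lemma blowup_rep: "blowup_rel x (rep_blowup (abs_blowup x))"
  using Quotient3_abs_rep[OF Quotient3_blowup, of "abs_blowup x"] blowup.abs_eq_iff by metis

section \<open>Boundedness of the Gaussian curvature\<close>

context straight_data
begin

lemma p_W: "p \<in> W"
  by (rule ball_point[OF zero_ball]) (use cinv_zero in simp)

lemma curve_data_exists:
  assumes sc: "singular_curve A B f p \<gamma>" and N: "open N" "p \<in> N"
  shows "\<exists>I J. curve_data A B g f p \<nu> W c d R H \<gamma> I J \<and> (\<forall>t\<in>J. \<gamma> t \<in> N)"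
proof -
  have NW: "open (N \<inter> W)" "p \<in> N \<inter> W" using N open_W p_W by auto
  obtain I J where IJ: "smooth_curve_on A I \<gamma>" "open J" "0 \<in> J" "J \<subseteq> I" "smooth_on J (cmap c \<circ> \<gamma>)" "(cmap c \<circ> \<gamma>) 0 = 0"
    "\<And>t. t \<in> J \<Longrightarrow> \<gamma> t \<in> N \<inter> W \<and> \<gamma> t \<in> cdom c \<and> (cmap c \<circ> \<gamma>) t \<in> ball 0 R \<and> (cmap c \<circ> \<gamma>) t $ 2 = 0 \<and>
       cinv c ((cmap c \<circ> \<gamma>) t) = \<gamma> t"
    "\<And>t. t \<in> J \<Longrightarrow> dd (cmap c \<circ> \<gamma>) 1 t = (dd (cmap c \<circ> \<gamma>) 1 t $ 1) *\<^sub>R e1 \<and> dd (cmap c \<circ> \<gamma>) 1 t $ 1 \<noteq> 0"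
    by (rule singular_curve_rep[OF sc NW]) (rule that)
  have "curve_data A B g f p \<nu> W c d R H \<gamma> I J"
    by (rule curve_data.intro[OF straight_data_axioms], unfold_locales) (use IJ in blast)+
  then show ?thesis using IJ(7) by blast
qed

text \<open>A bound M for |K| gives |\<phi>| \<le> |v| M off the axis, hence \<phi> = 0 on it by
  continuity. Conversely the smooth quotient of \<phi> by v agrees with K off the axis and is
  bounded on a compact ball.\<close>

lemma bounded_curvature_iff:
  "(\<exists>W' M. open W' \<and> p \<in> W' \<and> (\<forall>q\<in>W' \<inter> regular_points A B f. \<bar>frontal_curvature A B g f q\<bar> \<le> M))
    \<longleftrightarrow> (\<exists>\<rho>>0. \<forall>z. norm z < \<rho> \<longrightarrow> z $ 2 = 0 \<longrightarrow> L.\<phi> z = 0)" (is "?l \<longleftrightarrow> ?r")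
proof
  assume ?l
  then obtain W' M where W': "open W'" "p \<in> W'"
    and M: "\<And>q. q \<in> W' \<Longrightarrow> q \<in> regular_points A B f \<Longrightarrow> \<bar>frontal_curvature A B g f q\<bar> \<le> M" by blast
  have "open (cmap c ` (W' \<inter> cdom c) \<inter> ball 0 R)" by (intro open_Int S.open_image c W' open_ball)
  moreover have "0 \<in> cmap c ` (W' \<inter> cdom c) \<inter> ball 0 R"
    using W'(2) p_dom zero_ball p_zero[symmetric] by blast
  ultimately obtain \<rho> where \<rho>: "0 < \<rho>" "ball 0 \<rho> \<subseteq> cmap c ` (W' \<inter> cdom c) \<inter> ball 0 R"
    unfolding open_contains_ball by blast
  have bd: "\<bar>L.\<phi> z\<bar> \<le> \<bar>z $ 2\<bar> * M" if z: "z \<in> ball 0 \<rho>" "z $ 2 \<noteq> 0" for z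
  proof -
    have zR: "z \<in> ball 0 R" using z \<rho>(2) by blast
    obtain x where x: "x \<in> W'" "x \<in> cdom c" "z = cmap c x" using z \<rho>(2) by blast
    have "cinv c z = x" using S.cinv_cmap[OF c x(2)] x(3) by simp
    then have "\<bar>frontal_curvature A B g f (cinv c z)\<bar> \<le> M" using M[of x] x(1) regular_v[OF zR] z(2) by simp
    moreover have "\<bar>L.\<phi> z\<bar> = \<bar>z $ 2\<bar> * \<bar>frontal_curvature A B g f (cinv c z)\<bar>"
      unfolding curvature_v[OF zR z(2), symmetric] by (simp add: abs_mult)
    ultimately show ?thesis by (simp add: mult_left_mono)
  qed
  have "L.\<phi> z = 0" if z: "norm z < \<rho>" "z $ 2 = 0" for z
  proof -
    have zb: "z \<in> ball 0 R" "z \<in> ball 0 \<rho>" using z \<rho>(2) by auto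
    have line: "((\<lambda>t. z + t *\<^sub>R e2) \<longlongrightarrow> z) (at (0::real))" by (auto intro!: tendsto_eq_intros)
    have "isCont L.\<phi> z"
      using smooth_on_imp_continuous_on[OF L.smooth_\<phi>] continuous_on_eq_continuous_at[OF open_ball] zb(1) by blast
    from isCont_tendsto_compose[OF this line] have 1: "((\<lambda>t. \<bar>L.\<phi> (z + t *\<^sub>R e2)\<bar>) \<longlongrightarrow> \<bar>L.\<phi> z\<bar>) (at 0)"
      by (rule tendsto_rabs)
    have 2: "((\<lambda>t. \<bar>t\<bar> * M) \<longlongrightarrow> 0) (at (0::real))" by (auto intro!: tendsto_eq_intros)
    have "\<forall>\<^sub>F t in at (0::real). z + t *\<^sub>R e2 \<in> ball 0 \<rho>" by (rule topological_tendstoD[OF line open_ball zb(2)])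
    moreover have "\<forall>\<^sub>F t in at (0::real). t \<noteq> 0" by (rule eventually_neq_at_within)
    ultimately have "\<forall>\<^sub>F t in at (0::real). \<bar>L.\<phi> (z + t *\<^sub>R e2)\<bar> \<le> \<bar>t\<bar> * M"
    proof eventually_elim
      case (elim t)
      have "(z + t *\<^sub>R e2) $ 2 = t" using z(2) by (simp add: axis_def)
      then show ?case using bd[OF elim(1)] elim(2) by simp
    qed
    then have "\<bar>L.\<phi> z\<bar> \<le> 0" by (rule tendsto_le[OF _ 2 1, rotated]) simp
    then show ?thesis by simp
  qed
  then show ?r using \<rho>(1) by blast
next
  assume ?r
  then obtain \<rho> where \<rho>: "0 < \<rho>" "\<And>z. norm z < \<rho> \<Longrightarrow> z $ 2 = 0 \<Longrightarrow> L.\<phi> z = 0" by blast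
  define r where "r = min \<rho> R"
  have r: "0 < r" "ball (0 :: real^2) r \<subseteq> ball 0 R" "r \<le> \<rho>" using \<rho>(1) R_pos by (auto simp: r_def)
  have z: "L.\<phi> z = 0" if "z \<in> ball 0 r" "z \<bullet> e2 = 0" for z
    using \<rho>(2)[of z] that r(3) by (simp add: inner_axis2)
  obtain h where h: "smooth_on (ball 0 r) h" "\<And>z. z \<in> ball 0 r \<Longrightarrow> L.\<phi> z = (z \<bullet> e2) *\<^sub>R h z"
    by (rule smooth_division[OF open_ball e2_inner smooth_on_subset[OF L.smooth_\<phi> r(2)] squeeze_ball z])
      (assumption | rule that)+
  have "compact (h ` cball 0 (r/2))"
    by (rule compact_continuous_image[OF continuous_on_subset[OF smooth_on_imp_continuous_on[OF h(1)]]])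
      (use r in auto)
  then have "bounded (h ` cball 0 (r/2))" by (rule compact_imp_bounded)
  then obtain M where M: "\<And>z. z \<in> cball 0 (r/2) \<Longrightarrow> \<bar>h z\<bar> \<le> M"
    unfolding bounded_iff real_norm_def by blast
  let ?W = "{q \<in> cdom c. cmap c q \<in> ball 0 (r/2)}"
  have "\<bar>frontal_curvature A B g f q\<bar> \<le> M" if q: "q \<in> ?W" "q \<in> regular_points A B f" for q
  proof -
    have zr: "cmap c q \<in> ball 0 r" "cmap c q \<in> cball 0 (r/2)" using q(1) r(1) by auto
    have zR: "cmap c q \<in> ball 0 R" using zr(1) r(2) by blast
    have inv: "cinv c (cmap c q) = q" using S.cinv_cmap[OF c] q(1) by simp
    have v: "cmap c q $ 2 \<noteq> 0" using regular_v[OF zR] q(2) unfolding inv by simp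
    have "cmap c q $ 2 * frontal_curvature A B g f q = cmap c q $ 2 * h (cmap c q)"
      using curvature_v[OF zR v] h(2)[OF zr(1)] unfolding inv by (simp add: inner_axis2)
    then have "frontal_curvature A B g f q = h (cmap c q)" using v by simp
    then show ?thesis using M[OF zr(2)] by simp
  qed
  moreover have "p \<in> ?W" using p_dom p_zero r(1) by simp
  ultimately show ?l by (intro exI[of _ ?W] exI[of _ M] conjI open_ball_preimage) blast+
qed

end

section \<open>Rational boundedness and continuity of the Gaussian curvature\<close>

text \<open>The blow up is taken in an arbitrary centered chart \<open>e\<close>, whereas
  \<open>\<phi>\<close> lives in the straight chart \<open>c\<close>. Instead of comparing blow ups,
  the functions v and \<phi> are transported to \<open>e\<close>, where they become \<open>V\<close>
  and \<open>F\<close>.\<close>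

locale centered_data = straight_data A B g f p \<nu> W c d R H
  for A :: "('m::{t2_space,second_countable_topology}, 2) chart set"
    and B :: "('w::{t2_space,second_countable_topology}, 3) chart set" and g f p \<nu> W c d R H +
  fixes e :: "('m, 2) chart" and r :: real
  assumes e: "e \<in> A" and p_dom_e: "p \<in> cdom e" and p_zero_e: "cmap e p = 0" and r_pos: "0 < r"
    and ball_e: "ball 0 r \<subseteq> cmap e ` (cdom e \<inter> {q \<in> cdom c. cmap c q \<in> ball 0 R})"
begin

definition "\<tau> x = cmap c (cinv e x)"
definition "V x = \<tau> x $ 2"
definition "F x = L.\<phi> (\<tau> x)"

lemma point_e:
  assumes "x \<in> ball 0 r"
  shows "cinv e x \<in> cdom e" "cinv e x \<in> cdom c" "cmap e (cinv e x) = x" "\<tau> x \<in> ball 0 R"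
    "cinv c (\<tau> x) = cinv e x"
proof -
  obtain q where q: "q \<in> cdom e" "q \<in> cdom c" "cmap c q \<in> ball 0 R" "x = cmap e q" using assms ball_e by blast
  have "cinv e x = q" using S.cinv_cmap[OF e q(1)] q(4) by simp
  then show "cinv e x \<in> cdom e" "cinv e x \<in> cdom c" "cmap e (cinv e x) = x" "\<tau> x \<in> ball 0 R"
    "cinv c (\<tau> x) = cinv e x" using q S.cinv_cmap[OF c q(2)] by (simp_all add: \<tau>_def)
qed

lemma zero_e: "0 \<in> ball (0 :: real^2) r" "cinv e 0 = p" "\<tau> 0 = 0"
proof -
  show "0 \<in> ball (0 :: real^2) r" using r_pos by simp
  show "cinv e 0 = p" using S.cinv_cmap[OF e p_dom_e] p_zero_e by simp
  then show "\<tau> 0 = 0" using p_zero by (simp add: \<tau>_def)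
qed

lemma smooth_tau: "smooth_on (ball 0 r) \<tau>"
proof -
  have "ball 0 r \<subseteq> cmap e ` (cdom e \<inter> cdom c)" using ball_e by blast
  from smooth_on_subset[OF S.tr_smooth[OF e c] this] show ?thesis by (simp add: \<tau>_def[abs_def] o_def)
qed

lemma smooth_V: "smooth_on (ball 0 r) V" and smooth_F_e: "smooth_on (ball 0 r) F"
  unfolding V_def[abs_def] F_def[abs_def]
  by (rule smooth_on_vec_nth[OF open_ball smooth_tau],
      rule smooth_on_compose[OF L.smooth_\<phi> open_ball _ smooth_tau], use point_e(4) in blast)

lemma dd_V: "dd V v 0 = dd \<tau> v 0 $ 2" and dd_F: "dd F v 0 = dd L.\<phi> (dd \<tau> v 0) 0"
proof -
  have t: "\<tau> differentiable (at 0)" by (rule smooth_onD_diff[OF smooth_tau zero_e(1)])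
  show "dd V v 0 = dd \<tau> v 0 $ 2" unfolding V_def[abs_def] by (rule dd_bounded_linear[OF t bounded_linear_vec_nth])
  have "dd F v 0 = dd L.\<phi> (dd \<tau> v 0) (\<tau> 0)"
    unfolding F_def[abs_def]
    by (rule dd_compose[OF t], unfold zero_e(3), rule smooth_onD_diff[OF L.smooth_\<phi> zero_ball])
  then show "dd F v 0 = dd L.\<phi> (dd \<tau> v 0) 0" unfolding zero_e(3) .
qed

lemma surj_tau: "\<exists>v. dd \<tau> v 0 = u"
proof -
  have "surj (\<lambda>w. dd (cmap c \<circ> cinv e) w (cmap e p))" by (rule S.tr_surj[OF e c p_dom_e p_dom])
  then obtain v where "u = dd (cmap c \<circ> cinv e) v (cmap e p)" by (rule surjE)
  then show ?thesis unfolding p_zero_e by (auto simp: \<tau>_def[abs_def] o_def)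
qed

lemma V_zero: "V 0 = 0" "F 0 = L.\<phi> 0"
  by (simp_all add: V_def F_def zero_e(3))

lemma regular_V: "x \<in> ball 0 r \<Longrightarrow> cinv e x \<in> regular_points A B f \<longleftrightarrow> V x \<noteq> 0"
  using regular_v[OF point_e(4)] point_e(5) by (simp add: V_def)

lemma curvature_V: "x \<in> ball 0 r \<Longrightarrow> V x \<noteq> 0 \<Longrightarrow> V x * frontal_curvature A B g f (cinv e x) = F x"
  using curvature_v[OF point_e(4)] point_e(5) by (simp add: V_def F_def)

text \<open>Multiplied by \<open>V\<close>, the witness relation becomes
  \<open>V \<psi> = \<rho> F\<close> on the blow up, to which \<open>polar_quotient\<close> applies.
  For the second claim a direction mapped to \<open>e1\<close> is inserted: there the differential
  of \<open>V\<close> vanishes.\<close>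

lemma rational_witness_necessary:
  assumes wit: "rational_witness A e p W' (W' \<inter> regular_points A B f) (frontal_curvature A B g f) \<rho> \<psi>"
  shows "L.\<phi> 0 = 0" and "(\<And>b. b \<in> blowup_over e {p} \<Longrightarrow> \<psi> b = k * \<rho> b) \<Longrightarrow> dd L.\<phi> e1 0 = 0"
proof -
  let ?Q = "W' \<inter> regular_points A B f"
  have W': "open W'" "p \<in> W'" and sm: "blowup_smooth_on (blowup_over e W') \<rho>" "blowup_smooth_on (blowup_over e W') \<psi>"
    and fin: "finite {b \<in> blowup_over e {p}. \<rho> b = 0}"
    and eq: "\<And>b. b \<in> blowup_over e ?Q \<Longrightarrow> \<psi> b = \<rho> b * frontal_curvature A B g f (blowdown_at e b)"
    using wit unfolding rational_witness_def by blast+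
  have "open (cmap e ` (W' \<inter> cdom e) \<inter> ball 0 r)" by (intro open_Int S.open_image e W' open_ball)
  moreover have "0 \<in> cmap e ` (W' \<inter> cdom e) \<inter> ball 0 r"
    using W'(2) p_dom_e zero_e(1) p_zero_e[symmetric] by blast
  ultimately obtain r' where r': "0 < r'" "ball 0 r' \<subseteq> cmap e ` (W' \<inter> cdom e) \<inter> ball 0 r"
    unfolding open_contains_ball by blast
  have sub: "ball 0 r' \<subseteq> ball (0 :: real^2) r" using r'(2) by blast
  obtain u where u: "dd \<tau> u 0 = e2" using surj_tau by blast
  have du: "dd V u 0 \<noteq> 0" unfolding dd_V u by (simp add: axis_def)
  have over: "strip r' \<subseteq> abs_blowup -` blowup_over e W'"
  proof
    fix x assume "x \<in> strip r'"
    then have "polar x \<in> ball 0 r'" using polar_strip by blast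
    then have "polar x \<in> cmap e ` W'" using r'(2) by blast
    then show "x \<in> abs_blowup -` blowup_over e W'" by (simp add: blowup_over_def blowdown_abs)
  qed
  have cont: "continuous_on (strip r') (\<rho> \<circ> abs_blowup)" "continuous_on (strip r') (\<psi> \<circ> abs_blowup)"
    by (rule smooth_on_imp_continuous_on[OF smooth_on_subset[OF sm(1)[unfolded blowup_smooth_on_def] over]],
        rule smooth_on_imp_continuous_on[OF smooth_on_subset[OF sm(2)[unfolded blowup_smooth_on_def] over]])
  have rel: "V (polar x) * (\<psi> \<circ> abs_blowup) x = (\<rho> \<circ> abs_blowup) x * F (polar x)"
    if x: "x \<in> strip r'" "V (polar x) \<noteq> 0" for x
  proof -
    have px: "polar x \<in> ball 0 r'" using x(1) polar_strip by blast
    then obtain y where y: "y \<in> W'" "y \<in> cdom e" "polar x = cmap e y" using r'(2) by blast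
    have inv: "cinv e (polar x) = y" using S.cinv_cmap[OF e y(2)] y(3) by simp
    have "y \<in> ?Q" using regular_V[OF subsetD[OF sub px]] x(2) y(1) unfolding inv by blast
    then have "polar x \<in> cmap e ` ?Q" using y(3) by blast
    then have "abs_blowup x \<in> blowup_over e ?Q" unfolding blowup_over_def mem_Collect_eq blowdown_abs .
    from eq[OF this] have "\<psi> (abs_blowup x) = \<rho> (abs_blowup x) * frontal_curvature A B g f (cinv e (polar x))"
      unfolding blowdown_at_def blowdown_abs .
    then show ?thesis using curvature_V[OF subsetD[OF sub px] x(2)] by (simp add: mult.left_commute)
  qed
  have exc: "abs_blowup (0, \<theta>) \<in> blowup_over e {p}" for \<theta>
    by (simp add: blowup_over_def blowdown_abs p_zero_e polar_eq_zero)
  have fin': "finite {\<theta> \<in> {0..<pi}. (\<rho> \<circ> abs_blowup) (0, \<theta>) = 0}"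
  proof (rule finite_imageD)
    show "finite ((\<lambda>\<theta>. abs_blowup (0, \<theta>)) ` {\<theta> \<in> {0..<pi}. (\<rho> \<circ> abs_blowup) (0, \<theta>) = 0})"
      by (rule finite_subset[OF _ fin]) (use exc in auto)
    show "inj_on (\<lambda>\<theta>. abs_blowup (0, \<theta>)) {\<theta> \<in> {0..<pi}. (\<rho> \<circ> abs_blowup) (0, \<theta>) = 0}"
      by (rule inj_onI) (use abs_blowup_inj in blast)
  qed
  note pq = polar_quotient[OF r'(1) smooth_on_subset[OF smooth_V sub] V_zero(1) du
      smooth_on_subset[OF smooth_F_e sub] cont rel fin']
  show "L.\<phi> 0 = 0" using pq(1) V_zero(2) by simp
  assume k: "\<And>b. b \<in> blowup_over e {p} \<Longrightarrow> \<psi> b = k * \<rho> b"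
  obtain v where v: "dd \<tau> v 0 = e1" using surj_tau by blast
  have "dd F v 0 = k * dd V v 0" by (rule pq(2)) (use k[OF exc] in simp_all)
  then show "dd L.\<phi> e1 0 = 0" unfolding dd_F dd_V v by (simp add: axis_def)
qed

text \<open>With \<open>V = r w\<close> and \<open>F = r w'\<close> one has K = w'/w. Both
  \<open>w\<close> and \<open>w'\<close> change sign under the identification, so the fraction is
  expanded by \<open>w\<close>: the products \<open>w w\<close> and \<open>w w'\<close> descend to
  the blow up and serve as \<open>\<rho>\<close> and \<open>\<psi>\<close>.\<close>

lemma rational_witness_exists:
  assumes z: "L.\<phi> 0 = 0"
  shows "\<exists>W' \<rho> \<psi>. rational_witness A e p W' (W' \<inter> regular_points A B f) (frontal_curvature A B g f) \<rho> \<psi> \<and>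
    (dd L.\<phi> e1 0 = 0 \<longrightarrow> (\<exists>k. \<forall>b\<in>blowup_over e {p}. \<psi> b = k * \<rho> b))"
proof -
  let ?K = "frontal_curvature A B g f"
  define W' where "W' = {q \<in> cdom e. cmap e q \<in> ball 0 r}"
  define Q where "Q = W' \<inter> regular_points A B f"
  have W'_eq: "W' = cdom e \<inter> cmap e -` ball 0 r" by (auto simp: W'_def)
  have oW: "open W'"
    unfolding W'_eq by (rule continuous_open_preimage[OF S.continuous_on_cmap[OF e] S.open_cdom[OF e] open_ball])
  have inW: "q \<in> cdom e \<and> q \<in> cdom c \<and> cmap e q \<in> ball 0 r \<and> cinv e (cmap e q) = q \<and> cmap c q = \<tau> (cmap e q) \<and>
      cmap c q \<in> ball 0 R" if q: "q \<in> W'" for q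
  proof -
    have 1: "q \<in> cdom e" "cmap e q \<in> ball 0 r" using q by (simp_all add: W'_def)
    note 2 = point_e[OF 1(2)] and 3 = S.cinv_cmap[OF e 1(1)]
    show ?thesis using 1 2 3 by (simp add: \<tau>_def)
  qed
  have img: "cmap e ` W' = ball 0 r"
  proof
    show "cmap e ` W' \<subseteq> ball 0 r" by (auto simp: W'_def)
    show "ball 0 r \<subseteq> cmap e ` W'"
    proof
      fix x :: "real^2" assume x: "x \<in> ball 0 r"
      then have "cinv e x \<in> W'" using point_e[OF x] by (simp add: W'_def)
      then show "x \<in> cmap e ` W'" using point_e(3)[OF x] by (rule rev_image_eqI[OF _ sym])
    qed
  qed
  have Wc: "W' \<subseteq> cdom c" using inW by blast
  have regW: "q \<in> regular_points A B f \<longleftrightarrow> V (cmap e q) \<noteq> 0" if "q \<in> W'" for q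
    using regular_V[of "cmap e q"] inW[OF that] by simp
  have V_cmap: "V (cmap e q) = cmap c q $ 2" if "q \<in> W'" for q
    using inW[OF that] by (simp add: V_def)
  have Q_V: "Q = {q \<in> W'. V (cmap e q) \<noteq> 0}" unfolding Q_def using regW by blast
  have Q_eq: "Q = W' \<inter> (cdom c \<inter> cmap c -` {z. z $ 2 \<noteq> 0})"
  proof (rule set_eqI)
    fix q
    show "q \<in> Q \<longleftrightarrow> q \<in> W' \<inter> (cdom c \<inter> cmap c -` {z. z $ 2 \<noteq> 0})"
    proof (cases "q \<in> W'")
      case True
      then show ?thesis using V_cmap[OF True] subsetD[OF Wc True] by (simp add: Q_V)
    next
      case False
      then show ?thesis by (simp add: Q_V)
    qed
  qed
  have halfplanes: "open {z :: real^2. z $ 2 \<noteq> 0}"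
    by (intro open_Collect_neq continuous_intros)
  have oQ: "open Q"
    unfolding Q_eq
    by (intro open_Int oW continuous_open_preimage[OF S.continuous_on_cmap[OF c] S.open_cdom[OF c]] halfplanes)
  \<comment> \<open>Regular points are found near any point by a small displacement in the direction
    of v in the straight chart.\<close>
  have dense: "W' \<subseteq> closure Q"
  proof
    fix q assume q: "q \<in> W'"
    show "q \<in> closure Q"
      unfolding closure_iff_nhds_not_empty
    proof (intro allI impI)
      fix X T assume T: "T \<subseteq> X" "open T" "q \<in> T"
      have "open (cmap c ` ((T \<inter> W') \<inter> cdom c))" by (intro S.open_image c open_Int T(2) oW)
      moreover have "cmap c q \<in> cmap c ` ((T \<inter> W') \<inter> cdom c)" using T(3) q inW[OF q] by blast
      ultimately obtain s where s: "0 < s" "ball (cmap c q) s \<subseteq> cmap c ` ((T \<inter> W') \<inter> cdom c)"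
        unfolding open_contains_ball by blast
      obtain z where z: "z \<in> ball (cmap c q) s" "z $ 2 \<noteq> 0"
      proof (cases "cmap c q $ 2 = 0")
        case True
        show ?thesis
        proof (rule that[of "cmap c q + (s/2) *\<^sub>R e2"])
          show "cmap c q + (s/2) *\<^sub>R e2 \<in> ball (cmap c q) s" using s(1) by (simp add: dist_norm)
          show "(cmap c q + (s/2) *\<^sub>R e2) $ 2 \<noteq> 0" using True s(1) by (simp add: axis_def)
        qed
      next
        case False
        show ?thesis by (rule that[of "cmap c q"]) (use False s(1) in simp_all)
      qed
      then obtain x where x: "x \<in> T" "x \<in> W'" "x \<in> cdom c" "z = cmap c x" using s(2) by blast
      then have "x \<in> Q" using z(2) by (simp add: Q_eq)
      then show "Q \<inter> X \<noteq> {}" using x(1) T(1) by blast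
    qed
  qed
  have smK: "smooth_fun_on A Q ?K"
    unfolding smooth_fun_on_def
  proof (intro conjI ballI oQ)
    fix a assume a: "a \<in> A"
    let ?S = "cmap a ` (Q \<inter> cdom a)" and ?t = "cmap c \<circ> cinv a"
    have oS: "open ?S" by (rule S.open_image[OF a oQ])
    have pt: "?t x \<in> ball 0 R \<and> ?t x $ 2 \<noteq> 0 \<and> ?K (cinv a x) = L.\<phi> (?t x) / (?t x $ 2)" if x: "x \<in> ?S" for x
    proof -
      obtain q where q: "q \<in> Q" "q \<in> cdom a" "x = cmap a q" using x by blast
      have inv: "cinv a x = q" using S.cinv_cmap[OF a q(2)] q(3) by simp
      have qW: "q \<in> W'" and v: "cmap c q $ 2 \<noteq> 0" using q(1) by (simp_all add: Q_eq)
      have i: "cinv c (cmap c q) = q" using S.cinv_cmap[OF c] inW[OF qW] by blast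
      have "cmap c q $ 2 * ?K q = L.\<phi> (cmap c q)" using curvature_v[of "cmap c q"] inW[OF qW] v unfolding i by blast
      then have "?K q = L.\<phi> (cmap c q) / (cmap c q $ 2)" using v by (simp add: field_simps)
      moreover have "cmap c q \<in> ball 0 R" using inW[OF qW] by blast
      ultimately show ?thesis using v by (simp add: inv)
    qed
    have "Q \<inter> cdom a \<subseteq> cdom a \<inter> cdom c" using Wc unfolding Q_def by blast
    then have sub: "?S \<subseteq> cmap a ` (cdom a \<inter> cdom c)" by (rule image_mono)
    have smt: "smooth_on ?S ?t" by (rule smooth_on_subset[OF S.tr_smooth[OF a c] sub])
    have "smooth_on ?S (\<lambda>x. L.\<phi> (?t x) / (?t x $ 2))"
    proof (rule smooth_on_divide[OF oS])
      show "smooth_on ?S (\<lambda>x. L.\<phi> (?t x))"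
        by (rule smooth_on_compose[OF L.smooth_\<phi> oS _ smt]) (use pt in blast)
      show "smooth_on ?S (\<lambda>x. ?t x $ 2)" by (rule smooth_on_vec_nth[OF oS smt])
      show "?t x $ 2 \<noteq> 0" if "x \<in> ?S" for x using pt[OF that] by blast
    qed
    then show "smooth_on ?S (?K \<circ> cinv a)"
      by (rule smooth_on_cong_imp[OF _ oS]) (use pt in simp)
  qed
  have F0: "F 0 = 0" using V_zero(2) z by simp
  obtain w where w: "smooth_on (strip r) w" "\<And>x. x \<in> strip r \<Longrightarrow> V (polar x) = fst x * w x"
    "\<And>\<theta>. w (0, \<theta>) = dd V (polar (1, \<theta>)) 0"
    "\<And>x y. x \<in> strip r \<Longrightarrow> blowup_rel x y \<Longrightarrow> w y = cos (snd y - snd x) * w x"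
    by (rule polar_division[OF r_pos smooth_V V_zero(1)]) (rule that)
  obtain w' where w': "smooth_on (strip r) w'" "\<And>x. x \<in> strip r \<Longrightarrow> F (polar x) = fst x * w' x"
    "\<And>\<theta>. w' (0, \<theta>) = dd F (polar (1, \<theta>)) 0"
    "\<And>x y. x \<in> strip r \<Longrightarrow> blowup_rel x y \<Longrightarrow> w' y = cos (snd y - snd x) * w' x"
    by (rule polar_division[OF r_pos smooth_F_e F0]) (rule that)
  define \<rho> where "\<rho> b = w (rep_blowup b) * w (rep_blowup b)" for b
  define \<psi> where "\<psi> b = w (rep_blowup b) * w' (rep_blowup b)" for b
  \<comment> \<open>\<open>rep_blowup\<close> may return any representative; the sign by which it
    differs from \<open>x\<close> enters squared.\<close>
  have val: "\<rho> (abs_blowup x) = w x * w x" "\<psi> (abs_blowup x) = w x * w' x" if x: "x \<in> strip r" for x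
  proof -
    let ?y = "rep_blowup (abs_blowup x)"
    obtain \<sigma> where \<sigma>: "\<sigma> = cos (snd ?y - snd x)" "\<sigma> * \<sigma> = 1" by (rule blowup_rel_sign[OF blowup_rep]) (rule that)
    have y: "w ?y = \<sigma> * w x" "w' ?y = \<sigma> * w' x"
      unfolding \<sigma>(1) by (rule w(4)[OF x blowup_rep], rule w'(4)[OF x blowup_rep])
    have "\<rho> (abs_blowup x) = (\<sigma> * \<sigma>) * (w x * w x)" "\<psi> (abs_blowup x) = (\<sigma> * \<sigma>) * (w x * w' x)"
      unfolding \<rho>_def \<psi>_def y by (simp_all only: mult_ac)
    then show "\<rho> (abs_blowup x) = w x * w x" "\<psi> (abs_blowup x) = w x * w' x" unfolding \<sigma>(2) by simp_all
  qed
  have over: "abs_blowup x \<in> blowup_over e T \<longleftrightarrow> polar x \<in> cmap e ` T" for x T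
    by (simp add: blowup_over_def blowdown_abs)
  have over_W: "abs_blowup -` blowup_over e W' = strip r"
    by (rule set_eqI) (simp only: vimage_eq over img polar_strip)
  have inj: "inj_on (cmap e) W'" by (rule inj_on_inverseI[of _ "cinv e"]) (use inW in blast)
  have pW: "p \<in> W'" using p_dom_e p_zero_e r_pos by (simp add: W'_def)
  have over_p: "abs_blowup x \<in> blowup_over e {p} \<longleftrightarrow> fst x = 0" for x
    unfolding over by (simp add: p_zero_e polar_eq_zero)
  have over_Wp: "abs_blowup x \<in> blowup_over e (W' - {p}) \<longleftrightarrow> x \<in> strip r \<and> fst x \<noteq> 0" for x
  proof -
    have "cmap e ` (W' - {p}) = cmap e ` W' - cmap e ` {p}"
      by (rule inj_on_image_set_diff[OF inj]) (use pW in auto)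
    then have "cmap e ` (W' - {p}) = ball 0 r - {0}" unfolding img by (simp add: p_zero_e)
    then show ?thesis unfolding over by (simp add: strip_def polar_eq_zero)
  qed
  have over_Q: "abs_blowup x \<in> blowup_over e Q \<longleftrightarrow> x \<in> strip r \<and> fst x \<noteq> 0 \<and> w x \<noteq> 0" for x
  proof -
    have "cmap e ` Q = {x \<in> cmap e ` W'. V x \<noteq> 0}" unfolding Q_V by blast
    then have "abs_blowup x \<in> blowup_over e Q \<longleftrightarrow> x \<in> strip r \<and> V (polar x) \<noteq> 0"
      unfolding over img by (simp only: mem_Collect_eq polar_strip)
    then show ?thesis using w(2)[of x] by (cases "x \<in> strip r") simp_all
  qed
  have pQ: "p \<notin> Q" using p_zero by (simp add: Q_eq)
  have lV: "linear (\<lambda>v. dd V v 0)" by (rule linear_dd[OF smooth_onD_diff[OF smooth_V zero_e(1)]])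
  obtain u where u: "dd \<tau> u 0 = e2" using surj_tau by blast
  have du: "dd V u 0 \<noteq> 0" unfolding dd_V u by (simp add: axis_def)
  have s0: "(0, \<theta>) \<in> strip r" for \<theta> using r_pos by (simp add: strip_def)
  have wit: "rational_witness A e p W' Q ?K \<rho> \<psi>"
    unfolding rational_witness_def blowup_smooth_on_def over_W
  proof (intro conjI oW pW oQ dense smK)
    show "W' \<subseteq> cdom e" "Q \<subseteq> W'" by (auto simp: W'_def Q_def)
    have "smooth_on (strip r) (\<lambda>x. w x * w x)" by (rule smooth_on_mult[OF open_strip w(1) w(1)])
    then show "smooth_on (strip r) (\<rho> \<circ> abs_blowup)" by (rule smooth_on_cong_imp[OF _ open_strip]) (simp add: val)
    have "smooth_on (strip r) (\<lambda>x. w x * w' x)" by (rule smooth_on_mult[OF open_strip w(1) w'(1)])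
    then show "smooth_on (strip r) (\<psi> \<circ> abs_blowup)" by (rule smooth_on_cong_imp[OF _ open_strip]) (simp add: val)
    have ab: "abs_blowup x \<in> blowup_over e (Q - {p}) \<longleftrightarrow> abs_blowup x \<in> blowup_over e (W' - {p}) \<inter> {b. \<rho> b \<noteq> 0}" for x
    proof -
      have Qp: "Q - {p} = Q" using pQ by blast
      show ?thesis
        unfolding Qp over_Q Int_iff over_Wp mem_Collect_eq using val(1)[of x] by (cases "x \<in> strip r") simp_all
    qed
    show "blowup_over e (Q - {p}) = blowup_over e (W' - {p}) \<inter> {b. \<rho> b \<noteq> 0}"
    proof (rule set_eqI)
      show "b \<in> blowup_over e (Q - {p}) \<longleftrightarrow> b \<in> blowup_over e (W' - {p}) \<inter> {b. \<rho> b \<noteq> 0}" for b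
        by (induct b rule: blowup.abs_induct) (rule ab)
    qed
    have fib: "abs_blowup x \<in> (\<lambda>\<theta>. abs_blowup (0, \<theta>)) ` {\<theta> \<in> {0..<pi}. dd V (polar (1, \<theta>)) 0 = 0}"
      if x: "abs_blowup x \<in> blowup_over e {p}" "\<rho> (abs_blowup x) = 0" for x
    proof -
      have "fst x = 0" using x(1) over_p by blast
      then obtain \<theta> where t: "\<theta> \<in> {0..<pi}" "abs_blowup x = abs_blowup (0, \<theta>)" by (rule exceptional_rep)
      have "w (0, \<theta>) = 0" using x(2) val(1)[OF s0, of \<theta>] unfolding t(2) by simp
      then show ?thesis using t w(3) by auto
    qed
    have "b \<in> blowup_over e {p} \<longrightarrow> \<rho> b = 0 \<longrightarrow>
        b \<in> (\<lambda>\<theta>. abs_blowup (0, \<theta>)) ` {\<theta> \<in> {0..<pi}. dd V (polar (1, \<theta>)) 0 = 0}" for b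
      by (induct b rule: blowup.abs_induct) (intro impI fib)
    then have "{b \<in> blowup_over e {p}. \<rho> b = 0}
        \<subseteq> (\<lambda>\<theta>. abs_blowup (0, \<theta>)) ` {\<theta> \<in> {0..<pi}. dd V (polar (1, \<theta>)) 0 = 0}" by blast
    then show "finite {b \<in> blowup_over e {p}. \<rho> b = 0}"
      by (rule finite_subset[OF _ finite_imageI[OF finite_polar_zeros[OF lV du]]])
    have ab: "abs_blowup x \<in> blowup_over e Q \<longrightarrow> \<psi> (abs_blowup x) = \<rho> (abs_blowup x) * ?K (blowdown_at e (abs_blowup x))" for x
    proof
      assume "abs_blowup x \<in> blowup_over e Q"
      then have x: "x \<in> strip r" "fst x \<noteq> 0" "w x \<noteq> 0" using over_Q by blast+
      have px: "polar x \<in> ball 0 r" using x(1) polar_strip by blast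
      have "V (polar x) \<noteq> 0" using w(2)[OF x(1)] x by simp
      from curvature_V[OF px this] have "fst x * (w x * ?K (cinv e (polar x))) = fst x * w' x"
        unfolding w(2)[OF x(1)] w'(2)[OF x(1)] by (simp only: mult.assoc)
      then have "w x * ?K (cinv e (polar x)) = w' x" using x(2) by simp
      then show "\<psi> (abs_blowup x) = \<rho> (abs_blowup x) * ?K (blowdown_at e (abs_blowup x))"
        unfolding val[OF x(1)] blowdown_at_def blowdown_abs by (simp only: mult.assoc)
    qed
    have "b \<in> blowup_over e Q \<longrightarrow> \<psi> b = \<rho> b * ?K (blowdown_at e b)" for b
      by (induct b rule: blowup.abs_induct) (rule ab)
    then show "\<forall>b\<in>blowup_over e Q. \<psi> b = \<rho> b * ?K (blowdown_at e b)" by blast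
  qed
  have ex: "\<exists>k. \<forall>b\<in>blowup_over e {p}. \<psi> b = k * \<rho> b" if d0: "dd L.\<phi> e1 0 = 0"
  proof (intro exI ballI)
    \<comment> \<open>With vanishing u-derivative the differential of \<phi> at the origin is this
      multiple of dv, and the relation passes to \<open>F\<close> and \<open>V\<close> by the chain
      rule.\<close>
    let ?k = "dd L.\<phi> e2 0"
    have lphi: "linear (\<lambda>v. dd L.\<phi> v 0)" by (rule linear_dd[OF smooth_onD_diff[OF L.smooth_\<phi> zero_ball]])
    have dF: "dd F v 0 = ?k * dd V v 0" for v
      unfolding dd_F dd_V using linear_vec_expand[OF lphi, of "dd \<tau> v 0"] d0 by (simp add: UNIV_2_sum)
    have ab: "abs_blowup x \<in> blowup_over e {p} \<longrightarrow> \<psi> (abs_blowup x) = ?k * \<rho> (abs_blowup x)" for x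
    proof
      assume "abs_blowup x \<in> blowup_over e {p}"
      then have x0: "x = (0, snd x)" unfolding over_p by (simp add: prod_eq_iff)
      have "x \<in> strip r" by (subst x0) (rule s0)
      note v = val[OF this]
      have "w' x = ?k * w x" by (subst (1 2) x0) (simp only: w(3) w'(3) dF)
      then show "\<psi> (abs_blowup x) = ?k * \<rho> (abs_blowup x)" unfolding v by simp
    qed
    fix b assume b: "b \<in> blowup_over e {p}"
    have "b \<in> blowup_over e {p} \<longrightarrow> \<psi> b = ?k * \<rho> b"
      by (induct b rule: blowup.abs_induct) (rule ab)
    from mp[OF this b] show "\<psi> b = ?k * \<rho> b" .
  qed
  show ?thesis
  proof (rule exI[of _ W'], rule exI[of _ \<rho>], rule exI[of _ \<psi>], rule conjI)
    show "rational_witness A e p W' (W' \<inter> regular_points A B f) ?K \<rho> \<psi>" by (rule wit[unfolded Q_def])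
    show "dd L.\<phi> e1 0 = 0 \<longrightarrow> (\<exists>k. \<forall>b\<in>blowup_over e {p}. \<psi> b = k * \<rho> b)" by (rule impI) (rule ex)
  qed
qed

lemma rationally_bounded_iff:
  "(\<exists>W. rationally_bounded A e p W (W \<inter> regular_points A B f) (frontal_curvature A B g f)) \<longleftrightarrow> L.\<phi> 0 = 0"
  (is "?l \<longleftrightarrow> ?r")
proof
  assume ?l
  then obtain W' \<rho> \<psi> where "rational_witness A e p W' (W' \<inter> regular_points A B f) (frontal_curvature A B g f) \<rho> \<psi>"
    unfolding rationally_bounded_def by blast
  then show ?r by (rule rational_witness_necessary(1))
next
  assume ?r
  from rational_witness_exists[OF this] show ?l unfolding rationally_bounded_def by blast
qed

lemma rationally_continuous_iff:
  "(\<exists>W. rationally_continuous A e p W (W \<inter> regular_points A B f) (frontal_curvature A B g f))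
    \<longleftrightarrow> L.\<phi> 0 = 0 \<and> dd L.\<phi> e1 0 = 0" (is "?l \<longleftrightarrow> ?r")
proof
  assume ?l
  then obtain W' \<rho> \<psi> k where w: "rational_witness A e p W' (W' \<inter> regular_points A B f) (frontal_curvature A B g f) \<rho> \<psi>"
    and k: "\<forall>b\<in>blowup_over e {p}. \<psi> b = k * \<rho> b"
    unfolding rationally_continuous_def by (elim exE conjE)
  show ?r by (rule conjI[OF rational_witness_necessary(1)[OF w] rational_witness_necessary(2)[OF w bspec[OF k]]])
next
  assume ?r
  then have "L.\<phi> 0 = 0" "dd L.\<phi> e1 0 = 0" by blast+
  from rational_witness_exists[OF this(1)] this(2) show ?l unfolding rationally_continuous_def by meson
qed

end

lemma (in straight_data) centered_data_exists:
  assumes "centered_chart A p e"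
  shows "\<exists>r. centered_data A B g f p \<nu> W c d R H e r"
proof -
  have e: "e \<in> A" "p \<in> cdom e" "cmap e p = 0" using assms by (simp_all add: centered_chart_def)
  let ?O = "cmap e ` ({q \<in> cdom c. cmap c q \<in> ball 0 R} \<inter> cdom e)"
  have "open ?O" by (rule S.open_image[OF e(1) open_ball_preimage])
  moreover have "cmap e p \<in> ?O" using e(2) p_dom p_zero zero_ball by simp
  ultimately obtain r where r: "0 < r" "ball 0 r \<subseteq> ?O" unfolding e(3) open_contains_ball by blast
  have "ball 0 r \<subseteq> cmap e ` (cdom e \<inter> {q \<in> cdom c. cmap c q \<in> ball 0 R})" using r(2) by (simp only: Int_commute)
  then have "centered_data A B g f p \<nu> W c d R H e r"
    by (intro centered_data.intro[OF straight_data_axioms] centered_data_axioms.intro e r(1))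
  then show ?thesis by blast
qed

section \<open>Intrinsic invariance\<close>

text \<open>A point of the axis is a limit of points off it along \<open>e2\<close>.\<close>

lemma off_axis_eq:
  fixes h h' :: "real^2 \<Rightarrow> real"
  assumes "continuous_on (ball 0 r) h" "continuous_on (ball 0 r) h'"
    and eq: "\<And>z. z \<in> ball 0 r \<Longrightarrow> z $ 2 \<noteq> 0 \<Longrightarrow> h z = h' z" and z: "z \<in> ball 0 r"
  shows "h z = h' z"
proof (cases "z $ 2 = 0")
  case True
  have line: "((\<lambda>t. z + t *\<^sub>R e2) \<longlongrightarrow> z) (at (0::real))" by (auto intro!: tendsto_eq_intros)
  have c: "isCont h z" "isCont h' z"
    using assms(1,2) continuous_on_eq_continuous_at[OF open_ball] z by blast+
  have "\<forall>\<^sub>F t in at (0::real). z + t *\<^sub>R e2 \<in> ball 0 r" by (rule topological_tendstoD[OF line open_ball z])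
  moreover have "\<forall>\<^sub>F t in at (0::real). t \<noteq> 0" by (rule eventually_neq_at_within)
  ultimately have "\<forall>\<^sub>F t in at (0::real). h (z + t *\<^sub>R e2) = h' (z + t *\<^sub>R e2)"
  proof eventually_elim
    case (elim t)
    have "(z + t *\<^sub>R e2) $ 2 = t" using True by (simp add: axis_def)
    then show ?case using eq[OF elim(1)] elim(2) by simp
  qed
  then show ?thesis
    by (rule tendsto_eventually_eq[OF isCont_tendsto_compose[OF c(1) line] isCont_tendsto_compose[OF c(2) line]])
qed (use eq[OF z] in blast)

text \<open>Two frontals read in one source chart, each with its own target chart, normal and
  extension \<open>H\<close>. \<open>E\<close> is an entry of the common form;
  \<open>\<delta>\<close> and \<open>\<phi>\<close> are built from extrinsic data, and are
  recognized off the axis as det/v^2 and v K.\<close>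

locale straight_pair = D: straight_frontal V G "ball 0 r" F n H + D': straight_frontal V' G' "ball 0 r" F' n' H'
  for V G r F n H V' G' F' n' H' +
  assumes pb_eq: "z \<in> ball 0 r \<Longrightarrow> pb G F z = pb G' F' z"
begin

lemma E_eq: "z \<in> ball 0 r \<Longrightarrow> D.E z = D'.E z"
proof -
  assume "z \<in> ball 0 r"
  then have "pb G F z $ 1 $ 1 = pb G' F' z $ 1 $ 1" by (simp only: pb_eq)
  then show "D.E z = D'.E z" by (simp add: pb_def D.E_def D'.E_def)
qed

lemma delta_eq: "z \<in> ball 0 r \<Longrightarrow> D.\<delta> z = D'.\<delta> z"
proof (rule off_axis_eq[of r D.\<delta> D'.\<delta>])
  show "D.\<delta> z = D'.\<delta> z" if z: "z \<in> ball 0 r" "z $ 2 \<noteq> 0" for z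
    using D.det_pb[OF z(1)] D'.det_pb[OF z(1)] pb_eq[OF z(1)] z(2) by simp
qed (rule smooth_on_imp_continuous_on[OF D.smooth_\<delta>] smooth_on_imp_continuous_on[OF D'.smooth_\<delta>] | assumption)+

lemma phi_eq: "z \<in> ball 0 r \<Longrightarrow> D.\<phi> z = D'.\<phi> z"
proof (rule off_axis_eq[of r D.\<phi> D'.\<phi>])
  show "D.\<phi> z = D'.\<phi> z" if z: "z \<in> ball 0 r" "z $ 2 \<noteq> 0" for z
    using D.curvature_singularity[OF z] D'.curvature_singularity[OF z] kform_cong[OF open_ball z(1) pb_eq] by simp
qed (rule smooth_on_imp_continuous_on[OF D.smooth_\<phi>] smooth_on_imp_continuous_on[OF D'.smooth_\<phi>] | assumption)+

end

text \<open>The connection term of \<nabla>_v \<open>f\<^sub>v\<close> contains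
  \<open>f\<^sub>v\<close>, which vanishes at \<open>p\<close>, so the covariant second derivative
  is the ordinary one there.\<close>

lemma (in frontal_map) straight_volume:
  assumes n: "normal_on W \<nu>" "open W" "p \<in> W" and sc: "straight_chart p c" and d: "d \<in> B" "f p \<in> cdom d"
  shows "dd (rep c d) e2 0 = 0"
    and "vol_form B g (f p) (f_coord A B f c 1 p) (f_vv A B g f c p) (\<nu> p)
      = vol3 (mcomp B g d) (rep c d 0) (dd (rep c d) e1 0) (dd (dd (rep c d) e2) e2 0) (\<nu> (cinv c 0) d)"
proof -
  have c: "c \<in> A" "p \<in> cdom c" "cmap c p = 0"
    using sc unfolding straight_chart_def centered_chart_def by blast+
  have "cmap c p $ 2 = 0 \<longrightarrow> f_coord A B f c 2 p = (\<lambda>_. 0)"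
    by (rule eventually_nhds_x_imp_x[OF conjunct2[OF sc[unfolded straight_chart_def]]])
  then have "f_coord A B f c 2 p d = 0" using c(3) by simp
  then show F2: "dd (rep c d) e2 0 = 0" using f_coord_rep[OF c(1) d(1) c(2) d(2), of 2] c(3) by (simp add: f_coord_def)
  have fc: "f_coord A B f c i = (\<lambda>q. dmap A B f q (cfield A c i q))" for i by (rule ext) (simp add: f_coord_def)
  have ct: "cfield A c i p \<in> tangent_space A p" for i by (rule S.cfield_tangent[OF c(1,2)])
  have vf: "vfield_along A B f (cdom c) (f_coord A B f c 2)"
    unfolding fc by (rule vfield_dmap[OF S.cfield_vfield[OF c(1)]])
  have T: "f_coord A B f c 1 p \<in> tangent_space B (f p)" "f_vv A B g f c p \<in> tangent_space B (f p)"
    unfolding f_vv_def f_coord_def[of A B f c 1] by (rule dmap_tangent[OF ct], rule cov_tangent[OF vf c(2) ct])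
  have "f_vv A B g f c p d = covd (mcomp B g d) (rep c d) (dd (rep c d) e2) e2 0"
    unfolding f_vv_def fc using cov_f_coord[OF c(1) d(1) c(2) d(2), of 2 2] c(3) by simp
  then have fvv: "f_vv A B g f c p d = dd (dd (rep c d) e2) e2 0" by (simp add: covd_def F2)
  have fu: "f_coord A B f c 1 p d = dd (rep c d) e1 0"
    using f_coord_rep[OF c(1) d(1) c(2) d(2), of 1] c(3) by (simp add: f_coord_def)
  have inv: "cinv c 0 = p" using S.cinv_cmap[OF c(1,2)] c(3) by simp
  have "cmap d (f p) = rep c d 0" using rep_cmap[OF c(1,2), of d] c(3) by simp
  then show "vol_form B g (f p) (f_coord A B f c 1 p) (f_vv A B g f c p) (\<nu> p)
      = vol3 (mcomp B g d) (rep c d 0) (dd (rep c d) e1 0) (dd (dd (rep c d) e2) e2 0) (\<nu> (cinv c 0) d)"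
    using T.vol_form_eq[OF d T normal_tangent[OF n(1,3)]] unfolding fvv fu inv by simp
qed

text \<open>At \<open>p\<close> the extension \<open>H\<close> equals
  \<open>f\<^sub>v\<^sub>v\<close>, so the normalization of the normal says that \<open>r\<close> is
  positive at the origin; the square of the same volume is the Gram determinant.\<close>

lemma (in frontal_map) normalized_straight_data:
  assumes n: "normal_on W \<nu>" "open W" "p \<in> W" and sc: "straight_chart p c"
    and pos: "0 < vol_form B g (f p) (f_coord A B f c 1 p) (f_vv A B g f c p) (\<nu> p)"
  shows "\<exists>d R H. straight_data A B g f p \<nu> W c d R H \<and>
    0 < straight_frontal.r (mcomp B g d) (rep c d) (\<lambda>z. \<nu> (cinv c z) d) H 0"
proof -
  obtain d where d: "d \<in> B" "f p \<in> cdom d" using T.ex_chart by blast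
  have c: "c \<in> A" "p \<in> cdom c" "cmap c p = 0"
    using sc unfolding straight_chart_def centered_chart_def by blast+
  note vol = straight_volume[OF n sc d]
  interpret K: coord_frontal "cmap d ` cdom d" "mcomp B g d" "ndom W c d" "rep c d" "\<lambda>z. \<nu> (cinv c z) d"
    by (rule coord_frontal_rep[OF n(1,2) c(1) d(1)])
  have "cmap c p \<in> ndom W c d" using n(3) c(2) d(2) by (simp add: ndom_def)
  then have z0: "0 \<in> ndom W c d" using c(3) by simp
  have gram: "0 < straight_gram (mcomp B g d) (rep c d)"
    unfolding K.straight_gram_square[OF z0 vol(1)] vol(2)[symmetric] using pos by simp
  obtain R H where sd: "straight_data A B g f p \<nu> W c d R H"
    using straight_data_exists[OF n sc d gram] by blast
  interpret D: straight_data A B g f p \<nu> W c d R H by (rule sd)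
  have "dd (dd (rep c d) e2) e2 0 = covd (mcomp B g d) (rep c d) (dd (rep c d) e2) e2 0"
    by (simp add: covd_def vol(1))
  also have "\<dots> = H 0" using D.L.covd_F2[OF D.zero_ball, of e2] by simp
  finally have "D.L.r 0 = vol_form B g (f p) (f_coord A B f c 1 p) (f_vv A B g f c p) (\<nu> p)"
    unfolding vol(2) D.L.r_def by simp
  then have r: "0 < D.L.r 0" using pos by simp
  show ?thesis by (rule exI[of _ d], rule exI[of _ R], rule exI[of _ H], rule conjI[OF sd r])
qed

text \<open>With both signs \<open>sgn (r 0)\<close> equal to 1, the formula for \<kappa>_\<Pi>
  contains nothing but \<open>E\<close>, \<open>\<delta>\<close> and \<open>\<phi>\<close>, which
  agree for the two frontals. Equality near 0 gives equality of the derivatives, and the image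
  curves have equal speed.\<close>

lemma intrinsic_product_curvature:
  assumes sd: "straight_data A B g f p \<nu> W c d R H" and sd': "straight_data A B' g' f' p \<nu>' W' c d' R' H'"
    and pos: "0 < straight_frontal.r (mcomp B g d) (smooth_mapping.rep f c d) (\<lambda>z. \<nu> (cinv c z) d) H 0"
      "0 < straight_frontal.r (mcomp B' g' d') (smooth_mapping.rep f' c d') (\<lambda>z. \<nu>' (cinv c z) d') H' 0"
    and forms: "\<forall>\<^sub>F q in nhds p. \<forall>a\<in>tangent_space A q. \<forall>b\<in>tangent_space A q.
          first_form A B' g' f' q a b = first_form A B g f q a b"
    and sc: "singular_curve A B f p \<gamma>" and ne: "null_extension A B f \<gamma> \<eta>" "null_extension A B' f' \<gamma> \<eta>'"
  shows "(\<forall>\<^sub>F t in nhds 0. kappa_Pi A B' g' f' \<nu>' \<gamma> \<eta>' t = kappa_Pi A B g f \<nu> \<gamma> \<eta> t) \<and>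
     kappa_Pi' A B' g' f' \<nu>' \<gamma> \<eta>' 0 = kappa_Pi' A B g f \<nu> \<gamma> \<eta> 0"
proof -
  interpret D: straight_data A B g f p \<nu> W c d R H by (rule sd)
  interpret D': straight_data A B' g' f' p \<nu>' W' c d' R' H' by (rule sd')
  obtain N where N: "open N" "p \<in> N" and same: "\<And>q. q \<in> N \<Longrightarrow> \<forall>a\<in>tangent_space A q. \<forall>b\<in>tangent_space A q.
          first_form A B' g' f' q a b = first_form A B g f q a b"
    using forms unfolding eventually_nhds by blast
  let ?O = "cmap c ` (N \<inter> cdom c) \<inter> (ball 0 R \<inter> ball 0 R')"
  have "open ?O" by (intro open_Int D.S.open_image D.c N(1) open_ball)
  moreover have "0 \<in> ?O"
  proof -
    have "cmap c p \<in> cmap c ` (N \<inter> cdom c)" by (rule imageI[OF IntI[OF N(2) D.p_dom]])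
    then show ?thesis unfolding D.p_zero by (rule IntI[OF _ IntI[OF D.zero_ball D'.zero_ball]])
  qed
  ultimately obtain r where r: "0 < r" "ball 0 r \<subseteq> ?O" unfolding open_contains_ball by blast
  have sub: "ball (0 :: real^2) r \<subseteq> ball 0 R" "ball (0 :: real^2) r \<subseteq> ball 0 R'" using r(2) by blast+
  have pb: "pb (mcomp B g d) (D.rep c d) z = pb (mcomp B' g' d') (D'.rep c d') z" if z: "z \<in> ball 0 r" for z
  proof -
    obtain x where x: "x \<in> N" "x \<in> cdom c" "z = cmap c x" using z r(2) by blast
    have inv: "cinv c z = x" using D.S.cinv_cmap[OF D.c x(2)] x(3) by simp
    obtain q where q: "q \<in> cdom c" "f q \<in> cdom d" "z = cmap c q" by (rule D.ball_point[OF subsetD[OF sub(1) z]])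
    obtain q' where q': "q' \<in> cdom c" "f' q' \<in> cdom d'" "z = cmap c q'" by (rule D'.ball_point[OF subsetD[OF sub(2) z]])
    have dom: "z \<in> D.rdom c d" "z \<in> D'.rdom c d'" using D.rdomI[OF q(1,2)] D'.rdomI[OF q'(1,2)] q(3) q'(3) by simp_all
    have t: "cfield A c i x \<in> tangent_space A x" for i by (rule D.S.cfield_tangent[OF D.c x(2)])
    have "mcomp A (first_form A B' g' f') c z = mcomp A (first_form A B g f) c z"
      unfolding mcomp_def inv using same[OF x(1)] t by (simp add: vec_eq_iff)
    then show ?thesis unfolding D.mcomp_first_form[OF D.c D.d dom(1)] D'.mcomp_first_form[OF D'.c D'.d dom(2)] by simp
  qed
  interpret P: straight_pair "cmap d ` cdom d" "mcomp B g d" r "D.rep c d" "\<lambda>z. \<nu> (cinv c z) d" H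
      "cmap d' ` cdom d'" "mcomp B' g' d'" "D'.rep c d'" "\<lambda>z. \<nu>' (cinv c z) d'" H'
    by (rule straight_pair.intro[OF D.L.straight_frontal_ball[OF sub(1)] D'.L.straight_frontal_ball[OF sub(2)]],
        rule straight_pair_axioms.intro, rule pb)
  \<comment> \<open>The curve is cut down to the common domain, so that one interval
    \<open>J\<close> serves both frontals.\<close>
  have N1: "open (W' \<inter> {q \<in> cdom c. cmap c q \<in> ball 0 r})" "p \<in> W' \<inter> {q \<in> cdom c. cmap c q \<in> ball 0 r}"
    by (rule open_Int[OF D'.open_W D.open_ball_preimage]) (use D'.p_W D.p_dom D.p_zero r(1) in simp)
  from D.curve_data_exists[OF sc N1] obtain I J where C: "curve_data A B g f p \<nu> W c d R H \<gamma> I J"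
    and J_N: "\<forall>t\<in>J. \<gamma> t \<in> W' \<inter> {q \<in> cdom c. cmap c q \<in> ball 0 r}"
    by (elim exE conjE)
  note \<gamma> = bspec[OF J_N]
  interpret C: curve_data A B g f p \<nu> W c d R H \<gamma> I J by (rule C)
  have Zr: "C.Z t \<in> ball 0 r" if "t \<in> J" for t using \<gamma>[OF that] by (simp add: C.Z_def)
  interpret C': curve_data A B' g' f' p \<nu>' W' c d' R' H' \<gamma> I J
  proof (rule curve_data.intro[OF sd'], unfold_locales)
    fix t assume t: "t \<in> J"
    note ci = C.curve_in[OF t]
    have W: "\<gamma> t \<in> W'" and "cmap c (\<gamma> t) \<in> ball 0 r" using \<gamma>[OF t] by blast+
    then have ball: "(cmap c \<circ> \<gamma>) t \<in> ball 0 R'" unfolding o_apply by (intro subsetD[OF sub(2)])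
    show "\<gamma> t \<in> W' \<and> \<gamma> t \<in> cdom c \<and> (cmap c \<circ> \<gamma>) t \<in> ball 0 R' \<and>
      (cmap c \<circ> \<gamma>) t $ 2 = 0 \<and> cinv c ((cmap c \<circ> \<gamma>) t) = \<gamma> t"
      by (rule conjI[OF W conjI[OF conjunct1[OF conjunct2[OF ci]] conjI[OF ball conjunct2[OF conjunct2[OF conjunct2[OF ci]]]]]])
  qed (rule C.curve C.open_J C.zero_J C.J_I C.smooth_Z C.Z_zero C.curve_axis | assumption)+
  have om: "C.\<omega> z = C'.\<omega> z" if "z \<in> ball 0 r" for z
    unfolding C.\<omega>_def C'.\<omega>_def P.E_eq[OF that] P.delta_eq[OF that] ..
  have sg: "sgn (D.L.r 0) = 1" "sgn (D'.L.r 0) = 1" using pos by simp_all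
  have ev: "\<forall>\<^sub>F t in nhds 0. kappa_Pi A B' g' f' \<nu>' \<gamma> \<eta>' t = kappa_Pi A B g f \<nu> \<gamma> \<eta> t"
    using C.kappa_Pi_eq[OF ne(1)] C'.kappa_Pi_eq[OF ne(2)]
  proof eventually_elim
    case (elim t)
    have t: "t \<in> J" by (rule conjunct1[OF elim(1)])
    show ?case
      unfolding conjunct2[OF elim(1)] conjunct2[OF elim(2)] sg om[OF Zr[OF t]] P.phi_eq[OF Zr[OF t]] ..
  qed
  have "deriv (kappa_Pi A B' g' f' \<nu>' \<gamma> \<eta>') 0 = deriv (kappa_Pi A B g f \<nu> \<gamma> \<eta>) 0"
    by (rule deriv_cong_ev[OF ev refl])
  moreover have "D'.L.E 0 = D.L.E 0" using P.E_eq[of 0] r(1) by simp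
  ultimately show ?thesis
    unfolding C.kappa_Pi'_eq[OF ne(1)] C'.kappa_Pi'_eq[OF ne(2)] using ev by simp
qed

lemma frontal_mapI:
  assumes "oriented_manifold A" "oriented_riemannian_manifold B g" "frontal A B g f"
  shows "frontal_map A B g f"
  using assms by unfold_locales (simp_all add: oriented_riemannian_manifold_def frontal_def)

text \<open>The null extensions of the two frontals may differ, because \<kappa>_c depends on
  neither the length nor the extension of the null field. Adaptedness is imposed through
  \<open>f\<close> alone, being a property of the common first fundamental form. The criteria for K
  admit either unit normal, since a change of sign preserves the zeros of \<kappa>_\<Pi> and
  \<kappa>'_\<Pi>.\<close>

theorem theorem2p9:
  fixes A :: "('m::{t2_space,second_countable_topology}, 2) chart set"
    and B :: "('w::{t2_space,second_countable_topology}, 3) chart set"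
    and g :: "('w, 3) metric"
    and f :: "'m \<Rightarrow> 'w"
    and p :: 'm
  assumes "oriented_manifold A"
    and "oriented_riemannian_manifold B g"
    and "frontal A B g f"
    and "first_kind A B g f p"
  shows
    "(\<forall>(B' :: ('x::{t2_space,second_countable_topology}, 3) chart set) g' f' \<nu> \<nu>' c \<gamma> \<eta> \<eta>'.
       oriented_riemannian_manifold B' g' \<and> frontal A B' g' f' \<and> first_kind A B' g' f' p \<and>
       (\<forall>\<^sub>F q in nhds p. \<forall>a\<in>tangent_space A q. \<forall>b\<in>tangent_space A q.
          first_form A B' g' f' q a b = first_form A B g f q a b) \<and>
       unit_normal_near A B g f p \<nu> \<and> unit_normal_near A B' g' f' p \<nu>' \<and>
       adapted_chart A B g f \<nu> p c \<and>
       normalized_normal A B g f \<nu> p c \<and> normalized_normal A B' g' f' \<nu>' p c \<and>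
       singular_curve A B f p \<gamma> \<and>
       null_extension A B f \<gamma> \<eta> \<and> null_extension A B' f' \<gamma> \<eta>'
       \<longrightarrow> (\<forall>\<^sub>F t in nhds 0. kappa_Pi A B' g' f' \<nu>' \<gamma> \<eta>' t = kappa_Pi A B g f \<nu> \<gamma> \<eta> t) \<and>
           kappa_Pi' A B' g' f' \<nu>' \<gamma> \<eta>' 0 = kappa_Pi' A B g f \<nu> \<gamma> \<eta> 0) \<and>
     (\<forall>\<nu> \<gamma> \<eta> c.
       unit_normal_near A B g f p \<nu> \<and> singular_curve A B f p \<gamma> \<and> null_extension A B f \<gamma> \<eta> \<and>
       centered_chart A p c
       \<longrightarrow> ((\<exists>W. rationally_bounded A c p W (W \<inter> regular_points A B f) (frontal_curvature A B g f)) \<longleftrightarrow>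
              kappa_Pi A B g f \<nu> \<gamma> \<eta> 0 = 0) \<and>
           ((\<exists>W. rationally_continuous A c p W (W \<inter> regular_points A B f) (frontal_curvature A B g f)) \<longleftrightarrow>
              kappa_Pi A B g f \<nu> \<gamma> \<eta> 0 = 0 \<and> kappa_Pi' A B g f \<nu> \<gamma> \<eta> 0 = 0)) \<and>
     (\<forall>\<nu> \<gamma> \<eta>.
       unit_normal_near A B g f p \<nu> \<and> singular_curve A B f p \<gamma> \<and> null_extension A B f \<gamma> \<eta>
       \<longrightarrow> ((\<exists>W M. open W \<and> p \<in> W \<and>
                (\<forall>q\<in>W \<inter> regular_points A B f. \<bar>frontal_curvature A B g f q\<bar> \<le> M)) \<longleftrightarrow>
            (\<forall>\<^sub>F t in nhds 0. kappa_Pi A B g f \<nu> \<gamma> \<eta> t = 0)))"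
proof -
  interpret M: frontal_map A B g f by (rule frontal_mapI[OF assms(1-3)])
  \<comment> \<open>For the criteria on K only zeros matter, so any straightening chart will do,
    whatever the sign of \<open>r\<close>.\<close>
  have data: "\<exists>W c d R H I J. curve_data A B g f p \<nu> W c d R H \<gamma> I J"
    if un: "unit_normal_near A B g f p \<nu>" and sc: "singular_curve A B f p \<gamma>" for \<nu> \<gamma>
  proof -
    obtain W where W: "p \<in> W" "open W" "M.normal_on W \<nu>" by (rule M.unit_normal_nearE[OF un])
    obtain c where c: "M.straight_chart p c" "\<forall>d\<in>B. f p \<in> cdom d \<longrightarrow> 0 < straight_gram (mcomp B g d) (M.rep c d)"
      using M.straight_chart_exists[OF assms(4)] by blast
    obtain d where d: "d \<in> B" "f p \<in> cdom d" using M.T.ex_chart by blast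
    obtain R H where sd: "straight_data A B g f p \<nu> W c d R H"
      using M.straight_data_exists[OF W(3,2,1) c(1) d] c(2) d by blast
    show ?thesis using straight_data.curve_data_exists[OF sd sc open_UNIV UNIV_I] by blast
  qed
  show ?thesis
  proof (intro conjI allI impI; elim conjE)
    fix B' :: "('x, 3) chart set" and g' f' \<nu> \<nu>' c \<gamma> \<eta> \<eta>'
    assume B': "oriented_riemannian_manifold B' g'" and f': "frontal A B' g' f'"
      and forms: "\<forall>\<^sub>F q in nhds p. \<forall>a\<in>tangent_space A q. \<forall>b\<in>tangent_space A q.
          first_form A B' g' f' q a b = first_form A B g f q a b"
      and un: "unit_normal_near A B g f p \<nu>" and un': "unit_normal_near A B' g' f' p \<nu>'"
      and ad: "adapted_chart A B g f \<nu> p c"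
      and nn: "normalized_normal A B g f \<nu> p c" and nn': "normalized_normal A B' g' f' \<nu>' p c"
      and sc: "singular_curve A B f p \<gamma>"
      and ne: "null_extension A B f \<gamma> \<eta>" and ne': "null_extension A B' f' \<gamma> \<eta>'"
    interpret M': frontal_map A B' g' f' by (rule frontal_mapI[OF assms(1) B' f'])
    obtain W where W: "p \<in> W" "open W" "M.normal_on W \<nu>" by (rule M.unit_normal_nearE[OF un])
    obtain W' where W': "p \<in> W'" "open W'" "M'.normal_on W' \<nu>'" by (rule M'.unit_normal_nearE[OF un'])
    have cen: "centered_chart A p c" using ad unfolding adapted_chart_def by blast
    then have c: "c \<in> A" "p \<in> cdom c" "cmap c p = 0" unfolding centered_chart_def by blast+
    have axis: "\<forall>\<^sub>F q in nhds p. cmap c q $ 2 = 0 \<longrightarrow> f_coord A B f c 2 q = (\<lambda>_. 0)"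
    proof (rule eventually_mono)
      show "\<forall>\<^sub>F q in nhds p. cmap c q $ 2 = 0 \<longrightarrow>
        gnorm g (f q) (f_coord A B f c 1 q) = 1 \<and> f_coord A B f c 2 q = (\<lambda>_. 0) \<and>
        orthonormal3 g (f q) (f_coord A B f c 1 q) (f_vv A B g f c q) (\<nu> q)"
        using ad unfolding adapted_chart_def by blast
    qed blast
    have "\<forall>\<^sub>F q in nhds p. q \<in> cdom c" by (rule eventually_nhds_in_open[OF M.S.open_cdom[OF c(1)] c(2)])
    \<comment> \<open>The length of the v-derivative of \<open>f'\<close> is read off the common
      first fundamental form, so its vanishing along the axis passes from \<open>f\<close> to
      \<open>f'\<close>.\<close>
    then have axis': "\<forall>\<^sub>F q in nhds p. cmap c q $ 2 = 0 \<longrightarrow> f_coord A B' f' c 2 q = (\<lambda>_. 0)"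
      using axis forms
    proof eventually_elim
      case (elim q)
      show ?case
      proof (rule impI, rule ccontr)
        assume q: "cmap c q $ 2 = 0" and nz: "f_coord A B' f' c 2 q \<noteq> (\<lambda>_. 0)"
        have t: "cfield A c 2 q \<in> tangent_space A q" by (rule M.S.cfield_tangent[OF c(1) elim(1)])
        obtain d where d: "d \<in> B" "f q \<in> cdom d" using M.T.ex_chart by blast
        have "0 < g' (f' q) (f_coord A B' f' c 2 q) (f_coord A B' f' c 2 q)"
          by (rule M'.T.g_pos[OF _ nz]) (unfold f_coord_def, rule M'.dmap_tangent[OF t])
        also have "\<dots> = g (f q) (f_coord A B f c 2 q) (f_coord A B f c 2 q)"
          using elim(3) t unfolding first_form_def f_coord_def by blast
        also have "f_coord A B f c 2 q = (\<lambda>_. 0)" using elim(2) q by blast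
        also have "g (f q) (\<lambda>_. 0) (\<lambda>_. 0) = 0"
          using M.T.g_mip[OF d M.T.zero_tangent M.T.zero_tangent] by simp
        finally show False by simp
      qed
    qed
    have st: "M.straight_chart p c" "M'.straight_chart p c"
      unfolding M.straight_chart_def M'.straight_chart_def using cen axis axis' by blast+
    have v: "0 < vol_form B g (f p) (f_coord A B f c 1 p) (f_vv A B g f c p) (\<nu> p)"
      using eventually_nhds_x_imp_x[OF nn[unfolded normalized_normal_def]] c(3) by simp
    have v': "0 < vol_form B' g' (f' p) (f_coord A B' f' c 1 p) (f_vv A B' g' f' c p) (\<nu>' p)"
      using eventually_nhds_x_imp_x[OF nn'[unfolded normalized_normal_def]] c(3) by simp
    obtain d R H where D: "straight_data A B g f p \<nu> W c d R H"
      "0 < straight_frontal.r (mcomp B g d) (M.rep c d) (\<lambda>z. \<nu> (cinv c z) d) H 0"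
      using M.normalized_straight_data[OF W(3,2,1) st(1) v] by blast
    obtain d' R' H' where D': "straight_data A B' g' f' p \<nu>' W' c d' R' H'"
      "0 < straight_frontal.r (mcomp B' g' d') (M'.rep c d') (\<lambda>z. \<nu>' (cinv c z) d') H' 0"
      using M'.normalized_straight_data[OF W'(3,2,1) st(2) v'] by blast
    note i = intrinsic_product_curvature[OF D(1) D'(1) D(2) D'(2) forms sc ne ne']
    show "\<forall>\<^sub>F t in nhds 0. kappa_Pi A B' g' f' \<nu>' \<gamma> \<eta>' t = kappa_Pi A B g f \<nu> \<gamma> \<eta> t"
      by (rule conjunct1[OF i])
    show "kappa_Pi' A B' g' f' \<nu>' \<gamma> \<eta>' 0 = kappa_Pi' A B g f \<nu> \<gamma> \<eta> 0"
      by (rule conjunct2[OF i])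
  next
    fix \<nu> \<gamma> \<eta> c
    assume un: "unit_normal_near A B g f p \<nu>" and sc: "singular_curve A B f p \<gamma>"
      and ne: "null_extension A B f \<gamma> \<eta>" and cen: "centered_chart A p c"
    obtain W c0 d R H I J where C: "curve_data A B g f p \<nu> W c0 d R H \<gamma> I J" using data[OF un sc] by blast
    interpret C: curve_data A B g f p \<nu> W c0 d R H \<gamma> I J by (rule C)
    obtain r where X: "centered_data A B g f p \<nu> W c0 d R H c r" using C.centered_data_exists[OF cen] by blast
    show "(\<exists>W. rationally_bounded A c p W (W \<inter> regular_points A B f) (frontal_curvature A B g f)) \<longleftrightarrow>
              kappa_Pi A B g f \<nu> \<gamma> \<eta> 0 = 0"
      unfolding centered_data.rationally_bounded_iff[OF X] C.kappa_Pi_zero_iff[OF ne] ..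
    show "(\<exists>W. rationally_continuous A c p W (W \<inter> regular_points A B f) (frontal_curvature A B g f)) \<longleftrightarrow>
              kappa_Pi A B g f \<nu> \<gamma> \<eta> 0 = 0 \<and> kappa_Pi' A B g f \<nu> \<gamma> \<eta> 0 = 0"
      unfolding centered_data.rationally_continuous_iff[OF X] C.kappa_Pi_zero_iff[OF ne]
      using C.kappa_Pi'_zero_iff[OF ne] by blast
  next
    fix \<nu> \<gamma> \<eta>
    assume un: "unit_normal_near A B g f p \<nu>" and sc: "singular_curve A B f p \<gamma>"
      and ne: "null_extension A B f \<gamma> \<eta>"
    obtain W c d R H I J where C: "curve_data A B g f p \<nu> W c d R H \<gamma> I J" using data[OF un sc] by blast
    interpret C: curve_data A B g f p \<nu> W c d R H \<gamma> I J by (rule C)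
    show "(\<exists>W M. open W \<and> p \<in> W \<and>
                (\<forall>q\<in>W \<inter> regular_points A B f. \<bar>frontal_curvature A B g f q\<bar> \<le> M)) \<longleftrightarrow>
            (\<forall>\<^sub>F t in nhds 0. kappa_Pi A B g f \<nu> \<gamma> \<eta> t = 0)"
      unfolding C.bounded_curvature_iff C.kappa_Pi_eventually_zero_iff[OF ne] ..
  qed
qed

end
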